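(* Let $G$ be a Brauer graph which is either of the following: (i) it has only one vertex and at least two edges; or (ii) it has precisely two vertices, at least two edges, and is bipartite. Then the Brauer graph algebra of $G$ is not tilting-connected.
   Context: $K$ is an algebraically closed field. A Brauer graph is a finite connected graph $G$ (loops and multiple edges allowed) with at least one edge, together with a cyclic ordering of the half-edges at each vertex and a multiplicity $m(v)\ge1$ for each vertex $v$. Its Brauer graph algebra is $KQ/I$, where $Q$ has the edges of $G$ as vertices and, for each half-edge $h$ at a vertex $v$ with $m(v)\operatorname{val}(v)>1$, an arrow from the edge of $h$ to the edge of the successor of $h$ in the cyclic order at $v$. For such $h$ let $C_h$ be the cycle in $Q$ starting at $h$ and going once around $v$. The ideal $I$ is generated by: $C_h^{m(v)}-C_{h'}^{m(v')}$ for the two half-edges $h$ (at $v$), $h'$ (at $v'$) of an edge, whenever both cycles are defined; $C_h^{m(v)}\alpha$ with $\alpha$ the first arrow of $C_h$; and $\alpha\beta$ for all composable arrows $\alpha,\beta$ which are not consecutive in a cycle around a vertex. (If $G$ is a single edge with two distinct ends of multiplicity 1, the algebra is $K[x]/(x^2)$.) This is a symmetric algebra. For a symmetric algebra $\Lambda$, let $\mathsf{K^b}(\mathsf{proj}\,\Lambda)$ be the bounded homotopy category of finitely generated projective right modules. $T$ in it is tilting if $\operatorname{Hom}(T,T[i])=0$ for all $i\ne0$ and $T$ generates $\mathsf{K^b}(\mathsf{proj}\,\Lambda)$ as a thick subcategory. For a basic tilting complex $T=X\oplus M$ with $X$ indecomposable, the irreducible left mutation at $X$ is $Y\oplus M$,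 where $X\xrightarrow{f}M'\to Y\to X[1]$ is a triangle with $f$ a minimal left $\operatorname{add}M$-approximation; right mutation is defined dually. $\Lambda$ is tilting-connected if any two basic tilting complexes are linked by a finite sequence of irreducible (left or right) mutations. *)

theory Defs
  imports "HOL-Algebra.QuotRing" "HOL-Computational_Algebra.Polynomial"
begin

section \<open>Brauer graphs\<close>

text \<open>
  A graph is given by its half-edges: \<open>vert\<close> sends a half-edge to its vertex, \<open>opp\<close> to the other
  half of its edge, and \<open>nxt\<close> to its successor in the cyclic ordering at its vertex. An edge is the
  set of its two half-edges, so that loops and multiple edges are allowed.
\<close>

record ('v, 'h) bgraph =
  verts :: "'v set"
  halves :: "'h set"
  vert :: "'h \<Rightarrow> 'v"
  opp :: "'h \<Rightarrow> 'h"
  nxt :: "'h \<Rightarrow> 'h"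
  mlt :: "'v \<Rightarrow> nat"

definition edge_of :: "('v, 'h) bgraph \<Rightarrow> 'h \<Rightarrow> 'h set"
  where "edge_of G h = {h, opp G h}"

definition edges :: "('v, 'h) bgraph \<Rightarrow> 'h set set"
  where "edges G = edge_of G ` halves G"

text \<open>A loop contributes two half-edges to the valency.\<close>

definition val :: "('v, 'h) bgraph \<Rightarrow> 'v \<Rightarrow> nat"
  where "val G v = card {h \<in> halves G. vert G h = v}"

locale brauer_graph =
  fixes G :: "('v, 'h) bgraph"
  assumes finite_verts: "finite (verts G)"
    and finite_halves: "finite (halves G)"
    and halves_nonempty: "halves G \<noteq> {}"
    and vert_closed: "h \<in> halves G \<Longrightarrow> vert G h \<in> verts G"
    and opp_closed: "h \<in> halves G \<Longrightarrow> opp G h \<in> halves G"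
    and opp_opp: "h \<in> halves G \<Longrightarrow> opp G (opp G h) = h"
    and opp_neq: "h \<in> halves G \<Longrightarrow> opp G h \<noteq> h"
    and nxt_bij: "bij_betw (nxt G) (halves G) (halves G)"
    and nxt_vert: "h \<in> halves G \<Longrightarrow> vert G (nxt G h) = vert G h"
    and nxt_cyclic: "h \<in> halves G \<Longrightarrow> h' \<in> halves G \<Longrightarrow> vert G h = vert G h' \<Longrightarrow>
      \<exists>n. (nxt G ^^ n) h = h'"
    and mlt_pos: "v \<in> verts G \<Longrightarrow> 1 \<le> mlt G v"
    and connected: "u \<in> verts G \<Longrightarrow> v \<in> verts G \<Longrightarrow>
      (u, v) \<in> {(vert G h, vert G (opp G h)) | h. h \<in> halves G}\<^sup>*"

definition bipartite :: "('v, 'h) bgraph \<Rightarrow> bool"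
  where "bipartite G \<longleftrightarrow> (\<exists>A B. A \<union> B = verts G \<and> A \<inter> B = {} \<and>
    (\<forall>h \<in> halves G. vert G h \<in> A \<longleftrightarrow> vert G (opp G h) \<in> B))"


section \<open>Brauer graph algebras\<close>

definition single_edge_case :: "('v, 'h) bgraph \<Rightarrow> bool"
  where "single_edge_case G \<longleftrightarrow>
    card (edges G) = 1 \<and> card (verts G) = 2 \<and> (\<forall>v \<in> verts G. mlt G v = 1)"

text \<open>
  The arrow of a half-edge \<open>h\<close> runs from \<open>edge_of G h\<close> to \<open>edge_of G (nxt G h)\<close>; we identify it
  with \<open>h\<close>. If \<open>G\<close> is a single edge with two distinct ends of multiplicity \<open>1\<close>, no half-edge satisfies
  \<open>m(v) val(v) > 1\<close> and the algebra is \<open>K[x]/(x\<^sup>2)\<close> by convention. We get this algebra by keeping both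
  half-edges \<open>a\<close>, \<open>b\<close> as arrows: they are loops at the only vertex of the quiver, and the relations
  below become \<open>a - b\<close>, \<open>a\<^sup>2\<close>, \<open>b\<^sup>2\<close>, \<open>ab\<close>, \<open>ba\<close>.
\<close>

definition arrows :: "('v, 'h) bgraph \<Rightarrow> 'h set"
  where "arrows G = {h \<in> halves G. 1 < mlt G (vert G h) * val G (vert G h) \<or> single_edge_case G}"

text \<open>
  A path is a pair of its source and the list of its arrows, in the order in which they are
  traversed; in particular the product \<open>\<alpha>\<beta>\<close> is the path \<open>\<alpha>\<close> followed by \<open>\<beta>\<close>.
\<close>

type_synonym 'h path = "'h set \<times> 'h list"

fun is_walk :: "('v, 'h) bgraph \<Rightarrow> 'h set \<Rightarrow> 'h list \<Rightarrow> bool"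
  where
    "is_walk G e [] \<longleftrightarrow> e \<in> edges G"
  | "is_walk G e (h # hs) \<longleftrightarrow> h \<in> arrows G \<and> edge_of G h = e \<and> is_walk G (edge_of G (nxt G h)) hs"

fun walk_end :: "('v, 'h) bgraph \<Rightarrow> 'h set \<Rightarrow> 'h list \<Rightarrow> 'h set"
  where
    "walk_end G e [] = e"
  | "walk_end G e (h # hs) = walk_end G (edge_of G (nxt G h)) hs"

definition paths :: "('v, 'h) bgraph \<Rightarrow> 'h path set"
  where "paths G = {(e, hs). is_walk G e hs}"

text \<open>The path algebra \<open>KQ\<close>: finitely supported functions on the paths of \<open>Q\<close>.\<close>

definition path_algebra :: "('v, 'h) bgraph \<Rightarrow> ('h path \<Rightarrow> 'k::field) ring"
  where "path_algebra G = \<lparr>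
    carrier = {f. finite {p. f p \<noteq> 0} \<and> {p. f p \<noteq> 0} \<subseteq> paths G},
    monoid.mult = (\<lambda>f g (e, hs). \<Sum>i\<le>length hs.
      f (e, take i hs) * g (walk_end G e (take i hs), drop i hs)),
    one = (\<lambda>(e, hs). if e \<in> edges G \<and> hs = [] then 1 else 0),
    zero = (\<lambda>p. 0),
    add = (\<lambda>f g p. f p + g p)\<rparr>"

definition path_elem :: "'h path \<Rightarrow> 'h path \<Rightarrow> 'k::field"
  where "path_elem p = (\<lambda>q. if q = p then 1 else 0)"

text \<open>The arrow list of the cycle \<open>C\<^sub>h\<close>, and of its power \<open>C\<^sub>h\<^bsup>m(v)\<^esup>\<close>.\<close>

definition cyc :: "('v, 'h) bgraph \<Rightarrow> 'h \<Rightarrow> 'h list"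
  where "cyc G h = map (\<lambda>i. (nxt G ^^ i) h) [0..<val G (vert G h)]"

definition cyc_pow :: "('v, 'h) bgraph \<Rightarrow> 'h \<Rightarrow> 'h list"
  where "cyc_pow G h = concat (replicate (mlt G (vert G h)) (cyc G h))"

definition relations :: "('v, 'h) bgraph \<Rightarrow> ('h path \<Rightarrow> 'k::field) set"
  where "relations G =
    {(\<lambda>p. path_elem (edge_of G h, cyc_pow G h) p
        - path_elem (edge_of G (opp G h), cyc_pow G (opp G h)) p) | h.
      h \<in> arrows G \<and> opp G h \<in> arrows G}
    \<union> {path_elem (edge_of G h, cyc_pow G h @ [h]) | h. h \<in> arrows G}
    \<union> {path_elem (edge_of G h, [h, k]) | h k.
      h \<in> arrows G \<and> k \<in> arrows G \<and> edge_of G k = edge_of G (nxt G h) \<and> k \<noteq> nxt G h}"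

definition brauer_graph_algebra :: "('v, 'h) bgraph \<Rightarrow> ('h path \<Rightarrow> 'k::field) set ring"
  where "brauer_graph_algebra G = path_algebra G Quot (Idl\<^bsub>path_algebra G\<^esub> (relations G))"


section \<open>Right modules\<close>

text \<open>
  As for the modules of \<open>HOL-Algebra\<close>, the multiplicative fields of the underlying ring record are
  irrelevant.
\<close>

record ('a, 'm) rmodule = "'m ring" +
  ract :: "'m \<Rightarrow> 'a \<Rightarrow> 'm"

locale right_module = R?: ring R + M?: abelian_group M
  for R :: "'a ring" and M :: "('a, 'm) rmodule" +
  assumes ract_closed: "x \<in> carrier M \<Longrightarrow> a \<in> carrier R \<Longrightarrow> ract M x a \<in> carrier M"
    and ract_add_left: "x \<in> carrier M \<Longrightarrow> y \<in> carrier M \<Longrightarrow> a \<in> carrier R \<Longrightarrow>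
      ract M (x \<oplus>\<^bsub>M\<^esub> y) a = ract M x a \<oplus>\<^bsub>M\<^esub> ract M y a"
    and ract_add_right: "x \<in> carrier M \<Longrightarrow> a \<in> carrier R \<Longrightarrow> b \<in> carrier R \<Longrightarrow>
      ract M x (a \<oplus>\<^bsub>R\<^esub> b) = ract M x a \<oplus>\<^bsub>M\<^esub> ract M x b"
    and ract_mult: "x \<in> carrier M \<Longrightarrow> a \<in> carrier R \<Longrightarrow> b \<in> carrier R \<Longrightarrow>
      ract M x (a \<otimes>\<^bsub>R\<^esub> b) = ract M (ract M x a) b"
    and ract_one: "x \<in> carrier M \<Longrightarrow> ract M x \<one>\<^bsub>R\<^esub> = x"

definition rhom :: "'a ring \<Rightarrow> ('a, 'm) rmodule \<Rightarrow> ('a, 'n) rmodule \<Rightarrow> ('m \<Rightarrow> 'n) set"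
  where "rhom R M N = {f \<in> carrier M \<rightarrow> carrier N.
    (\<forall>x \<in> carrier M. \<forall>y \<in> carrier M. f (x \<oplus>\<^bsub>M\<^esub> y) = f x \<oplus>\<^bsub>N\<^esub> f y) \<and>
    (\<forall>x \<in> carrier M. \<forall>a \<in> carrier R. f (ract M x a) = ract N (f x) a)}"

text \<open>
  All modules below have elements of type \<open>nat \<Rightarrow> 'a\<close>. This is no restriction: this type contains all
  modules \<open>R\<^sup>n\<close>, so every finitely generated projective module is isomorphic to one of this type. A
  direct sum stays in this type by interleaving the two components.
\<close>

type_synonym 'a rmod = "('a, nat \<Rightarrow> 'a) rmodule"

definition free_rmod :: "'a ring \<Rightarrow> nat \<Rightarrow> 'a rmod"
  where "free_rmod R n = \<lparr>
    carrier = {x. (\<forall>i<n. x i \<in> carrier R) \<and> (\<forall>i\<ge>n. x i = \<zero>\<^bsub>R\<^esub>)},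
    monoid.mult = undefined, one = undefined,
    zero = (\<lambda>i. \<zero>\<^bsub>R\<^esub>), add = (\<lambda>x y i. x i \<oplus>\<^bsub>R\<^esub> y i),
    ract = (\<lambda>x a i. x i \<otimes>\<^bsub>R\<^esub> a)\<rparr>"

text \<open>Finitely generated projective: a direct summand of some \<open>R\<^sup>n\<close>.\<close>

definition fg_projective :: "'a ring \<Rightarrow> 'a rmod \<Rightarrow> bool"
  where "fg_projective R P \<longleftrightarrow> right_module R P \<and>
    (\<exists>n. \<exists>s \<in> rhom R P (free_rmod R n). \<exists>r \<in> rhom R (free_rmod R n) P. \<forall>x \<in> carrier P. r (s x) = x)"

definition pair :: "(nat \<Rightarrow> 'a) \<Rightarrow> (nat \<Rightarrow> 'a) \<Rightarrow> nat \<Rightarrow> 'a"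
  where "pair x y = (\<lambda>i. if even i then x (i div 2) else y (i div 2))"

definition lft :: "(nat \<Rightarrow> 'a) \<Rightarrow> nat \<Rightarrow> 'a"
  where "lft z = (\<lambda>i. z (2 * i))"

definition rgt :: "(nat \<Rightarrow> 'a) \<Rightarrow> nat \<Rightarrow> 'a"
  where "rgt z = (\<lambda>i. z (2 * i + 1))"

definition sum_rmod :: "'a rmod \<Rightarrow> 'a rmod \<Rightarrow> 'a rmod"
  where "sum_rmod M N = \<lparr>
    carrier = {z. lft z \<in> carrier M \<and> rgt z \<in> carrier N},
    monoid.mult = undefined, one = undefined,
    zero = pair \<zero>\<^bsub>M\<^esub> \<zero>\<^bsub>N\<^esub>,
    add = (\<lambda>z w. pair (lft z \<oplus>\<^bsub>M\<^esub> lft w) (rgt z \<oplus>\<^bsub>N\<^esub> rgt w)),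
    ract = (\<lambda>z a. pair (ract M (lft z) a) (ract N (rgt z) a))\<rparr>"


section \<open>The bounded homotopy category of finitely generated projective modules\<close>

text \<open>Cochain complexes: \<open>dif X n\<close> is the differential \<open>X\<^sup>n \<rightarrow> X\<^bsup>n+1\<^esup>\<close>.\<close>

record 'a cplx =
  obj :: "int \<Rightarrow> 'a rmod"
  dif :: "int \<Rightarrow> (nat \<Rightarrow> 'a) \<Rightarrow> (nat \<Rightarrow> 'a)"

type_synonym 'a cmap = "int \<Rightarrow> (nat \<Rightarrow> 'a) \<Rightarrow> (nat \<Rightarrow> 'a)"

definition Kb_proj :: "'a ring \<Rightarrow> 'a cplx set"
  where "Kb_proj R = {X.
    (\<forall>n. fg_projective R (obj X n)) \<and>
    (\<forall>n. dif X n \<in> rhom R (obj X n) (obj X (n + 1))) \<and>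
    (\<forall>n. \<forall>x \<in> carrier (obj X n). dif X (n + 1) (dif X n x) = \<zero>\<^bsub>obj X (n + 2)\<^esub>) \<and>
    (\<exists>a b. \<forall>n. n < a \<or> b < n \<longrightarrow> carrier (obj X n) = {\<zero>\<^bsub>obj X n\<^esub>})}"

text \<open>
  A morphism of the homotopy category is a class of chain maps modulo homotopy. We work with
  representatives; equality of morphisms is \<open>homotopic\<close>.
\<close>

definition chain_maps :: "'a ring \<Rightarrow> 'a cplx \<Rightarrow> 'a cplx \<Rightarrow> 'a cmap set"
  where "chain_maps R X Y = {f.
    (\<forall>n. f n \<in> rhom R (obj X n) (obj Y n)) \<and>
    (\<forall>n. \<forall>x \<in> carrier (obj X n). f (n + 1) (dif X n x) = dif Y n (f n x))}"

definition homotopic :: "'a ring \<Rightarrow> 'a cplx \<Rightarrow> 'a cplx \<Rightarrow> 'a cmap \<Rightarrow> 'a cmap \<Rightarrow> bool"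
  where "homotopic R X Y f g \<longleftrightarrow>
    (\<exists>s. (\<forall>n. s n \<in> rhom R (obj X n) (obj Y (n - 1))) \<and>
      (\<forall>n. \<forall>x \<in> carrier (obj X n).
        f n x \<ominus>\<^bsub>obj Y n\<^esub> g n x = dif Y (n - 1) (s n x) \<oplus>\<^bsub>obj Y n\<^esub> s (n + 1) (dif X n x)))"

definition cid :: "'a cmap"
  where "cid = (\<lambda>n x. x)"

definition ccomp :: "'a cmap \<Rightarrow> 'a cmap \<Rightarrow> 'a cmap"  (infixl \<open>\<bullet>\<close> 70)
  where "g \<bullet> f = (\<lambda>n x. g n (f n x))"

definition czero :: "'a cplx \<Rightarrow> 'a cmap"
  where "czero Y = (\<lambda>n x. \<zero>\<^bsub>obj Y n\<^esub>)"

definition is_iso :: "'a ring \<Rightarrow> 'a cplx \<Rightarrow> 'a cplx \<Rightarrow> 'a cmap \<Rightarrow> bool"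
  where "is_iso R X Y f \<longleftrightarrow> f \<in> chain_maps R X Y \<and>
    (\<exists>g \<in> chain_maps R Y X. homotopic R X X (g \<bullet> f) cid \<and> homotopic R Y Y (f \<bullet> g) cid)"

definition isomorphic :: "'a ring \<Rightarrow> 'a cplx \<Rightarrow> 'a cplx \<Rightarrow> bool"
  where "isomorphic R X Y \<longleftrightarrow> (\<exists>f. is_iso R X Y f)"

definition zero_cplx :: "'a ring \<Rightarrow> 'a cplx"
  where "zero_cplx R = \<lparr>obj = (\<lambda>n. free_rmod R 0), dif = (\<lambda>n x. x)\<rparr>"

definition sum_cplx :: "'a cplx \<Rightarrow> 'a cplx \<Rightarrow> 'a cplx"
  where "sum_cplx X Y = \<lparr>
    obj = (\<lambda>n. sum_rmod (obj X n) (obj Y n)),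
    dif = (\<lambda>n z. pair (dif X n (lft z)) (dif Y n (rgt z)))\<rparr>"

definition sum_list_cplx :: "'a ring \<Rightarrow> 'a cplx list \<Rightarrow> 'a cplx"
  where "sum_list_cplx R Xs = foldr sum_cplx Xs (zero_cplx R)"

definition shift :: "int \<Rightarrow> 'a cplx \<Rightarrow> 'a cplx"
  where "shift i X = \<lparr>
    obj = (\<lambda>n. obj X (n + i)),
    dif = (\<lambda>n x. if even i then dif X (n + i) x else \<ominus>\<^bsub>obj X (n + i + 1)\<^esub> dif X (n + i) x)\<rparr>"

definition shift_map :: "int \<Rightarrow> 'a cmap \<Rightarrow> 'a cmap"
  where "shift_map i f = (\<lambda>n. f (n + i))"

text \<open>The mapping cone of \<open>f : X \<rightarrow> Y\<close>, with differential \<open>(x, y) \<mapsto> (- d x, f x + d y)\<close>.\<close>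

definition cone :: "'a cplx \<Rightarrow> 'a cplx \<Rightarrow> 'a cmap \<Rightarrow> 'a cplx"
  where "cone X Y f = \<lparr>
    obj = (\<lambda>n. sum_rmod (obj X (n + 1)) (obj Y n)),
    dif = (\<lambda>n z. pair (\<ominus>\<^bsub>obj X (n + 2)\<^esub> dif X (n + 1) (lft z))
      (f (n + 1) (lft z) \<oplus>\<^bsub>obj Y (n + 1)\<^esub> dif Y n (rgt z)))\<rparr>"

definition cone_incl :: "'a cplx \<Rightarrow> 'a cmap"
  where "cone_incl X = (\<lambda>n y. pair \<zero>\<^bsub>obj X (n + 1)\<^esub> y)"

definition cone_proj :: "'a cmap"
  where "cone_proj = (\<lambda>n z. lft z)"

text \<open>
  A triangle \<open>X \<rightarrow> Y \<rightarrow> Z \<rightarrow> X[1]\<close> is distinguished if it is isomorphic, in the homotopy category, to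
  the standard triangle \<open>X' \<rightarrow> Y' \<rightarrow> cone f \<rightarrow> X'[1]\<close> of some chain map \<open>f\<close>.
\<close>

definition triangle ::
  "'a ring \<Rightarrow> 'a cplx \<Rightarrow> 'a cplx \<Rightarrow> 'a cplx \<Rightarrow> 'a cmap \<Rightarrow> 'a cmap \<Rightarrow> 'a cmap \<Rightarrow> bool"
  where "triangle R X Y Z u v w \<longleftrightarrow>
    X \<in> Kb_proj R \<and> Y \<in> Kb_proj R \<and> Z \<in> Kb_proj R \<and>
    u \<in> chain_maps R X Y \<and> v \<in> chain_maps R Y Z \<and> w \<in> chain_maps R Z (shift 1 X) \<and>
    (\<exists>X' \<in> Kb_proj R. \<exists>Y' \<in> Kb_proj R. \<exists>f \<in> chain_maps R X' Y'. \<exists>\<alpha> \<beta> \<gamma>.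
      is_iso R X X' \<alpha> \<and> is_iso R Y Y' \<beta> \<and> is_iso R Z (cone X' Y' f) \<gamma> \<and>
      homotopic R X Y' (\<beta> \<bullet> u) (f \<bullet> \<alpha>) \<and>
      homotopic R Y (cone X' Y' f) (\<gamma> \<bullet> v) (cone_incl X' \<bullet> \<beta>) \<and>
      homotopic R Z (shift 1 X') (shift_map 1 \<alpha> \<bullet> w) (cone_proj \<bullet> \<gamma>))"


section \<open>Tilting complexes and mutation\<close>

definition thick_subcat :: "'a ring \<Rightarrow> 'a cplx set \<Rightarrow> bool"
  where "thick_subcat R S \<longleftrightarrow> S \<subseteq> Kb_proj R \<and> zero_cplx R \<in> S \<and>
    (\<forall>X \<in> S. \<forall>Y \<in> Kb_proj R. isomorphic R X Y \<longrightarrow> Y \<in> S) \<and>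
    (\<forall>X \<in> S. \<forall>i. shift i X \<in> S) \<and>
    (\<forall>X Y Z u v w. triangle R X Y Z u v w \<longrightarrow> X \<in> S \<longrightarrow> Y \<in> S \<longrightarrow> Z \<in> S) \<and>
    (\<forall>X \<in> Kb_proj R. \<forall>Y \<in> Kb_proj R. sum_cplx X Y \<in> S \<longrightarrow> X \<in> S)"

definition tilting :: "'a ring \<Rightarrow> 'a cplx \<Rightarrow> bool"
  where "tilting R T \<longleftrightarrow> T \<in> Kb_proj R \<and>
    (\<forall>i. i \<noteq> 0 \<longrightarrow>
      (\<forall>f \<in> chain_maps R T (shift i T). homotopic R T (shift i T) f (czero (shift i T)))) \<and>
    (\<forall>S. thick_subcat R S \<longrightarrow> T \<in> S \<longrightarrow> S = Kb_proj R)"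

definition indecomposable :: "'a ring \<Rightarrow> 'a cplx \<Rightarrow> bool"
  where "indecomposable R X \<longleftrightarrow> X \<in> Kb_proj R \<and> \<not> isomorphic R X (zero_cplx R) \<and>
    (\<forall>A \<in> Kb_proj R. \<forall>B \<in> Kb_proj R. isomorphic R X (sum_cplx A B) \<longrightarrow>
      isomorphic R A (zero_cplx R) \<or> isomorphic R B (zero_cplx R))"

text \<open>Basic: a direct sum of pairwise non-isomorphic indecomposable complexes.\<close>

definition basic :: "'a ring \<Rightarrow> 'a cplx \<Rightarrow> bool"
  where "basic R T \<longleftrightarrow> (\<exists>Xs. (\<forall>X \<in> set Xs. indecomposable R X) \<and>
    (\<forall>i j. i < j \<and> j < length Xs \<longrightarrow> \<not> isomorphic R (Xs ! i) (Xs ! j)) \<and>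
    isomorphic R T (sum_list_cplx R Xs))"

definition basic_tilting :: "'a ring \<Rightarrow> 'a cplx \<Rightarrow> bool"
  where "basic_tilting R T \<longleftrightarrow> tilting R T \<and> basic R T"

definition add_closure :: "'a ring \<Rightarrow> 'a cplx \<Rightarrow> 'a cplx set"
  where "add_closure R M = {N \<in> Kb_proj R. \<exists>N' \<in> Kb_proj R. \<exists>n.
    isomorphic R (sum_cplx N N') (sum_list_cplx R (replicate n M))}"

text \<open>\<open>f : X \<rightarrow> M'\<close> is a minimal left \<open>add M\<close>-approximation; dually for right approximations.\<close>

definition min_left_approx ::
  "'a ring \<Rightarrow> 'a cplx \<Rightarrow> 'a cplx \<Rightarrow> 'a cplx \<Rightarrow> 'a cmap \<Rightarrow> bool"
  where "min_left_approx R M X M' f \<longleftrightarrow>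
    M' \<in> add_closure R M \<and> f \<in> chain_maps R X M' \<and>
    (\<forall>N \<in> add_closure R M. \<forall>g \<in> chain_maps R X N.
      \<exists>h \<in> chain_maps R M' N. homotopic R X N (h \<bullet> f) g) \<and>
    (\<forall>h \<in> chain_maps R M' M'. homotopic R X M' (h \<bullet> f) f \<longrightarrow> is_iso R M' M' h)"

definition min_right_approx ::
  "'a ring \<Rightarrow> 'a cplx \<Rightarrow> 'a cplx \<Rightarrow> 'a cplx \<Rightarrow> 'a cmap \<Rightarrow> bool"
  where "min_right_approx R M X M' f \<longleftrightarrow>
    M' \<in> add_closure R M \<and> f \<in> chain_maps R M' X \<and>
    (\<forall>N \<in> add_closure R M. \<forall>g \<in> chain_maps R N X.
      \<exists>h \<in> chain_maps R N M'. homotopic R N X (f \<bullet> h) g) \<and>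
    (\<forall>h \<in> chain_maps R M' M'. homotopic R M' X (f \<bullet> h) f \<longrightarrow> is_iso R M' M' h)"

text \<open>
  \<open>left_mutation R T T'\<close>: there is a decomposition \<open>T = X \<oplus> M\<close> with \<open>X\<close> indecomposable such that \<open>T'\<close> is
  the left mutation \<open>Y \<oplus> M\<close> of \<open>T\<close> at \<open>X\<close>. All this is up to isomorphism in the homotopy category.
\<close>

definition left_mutation :: "'a ring \<Rightarrow> 'a cplx \<Rightarrow> 'a cplx \<Rightarrow> bool"
  where "left_mutation R T T' \<longleftrightarrow> basic_tilting R T \<and> T' \<in> Kb_proj R \<and>
    (\<exists>X M M' Y f g h. indecomposable R X \<and> M \<in> Kb_proj R \<and> isomorphic R T (sum_cplx X M) \<and>
      min_left_approx R M X M' f \<and> triangle R X M' Y f g h \<and> isomorphic R T' (sum_cplx Y M))"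

definition right_mutation :: "'a ring \<Rightarrow> 'a cplx \<Rightarrow> 'a cplx \<Rightarrow> bool"
  where "right_mutation R T T' \<longleftrightarrow> basic_tilting R T \<and> T' \<in> Kb_proj R \<and>
    (\<exists>X M M' Y f g h. indecomposable R X \<and> M \<in> Kb_proj R \<and> isomorphic R T (sum_cplx X M) \<and>
      min_right_approx R M X M' f \<and> triangle R Y M' X g f h \<and> isomorphic R T' (sum_cplx Y M))"

text \<open>Tilting complexes are considered up to isomorphism, so isomorphic ones are always linked.\<close>

definition tilting_connected :: "'a ring \<Rightarrow> bool"
  where "tilting_connected R \<longleftrightarrow>
    (\<forall>T T'. basic_tilting R T \<longrightarrow> basic_tilting R T' \<longrightarrow>
      (\<exists>T''. (\<lambda>U V. left_mutation R U V \<or> right_mutation R U V)\<^sup>*\<^sup>* T T'' \<and> isomorphic R T'' T'))"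

end

theory Submission
  imports Defs "HOL-Library.Function_Algebras"
begin

text \<open>
  All entries of the Cartan matrix of the algebra \<open>A\<close> are equal: with \<open>c = 4 m(v)\<close> in case (i) and
  \<open>c = m(u) + m(v)\<close> in case (ii), \<open>dim \<epsilon>\<^sub>i A \<epsilon>\<^sub>j = c\<close> for all edges \<open>i\<close>, \<open>j\<close>. Hence the Euler form on
  \<open>K\<^sup>b(proj A)\<close> is \<open>\<chi>(X, Y) = c s(X) s(Y)\<close>, where \<open>s(X)\<close> is the alternating sum of the numbers of
  indecomposable summands of the terms of \<open>X\<close>. If \<open>X\<close> and \<open>Y\<close> are summands of a tilting complex, then
  \<open>\<chi>(X, Y) = dim Hom(X, Y) \<ge> 0\<close>, and \<open>\<chi>(X, X) > 0\<close> for \<open>X \<noteq> 0\<close>; so all nonzero summands of a tilting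
  complex have values \<open>s \<noteq> 0\<close> of the same sign. A mutation at \<open>X\<close> of \<open>X \<oplus> M\<close> keeps \<open>M\<close>, so the
  sign does not change if \<open>M \<noteq> 0\<close>. This holds at the start, since \<open>A\<close> has at least two simple modules, and
  mutation preserves it: if \<open>Y \<oplus> M\<close> were indecomposable, then \<open>Y = 0\<close>, and \<open>X \<cong> M' \<in> add M\<close> would be
  isomorphic to \<open>M\<close>, although \<open>X \<oplus> M\<close> is basic. But the sign is positive for \<open>A\<close> and negative for \<open>A[1]\<close>.
\<close>

section \<open>Linear algebra of finitely supported functions\<close>

text \<open>An entry of the Cartan matrix counts visits to the edge j on the walks that start at the
  two half-edges of the edge i and run m(v) times around their vertices. It is a sum of terms m(v)
  times the number of halves of j at v: two starts and two halves at the only vertex, or one start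
  and one half at each of two vertices. The formula for the Euler form has to become a dimension
  count. Since only the parity of degrees enters, the total Hom complex is folded to an even and an
  odd term. Orthogonality makes it exact at the odd term, and then the difference of the two
  dimensions is the dimension of the even cohomology. An invariant that is conditional on being
  basic tilting can be carried along a sequence of mutations, because each mutation demands a basic
  tilting source. To exclude an indecomposable target, the summands of one complex are compared in
  two decompositions; the exchange argument rests on a Fitting lemma, obtained from linear
  dependence among the powers of a chain map.\<close>

definition fscale :: "'k::field \<Rightarrow> ('i \<Rightarrow> 'k) \<Rightarrow> 'i \<Rightarrow> 'k"
  where "fscale c f = (\<lambda>i. c * f i)"

interpretation fv: vector_space fscale
  by unfold_locales (auto simp: fscale_def fun_eq_iff algebra_simps)

text \<open>Stands in for the finite-dimensional space K^S. All dimension counts take place inside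
  one function type, so that spaces with different finite supports can be compared.\<close>

definition supported :: "'i set \<Rightarrow> ('i \<Rightarrow> 'k::field) set"
  where "supported S = {f. \<forall>i. i \<notin> S \<longrightarrow> f i = 0}"

definition unit_fun :: "'i \<Rightarrow> 'i \<Rightarrow> 'k::field"
  where "unit_fun j = (\<lambda>i. if i = j then 1 else 0)"

lemma supported_expand:
  assumes "finite S" "f \<in> supported S"
  shows "f = (\<Sum>j\<in>S. fscale (f j) (unit_fun j))"
proof
  fix i
  have "(\<Sum>j\<in>S. fscale (f j) (unit_fun j)) i = (\<Sum>j\<in>S. f j * (if i = j then 1 else 0))"
    by (induction S rule: infinite_finite_induct) (auto simp: fscale_def unit_fun_def)
  also have "\<dots> = f i" using assms by (auto simp: supported_def if_distrib[of "(*) _"] cong: if_cong)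
  finally show "f i = (\<Sum>j\<in>S. fscale (f j) (unit_fun j)) i" by simp
qed

lemma inj_unit_fun: "inj (unit_fun :: 'i \<Rightarrow> 'i \<Rightarrow> 'k::field)"
  by (rule injI) (metis unit_fun_def zero_neq_one)

lemma subspace_supported: "fv.subspace (supported S)"
  by (auto simp: fv.subspace_def supported_def fscale_def)

lemma span_unit_fun:
  assumes "finite S"
  shows "fv.span (unit_fun ` S) = (supported S :: ('i \<Rightarrow> 'k::field) set)"
proof
  have "unit_fun ` S \<subseteq> (supported S :: ('i \<Rightarrow> 'k) set)"
    by (auto simp: supported_def unit_fun_def)
  then show "fv.span (unit_fun ` S) \<subseteq> (supported S :: ('i \<Rightarrow> 'k) set)"
    by (rule fv.span_minimal[OF _ subspace_supported])
next
  show "supported S \<subseteq> (fv.span (unit_fun ` S) :: ('i \<Rightarrow> 'k) set)"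
  proof
    fix f :: "'i \<Rightarrow> 'k" assume "f \<in> supported S"
    from supported_expand[OF assms this] show "f \<in> fv.span (unit_fun ` S)"
      by (metis (no_types, lifting) fv.span_sum fv.span_scale fv.span_base imageI)
  qed
qed

lemma independent_unit_fun:
  assumes "finite S"
  shows "fv.independent (unit_fun ` S :: ('i \<Rightarrow> 'k::field) set)"
  unfolding fv.dependent_def
proof
  assume "\<exists>a\<in>unit_fun ` S. a \<in> fv.span (unit_fun ` S - {a :: 'i \<Rightarrow> 'k})"
  then obtain j where j: "j \<in> S" "(unit_fun j :: 'i \<Rightarrow> 'k) \<in> fv.span (unit_fun ` S - {unit_fun j})"
    by blast
  have "unit_fun ` S - {unit_fun j :: 'i \<Rightarrow> 'k} \<subseteq> unit_fun ` (S - {j})" by auto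
  with j have "(unit_fun j :: 'i \<Rightarrow> 'k) \<in> fv.span (unit_fun ` (S - {j}))"
    using fv.span_mono by blast
  then have "(unit_fun j :: 'i \<Rightarrow> 'k) \<in> supported (S - {j})" using span_unit_fun[of "S - {j}"] assms by auto
  then show False by (auto simp: supported_def unit_fun_def)
qed

lemma dim_supported:
  assumes "finite S"
  shows "fv.dim (supported S :: ('i \<Rightarrow> 'k::field) set) = card S"
proof -
  have "fv.dim (supported S :: ('i \<Rightarrow> 'k) set) = card (unit_fun ` S :: ('i \<Rightarrow> 'k) set)"
    using span_unit_fun[OF assms] independent_unit_fun[OF assms]
    by (metis fv.dim_span_eq_card_independent)
  also have "\<dots> = card S" by (rule card_image) (metis inj_unit_fun inj_on_subset subset_UNIV)
  finally show ?thesis .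
qed

lemma finite_independent_supported:
  assumes "finite S" "fv.independent B" "B \<subseteq> (supported S :: ('i \<Rightarrow> 'k::field) set)"
  shows "finite B" "card B \<le> card S"
proof -
  have "B \<subseteq> fv.span (unit_fun ` S)" using assms span_unit_fun by auto
  from fv.independent_span_bound[OF _ assms(2) this] assms(1)
  show "finite B" "card B \<le> card S" by (auto intro: order_trans card_image_le)
qed

definition flinear :: "(('i \<Rightarrow> 'k::field) \<Rightarrow> ('j \<Rightarrow> 'k)) \<Rightarrow> bool"
  where "flinear d \<longleftrightarrow> (\<forall>u v. d (u + v) = d u + d v) \<and> (\<forall>c v. d (fscale c v) = fscale c (d v))"

lemma flinear_linear: "flinear d \<Longrightarrow> Vector_Spaces.linear fscale fscale d"
  by (simp add: flinear_def Vector_Spaces.linear_iff fv.vector_space_axioms)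

text \<open>The map is linear on all functions, in general an infinite-dimensional space, so the
  count is made inside \<open>supported S\<close>: a basis \<open>B0\<close> of the kernel is
  extended to a basis \<open>B\<close>, and \<open>d\<close> maps \<open>B - B0\<close> bijectively
  onto a basis of the image.\<close>

lemma rank_nullity:
  fixes d :: "('i \<Rightarrow> 'k::field) \<Rightarrow> ('j \<Rightarrow> 'k)"
  assumes S: "finite S" and d: "flinear d"
  shows "card S = fv.dim {v \<in> supported S. d v = 0} + fv.dim (d ` supported S)"
proof -
  interpret d: Vector_Spaces.linear fscale fscale d by (rule flinear_linear[OF d])
  let ?K = "{v \<in> supported S. d v = 0}"
  have sK: "fv.subspace ?K"
    using subspace_supported[of S] by (auto simp: fv.subspace_def d.add d.scale)
  obtain B0 where B0: "B0 \<subseteq> ?K" "fv.independent B0" "?K \<subseteq> fv.span B0"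
    by (metis (no_types, lifting) fv.basis_exists)
  have B0s: "B0 \<subseteq> supported S" using B0 by auto
  obtain B where B: "B0 \<subseteq> B" "B \<subseteq> supported S" "fv.independent B" "supported S \<subseteq> fv.span B"
    using fv.maximal_independent_subset_extend[OF B0s B0(2)] by blast
  have finB: "finite B" by (rule finite_independent_supported[OF S B(3,2)])
  have spanB: "fv.span B = supported S"
    using B(2,4) fv.span_minimal[OF B(2) subspace_supported] by auto
  let ?C = "B - B0"
  have inj: "inj_on d (fv.span ?C)"
  proof (subst d.inj_on_iff_eq_0)
    show "fv.subspace (fv.span ?C)" by simp
    show "\<forall>x\<in>fv.span ?C. d x = 0 \<longrightarrow> x = 0"
    proof (intro ballI impI)
      fix x assume x: "x \<in> fv.span ?C" "d x = 0"
      have "fv.span ?C \<subseteq> fv.span B" by (rule fv.span_mono) auto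
      then have "x \<in> ?K" using x spanB by auto
      then have "x \<in> fv.span B0" using B0 by auto
      then have "x \<in> fv.span B0 \<inter> fv.span ?C" using x by auto
      then have xB0: "x \<in> fv.span B0" and xC: "x \<in> fv.span ?C" by auto
      \<comment> \<open>\<open>x\<close> lies in the spans of two disjoint parts of the basis
        \<open>B\<close>; by uniqueness of its representation all coefficients vanish.\<close>
      have r0: "fv.representation B x = fv.representation B0 x"
        by (rule fv.representation_extend[OF B(3) xB0 B(1)])
      have r1: "fv.representation B x = fv.representation ?C x"
        by (rule fv.representation_extend[OF B(3) xC]) auto
      have "fv.representation B x b = 0" for b
        using fv.representation_ne_zero[of B0 x b] fv.representation_ne_zero[of ?C x b] r0 r1 by auto
      moreover have "x \<in> fv.span B" using xB0 B(1) fv.span_mono by blast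
      ultimately show "x = 0" using fv.sum_nonzero_representation_eq[OF B(3), of x] by simp
    qed
  qed
  have "fv.independent (d ` ?C)"
    using d.independent_inj_on_image inj B(3) fv.independent_mono by (metis Diff_subset)
  then have "fv.dim (fv.span (d ` ?C)) = card (d ` ?C)" by (rule fv.dim_span_eq_card_independent)
  also have "card (d ` ?C) = card ?C"
    by (rule card_image) (rule inj_on_subset[OF inj fv.span_superset])
  also have "fv.span (d ` ?C) = d ` supported S"
  proof -
    have "fv.span (d ` B) = d ` supported S" using d.span_image spanB by metis
    moreover have "fv.span (d ` ?C) = fv.span (d ` B)"
    proof
      show "fv.span (d ` ?C) \<subseteq> fv.span (d ` B)" by (rule fv.span_mono) auto
      have "d ` B \<subseteq> fv.span (d ` ?C)"
      proof
        fix y assume "y \<in> d ` B"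
        then obtain b where b: "b \<in> B" "y = d b" by auto
        show "y \<in> fv.span (d ` ?C)"
        proof (cases "b \<in> B0")
          case True
          then have "y = 0" using b B0 by auto
          then show ?thesis by (simp add: fv.span_zero)
        qed (use b in \<open>auto intro: fv.span_base\<close>)
      qed
      then show "fv.span (d ` B) \<subseteq> fv.span (d ` ?C)" by (rule fv.span_minimal) simp
    qed
    ultimately show ?thesis by simp
  qed
  finally have "fv.dim (d ` supported S) = card ?C" .
  moreover have "fv.dim ?K = card B0" using B0 fv.basis_card_eq_dim by metis
  moreover have "card S = card B"
    using dim_supported[OF S, where ?'k = 'k] spanB B(3) fv.dim_span_eq_card_independent by metis
  moreover have "card B = card B0 + card ?C"
    using B(1) finB by (metis card_Diff_subset card_mono finite_subset le_add_diff_inverse)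
  ultimately show ?thesis by simp
qed

lemma subspace_eq_of_dim:
  assumes S: "finite S" and U: "fv.subspace U" "fv.subspace V" "U \<subseteq> V" "V \<subseteq> supported S"
    and d: "fv.dim V \<le> fv.dim U"
  shows "U = V"
proof (rule antisym[OF U(3)], rule ccontr)
  obtain B where B: "B \<subseteq> U" "fv.independent B" "U \<subseteq> fv.span B" by (metis fv.basis_exists)
  assume "\<not> V \<subseteq> U"
  then obtain x where x: "x \<in> V" "x \<notin> U" by auto
  have sB: "fv.span B = U" using B U(1) fv.span_minimal by blast
  then have i: "fv.independent (insert x B)" using B(2) x(2) fv.independent_insertI by blast
  obtain B' where B': "insert x B \<subseteq> B'" "B' \<subseteq> V" "fv.independent B'" "V \<subseteq> fv.span B'"
    using fv.maximal_independent_subset_extend[OF _ i, of V] x B U(3)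
    by (metis insert_subset subset_trans)
  have f: "finite B'" using finite_independent_supported[OF S B'(3)] B'(2) U(4) by auto
  have "fv.dim V = card B'" using B' fv.basis_card_eq_dim by metis
  moreover have "fv.dim U = card B" using B fv.basis_card_eq_dim by metis
  moreover have "x \<notin> B" using x(2) B(1) by auto
  moreover have "card (insert x B) \<le> card B'" using B'(1) f card_mono by blast
  moreover have "finite B" using f B'(1) by (meson finite_insert finite_subset)
  ultimately show False using d by simp
qed

text \<open>A complex of period two with terms K^S0 and K^S1. The difference of the dimensions of
  its terms equals that of its cohomologies. If the cohomology at S1 vanishes,
  \<open>card S0 - card S1\<close> is the dimension of the cohomology at S0; so it is nonnegative,
  and it is zero only if this cohomology vanishes as well.\<close>

lemma exactness_transfer:
  fixes d :: "('i \<Rightarrow> 'k::field) \<Rightarrow> ('i \<Rightarrow> 'k)"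
  assumes S: "finite S0" "finite S1" and d: "flinear d"
    and cl: "d ` supported S0 \<subseteq> supported S1" "d ` supported S1 \<subseteq> supported S0"
    and dd0: "\<And>v. v \<in> supported S0 \<Longrightarrow> d (d v) = 0"
    and dd1: "\<And>v. v \<in> supported S1 \<Longrightarrow> d (d v) = 0"
    and ex: "\<And>v. v \<in> supported S1 \<Longrightarrow> d v = 0 \<Longrightarrow> v \<in> d ` supported S0"
  shows "card S1 \<le> card S0"
    and "card S0 = card S1 \<Longrightarrow> v \<in> supported S0 \<Longrightarrow> d v = 0 \<Longrightarrow> v \<in> d ` supported S1"
proof -
  interpret d: Vector_Spaces.linear fscale fscale d by (rule flinear_linear[OF d])
  let ?K0 = "{v \<in> supported S0. d v = 0}" and ?K1 = "{v \<in> supported S1. d v = 0}"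
  have e: "d ` supported S0 = ?K1" using cl ex dd0 by auto
  have s: "d ` supported S1 \<subseteq> ?K0" using cl dd1 by auto
  have r0: "card S0 = fv.dim ?K0 + fv.dim ?K1" using rank_nullity[OF S(1) d] e by simp
  have r1: "card S1 = fv.dim ?K1 + fv.dim (d ` supported S1)" using rank_nullity[OF S(2) d] by simp
  have sK: "fv.subspace ?K0"
    using subspace_supported[of S0] by (auto simp: fv.subspace_def d.add d.scale)
  have sI: "fv.subspace (d ` supported S1)" by (rule d.subspace_image[OF subspace_supported])
  have le: "fv.dim (d ` supported S1) \<le> fv.dim ?K0"
  proof -
    obtain B where B: "B \<subseteq> d ` supported S1" "fv.independent B" "d ` supported S1 \<subseteq> fv.span B"
      by (metis fv.basis_exists)
    obtain B' where B': "B \<subseteq> B'" "B' \<subseteq> ?K0" "fv.independent B'" "?K0 \<subseteq> fv.span B'"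
      using fv.maximal_independent_subset_extend[OF _ B(2), of ?K0] B s by (metis (no_types, lifting) order_trans)
    have "finite B'" using finite_independent_supported[OF S(1) B'(3)] B'(2) by auto
    then have "card B \<le> card B'" using B'(1) card_mono by blast
    then show ?thesis using B B' fv.basis_card_eq_dim by metis
  qed
  show "card S1 \<le> card S0" using r0 r1 le by simp
  assume "card S0 = card S1" and v: "v \<in> supported S0" "d v = 0"
  then have "fv.dim ?K0 \<le> fv.dim (d ` supported S1)" using r0 r1 by simp
  from subspace_eq_of_dim[OF S(1) sI sK s _ this] have "d ` supported S1 = ?K0" by auto
  then show "v \<in> d ` supported S1" using v by auto
qed

text \<open>\<open>fv.dependent\<close> concerns sets, but a sequence may repeat a vector; a
  repetition is itself a dependency. The intended sequence consists of the powers of an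
  endomorphism.\<close>

lemma supported_dependency:
  fixes v :: "nat \<Rightarrow> 'i \<Rightarrow> 'k::field"
  assumes S: "finite S" and v: "\<And>k. v k \<in> supported S"
  obtains N c where "(\<Sum>k\<le>N. fscale (c k) (v k)) = 0" "\<exists>k\<le>N. c k \<noteq> 0"
proof (cases "inj v")
  case False
  then obtain a b where ab: "a < b" "v a = v b" unfolding inj_def by (metis linorder_neqE_nat)
  define c :: "nat \<Rightarrow> 'k" where "c k = (if k = b then 1 else if k = a then -1 else 0)" for k
  have "(\<Sum>k\<le>b. fscale (c k) (v k)) = (\<Sum>k\<in>{a,b}. fscale (c k) (v k))"
    by (rule sum.mono_neutral_right) (use ab in \<open>auto simp: c_def\<close>)
  also have "\<dots> = 0" using ab by (auto simp: c_def)
  finally show ?thesis by (rule that) (auto simp: c_def)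
next
  case True
  have "fv.dependent (v ` {..card S})"
  proof (rule ccontr)
    assume i: "fv.independent (v ` {..card S})"
    have "card (v ` {..card S}) \<le> card S"
      by (rule finite_independent_supported(2)[OF S i]) (use v in auto)
    moreover have "card (v ` {..card S}) = Suc (card S)"
      using card_image[OF inj_on_subset[OF True]] by simp
    ultimately show False by simp
  qed
  then obtain u where u: "(\<exists>w\<in>v ` {..card S}. u w \<noteq> 0)" "(\<Sum>w\<in>v ` {..card S}. fscale (u w) w) = 0"
    by (auto simp: fv.dependent_finite)
  show ?thesis
  proof (rule that)
    show "(\<Sum>k\<le>card S. fscale (u (v k)) (v k)) = 0"
      using u(2) by (subst (asm) sum.reindex) (auto intro: inj_on_subset[OF True])
    show "\<exists>k\<le>card S. u (v k) \<noteq> 0" using u(1) by auto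
  qed
qed

section \<open>Modules and complexes\<close>

locale base_ring = ring R for R :: "'a ring" (structure)
begin

abbreviation rmd :: "'a rmod \<Rightarrow> bool"
  where "rmd M \<equiv> right_module R M"

lemma rmd_ag: "rmd M \<Longrightarrow> abelian_group M" by (simp add: right_module_def)

lemma rmd_am: "rmd M \<Longrightarrow> abelian_monoid M" using rmd_ag abelian_group_def by blast

lemmas m_closed' = abelian_monoid.a_closed[OF rmd_am]
lemmas m_zero = abelian_monoid.zero_closed[OF rmd_am]
lemmas m_neg_closed = abelian_group.a_inv_closed[OF rmd_ag]
lemmas m_assoc' = abelian_monoid.a_assoc[OF rmd_am]
lemmas m_comm' = abelian_monoid.a_comm[OF rmd_am]
lemmas m_lcomm' = abelian_monoid.a_lcomm[OF rmd_am]
lemmas m_l_zero = abelian_monoid.l_zero[OF rmd_am]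
lemmas m_r_zero = abelian_monoid.r_zero[OF rmd_am]
lemmas m_l_neg = abelian_group.l_neg[OF rmd_ag]
lemmas m_r_neg = abelian_group.r_neg[OF rmd_ag]
lemmas m_r_neg1 = abelian_group.r_neg1[OF rmd_ag]
lemmas m_r_neg2 = abelian_group.r_neg2[OF rmd_ag]
lemmas m_minus_add = abelian_group.minus_add[OF rmd_ag]
lemmas m_minus_minus = abelian_group.minus_minus[OF rmd_ag]
lemma m_minus_zero: "rmd M \<Longrightarrow> \<ominus>\<^bsub>M\<^esub> \<zero>\<^bsub>M\<^esub> = \<zero>\<^bsub>M\<^esub>"
  by (metis abelian_group.minus_equality m_l_zero m_zero rmd_ag)

lemmas m_ract = right_module.ract_closed
lemmas m_simps = m_closed' m_zero m_neg_closed m_l_zero m_r_zero m_l_neg m_r_neg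
  m_r_neg1 m_r_neg2 m_minus_add m_minus_minus m_minus_zero m_ract
lemmas m_ac = m_assoc' m_comm' m_lcomm'

lemma m_cancel:
  "rmd M \<Longrightarrow> x \<in> carrier M \<Longrightarrow> y \<in> carrier M \<Longrightarrow> z \<in> carrier M \<Longrightarrow> x \<oplus>\<^bsub>M\<^esub> y = x \<oplus>\<^bsub>M\<^esub> z \<Longrightarrow> y = z"
  by (metis m_r_neg1)

lemma m_eq_minus:
  "rmd M \<Longrightarrow> x \<in> carrier M \<Longrightarrow> y \<in> carrier M \<Longrightarrow> x \<oplus>\<^bsub>M\<^esub> y = \<zero>\<^bsub>M\<^esub> \<Longrightarrow> x = \<ominus>\<^bsub>M\<^esub> y"
  by (metis abelian_group.minus_equality rmd_ag)

lemma m_minus_eq_iff: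
  "rmd M \<Longrightarrow> x \<in> carrier M \<Longrightarrow> y \<in> carrier M \<Longrightarrow> z \<in> carrier M \<Longrightarrow>
    x \<ominus>\<^bsub>M\<^esub> y = z \<longleftrightarrow> x = y \<oplus>\<^bsub>M\<^esub> z"
  unfolding a_minus_def using m_r_neg2[of M y z] m_simps(5)
  by (auto simp: m_simps m_ac)

lemma m_ract_zero: "rmd M \<Longrightarrow> a \<in> carrier R \<Longrightarrow> ract M \<zero>\<^bsub>M\<^esub> a = \<zero>\<^bsub>M\<^esub>"
  by (metis m_cancel m_l_zero m_r_zero m_ract m_zero right_module.ract_add_left)

lemma m_ract_neg:
  "rmd M \<Longrightarrow> x \<in> carrier M \<Longrightarrow> a \<in> carrier R \<Longrightarrow> ract M (\<ominus>\<^bsub>M\<^esub> x) a = \<ominus>\<^bsub>M\<^esub> ract M x a"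
  by (metis m_eq_minus m_l_neg m_neg_closed m_ract m_ract_zero right_module.ract_add_left)

lemma rhomI:
  assumes "\<And>x. x \<in> carrier M \<Longrightarrow> f x \<in> carrier N"
    "\<And>x y. x \<in> carrier M \<Longrightarrow> y \<in> carrier M \<Longrightarrow> f (x \<oplus>\<^bsub>M\<^esub> y) = f x \<oplus>\<^bsub>N\<^esub> f y"
    "\<And>x a. x \<in> carrier M \<Longrightarrow> a \<in> carrier R \<Longrightarrow> f (ract M x a) = ract N (f x) a"
  shows "f \<in> rhom R M N"
  using assms by (auto simp: rhom_def)

lemma rhom_closed: "f \<in> rhom R M N \<Longrightarrow> x \<in> carrier M \<Longrightarrow> f x \<in> carrier N"
  by (auto simp: rhom_def)

lemma rhom_add: "f \<in> rhom R M N \<Longrightarrow> x \<in> carrier M \<Longrightarrow> y \<in> carrier M \<Longrightarrow> f (x \<oplus>\<^bsub>M\<^esub> y) = f x \<oplus>\<^bsub>N\<^esub> f y"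
  by (auto simp: rhom_def)

lemma rhom_act: "f \<in> rhom R M N \<Longrightarrow> x \<in> carrier M \<Longrightarrow> a \<in> carrier R \<Longrightarrow> f (ract M x a) = ract N (f x) a"
  by (auto simp: rhom_def)

lemma rhom_0: "rmd M \<Longrightarrow> rmd N \<Longrightarrow> f \<in> rhom R M N \<Longrightarrow> f \<zero>\<^bsub>M\<^esub> = \<zero>\<^bsub>N\<^esub>"
  using rhom_add[of f M N "\<zero>\<^bsub>M\<^esub>" "\<zero>\<^bsub>M\<^esub>"] m_cancel[of N "f \<zero>\<^bsub>M\<^esub>" "f \<zero>\<^bsub>M\<^esub>" "\<zero>\<^bsub>N\<^esub>"]
  by (simp add: m_simps rhom_closed)

lemma rhom_neg: "rmd M \<Longrightarrow> rmd N \<Longrightarrow> f \<in> rhom R M N \<Longrightarrow> x \<in> carrier M \<Longrightarrow> f (\<ominus>\<^bsub>M\<^esub> x) = \<ominus>\<^bsub>N\<^esub> f x"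
  using rhom_add[of f M N "\<ominus>\<^bsub>M\<^esub> x" x] m_eq_minus[of N "f (\<ominus>\<^bsub>M\<^esub> x)" "f x"]
  by (simp add: m_simps rhom_closed rhom_0)

lemma rhom_id: "(\<lambda>x. x) \<in> rhom R M M"
  by (rule rhomI) auto

lemma rhom_comp: "f \<in> rhom R M N \<Longrightarrow> g \<in> rhom R N L \<Longrightarrow> (\<lambda>x. g (f x)) \<in> rhom R M L"
  by (rule rhomI) (auto simp: rhom_closed rhom_add rhom_act)

lemma rhom_plus:
  "rmd N \<Longrightarrow> f \<in> rhom R M N \<Longrightarrow> g \<in> rhom R M N \<Longrightarrow> (\<lambda>x. f x \<oplus>\<^bsub>N\<^esub> g x) \<in> rhom R M N"
  by (rule rhomI) (simp_all add: rhom_closed rhom_add rhom_act m_simps m_ac right_module.ract_add_left)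

lemma rhom_uminus: "rmd N \<Longrightarrow> f \<in> rhom R M N \<Longrightarrow> (\<lambda>x. \<ominus>\<^bsub>N\<^esub> f x) \<in> rhom R M N"
  by (rule rhomI) (simp_all add: rhom_closed rhom_add rhom_act m_simps m_ac m_ract_neg)

lemma rhom_zero: "rmd N \<Longrightarrow> (\<lambda>x. \<zero>\<^bsub>N\<^esub>) \<in> rhom R M N"
  by (rule rhomI) (simp_all add: m_simps m_ract_zero)

subsection \<open>Complexes\<close>

text \<open>The setting of the homotopy calculus: complexes of arbitrary right modules. Objects of
  \<open>Kb_proj R\<close> enter it through \<open>Kb_cx\<close>.\<close>

definition cx :: "'a cplx \<Rightarrow> bool"
  where "cx X \<longleftrightarrow> (\<forall>n. rmd (obj X n)) \<and> (\<forall>n. dif X n \<in> rhom R (obj X n) (obj X (n + 1))) \<and>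
    (\<forall>n. \<forall>x \<in> carrier (obj X n). dif X (n + 1) (dif X n x) = \<zero>\<^bsub>obj X (n + 2)\<^esub>)"

lemma Kb_cx: "X \<in> Kb_proj R \<Longrightarrow> cx X"
  by (auto simp: Kb_proj_def cx_def fg_projective_def)

lemma cx_rmd: "cx X \<Longrightarrow> rmd (obj X n)" by (simp add: cx_def)

lemma cx_dif: "cx X \<Longrightarrow> dif X n \<in> rhom R (obj X n) (obj X (n + 1))" by (simp add: cx_def)

lemma cx_dif': "cx X \<Longrightarrow> dif X (n - 1) \<in> rhom R (obj X (n - 1)) (obj X n)"
  using cx_dif[of X "n - 1"] by simp

lemma cx_dd: "cx X \<Longrightarrow> x \<in> carrier (obj X n) \<Longrightarrow> dif X (n + 1) (dif X n x) = \<zero>\<^bsub>obj X (n + 2)\<^esub>"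
  by (simp add: cx_def)

lemma cx_dd': "cx X \<Longrightarrow> x \<in> carrier (obj X (n - 1)) \<Longrightarrow> dif X n (dif X (n - 1) x) = \<zero>\<^bsub>obj X (n + 1)\<^esub>"
  using cx_dd[of X x "n - 1"] by (simp add: add.commute)

text \<open>Elementwise typing of a family of maps: what it takes to move a term to the other side
  of the homotopy equation.\<close>

definition mp :: "'a cplx \<Rightarrow> 'a cplx \<Rightarrow> 'a cmap \<Rightarrow> bool"
  where "mp X Y f \<longleftrightarrow> (\<forall>n. \<forall>x \<in> carrier (obj X n). f n x \<in> carrier (obj Y n))"

lemma cm_rhom: "f \<in> chain_maps R X Y \<Longrightarrow> f n \<in> rhom R (obj X n) (obj Y n)"
  by (simp add: chain_maps_def)

lemma cm_dif: "f \<in> chain_maps R X Y \<Longrightarrow> x \<in> carrier (obj X n) \<Longrightarrow> f (n + 1) (dif X n x) = dif Y n (f n x)"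
  by (simp add: chain_maps_def)

lemma cm_dif': "f \<in> chain_maps R X Y \<Longrightarrow> x \<in> carrier (obj X (n - 1)) \<Longrightarrow> f n (dif X (n - 1) x) = dif Y (n - 1) (f (n - 1) x)"
  using cm_dif[of f X Y x "n - 1"] by simp

lemma cm_closed: "f \<in> chain_maps R X Y \<Longrightarrow> x \<in> carrier (obj X n) \<Longrightarrow> f n x \<in> carrier (obj Y n)"
  by (metis cm_rhom rhom_closed)

lemma cm_mp: "f \<in> chain_maps R X Y \<Longrightarrow> mp X Y f"
  by (simp add: mp_def cm_closed)

lemma cmI:
  assumes "\<And>n. f n \<in> rhom R (obj X n) (obj Y n)"
    "\<And>n x. x \<in> carrier (obj X n) \<Longrightarrow> f (n + 1) (dif X n x) = dif Y n (f n x)"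
  shows "f \<in> chain_maps R X Y"
  using assms by (simp add: chain_maps_def)

lemma cm_id: "cid \<in> chain_maps R X X"
  by (rule cmI) (auto simp: cid_def rhom_id)

lemma cm_comp: "f \<in> chain_maps R X Y \<Longrightarrow> g \<in> chain_maps R Y Z \<Longrightarrow> g \<bullet> f \<in> chain_maps R X Z"
  unfolding ccomp_def
  by (rule cmI) (auto simp: cm_dif cm_closed intro: rhom_comp[OF cm_rhom cm_rhom])

lemma cm_zero: "cx X \<Longrightarrow> cx Y \<Longrightarrow> czero Y \<in> chain_maps R X Y"
  by (rule cmI) (auto simp: czero_def cx_rmd rhom_zero rhom_0[OF _ _ cx_dif])

definition cplus :: "'a cplx \<Rightarrow> 'a cmap \<Rightarrow> 'a cmap \<Rightarrow> 'a cmap"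
  where "cplus Y f g = (\<lambda>n x. f n x \<oplus>\<^bsub>obj Y n\<^esub> g n x)"

definition cneg :: "'a cplx \<Rightarrow> 'a cmap \<Rightarrow> 'a cmap"
  where "cneg Y f = (\<lambda>n x. \<ominus>\<^bsub>obj Y n\<^esub> f n x)"

lemma cm_plus: "cx Y \<Longrightarrow> f \<in> chain_maps R X Y \<Longrightarrow> g \<in> chain_maps R X Y \<Longrightarrow> cplus Y f g \<in> chain_maps R X Y"
  by (rule cmI) (auto simp: cplus_def cx_rmd cm_dif rhom_add[OF cx_dif] cm_closed intro!: rhom_plus[OF cx_rmd cm_rhom cm_rhom])

lemma cm_neg: "cx Y \<Longrightarrow> f \<in> chain_maps R X Y \<Longrightarrow> cneg Y f \<in> chain_maps R X Y"
  by (rule cmI) (auto simp: cneg_def cx_rmd cm_dif rhom_neg[OF _ _ cx_dif] cm_closed intro!: rhom_uminus[OF cx_rmd cm_rhom])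

subsection \<open>Homotopies\<close>

definition is_htpy :: "'a cplx \<Rightarrow> 'a cplx \<Rightarrow> 'a cmap \<Rightarrow> bool"
  where "is_htpy X Y s \<longleftrightarrow> (\<forall>n. s n \<in> rhom R (obj X n) (obj Y (n - 1)))"

definition htpy_map :: "'a cplx \<Rightarrow> 'a cplx \<Rightarrow> 'a cmap \<Rightarrow> 'a cmap"
  where "htpy_map X Y s = (\<lambda>n x. dif Y (n - 1) (s n x) \<oplus>\<^bsub>obj Y n\<^esub> s (n + 1) (dif X n x))"

text \<open>Subtraction-free form of \<open>homotopic\<close>.\<close>

definition htp :: "'a cplx \<Rightarrow> 'a cplx \<Rightarrow> 'a cmap \<Rightarrow> 'a cmap \<Rightarrow> bool"
  where "htp X Y f g \<longleftrightarrow> (\<exists>s. is_htpy X Y s \<and>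
    (\<forall>n. \<forall>x \<in> carrier (obj X n). f n x = g n x \<oplus>\<^bsub>obj Y n\<^esub> htpy_map X Y s n x))"

lemma is_htpy_closed: "is_htpy X Y s \<Longrightarrow> x \<in> carrier (obj X n) \<Longrightarrow> s n x \<in> carrier (obj Y (n - 1))"
  unfolding is_htpy_def by (metis rhom_closed)

lemma is_htpy_closed': "is_htpy X Y s \<Longrightarrow> x \<in> carrier (obj X (n + 1)) \<Longrightarrow> s (n + 1) x \<in> carrier (obj Y n)"
  using is_htpy_closed[of X Y s x "n + 1"] by simp

lemma htpy_map_closed:
  "cx X \<Longrightarrow> cx Y \<Longrightarrow> is_htpy X Y s \<Longrightarrow> x \<in> carrier (obj X n) \<Longrightarrow> htpy_map X Y s n x \<in> carrier (obj Y n)"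
  by (simp add: htpy_map_def m_closed' cx_rmd rhom_closed[OF cx_dif'] is_htpy_closed is_htpy_closed'
      rhom_closed[OF cx_dif])

lemma homotopic_iff:
  assumes "cx X" "cx Y" "mp X Y f" "mp X Y g"
  shows "homotopic R X Y f g \<longleftrightarrow> htp X Y f g"
proof -
  have "(f n x \<ominus>\<^bsub>obj Y n\<^esub> g n x = htpy_map X Y s n x) \<longleftrightarrow> (f n x = g n x \<oplus>\<^bsub>obj Y n\<^esub> htpy_map X Y s n x)"
    if "is_htpy X Y s" "x \<in> carrier (obj X n)" for s n x
    using assms that by (intro m_minus_eq_iff) (auto simp: mp_def htpy_map_closed cx_rmd)
  then show ?thesis unfolding homotopic_def htp_def is_htpy_def htpy_map_def by blast
qed

lemma htpI:
  "is_htpy X Y s \<Longrightarrow> (\<And>n x. x \<in> carrier (obj X n) \<Longrightarrow> f n x = g n x \<oplus>\<^bsub>obj Y n\<^esub> htpy_map X Y s n x) \<Longrightarrow>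
    htp X Y f g"
  unfolding htp_def by blast

lemma htp_eq: 
  assumes "cx X" "cx Y" "mp X Y g" "\<And>n x. x \<in> carrier (obj X n) \<Longrightarrow> f n x = g n x"
  shows "htp X Y f g"
proof (rule htpI)
  show "is_htpy X Y (\<lambda>n x. \<zero>\<^bsub>obj Y (n - 1)\<^esub>)" 
    using assms by (auto simp: is_htpy_def cx_rmd rhom_zero)
  show "f n x = g n x \<oplus>\<^bsub>obj Y n\<^esub> htpy_map X Y (\<lambda>n x. \<zero>\<^bsub>obj Y (n - 1)\<^esub>) n x" if "x \<in> carrier (obj X n)" for n x
    using assms that
    by (simp add: htpy_map_def mp_def cx_rmd m_simps rhom_0[OF _ _ cx_dif'])
qed

lemma htp_refl: "cx X \<Longrightarrow> cx Y \<Longrightarrow> mp X Y f \<Longrightarrow> htp X Y f f"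
  by (rule htp_eq) auto

lemma htpy_map_plus:
  assumes "cx X" "cx Y" "is_htpy X Y s" "is_htpy X Y t" "x \<in> carrier (obj X n)"
  shows "htpy_map X Y (\<lambda>n x. s n x \<oplus>\<^bsub>obj Y (n - 1)\<^esub> t n x) n x =
    htpy_map X Y s n x \<oplus>\<^bsub>obj Y n\<^esub> htpy_map X Y t n x"
  using assms
  by (simp add: htpy_map_def rhom_add[OF cx_dif'] is_htpy_closed is_htpy_closed' rhom_closed[OF cx_dif]
      rhom_closed[OF cx_dif'] m_closed' cx_rmd m_ac)

lemma htpy_map_uminus:
  assumes "cx X" "cx Y" "is_htpy X Y s" "x \<in> carrier (obj X n)"
  shows "htpy_map X Y (\<lambda>n x. \<ominus>\<^bsub>obj Y (n - 1)\<^esub> s n x) n x = \<ominus>\<^bsub>obj Y n\<^esub> htpy_map X Y s n x"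
  using assms
  by (simp add: htpy_map_def rhom_neg[OF _ _ cx_dif'] is_htpy_closed is_htpy_closed' rhom_closed[OF cx_dif]
      rhom_closed[OF cx_dif'] m_simps cx_rmd)

lemma is_htpy_plus:
  "cx Y \<Longrightarrow> is_htpy X Y s \<Longrightarrow> is_htpy X Y t \<Longrightarrow> is_htpy X Y (\<lambda>n x. s n x \<oplus>\<^bsub>obj Y (n - 1)\<^esub> t n x)"
  by (auto simp: is_htpy_def cx_rmd intro: rhom_plus)

lemma is_htpy_uminus: "cx Y \<Longrightarrow> is_htpy X Y s \<Longrightarrow> is_htpy X Y (\<lambda>n x. \<ominus>\<^bsub>obj Y (n - 1)\<^esub> s n x)"
  by (auto simp: is_htpy_def cx_rmd intro: rhom_uminus)

lemma htp_plus:
  assumes "cx X" "cx Y" "mp X Y f'" "mp X Y g'" "htp X Y f f'" "htp X Y g g'"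
  shows "htp X Y (cplus Y f g) (cplus Y f' g')"
proof -
  from assms obtain s t where s: "is_htpy X Y s" "is_htpy X Y t"
    "\<And>n x. x \<in> carrier (obj X n) \<Longrightarrow> f n x = f' n x \<oplus>\<^bsub>obj Y n\<^esub> htpy_map X Y s n x"
    "\<And>n x. x \<in> carrier (obj X n) \<Longrightarrow> g n x = g' n x \<oplus>\<^bsub>obj Y n\<^esub> htpy_map X Y t n x"
    unfolding htp_def by metis
  show ?thesis
    by (rule htpI[OF is_htpy_plus[OF assms(2) s(1,2)]])
      (use assms s in \<open>simp add: cplus_def htpy_map_plus htpy_map_closed cx_rmd m_simps m_ac mp_def\<close>)
qed

lemma htp_sym:
  assumes "cx X" "cx Y" "mp X Y g" "htp X Y f g"
  shows "htp X Y g f"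
proof -
  from assms obtain s where s: "is_htpy X Y s" 
    "\<And>n x. x \<in> carrier (obj X n) \<Longrightarrow> f n x = g n x \<oplus>\<^bsub>obj Y n\<^esub> htpy_map X Y s n x"
    unfolding htp_def by metis
  show ?thesis
    by (rule htpI[OF is_htpy_uminus[OF assms(2) s(1)]])
      (use assms s in \<open>simp add: htpy_map_uminus htpy_map_closed cx_rmd m_simps m_assoc' mp_def\<close>)
qed

lemma htp_trans:
  assumes "cx X" "cx Y" "mp X Y h" "htp X Y f g" "htp X Y g h"
  shows "htp X Y f h"
proof -
  from assms obtain s t where s: "is_htpy X Y s" "is_htpy X Y t"
    "\<And>n x. x \<in> carrier (obj X n) \<Longrightarrow> f n x = g n x \<oplus>\<^bsub>obj Y n\<^esub> htpy_map X Y s n x"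
    "\<And>n x. x \<in> carrier (obj X n) \<Longrightarrow> g n x = h n x \<oplus>\<^bsub>obj Y n\<^esub> htpy_map X Y t n x"
    unfolding htp_def by metis
  show ?thesis
    by (rule htpI[OF is_htpy_plus[OF assms(2) s(1,2)]])
      (use assms s in \<open>simp add: htpy_map_plus htpy_map_closed cx_rmd m_simps m_ac mp_def\<close>)
qed

lemma htp_comp_left:
  assumes "cx X" "cx Y" "cx Z" "mp X Y f'" "htp X Y f f'" "g \<in> chain_maps R Y Z"
  shows "htp X Z (g \<bullet> f) (g \<bullet> f')"
proof -
  from assms obtain s where s: "is_htpy X Y s" 
    "\<And>n x. x \<in> carrier (obj X n) \<Longrightarrow> f n x = f' n x \<oplus>\<^bsub>obj Y n\<^esub> htpy_map X Y s n x"
    unfolding htp_def by metis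
  show ?thesis
  proof (rule htpI)
    show "is_htpy X Z (\<lambda>n x. g (n - 1) (s n x))"
      using s assms unfolding is_htpy_def by (blast intro: rhom_comp[OF _ cm_rhom])
    show "(g \<bullet> f) n x = (g \<bullet> f') n x \<oplus>\<^bsub>obj Z n\<^esub> htpy_map X Z (\<lambda>n x. g (n - 1) (s n x)) n x"
      if x: "x \<in> carrier (obj X n)" for n x
    proof -
      have "g n (htpy_map X Y s n x) = htpy_map X Z (\<lambda>n x. g (n - 1) (s n x)) n x"
        using assms s x by (simp add: htpy_map_def rhom_add[OF cm_rhom[OF assms(6)]] cm_dif'
            rhom_closed[OF cx_dif'] rhom_closed[OF cx_dif] is_htpy_closed is_htpy_closed')
      then show ?thesis using s x assms
        by (simp add: ccomp_def rhom_add[OF cm_rhom[OF assms(6)]] htpy_map_closed mp_def)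
    qed
  qed
qed

lemma htp_comp_right:
  assumes "cx X" "cx Y" "cx Z" "htp Y Z f f'" "g \<in> chain_maps R X Y"
  shows "htp X Z (f \<bullet> g) (f' \<bullet> g)"
proof -
  from assms obtain s where s: "is_htpy Y Z s" 
    "\<And>n x. x \<in> carrier (obj Y n) \<Longrightarrow> f n x = f' n x \<oplus>\<^bsub>obj Z n\<^esub> htpy_map Y Z s n x"
    unfolding htp_def by metis
  show ?thesis
  proof (rule htpI)
    show "is_htpy X Z (\<lambda>n x. s n (g n x))"
      using s assms unfolding is_htpy_def by (blast intro: rhom_comp[OF cm_rhom])
    show "(f \<bullet> g) n x = (f' \<bullet> g) n x \<oplus>\<^bsub>obj Z n\<^esub> htpy_map X Z (\<lambda>n x. s n (g n x)) n x"
      if x: "x \<in> carrier (obj X n)" for n x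
      using s x assms by (simp add: ccomp_def htpy_map_def cm_dif cm_closed)
  qed
qed

end

context base_ring
begin

subsection \<open>Isomorphisms and retracts\<close>

lemma ccomp_assoc: "h \<bullet> (g \<bullet> f) = h \<bullet> g \<bullet> f"
  by (simp add: ccomp_def)

lemma ccomp_cid [simp]: "cid \<bullet> f = f" "f \<bullet> cid = f"
  by (simp_all add: ccomp_def cid_def)

lemma is_iso_iff:
  assumes "cx X" "cx Y"
  shows "is_iso R X Y f \<longleftrightarrow> f \<in> chain_maps R X Y \<and>
    (\<exists>g \<in> chain_maps R Y X. htp X X (g \<bullet> f) cid \<and> htp Y Y (f \<bullet> g) cid)"
  unfolding is_iso_def using assms by (metis homotopic_iff cm_mp cm_comp cm_id)

lemma isoE:
  assumes "isomorphic R X Y" "cx X" "cx Y"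
  obtains f g where "f \<in> chain_maps R X Y" "g \<in> chain_maps R Y X"
    "htp X X (g \<bullet> f) cid" "htp Y Y (f \<bullet> g) cid"
  using assms unfolding isomorphic_def by (metis is_iso_iff)

lemma isoI:
  assumes "cx X" "cx Y" "f \<in> chain_maps R X Y" "g \<in> chain_maps R Y X"
    "htp X X (g \<bullet> f) cid" "htp Y Y (f \<bullet> g) cid"
  shows "isomorphic R X Y"
  using assms unfolding isomorphic_def by (metis is_iso_iff)

lemma isoI_strict:
  assumes "cx X" "cx Y" "f \<in> chain_maps R X Y" "g \<in> chain_maps R Y X"
    "\<And>n x. x \<in> carrier (obj X n) \<Longrightarrow> g n (f n x) = x"
    "\<And>n y. y \<in> carrier (obj Y n) \<Longrightarrow> f n (g n y) = y"
  shows "isomorphic R X Y"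
  using assms by (intro isoI[of X Y f g] htp_eq) (auto simp: ccomp_def cid_def mp_def)

lemma iso_refl: "cx X \<Longrightarrow> isomorphic R X X"
  by (rule isoI_strict[of X X cid cid]) (auto simp: cm_id, auto simp: cid_def)

lemma iso_sym: "cx X \<Longrightarrow> cx Y \<Longrightarrow> isomorphic R X Y \<Longrightarrow> isomorphic R Y X"
  by (metis isoE isoI)

text \<open>The inner composite is contracted first: k h g f is homotopic to k f and then to the
  identity. Serves the composition of isomorphisms as well as that of retractions.\<close>

lemma htp_sandwich:
  assumes "cx X" "cx Y" "cx Z" "f \<in> chain_maps R X Y" "k \<in> chain_maps R Y X"
    "g \<in> chain_maps R Y Z" "h \<in> chain_maps R Z Y" "htp X X (k \<bullet> f) cid" "htp Y Y (h \<bullet> g) cid"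
  shows "htp X X (k \<bullet> h \<bullet> (g \<bullet> f)) cid"
proof -
  have "htp X X (k \<bullet> (h \<bullet> g \<bullet> f)) (k \<bullet> (cid \<bullet> f))"
    by (rule htp_comp_left[OF assms(1,2,1) _ htp_comp_right[OF assms(1,2,2,9,4)] assms(5)])
      (use assms in \<open>simp add: cm_mp\<close>)
  then have "htp X X (k \<bullet> h \<bullet> (g \<bullet> f)) (k \<bullet> f)" by (simp add: ccomp_def cid_def)
  then show ?thesis using assms htp_trans cm_mp cm_id by blast
qed

lemma iso_trans:
  assumes "cx X" "cx Y" "cx Z" "isomorphic R X Y" "isomorphic R Y Z"
  shows "isomorphic R X Z"
proof -
  obtain f k where f: "f \<in> chain_maps R X Y" "k \<in> chain_maps R Y X"
    "htp X X (k \<bullet> f) cid" "htp Y Y (f \<bullet> k) cid" by (rule isoE[OF assms(4,1,2)])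
  obtain g h where g: "g \<in> chain_maps R Y Z" "h \<in> chain_maps R Z Y"
    "htp Y Y (h \<bullet> g) cid" "htp Z Z (g \<bullet> h) cid" by (rule isoE[OF assms(5,2,3)])
  show ?thesis
    by (rule isoI[OF assms(1,3) cm_comp[OF f(1) g(1)] cm_comp[OF g(2) f(2)]])
      (use htp_sandwich[OF assms(1-3) f(1,2) g(1,2) f(3) g(3)]
        htp_sandwich[OF assms(3,2,1) g(2,1) f(2,1) g(4) f(4)] in auto)
qed

text \<open>Direct summands in the homotopy category, without a chosen complement. In this form the
  relation is transitive and passes to isomorphic complexes at once.\<close>

definition retr :: "'a cplx \<Rightarrow> 'a cplx \<Rightarrow> bool"
  where "retr X Y \<longleftrightarrow> (\<exists>a \<in> chain_maps R X Y. \<exists>b \<in> chain_maps R Y X. htp X X (b \<bullet> a) cid)"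

lemma iso_retr: "cx X \<Longrightarrow> cx Y \<Longrightarrow> isomorphic R X Y \<Longrightarrow> retr X Y"
  unfolding retr_def by (metis isoE)

lemma retr_trans: "cx X \<Longrightarrow> cx Y \<Longrightarrow> cx Z \<Longrightarrow> retr X Y \<Longrightarrow> retr Y Z \<Longrightarrow> retr X Z"
  unfolding retr_def by (blast intro: htp_sandwich cm_comp)

text \<open>Contractible complexes, the zero objects of the homotopy category;
  \<open>null_iff\<close> compares them with \<open>zero_cplx R\<close>.\<close>

definition nullobj :: "'a cplx \<Rightarrow> bool"
  where "nullobj X \<longleftrightarrow> htp X X cid (czero X)"

lemma retr_nullobj:
  assumes "cx X" "cx Y" "retr X Y" "nullobj Y"
  shows "nullobj X"
proof -
  obtain a b where ab: "a \<in> chain_maps R X Y" "b \<in> chain_maps R Y X" "htp X X (b \<bullet> a) cid"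
    using assms unfolding retr_def by auto
  have "htp X X (b \<bullet> (cid \<bullet> a)) (b \<bullet> (czero Y \<bullet> a))"
    using ab assms htp_comp_left[OF assms(1,2,1)] htp_comp_right[OF assms(1,2,2)] cm_mp cm_comp cm_zero
    unfolding nullobj_def by (metis ccomp_cid(1))
  moreover have "htp X X (b \<bullet> (czero Y \<bullet> a)) (czero X)"
    using ab assms by (intro htp_eq) (auto simp: ccomp_def czero_def mp_def cx_rmd m_zero rhom_0[OF _ _ cm_rhom])
  ultimately have "htp X X (b \<bullet> a) (czero X)"
    using assms(1) cm_mp[OF cm_zero[OF assms(1,1)]] htp_trans by simp
  moreover have "htp X X cid (b \<bullet> a)"
    by (rule htp_sym[OF assms(1,1) _ ab(3)]) (auto simp: cm_mp cm_id)
  ultimately show ?thesis unfolding nullobj_def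
    using htp_trans[OF assms(1,1) cm_mp[OF cm_zero[OF assms(1,1)]]] by blast
qed

subsection \<open>Direct sums\<close>

lemma lft_pair [simp]: "lft (pair x y) = x" by (simp add: lft_def pair_def)

lemma rgt_pair [simp]: "rgt (pair x y) = y" by (simp add: rgt_def pair_def)

lemma pair_lft_rgt [simp]: "pair (lft z) (rgt z) = z"
  by (auto simp: lft_def rgt_def pair_def fun_eq_iff elim: evenE oddE)

lemma pair_eqI: "lft z = lft w \<Longrightarrow> rgt z = rgt w \<Longrightarrow> z = w"
  by (metis pair_lft_rgt)

lemma sum_rmod_simps [simp]:
  "z \<in> carrier (sum_rmod M N) \<longleftrightarrow> lft z \<in> carrier M \<and> rgt z \<in> carrier N"
  "\<zero>\<^bsub>sum_rmod M N\<^esub> = pair \<zero>\<^bsub>M\<^esub> \<zero>\<^bsub>N\<^esub>"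
  "z \<oplus>\<^bsub>sum_rmod M N\<^esub> w = pair (lft z \<oplus>\<^bsub>M\<^esub> lft w) (rgt z \<oplus>\<^bsub>N\<^esub> rgt w)"
  "ract (sum_rmod M N) z a = pair (ract M (lft z) a) (ract N (rgt z) a)"
  by (simp_all add: sum_rmod_def)

lemma rmd_sum:
  assumes "rmd M" "rmd N"
  shows "rmd (sum_rmod M N)"
proof -
  have "abelian_group (sum_rmod M N)"
  proof (rule abelian_groupI)
    show "\<exists>y\<in>carrier (sum_rmod M N). y \<oplus>\<^bsub>sum_rmod M N\<^esub> x = \<zero>\<^bsub>sum_rmod M N\<^esub>"
      if "x \<in> carrier (sum_rmod M N)" for x
      by (rule bexI[of _ "pair (\<ominus>\<^bsub>M\<^esub> lft x) (\<ominus>\<^bsub>N\<^esub> rgt x)"]) (use that assms in \<open>simp_all add: m_simps\<close>)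
  qed (use assms in \<open>simp_all add: m_simps m_ac\<close>)
  moreover have "ring R" by (rule ring_axioms)
  moreover have "right_module_axioms R (sum_rmod M N)"
    by unfold_locales (use assms in \<open>simp_all add: m_simps right_module.ract_add_left
      right_module.ract_add_right right_module.ract_mult right_module.ract_one\<close>)
  ultimately show ?thesis by (simp add: right_module_def)
qed

lemma sum_cplx_simps [simp]:
  "obj (sum_cplx X Y) n = sum_rmod (obj X n) (obj Y n)"
  "dif (sum_cplx X Y) n z = pair (dif X n (lft z)) (dif Y n (rgt z))"
  by (simp_all add: sum_cplx_def)

lemma rhom_lft: "lft \<in> rhom R (sum_rmod M N) M" and rhom_rgt: "rgt \<in> rhom R (sum_rmod M N) N"
  by (rule rhomI; simp)+

lemma rhom_pair:
  "f \<in> rhom R L M \<Longrightarrow> g \<in> rhom R L N \<Longrightarrow> (\<lambda>x. pair (f x) (g x)) \<in> rhom R L (sum_rmod M N)"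
  by (rule rhomI) (auto simp: rhom_closed rhom_add rhom_act)

lemma cx_sum:
  assumes "cx X" "cx Y"
  shows "cx (sum_cplx X Y)"
proof -
  have "dif (sum_cplx X Y) n \<in> rhom R (obj (sum_cplx X Y) n) (obj (sum_cplx X Y) (n + 1))" for n
    using rhom_pair[OF rhom_comp[OF rhom_lft cx_dif[OF assms(1)]] rhom_comp[OF rhom_rgt cx_dif[OF assms(2)]]]
    by (simp add: sum_cplx_def)
  then show ?thesis
    using assms unfolding cx_def by (simp add: rmd_sum)
qed

definition cinl :: "'a cplx \<Rightarrow> 'a cmap" where "cinl Y = (\<lambda>n x. pair x \<zero>\<^bsub>obj Y n\<^esub>)"
definition cinr :: "'a cplx \<Rightarrow> 'a cmap" where "cinr X = (\<lambda>n y. pair \<zero>\<^bsub>obj X n\<^esub> y)"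
definition cprl :: "'a cmap" where "cprl = (\<lambda>n. lft)"
definition cprr :: "'a cmap" where "cprr = (\<lambda>n. rgt)"

lemma cm_inl: "cx Y \<Longrightarrow> cinl Y \<in> chain_maps R X (sum_cplx X Y)"
  unfolding cinl_def
  by (rule cmI) (auto simp: cx_rmd rhom_0[OF _ _ cx_dif] intro!: rhom_pair rhom_id rhom_zero)

lemma cm_inr: "cx X \<Longrightarrow> cinr X \<in> chain_maps R Y (sum_cplx X Y)"
  unfolding cinr_def
  by (rule cmI) (auto simp: cx_rmd rhom_0[OF _ _ cx_dif] intro!: rhom_pair rhom_id rhom_zero)

lemma cm_prl: "cprl \<in> chain_maps R (sum_cplx X Y) X"
  by (rule cmI) (auto simp: cprl_def rhom_lft)

lemma cm_prr: "cprr \<in> chain_maps R (sum_cplx X Y) Y"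
  by (rule cmI) (auto simp: cprr_def rhom_rgt)

lemma retr_sum_l: "cx X \<Longrightarrow> cx Y \<Longrightarrow> retr X (sum_cplx X Y)"
  unfolding retr_def
  by (intro bexI[OF _ cm_inl] bexI[OF _ cm_prl] htp_eq)
    (auto simp: ccomp_def cinl_def cprl_def cid_def mp_def)

lemma retr_sum_r: "cx X \<Longrightarrow> cx Y \<Longrightarrow> retr Y (sum_cplx X Y)"
  unfolding retr_def
  by (intro bexI[OF _ cm_inr] bexI[OF _ cm_prr] htp_eq)
    (auto simp: ccomp_def cinr_def cprr_def cid_def mp_def)

lemma sum_decomp:
  assumes "cx X" "cx Y" 
  shows "htp (sum_cplx X Y) (sum_cplx X Y) (cplus (sum_cplx X Y) (cinl Y \<bullet> cprl) (cinr X \<bullet> cprr)) cid"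
  using assms by (intro htp_eq cx_sum)
    (auto simp: cplus_def ccomp_def cinl_def cinr_def cprl_def cprr_def cid_def mp_def cx_rmd m_simps)

definition csum :: "'a cmap \<Rightarrow> 'a cmap \<Rightarrow> 'a cmap"
  where "csum f g = (\<lambda>n z. pair (f n (lft z)) (g n (rgt z)))"

lemma cm_csum:
  assumes "f \<in> chain_maps R X X'" "g \<in> chain_maps R Y Y'"
  shows "csum f g \<in> chain_maps R (sum_cplx X Y) (sum_cplx X' Y')"
  unfolding csum_def
  by (rule cmI) (use assms in \<open>auto simp: cm_dif intro!: rhom_pair
    rhom_comp[OF rhom_lft cm_rhom] rhom_comp[OF rhom_rgt cm_rhom]\<close>)

lemma htp_csum:
  assumes "cx X" "cx Y" "cx X'" "cx Y'" "htp X X' f f'" "htp Y Y' g g'"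
  shows "htp (sum_cplx X Y) (sum_cplx X' Y') (csum f g) (csum f' g')"
proof -
  from assms obtain s t where s: "is_htpy X X' s" "is_htpy Y Y' t"
    "\<And>n x. x \<in> carrier (obj X n) \<Longrightarrow> f n x = f' n x \<oplus>\<^bsub>obj X' n\<^esub> htpy_map X X' s n x"
    "\<And>n x. x \<in> carrier (obj Y n) \<Longrightarrow> g n x = g' n x \<oplus>\<^bsub>obj Y' n\<^esub> htpy_map Y Y' t n x"
    unfolding htp_def by metis
  show ?thesis
  proof (rule htpI)
    show "is_htpy (sum_cplx X Y) (sum_cplx X' Y') (csum s t)"
      using s unfolding is_htpy_def csum_def
      by (auto intro!: rhom_pair rhom_comp[OF rhom_lft] rhom_comp[OF rhom_rgt])
  qed (use s in \<open>simp add: csum_def htpy_map_def\<close>)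
qed

lemma csum_cid: "csum cid cid = cid" by (simp add: csum_def cid_def)

lemma csum_comp: "csum f g \<bullet> csum f' g' = csum (f \<bullet> f') (g \<bullet> g')" by (simp add: csum_def ccomp_def)

lemma iso_sum:
  assumes "cx X" "cx Y" "cx X'" "cx Y'" "isomorphic R X X'" "isomorphic R Y Y'"
  shows "isomorphic R (sum_cplx X Y) (sum_cplx X' Y')"
proof -
  obtain f k where f: "f \<in> chain_maps R X X'" "k \<in> chain_maps R X' X"
    "htp X X (k \<bullet> f) cid" "htp X' X' (f \<bullet> k) cid" by (rule isoE[OF assms(5,1,3)])
  obtain g h where g: "g \<in> chain_maps R Y Y'" "h \<in> chain_maps R Y' Y"
    "htp Y Y (h \<bullet> g) cid" "htp Y' Y' (g \<bullet> h) cid" by (rule isoE[OF assms(6,2,4)])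
  show ?thesis
    by (rule isoI[OF cx_sum cx_sum cm_csum[OF f(1) g(1)] cm_csum[OF f(2) g(2)]])
      (use assms htp_csum[OF assms(1,2,1,2) f(3) g(3)] htp_csum[OF assms(3,4,3,4) f(4) g(4)]
        in \<open>auto simp: csum_comp csum_cid\<close>)
qed

lemma null_comp:
  assumes "cx X" "cx Y" "cx Z" "nullobj Y" "f \<in> chain_maps R X Y" "g \<in> chain_maps R Y Z"
  shows "htp X Z (g \<bullet> f) (czero Z)"
proof -
  have "htp X Z (g \<bullet> (cid \<bullet> f)) (g \<bullet> (czero Y \<bullet> f))"
    by (rule htp_comp_left[OF assms(1-3) _ htp_comp_right[OF assms(1,2,2)]])
      (use assms in \<open>auto simp: nullobj_def intro: cm_mp cm_comp cm_zero\<close>)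
  moreover have "htp X Z (g \<bullet> (czero Y \<bullet> f)) (czero Z)"
    using assms by (intro htp_eq) (auto simp: ccomp_def czero_def mp_def cx_rmd m_zero rhom_0[OF _ _ cm_rhom])
  ultimately show ?thesis
    using htp_trans[OF assms(1,3) cm_mp[OF cm_zero[OF assms(1,3)]]] by auto
qed

text \<open>The idempotent that belongs to Y factors through a contractible complex, so the one that
  belongs to X is already homotopic to the identity.\<close>

lemma sum_null_r:
  assumes "cx X" "cx Y" "nullobj Y"
  shows "isomorphic R (sum_cplx X Y) X"
proof (rule isoI[OF cx_sum[OF assms(1,2)] assms(1) cm_prl cm_inl[OF assms(2)]])
  let ?S = "sum_cplx X Y"
  note S = cx_sum[OF assms(1,2)]
  show "htp X X (cprl \<bullet> cinl Y) cid"
    using assms by (intro htp_eq) (auto simp: ccomp_def cprl_def cinl_def cid_def mp_def)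
  have z: "htp ?S ?S (cinr X \<bullet> cprr) (czero ?S)"
    by (rule null_comp[OF S assms(2) S assms(3) cm_prr cm_inr[OF assms(1)]])
  have a: "mp ?S ?S (cinl Y \<bullet> cprl)" by (rule cm_mp[OF cm_comp[OF cm_prl cm_inl[OF assms(2)]]])
  have "htp ?S ?S (cplus ?S (cinl Y \<bullet> cprl) (cinr X \<bullet> cprr)) (cplus ?S (cinl Y \<bullet> cprl) (czero ?S))"
    by (rule htp_plus[OF S S a cm_mp[OF cm_zero[OF S S]] htp_refl[OF S S a] z])
  moreover have "htp ?S ?S (cplus ?S (cinl Y \<bullet> cprl) (czero ?S)) (cinl Y \<bullet> cprl)"
    by (rule htp_eq[OF S S a]) (use assms in \<open>auto simp: cplus_def czero_def ccomp_def cinl_def cprl_def cx_rmd m_simps\<close>)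
  moreover have "htp ?S ?S cid (cplus ?S (cinl Y \<bullet> cprl) (cinr X \<bullet> cprr))"
    by (rule htp_sym[OF S S cm_mp[OF cm_id] sum_decomp[OF assms(1,2)]])
  ultimately have "htp ?S ?S cid (cinl Y \<bullet> cprl)"
    using htp_trans[OF S S a] htp_trans[OF S S cm_mp[OF cm_plus[OF S]]] a 
    by (meson S cm_comp cm_inl cm_mp cm_plus cm_prl cm_zero htp_trans assms(2))
  then show "htp ?S ?S (cinl Y \<bullet> cprl) cid" by (rule htp_sym[OF S S a])
qed

lemma sum_comm:
  assumes "cx X" "cx Y"
  shows "isomorphic R (sum_cplx X Y) (sum_cplx Y X)"
proof -
  have c: "(\<lambda>n z. pair (rgt z) (lft z)) \<in> chain_maps R (sum_cplx X Y) (sum_cplx Y X)" for X Y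
    by (rule cmI) (auto intro!: rhom_pair rhom_lft rhom_rgt)
  show ?thesis
    by (rule isoI_strict[OF cx_sum cx_sum c c]) (use assms in auto)
qed

lemma sum_null_l:
  assumes "cx X" "cx Y" "nullobj X"
  shows "isomorphic R (sum_cplx X Y) Y"
  using sum_comm[OF assms(1,2)] sum_null_r[OF assms(2,1,3)] iso_trans assms cx_sum by meson

lemma free_rmod_simps [simp]:
  "x \<in> carrier (free_rmod R n) \<longleftrightarrow> (\<forall>i<n. x i \<in> carrier R) \<and> (\<forall>i\<ge>n. x i = \<zero>)"
  "\<zero>\<^bsub>free_rmod R n\<^esub> = (\<lambda>i. \<zero>)"
  "x \<oplus>\<^bsub>free_rmod R n\<^esub> y = (\<lambda>i. x i \<oplus> y i)"
  "ract (free_rmod R n) x a = (\<lambda>i. x i \<otimes> a)"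
  by (simp_all add: free_rmod_def)

lemma free_carrier: "x \<in> carrier (free_rmod R n) \<Longrightarrow> x i \<in> carrier R"
  by (metis free_rmod_simps(1) linorder_not_less zero_closed)

lemma rmd_free: "rmd (free_rmod R n)"
proof -
  have "abelian_group (free_rmod R n)"
  proof (rule abelian_groupI)
    show "\<exists>y\<in>carrier (free_rmod R n). y \<oplus>\<^bsub>free_rmod R n\<^esub> x = \<zero>\<^bsub>free_rmod R n\<^esub>"
      if "x \<in> carrier (free_rmod R n)" for x
      by (rule bexI[of _ "\<lambda>i. \<ominus> x i"]) (use that free_carrier[OF that] in \<open>auto simp: l_neg\<close>)
  next
    fix x y z assume "x \<in> carrier (free_rmod R n)" "y \<in> carrier (free_rmod R n)" "z \<in> carrier (free_rmod R n)"
    note c = this[THEN free_carrier]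
    show "x \<oplus>\<^bsub>free_rmod R n\<^esub> y \<oplus>\<^bsub>free_rmod R n\<^esub> z = x \<oplus>\<^bsub>free_rmod R n\<^esub> (y \<oplus>\<^bsub>free_rmod R n\<^esub> z)"
      "x \<oplus>\<^bsub>free_rmod R n\<^esub> y = y \<oplus>\<^bsub>free_rmod R n\<^esub> x"
      "\<zero>\<^bsub>free_rmod R n\<^esub> \<oplus>\<^bsub>free_rmod R n\<^esub> x = x"
      using c by (simp_all add: a_ac)
  qed auto
  moreover have "right_module_axioms R (free_rmod R n)"
  proof
    fix x a b assume x: "x \<in> carrier (free_rmod R n)" and a: "a \<in> carrier R" "b \<in> carrier R"
    note c = free_carrier[OF x]
    show "ract (free_rmod R n) x a \<in> carrier (free_rmod R n)" using x a by simp
    show "ract (free_rmod R n) x (a \<oplus> b) = ract (free_rmod R n) x a \<oplus>\<^bsub>free_rmod R n\<^esub> ract (free_rmod R n) x b"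
      using c a by (simp add: r_distr)
    show "ract (free_rmod R n) x (a \<otimes> b) = ract (free_rmod R n) (ract (free_rmod R n) x a) b"
      using c a by (simp add: m_assoc)
    fix y assume y: "y \<in> carrier (free_rmod R n)"
    show "ract (free_rmod R n) (x \<oplus>\<^bsub>free_rmod R n\<^esub> y) a =
      ract (free_rmod R n) x a \<oplus>\<^bsub>free_rmod R n\<^esub> ract (free_rmod R n) y a"
      using c free_carrier[OF y] a by (simp add: l_distr)
  next
    fix x assume x: "x \<in> carrier (free_rmod R n)"
    show "ract (free_rmod R n) x \<one> = x"
      using free_carrier[OF x] by simp
  qed
  ultimately show ?thesis by (simp add: right_module_def ring_axioms)
qed

lemma zero_cplx_simps [simp]:
  "obj (zero_cplx R) n = free_rmod R 0" "dif (zero_cplx R) n x = x"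
  by (simp_all add: zero_cplx_def)

lemma cx_zero: "cx (zero_cplx R)"
  by (auto simp: cx_def rmd_free intro: rhom_id) (auto simp: rhom_def)

lemma nullobj_zero: "nullobj (zero_cplx R)"
  unfolding nullobj_def
  by (rule htp_eq) (auto simp: cx_zero cid_def czero_def mp_def)

lemma null_iff: 
  assumes "cx X"
  shows "isomorphic R X (zero_cplx R) \<longleftrightarrow> nullobj X"
proof
  assume "isomorphic R X (zero_cplx R)"
  then show "nullobj X" using retr_nullobj iso_retr nullobj_zero cx_zero assms by blast
next
  assume n: "nullobj X"
  note Z = cx_zero
  have c: "czero (zero_cplx R) \<in> chain_maps R X (zero_cplx R)" "czero X \<in> chain_maps R (zero_cplx R) X"
    using cm_zero assms Z by auto
  show "isomorphic R X (zero_cplx R)"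
  proof (rule isoI[OF assms Z c])
    have "htp X X (czero X) cid" by (rule htp_sym[OF assms assms cm_mp[OF cm_zero[OF assms assms]]])
       (use n in \<open>simp add: nullobj_def\<close>)
    then show "htp X X (czero X \<bullet> czero (zero_cplx R)) cid" by (simp add: ccomp_def czero_def)
    show "htp (zero_cplx R) (zero_cplx R) (czero (zero_cplx R) \<bullet> czero X) cid"
      by (rule htp_eq) (auto simp: Z cid_def czero_def ccomp_def mp_def)
  qed
qed

lemma iso_null: "cx X \<Longrightarrow> cx Y \<Longrightarrow> isomorphic R X Y \<Longrightarrow> nullobj X \<longleftrightarrow> nullobj Y"
  using iso_retr iso_sym retr_nullobj by blast

end

context base_ring
begin

subsection \<open>Shifts and orthogonality\<close>

lemma shift_simps [simp]:
  "obj (shift i X) n = obj X (n + i)"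
  "dif (shift i X) n x = (if even i then dif X (n + i) x else \<ominus>\<^bsub>obj X (n + i + 1)\<^esub> dif X (n + i) x)"
  by (simp_all add: shift_def)

lemma cx_shift:
  assumes "cx X"
  shows "cx (shift i X)"
proof -
  have d: "dif X (n + i) \<in> rhom R (obj X (n + i)) (obj X (n + 1 + i))" for n
    using cx_dif[OF assms, of "n + i"] by (simp add: ac_simps)
  have e: "dif X (n + 1 + i) (dif X (n + i) x) = \<zero>\<^bsub>obj X (n + 2 + i)\<^esub>" if "x \<in> carrier (obj X (n + i))" for n x
    using cx_dd[OF assms that] by (simp add: ac_simps)
  have f: "dif X (n + 1 + i) y \<in> carrier (obj X (n + 2 + i))" if "y \<in> carrier (obj X (n + 1 + i))" for n y
    using rhom_closed[OF cx_dif[OF assms, of "n + 1 + i"]] that by (simp add: ac_simps)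
  show ?thesis
  proof (cases "even i")
    case True
    then show ?thesis using assms d e by (simp add: cx_def shift_def)
  next
    case False
    have "(\<lambda>x. \<ominus>\<^bsub>obj X (n + 1 + i)\<^esub> dif X (n + i) x) \<in> rhom R (obj X (n + i)) (obj X (n + 1 + i))" for n
      using rhom_uminus[OF cx_rmd[OF assms] d] .
    moreover have "dif X (n + 1 + i) (\<ominus>\<^bsub>obj X (n + 1 + i)\<^esub> dif X (n + i) x) = \<zero>\<^bsub>obj X (n + 2 + i)\<^esub>"
      if "x \<in> carrier (obj X (n + i))" for n x
    proof -
      have "dif X (n + 1 + i) \<in> rhom R (obj X (n + 1 + i)) (obj X (n + 2 + i))"
        using d[of "n + 1"] by (simp add: ac_simps)
      from rhom_neg[OF _ _ this rhom_closed[OF d that]] show ?thesis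
        using e[OF that] cx_rmd[OF assms] by (simp add: m_minus_zero)
    qed
    ultimately show ?thesis using assms False
      by (simp add: cx_def shift_def m_minus_zero add.assoc add.left_commute add.commute)
  qed
qed

lemma cm_shift_map:
  assumes "cx X" "cx Y" "f \<in> chain_maps R X Y"
  shows "shift_map i f \<in> chain_maps R (shift i X) (shift i Y)"
proof (rule cmI)
  show "shift_map i f n \<in> rhom R (obj (shift i X) n) (obj (shift i Y) n)" for n
    using assms by (simp add: shift_map_def cm_rhom)
  fix n x assume x: "x \<in> carrier (obj (shift i X) n)"
  have e: "n + 1 + i = n + i + 1" by simp
  show "shift_map i f (n + 1) (dif (shift i X) n x) = dif (shift i Y) n (shift_map i f n x)"
    using x assms unfolding shift_map_def e
    by (simp add: cm_dif rhom_neg[OF _ _ cm_rhom[OF assms(3)]] cx_rmd rhom_closed[OF cx_dif])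
qed

lemma htp_shift_map:
  assumes "cx X" "cx Y" "f \<in> chain_maps R X Y" "g \<in> chain_maps R X Y" "htp X Y f g"
  shows "htp (shift i X) (shift i Y) (shift_map i f) (shift_map i g)"
proof -
  obtain s where s: "is_htpy X Y s"
    "\<And>n x. x \<in> carrier (obj X n) \<Longrightarrow> f n x = g n x \<oplus>\<^bsub>obj Y n\<^esub> htpy_map X Y s n x"
    using assms(5) unfolding htp_def by blast
  \<comment> \<open>In an odd shift the differentials of both complexes change sign, and the
    homotopy has to change sign with them.\<close>
  define t where "t n x = (if even i then s (n + i) x else \<ominus>\<^bsub>obj Y (n + i - 1)\<^esub> s (n + i) x)" for n x
  have e: "n - 1 + i = n + i - 1" "n + 1 + i = n + i + 1" for n :: int by simp_all
  have c: "s (n + i) x \<in> carrier (obj Y (n + i - 1))" if "x \<in> carrier (obj X (n + i))" for n x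
    using is_htpy_closed[OF s(1) that] .
  have sn: "s (n + i + 1) (\<ominus>\<^bsub>obj X (n + i + 1)\<^esub> x) = \<ominus>\<^bsub>obj Y (n + i)\<^esub> s (n + i + 1) x"
    if "x \<in> carrier (obj X (n + i + 1))" for n x
  proof (rule rhom_neg[OF cx_rmd[OF assms(1)] cx_rmd[OF assms(2)] _ that])
    have "s (n + i + 1) \<in> rhom R (obj X (n + i + 1)) (obj Y (n + i + 1 - 1))"
      using s(1) unfolding is_htpy_def by blast
    then show "s (n + i + 1) \<in> rhom R (obj X (n + i + 1)) (obj Y (n + i))" by simp
  qed
  have c': "s (n + i + 1) x \<in> carrier (obj Y (n + i))" if "x \<in> carrier (obj X (n + i + 1))" for n x
    using is_htpy_closed'[OF s(1) that] .
  show ?thesis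
  proof (rule htpI)
    have "t n \<in> rhom R (obj X (n + i)) (obj Y (n + i - 1))" for n
    proof -
      have h: "s (n + i) \<in> rhom R (obj X (n + i)) (obj Y (n + i - 1))" using s(1) by (simp add: is_htpy_def)
      show ?thesis using h rhom_uminus[OF cx_rmd[OF assms(2)] h]
        by (cases "even i") (auto simp: t_def[abs_def])
    qed
    then show "is_htpy (shift i X) (shift i Y) t" by (simp add: is_htpy_def e)
    fix n x assume "x \<in> carrier (obj (shift i X) n)"
    then have x: "x \<in> carrier (obj X (n + i))" by simp
    have d: "dif X (n + i) x \<in> carrier (obj X (n + i + 1))" using rhom_closed[OF cx_dif[OF assms(1)] x] .
    have "htpy_map (shift i X) (shift i Y) t n x = htpy_map X Y s (n + i) x"
      unfolding htpy_map_def t_def shift_simps e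
      using c[OF x] c'[OF d] d assms rhom_closed[OF cx_dif'[OF assms(2)] c[OF x]]
      by (simp add: rhom_neg[OF _ _ cx_dif'[OF assms(2)]] sn cx_rmd m_simps)
    then show "shift_map i f n x = shift_map i g n x \<oplus>\<^bsub>obj (shift i Y) n\<^esub> htpy_map (shift i X) (shift i Y) t n x"
      using s(2)[OF x] by (simp add: shift_map_def)
  qed
qed

text \<open>Vanishing of Hom(X, Y[i]) for all i \<noteq> 0: the tilting condition as a relation
  between two complexes, so that it can be passed to summands.\<close>

definition orth :: "'a cplx \<Rightarrow> 'a cplx \<Rightarrow> bool"
  where "orth X Y \<longleftrightarrow> (\<forall>i. i \<noteq> 0 \<longrightarrow>
    (\<forall>f \<in> chain_maps R X (shift i Y). htp X (shift i Y) f (czero (shift i Y))))"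

lemma tilting_orth: "tilting R T \<Longrightarrow> orth T T"
  unfolding tilting_def orth_def
  by (metis Kb_cx cm_mp cm_zero cx_shift homotopic_iff)

lemma shift_map_cid: "shift_map i cid = cid" by (simp add: shift_map_def cid_def)

lemma shift_map_comp: "shift_map i (g \<bullet> f) = shift_map i g \<bullet> shift_map i f"
  by (simp add: shift_map_def ccomp_def)

lemma zero_comp:
  assumes "cx X" "cx Y" "cx Z" "g \<in> chain_maps R Y Z"
  shows "htp X Z (g \<bullet> (czero Y \<bullet> f)) (czero Z)"
  using assms by (intro htp_eq) (auto simp: ccomp_def czero_def mp_def cx_rmd m_zero rhom_0[OF _ _ cm_rhom])

text \<open>A map f from X' to Y'[i] is homotopic to v (u f b) a, and the bracket is a map from X to
  Y[i], hence null-homotopic.\<close>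

lemma orth_retr:
  assumes c: "cx X" "cx Y" "cx X'" "cx Y'" and o: "orth X Y" and r: "retr X' X" "retr Y' Y"
  shows "orth X' Y'"
  unfolding orth_def
proof (intro allI impI ballI)
  fix i f assume i: "i \<noteq> (0::int)" and f: "f \<in> chain_maps R X' (shift i Y')"
  note S = cx_shift[OF c(2), of i] cx_shift[OF c(4), of i]
  obtain a b where ab: "a \<in> chain_maps R X' X" "b \<in> chain_maps R X X'" "htp X' X' (b \<bullet> a) cid"
    using r(1) unfolding retr_def by auto
  obtain u v where uv: "u \<in> chain_maps R Y' Y" "v \<in> chain_maps R Y Y'" "htp Y' Y' (v \<bullet> u) cid"
    using r(2) unfolding retr_def by auto
  let ?u = "shift_map i u" and ?v = "shift_map i v"
  have uv': "?u \<in> chain_maps R (shift i Y') (shift i Y)" "?v \<in> chain_maps R (shift i Y) (shift i Y')"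
    using cm_shift_map uv c by auto
  have id: "htp (shift i Y') (shift i Y') (?v \<bullet> ?u) cid"
    using htp_shift_map[OF c(4,4) cm_comp[OF uv(1,2)] cm_id uv(3)]
    by (simp add: shift_map_cid shift_map_comp)
  let ?F = "?u \<bullet> f \<bullet> b"
  have F: "?F \<in> chain_maps R X (shift i Y)" using uv' f ab by (auto intro: cm_comp)
  have "htp X (shift i Y) ?F (czero (shift i Y))" using o i F unfolding orth_def by blast
  then have "htp X' (shift i Y') (?v \<bullet> (?F \<bullet> a)) (?v \<bullet> (czero (shift i Y) \<bullet> a))"
    using htp_comp_left[OF c(3) S(1,2) _ htp_comp_right[OF c(3,1) S(1)]] ab uv' c S cm_mp cm_comp cm_zero by metis
  then have 1: "htp X' (shift i Y') (?v \<bullet> (?F \<bullet> a)) (czero (shift i Y'))"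
    using htp_trans[OF c(3) S(2) cm_mp[OF cm_zero[OF c(3) S(2)]]] zero_comp[OF c(3) S uv'(2)] by blast
  have 2: "htp X' (shift i Y') (f \<bullet> (b \<bullet> a)) (f \<bullet> cid)"
    by (rule htp_comp_left[OF c(3,3) S(2) cm_mp[OF cm_id] ab(3) f])
  have 3: "htp X' (shift i Y') (?v \<bullet> ?u \<bullet> (f \<bullet> (b \<bullet> a))) (cid \<bullet> (f \<bullet> (b \<bullet> a)))"
    by (rule htp_comp_right[OF c(3) S(2,2) id]) (use ab f cm_comp in blast)
  have 4: "htp X' (shift i Y') (?v \<bullet> (?F \<bullet> a)) f"
    using htp_trans[OF c(3) S(2) cm_mp[OF f]] 2 3 by (simp add: ccomp_assoc)
  show "htp X' (shift i Y') f (czero (shift i Y'))"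
    using htp_trans[OF c(3) S(2) cm_mp[OF cm_zero[OF c(3) S(2)]] htp_sym[OF c(3) S(2) cm_mp[OF f] 4] 1] .
qed

subsection \<open>Triangles with a zero end\<close>

lemma cone_simps [simp]:
  "obj (cone X Y f) n = sum_rmod (obj X (n + 1)) (obj Y n)"
  "dif (cone X Y f) n z = pair (\<ominus>\<^bsub>obj X (n + 2)\<^esub> dif X (n + 1) (lft z))
      (f (n + 1) (lft z) \<oplus>\<^bsub>obj Y (n + 1)\<^esub> dif Y n (rgt z))"
  by (simp_all add: cone_def)

lemma cx_cone:
  assumes "cx X" "cx Y" "f \<in> chain_maps R X Y"
  shows "cx (cone X Y f)"
  unfolding cx_def
proof (intro conjI allI ballI)
  fix n
  show "rmd (obj (cone X Y f) n)" using assms by (simp add: rmd_sum cx_rmd)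
  have e: "n + 1 + 1 = n + 2" by simp
  have d: "dif X (n + 1) \<in> rhom R (obj X (n + 1)) (obj X (n + 2))" using cx_dif[OF assms(1), of "n + 1"] by (simp add: add.commute[of 2])
  note h = rhom_pair[OF rhom_comp[OF rhom_lft rhom_uminus[OF cx_rmd[OF assms(1)] d]]
      rhom_plus[OF cx_rmd[OF assms(2)] rhom_comp[OF rhom_lft cm_rhom[OF assms(3)]] rhom_comp[OF rhom_rgt cx_dif[OF assms(2)]]]]
  show "dif (cone X Y f) n \<in> rhom R (obj (cone X Y f) n) (obj (cone X Y f) (n + 1))"
    by (simp add: cone_def add.commute[of 2] h)
  fix x assume "x \<in> carrier (obj (cone X Y f) n)"
  then have x: "lft x \<in> carrier (obj X (n + 1))" "rgt x \<in> carrier (obj Y n)" by simp_all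
  have dx: "dif X (n + 1) (lft x) \<in> carrier (obj X (n + 2))" by (rule rhom_closed[OF d x(1)])
  have d2: "dif X (n + 2) \<in> rhom R (obj X (n + 2)) (obj X (n + 3))" using cx_dif[OF assms(1), of "n + 2"] by (simp add: add.commute[of 3])
  have dd: "dif X (n + 2) (dif X (n + 1) (lft x)) = \<zero>\<^bsub>obj X (n + 3)\<^esub>" using cx_dd[OF assms(1) x(1)] by (simp add: add.commute[of 2] add.commute[of 3])
  have fd: "f (n + 2) (dif X (n + 1) (lft x)) = dif Y (n + 1) (f (n + 1) (lft x))"
    using cm_dif[OF assms(3) x(1)] by (simp add: add.commute[of 2])
  have dy: "dif Y (n + 1) \<in> rhom R (obj Y (n + 1)) (obj Y (n + 2))" using cx_dif[OF assms(2), of "n + 1"] by (simp add: add.commute[of 2])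
  have fx: "f (n + 1) (lft x) \<in> carrier (obj Y (n + 1))" "dif Y n (rgt x) \<in> carrier (obj Y (n + 1))"
    using cm_closed[OF assms(3) x(1)] rhom_closed[OF cx_dif[OF assms(2)] x(2)] by auto
  have dyy: "dif Y (n + 1) (f (n + 1) (lft x)) \<in> carrier (obj Y (n + 2))" using rhom_closed[OF dy fx(1)] .
  show "dif (cone X Y f) (n + 1) (dif (cone X Y f) n x) = \<zero>\<^bsub>obj (cone X Y f) (n + 2)\<^esub>"
    using assms dx dyy fx dd cx_dd[OF assms(2) x(2)]
    by (simp add: add.assoc rhom_neg[OF _ _ d2] rhom_neg[OF _ _ cm_rhom[OF assms(3)]] rhom_add[OF dy] fd cx_rmd m_simps)
qed

text \<open>A contraction s of the cone is a matrix of maps. The equation d s + s d = 1 says that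
  one entry is a homotopy inverse of f and that the diagonal entries provide the homotopies.\<close>

lemma cone_null_iso:
  assumes "cx X" "cx Y" "f \<in> chain_maps R X Y" "nullobj (cone X Y f)"
  shows "isomorphic R X Y"
proof -
  let ?C = "cone X Y f"
  note C = cx_cone[OF assms(1-3)]
  from assms(4) obtain s where s: "is_htpy ?C ?C s"
    "\<And>n z. z \<in> carrier (obj ?C n) \<Longrightarrow> cid n z = czero ?C n z \<oplus>\<^bsub>obj ?C n\<^esub> htpy_map ?C ?C s n z"
    unfolding nullobj_def htp_def by blast
  have id: "z = htpy_map ?C ?C s n z" if "z \<in> carrier (obj ?C n)" for n z
    using s(2)[OF that] htpy_map_closed[OF C C s(1) that] cx_rmd[OF C]
    unfolding cid_def czero_def by (metis m_l_zero)
  \<comment> \<open>Entries of \<open>s n\<close>, which maps X^(n+1) \<oplus> Y^n to X^n \<oplus>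
    Y^(n-1): \<open>g\<close> goes from Y to X, \<open>r\<close> stays in Y and \<open>a\<close>
    stays in X. The index of \<open>a\<close> is lowered by one so that it starts at X^n.\<close>
  define g where "g n y = lft (s n (pair \<zero>\<^bsub>obj X (n + 1)\<^esub> y))" for n y
  define r where "r n y = rgt (s n (pair \<zero>\<^bsub>obj X (n + 1)\<^esub> y))" for n y
  define a where "a n x = lft (s (n - 1) (pair x \<zero>\<^bsub>obj Y (n - 1)\<^esub>))" for n x
  have sh: "s n \<in> rhom R (sum_rmod (obj X (n + 1)) (obj Y n)) (sum_rmod (obj X n) (obj Y (n - 1)))" for n
    using s(1) by (simp add: is_htpy_def)
  have R: "rmd (obj X n)" "rmd (obj Y n)" for n using assms cx_rmd by auto
  have i2: "(\<lambda>y. pair \<zero>\<^bsub>obj X (n + 1)\<^esub> y) \<in> rhom R (obj Y n) (sum_rmod (obj X (n + 1)) (obj Y n))" for n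
    by (intro rhom_pair rhom_zero rhom_id R)
  have i1: "(\<lambda>x. pair x \<zero>\<^bsub>obj Y n\<^esub>) \<in> rhom R (obj X (n + 1)) (sum_rmod (obj X (n + 1)) (obj Y n))" for n
    by (intro rhom_pair rhom_zero rhom_id R)
  have gh: "g n \<in> rhom R (obj Y n) (obj X n)" for n
    unfolding g_def by (rule rhom_comp[OF rhom_comp[OF i2 sh] rhom_lft])
  have rh: "r n \<in> rhom R (obj Y n) (obj Y (n - 1))" for n
    unfolding r_def by (rule rhom_comp[OF rhom_comp[OF i2 sh] rhom_rgt])
  have ah: "a n \<in> rhom R (obj X n) (obj X (n - 1))" for n
    unfolding a_def using rhom_comp[OF rhom_comp[OF i1 sh] rhom_lft, of "n - 1"] by simp
  have D: "dif X n x \<in> carrier (obj X (n + 1))" if "x \<in> carrier (obj X n)" for n x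
    by (rule rhom_closed[OF cx_dif[OF assms(1)] that])
  have E: "dif Y n x \<in> carrier (obj Y (n + 1))" if "x \<in> carrier (obj Y n)" for n x
    by (rule rhom_closed[OF cx_dif[OF assms(2)] that])
  note g0 = rhom_closed[OF gh] note r0 = rhom_closed[OF rh] note a0 = rhom_closed[OF ah]
  have sy: "s n (pair \<zero>\<^bsub>obj X (n + 1)\<^esub> y) = pair (g n y) (r n y)" for n y
    by (simp add: g_def r_def)
  \<comment> \<open>The contraction equation at (0, y): its first component makes \<open>g\<close> a
    chain map, its second makes \<open>r\<close> a homotopy between 1 and f g.\<close>
  have inY: "\<zero>\<^bsub>obj X (n + 1)\<^esub> = \<ominus>\<^bsub>obj X (n + 1)\<^esub> dif X n (g n y) \<oplus>\<^bsub>obj X (n + 1)\<^esub> g (n + 1) (dif Y n y)"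
    "y = f n (g n y) \<oplus>\<^bsub>obj Y n\<^esub> dif Y (n - 1) (r n y) \<oplus>\<^bsub>obj Y n\<^esub> r (n + 1) (dif Y n y)"
    if y: "y \<in> carrier (obj Y n)" for n y
  proof -
    have c: "pair \<zero>\<^bsub>obj X (n + 1)\<^esub> y \<in> carrier (obj ?C n)" using y R by (simp add: m_zero)
    have d: "dif ?C n (pair \<zero>\<^bsub>obj X (n + 1)\<^esub> y) = pair \<zero>\<^bsub>obj X (n + 1 + 1)\<^esub> (dif Y n y)"
      using y E[OF y] rhom_0[OF R(1,1) cx_dif[OF assms(1)], of "n + 1"] rhom_0[OF R(1,2) cm_rhom[OF assms(3)]]
      by (simp add: m_minus_zero m_l_zero R add.assoc)
    from id[OF c] have "pair \<zero>\<^bsub>obj X (n + 1)\<^esub> y = htpy_map ?C ?C s n (pair \<zero>\<^bsub>obj X (n + 1)\<^esub> y)" .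
    also have "\<dots> = pair (\<ominus>\<^bsub>obj X (n + 1)\<^esub> dif X n (g n y) \<oplus>\<^bsub>obj X (n + 1)\<^esub> g (n + 1) (dif Y n y))
      (f n (g n y) \<oplus>\<^bsub>obj Y n\<^esub> dif Y (n - 1) (r n y) \<oplus>\<^bsub>obj Y n\<^esub> r (n + 1) (dif Y n y))"
      unfolding htpy_map_def d sy by (simp add: add.commute[of 1])
    finally have p: "pair \<zero>\<^bsub>obj X (n + 1)\<^esub> y = \<dots>" .
    from arg_cong[OF p, of lft] show "\<zero>\<^bsub>obj X (n + 1)\<^esub> = \<ominus>\<^bsub>obj X (n + 1)\<^esub> dif X n (g n y) \<oplus>\<^bsub>obj X (n + 1)\<^esub> g (n + 1) (dif Y n y)" by simp
    from arg_cong[OF p, of rgt] show "y = f n (g n y) \<oplus>\<^bsub>obj Y n\<^esub> dif Y (n - 1) (r n y) \<oplus>\<^bsub>obj Y n\<^esub> r (n + 1) (dif Y n y)" by simp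
  qed
  have gc: "g \<in> chain_maps R Y X"
  proof (rule cmI[OF gh])
    fix n y assume y: "y \<in> carrier (obj Y n)"
    have c: "dif X n (g n y) \<in> carrier (obj X (n + 1))" "g (n + 1) (dif Y n y) \<in> carrier (obj X (n + 1))"
      using y g0 D E by auto
    show "g (n + 1) (dif Y n y) = dif X n (g n y)"
      using inY(1)[OF y] c R(1) by (metis m_r_neg1 m_r_zero m_neg_closed m_minus_minus)
  qed
  \<comment> \<open>First component of the contraction equation at (x, 0) in degree n - 1. Because
    of the minus sign in the differential of the cone, the homotopy is -a.\<close>
  have inX: "x = g n (f n x) \<oplus>\<^bsub>obj X n\<^esub> (\<ominus>\<^bsub>obj X n\<^esub> (dif X (n - 1) (a n x) \<oplus>\<^bsub>obj X n\<^esub> a (n + 1) (dif X n x)))"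
    if x: "x \<in> carrier (obj X n)" for n x
  proof -
    let ?z = "pair x \<zero>\<^bsub>obj Y (n - 1)\<^esub>"
    have c: "?z \<in> carrier (obj ?C (n - 1))" using x R by (simp add: m_zero)
    have dx: "dif X n x \<in> carrier (obj X (n + 1))" by (rule D[OF x])
    have fx: "f n x \<in> carrier (obj Y n)" by (rule cm_closed[OF assms(3) x])
    have d: "dif ?C (n - 1) ?z = pair (\<ominus>\<^bsub>obj X (n + 1)\<^esub> dif X n x) (f n x)"
      using fx rhom_0[OF R(2,2) cx_dif'[OF assms(2)], of n] by (simp add: m_r_zero R add.commute)
    have p: "pair (\<ominus>\<^bsub>obj X (n + 1)\<^esub> dif X n x) (f n x) =
      pair (\<ominus>\<^bsub>obj X (n + 1)\<^esub> dif X n x) \<zero>\<^bsub>obj Y n\<^esub> \<oplus>\<^bsub>sum_rmod (obj X (n + 1)) (obj Y n)\<^esub> pair \<zero>\<^bsub>obj X (n + 1)\<^esub> (f n x)"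
      using dx fx R by (simp add: m_simps)
    have sd: "s n (pair (\<ominus>\<^bsub>obj X (n + 1)\<^esub> dif X n x) (f n x)) =
      s n (pair (\<ominus>\<^bsub>obj X (n + 1)\<^esub> dif X n x) \<zero>\<^bsub>obj Y n\<^esub>) \<oplus>\<^bsub>sum_rmod (obj X n) (obj Y (n - 1))\<^esub> pair (g n (f n x)) (r n (f n x))"
      unfolding p by (subst rhom_add[OF sh]) (use dx fx R in \<open>simp_all add: m_simps sy\<close>)
    have la: "lft (s n (pair (\<ominus>\<^bsub>obj X (n + 1)\<^esub> dif X n x) \<zero>\<^bsub>obj Y n\<^esub>)) = \<ominus>\<^bsub>obj X n\<^esub> a (n + 1) (dif X n x)"
      using rhom_neg[OF R(1,1) ah[of "n + 1"], of "dif X n x"] dx by (simp add: a_def)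
    have "lft ?z = lft (htpy_map ?C ?C s (n - 1) ?z)" using id[OF c] by simp
    also have "\<dots> = \<ominus>\<^bsub>obj X n\<^esub> dif X (n - 1) (a n x) \<oplus>\<^bsub>obj X n\<^esub> (\<ominus>\<^bsub>obj X n\<^esub> a (n + 1) (dif X n x) \<oplus>\<^bsub>obj X n\<^esub> g n (f n x))"
      unfolding htpy_map_def d using sd la by (simp add: a_def)
    finally show ?thesis
      using a0[OF x] a0[OF dx] g0[OF fx] rhom_closed[OF cx_dif'[OF assms(1)] a0[OF x]] R
      by (simp add: m_simps m_ac)
  qed
  have "htp Y Y cid (f \<bullet> g)"
  proof (rule htpI[of Y Y r])
    show "is_htpy Y Y r" using rh by (simp add: is_htpy_def)
    fix n y assume y: "y \<in> carrier (obj Y n)"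
    show "cid n y = (f \<bullet> g) n y \<oplus>\<^bsub>obj Y n\<^esub> htpy_map Y Y r n y"
      using inY(2)[OF y] y rhom_closed[OF cx_dif'[OF assms(2)] r0[OF y]] r0[OF E[OF y]] cm_closed[OF assms(3) g0[OF y]] R
      by (simp add: cid_def ccomp_def htpy_map_def m_assoc')
  qed
  then have 1: "htp Y Y (f \<bullet> g) cid" using htp_sym[OF assms(2,2)] cm_mp[OF cm_comp[OF gc assms(3)]] by blast
  have "htp X X cid (g \<bullet> f)"
  proof (rule htpI[OF is_htpy_uminus[OF assms(1), of X a]])
    show ia: "is_htpy X X a" using ah by (simp add: is_htpy_def)
    fix n x assume x: "x \<in> carrier (obj X n)"
    show "cid n x = (g \<bullet> f) n x \<oplus>\<^bsub>obj X n\<^esub> htpy_map X X (\<lambda>n x. \<ominus>\<^bsub>obj X (n - 1)\<^esub> a n x) n x"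
      using inX[OF x] htpy_map_uminus[OF assms(1,1) ia x] by (simp add: cid_def ccomp_def htpy_map_def)
  qed
  then have 2: "htp X X (g \<bullet> f) cid" using htp_sym[OF assms(1,1)] cm_mp[OF cm_comp[OF assms(3) gc]] by blast
  show ?thesis by (rule isoI[OF assms(1,2,3) gc 2 1])
qed

text \<open>If \<open>t\<close> contracts X, then (x, y) \<mapsto> y + f (t x) is a chain map from
  the cone to Y. It is a left inverse of the inclusion, and (x, y) \<mapsto> (- t x, 0) is the
  homotopy for the other composite.\<close>

lemma null_cone_iso:
  assumes "cx X" "cx Y" "f \<in> chain_maps R X Y" "nullobj X"
  shows "isomorphic R Y (cone X Y f)"
proof -
  let ?C = "cone X Y f"
  note C = cx_cone[OF assms(1-3)]
  from assms(4) obtain t where t: "is_htpy X X t"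
    "\<And>n z. z \<in> carrier (obj X n) \<Longrightarrow> cid n z = czero X n z \<oplus>\<^bsub>obj X n\<^esub> htpy_map X X t n z"
    unfolding nullobj_def htp_def by blast
  have R: "rmd (obj X n)" "rmd (obj Y n)" for n using assms cx_rmd by auto
  have id: "dif X (n - 1) (t n z) \<oplus>\<^bsub>obj X n\<^esub> t (n + 1) (dif X n z) = z" if "z \<in> carrier (obj X n)" for n z
    using t(2)[OF that] htpy_map_closed[OF assms(1,1) t(1) that] R
    unfolding cid_def czero_def by (metis htpy_map_def m_l_zero)
  have th: "t n \<in> rhom R (obj X n) (obj X (n - 1))" for n using t(1) by (simp add: is_htpy_def)
  have th1: "t (n + 1) \<in> rhom R (obj X (n + 1)) (obj X n)" for n using th[of "n + 1"] by simp
  have D: "dif X n x \<in> carrier (obj X (n + 1))" if "x \<in> carrier (obj X n)" for n x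
    by (rule rhom_closed[OF cx_dif[OF assms(1)] that])
  have E: "dif Y n x \<in> carrier (obj Y (n + 1))" if "x \<in> carrier (obj Y n)" for n x
    by (rule rhom_closed[OF cx_dif[OF assms(2)] that])
  define p where "p n z = rgt z \<oplus>\<^bsub>obj Y n\<^esub> f n (t (n + 1) (lft z))" for n z
  define S where "S n z = pair (\<ominus>\<^bsub>obj X n\<^esub> t (n + 1) (lft z)) \<zero>\<^bsub>obj Y (n - 1)\<^esub>" for n z
  have ph: "p n \<in> rhom R (sum_rmod (obj X (n + 1)) (obj Y n)) (obj Y n)" for n
    unfolding p_def
    by (rule rhom_plus[OF R(2) rhom_rgt rhom_comp[OF rhom_comp[OF rhom_lft th1] cm_rhom[OF assms(3)]]])
  have Sh: "S n \<in> rhom R (sum_rmod (obj X (n + 1)) (obj Y n)) (sum_rmod (obj X n) (obj Y (n - 1)))" for n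
    unfolding S_def
    by (intro rhom_pair rhom_zero R rhom_uminus rhom_comp[OF rhom_lft th1])
  have ic: "cone_incl X \<in> chain_maps R Y ?C"
  proof (rule cmI)
    show "cone_incl X n \<in> rhom R (obj Y n) (obj ?C n)" for n
      using rhom_pair[OF rhom_zero[OF R(1)] rhom_id] by (simp add: cone_incl_def)
    fix n y assume y: "y \<in> carrier (obj Y n)"
    show "cone_incl X (n + 1) (dif Y n y) = dif ?C n (cone_incl X n y)"
      using y E[OF y] rhom_0[OF R(1,1) cx_dif[OF assms(1)], of "n + 1"] rhom_0[OF R(1,2) cm_rhom[OF assms(3)]]
      by (simp add: cone_incl_def m_minus_zero m_l_zero R add.assoc)
  qed
  have pc: "p \<in> chain_maps R ?C Y"
  proof (rule cmI)
    show "p n \<in> rhom R (obj ?C n) (obj Y n)" for n using ph by simp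
    fix n z assume "z \<in> carrier (obj ?C n)"
    then have z: "lft z \<in> carrier (obj X (n + 1))" "rgt z \<in> carrier (obj Y n)" by auto
    let ?x = "lft z"
    have dx: "dif X (n + 1) ?x \<in> carrier (obj X (n + 2))" using D[OF z(1)] by (simp add: add.commute[of 2])
    have tx: "t (n + 1) ?x \<in> carrier (obj X n)" using rhom_closed[OF th1 z(1)] .
    have t2: "t (n + 2) \<in> rhom R (obj X (n + 2)) (obj X (n + 1))" using th1[of "n + 1"] by (simp add: add.commute[of 2])
    have tdx: "t (n + 2) (dif X (n + 1) ?x) \<in> carrier (obj X (n + 1))" by (rule rhom_closed[OF t2 dx])
    have dtx: "dif X n (t (n + 1) ?x) \<in> carrier (obj X (n + 1))" by (rule D[OF tx])
    have e: "dif X n (t (n + 1) ?x) \<oplus>\<^bsub>obj X (n + 1)\<^esub> t (n + 2) (dif X (n + 1) ?x) = ?x"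
      using id[OF z(1)] by (simp add: add.commute[of 2])
    have F: "f (n + 1) \<in> rhom R (obj X (n + 1)) (obj Y (n + 1))" by (rule cm_rhom[OF assms(3)])
    have "f (n + 1) ?x = f (n + 1) (dif X n (t (n + 1) ?x)) \<oplus>\<^bsub>obj Y (n + 1)\<^esub> f (n + 1) (t (n + 2) (dif X (n + 1) ?x))"
      using rhom_add[OF F dtx tdx] e by simp
    then have fx: "f (n + 1) ?x = dif Y n (f n (t (n + 1) ?x)) \<oplus>\<^bsub>obj Y (n + 1)\<^esub> f (n + 1) (t (n + 2) (dif X (n + 1) ?x))"
      using cm_dif[OF assms(3) tx] by simp
    have "p (n + 1) (dif ?C n z) = (f (n + 1) ?x \<oplus>\<^bsub>obj Y (n + 1)\<^esub> dif Y n (rgt z)) \<oplus>\<^bsub>obj Y (n + 1)\<^esub>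
      (\<ominus>\<^bsub>obj Y (n + 1)\<^esub> f (n + 1) (t (n + 2) (dif X (n + 1) ?x)))"
      using rhom_neg[OF R(1,1) t2 dx] rhom_neg[OF R F tdx] by (simp add: p_def add.assoc)
    also have "\<dots> = dif Y n (rgt z) \<oplus>\<^bsub>obj Y (n + 1)\<^esub> dif Y n (f n (t (n + 1) ?x))"
      unfolding fx using E[OF z(2)] E[OF cm_closed[OF assms(3) tx]] rhom_closed[OF F tdx] R
      by (simp add: m_simps m_ac)
    also have "\<dots> = dif Y n (p n z)"
      unfolding p_def using rhom_add[OF cx_dif[OF assms(2)] z(2) cm_closed[OF assms(3) tx]] by simp
    finally show "p (n + 1) (dif ?C n z) = dif Y n (p n z)" .
  qed
  have 1: "htp Y Y (p \<bullet> cone_incl X) cid"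
  proof (rule htp_eq[OF assms(2,2) cm_mp[OF cm_id]])
    fix n y assume y: "y \<in> carrier (obj Y n)"
    show "(p \<bullet> cone_incl X) n y = cid n y"
      using y R rhom_0[OF R(1,1) th1] rhom_0[OF R cm_rhom[OF assms(3)]]
      by (simp add: ccomp_def p_def cone_incl_def cid_def m_simps)
  qed
  have "htp ?C ?C cid (cone_incl X \<bullet> p)"
  proof (rule htpI[of ?C ?C S])
    show "is_htpy ?C ?C S" using Sh by (simp add: is_htpy_def)
    fix n z assume "z \<in> carrier (obj ?C n)"
    then have z: "lft z \<in> carrier (obj X (n + 1))" "rgt z \<in> carrier (obj Y n)" by auto
    let ?x = "lft z"
    have dx: "dif X (n + 1) ?x \<in> carrier (obj X (n + 2))" using D[OF z(1)] by (simp add: add.commute[of 2])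
    have tx: "t (n + 1) ?x \<in> carrier (obj X n)" using rhom_closed[OF th1 z(1)] .
    have t2: "t (n + 2) \<in> rhom R (obj X (n + 2)) (obj X (n + 1))" using th1[of "n + 1"] by (simp add: add.commute[of 2])
    have tdx: "t (n + 2) (dif X (n + 1) ?x) \<in> carrier (obj X (n + 1))" by (rule rhom_closed[OF t2 dx])
    have dtx: "dif X n (t (n + 1) ?x) \<in> carrier (obj X (n + 1))" by (rule D[OF tx])
    have ftx: "f n (t (n + 1) ?x) \<in> carrier (obj Y n)" by (rule cm_closed[OF assms(3) tx])
    have e: "dif X n (t (n + 1) ?x) \<oplus>\<^bsub>obj X (n + 1)\<^esub> t (n + 2) (dif X (n + 1) ?x) = ?x"
      using id[OF z(1)] by (simp add: add.commute[of 2])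
    have n2: "n - 1 + 1 = n" "n - 1 + 2 = n + 1" "n + 1 + 1 = n + 2" by simp_all
    have "htpy_map ?C ?C S n z = pair (dif X n (t (n + 1) ?x) \<oplus>\<^bsub>obj X (n + 1)\<^esub> t (n + 2) (dif X (n + 1) ?x))
      (\<ominus>\<^bsub>obj Y n\<^esub> f n (t (n + 1) ?x))"
      unfolding htpy_map_def S_def cone_simps n2 lft_pair rgt_pair sum_rmod_simps
        rhom_neg[OF R(1,1) t2 dx] rhom_neg[OF R cm_rhom[OF assms(3)] tx]
          rhom_neg[OF R(1,1) cx_dif[OF assms(1)] tx]
      using tx dx tdx dtx ftx R rhom_0[OF R(2,2) cx_dif'[OF assms(2)]]
      by (simp add: m_simps)
    then have "htpy_map ?C ?C S n z = pair ?x (\<ominus>\<^bsub>obj Y n\<^esub> f n (t (n + 1) ?x))" unfolding e .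
    then show "cid n z = (cone_incl X \<bullet> p) n z \<oplus>\<^bsub>obj ?C n\<^esub> htpy_map ?C ?C S n z"
      using z ftx R by (simp add: cid_def ccomp_def cone_incl_def p_def m_simps m_assoc')
  qed
  then have 2: "htp ?C ?C (cone_incl X \<bullet> p) cid"
    using htp_sym[OF C C] cm_mp[OF cm_comp[OF pc ic]] by blast
  show ?thesis by (rule isoI[OF assms(2) C ic pc 1 2])
qed

lemma is_iso_isomorphic: "is_iso R X Y f \<Longrightarrow> isomorphic R X Y"
  by (auto simp: isomorphic_def)

text \<open>Intended for the exchange triangle of a left mutation whose new summand is zero;
  \<open>triangle_first_null\<close> is the counterpart for right mutations.\<close>

lemma triangle_third_null:
  assumes "triangle R X Y Z u v w" "nullobj Z"
  shows "isomorphic R X Y"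
proof -
  from assms(1) obtain X' Y' f \<alpha> \<beta> \<gamma> where
    k: "X \<in> Kb_proj R" "Y \<in> Kb_proj R" "Z \<in> Kb_proj R" "X' \<in> Kb_proj R" "Y' \<in> Kb_proj R" and
    h: "f \<in> chain_maps R X' Y'" "is_iso R X X' \<alpha>" "is_iso R Y Y' \<beta>" "is_iso R Z (cone X' Y' f) \<gamma>"
    unfolding triangle_def by blast
  note c = k[THEN Kb_cx] note C = cx_cone[OF c(4,5) h(1)]
  have "nullobj (cone X' Y' f)" using iso_null[OF c(3) C is_iso_isomorphic[OF h(4)]] assms(2) by simp
  from cone_null_iso[OF c(4,5) h(1) this] show ?thesis
    using is_iso_isomorphic[OF h(2)] is_iso_isomorphic[OF h(3)] iso_trans iso_sym c by meson
qed

lemma triangle_first_null: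
  assumes "triangle R X Y Z u v w" "nullobj X"
  shows "isomorphic R Y Z"
proof -
  from assms(1) obtain X' Y' f \<alpha> \<beta> \<gamma> where
    k: "X \<in> Kb_proj R" "Y \<in> Kb_proj R" "Z \<in> Kb_proj R" "X' \<in> Kb_proj R" "Y' \<in> Kb_proj R" and
    h: "f \<in> chain_maps R X' Y'" "is_iso R X X' \<alpha>" "is_iso R Y Y' \<beta>" "is_iso R Z (cone X' Y' f) \<gamma>"
    unfolding triangle_def by blast
  note c = k[THEN Kb_cx] note C = cx_cone[OF c(4,5) h(1)]
  have "nullobj X'" using iso_null[OF c(1,4) is_iso_isomorphic[OF h(2)]] assms(2) by simp
  from null_cone_iso[OF c(4,5) h(1) this] show ?thesis
    using is_iso_isomorphic[OF h(3)] is_iso_isomorphic[OF h(4)] iso_trans iso_sym c C by meson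
qed

end

section \<open>Algebras with a constant Cartan matrix\<close>

text \<open>
  The idempotents are indexed by all natural numbers, periodically, so that every module \<open>R\<^sup>m\<close> is a
  sum of modules \<open>\<epsilon>\<^sub>i R\<close> with pairwise different indices. The sets \<open>J k\<close> stand for the powers of the
  radical.
\<close>

locale cartan_alg = base_ring R for R :: "'a ring" (structure) +
  fixes \<kappa> :: "'k::field \<Rightarrow> 'a" and n c :: nat and \<epsilon> :: "nat \<Rightarrow> 'a"
    and base :: "nat \<Rightarrow> nat \<Rightarrow> nat \<Rightarrow> 'a" and co :: "nat \<Rightarrow> nat \<Rightarrow> nat \<Rightarrow> 'a \<Rightarrow> 'k"
    and J :: "nat \<Rightarrow> 'a set" and N :: nat
  assumes \<kappa>_closed: "\<kappa> t \<in> carrier R"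
    and \<kappa>_add: "\<kappa> (s + t) = \<kappa> s \<oplus> \<kappa> t"
    and \<kappa>_mult: "\<kappa> (s * t) = \<kappa> s \<otimes> \<kappa> t"
    and \<kappa>_one: "\<kappa> 1 = \<one>"
    and \<kappa>_central: "a \<in> carrier R \<Longrightarrow> \<kappa> t \<otimes> a = a \<otimes> \<kappa> t"
    and n_ge_2: "2 \<le> n" and c_pos: "0 < c"
    and eps_closed: "\<epsilon> i \<in> carrier R"
    and eps_mod: "\<epsilon> (i mod n) = \<epsilon> i"
    and eps_idem: "\<epsilon> i \<otimes> \<epsilon> i = \<epsilon> i"
    and eps_sum: "(\<Oplus>i\<in>{..<n}. \<epsilon> i) = \<one>"
    and base_closed: "b < c \<Longrightarrow> base i j b \<in> carrier R"
    and base_left: "b < c \<Longrightarrow> \<epsilon> i \<otimes> base i j b = base i j b"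
    and base_right: "b < c \<Longrightarrow> base i j b \<otimes> \<epsilon> j = base i j b"
    and co_add: "x \<in> carrier R \<Longrightarrow> y \<in> carrier R \<Longrightarrow> co i j b (x \<oplus> y) = co i j b x + co i j b y"
    and co_scale: "x \<in> carrier R \<Longrightarrow> co i j b (\<kappa> t \<otimes> x) = t * co i j b x"
    and co_base: "b < c \<Longrightarrow> b' < c \<Longrightarrow> co i j b (base i j b') = (if b = b' then 1 else 0)"
    and co_inj: "a \<in> carrier R \<Longrightarrow> \<epsilon> i \<otimes> a = a \<Longrightarrow> a \<otimes> \<epsilon> j = a \<Longrightarrow> (\<And>b. b < c \<Longrightarrow> co i j b a = 0) \<Longrightarrow> a = \<zero>"
    and J_0: "J 0 = carrier R"
    and J_sub: "J k \<subseteq> carrier R"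
    and J_add: "x \<in> J k \<Longrightarrow> y \<in> J k \<Longrightarrow> x \<oplus> y \<in> J k"
    and J_zero: "\<zero> \<in> J k"
    and J_scale: "x \<in> J k \<Longrightarrow> \<kappa> t \<otimes> x \<in> J k"
    and J_mult: "x \<in> J 1 \<Longrightarrow> y \<in> J k \<Longrightarrow> x \<otimes> y \<in> J (Suc k)"
    and J_last: "J N = {\<zero>}"
    and J_local: "a \<in> carrier R \<Longrightarrow> \<epsilon> i \<otimes> a = a \<Longrightarrow> a \<otimes> \<epsilon> j = a \<Longrightarrow>
      a \<in> J 1 \<or> (i mod n = j mod n \<and> (\<exists>t b. t \<noteq> 0 \<and> b \<in> J 1 \<and> a = \<kappa> t \<otimes> \<epsilon> i \<oplus> b))"
begin

lemma eps_cong: "i mod n = j mod n \<Longrightarrow> \<epsilon> i = \<epsilon> j"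
  by (metis eps_mod)

lemma \<kappa>_0: "\<kappa> 0 = \<zero>"
  using \<kappa>_add[of 0 0] \<kappa>_closed[of 0] by (metis add.right_neutral add.r_cancel_one')

lemma \<kappa>_uminus: "\<kappa> (- t) = \<ominus> \<kappa> t"
  using \<kappa>_add[of "- t" t] \<kappa>_closed \<kappa>_0 by (metis ab_left_minus minus_equality)

lemma co_0: "co i j b \<zero> = 0"
  using co_add[of \<zero> \<zero> i j b] by (metis add_cancel_right_left l_zero zero_closed)

lemma eps_eps: "x \<in> carrier R \<Longrightarrow> \<epsilon> i \<otimes> (\<epsilon> i \<otimes> x) = \<epsilon> i \<otimes> x"
  using eps_closed eps_idem by (metis m_assoc)

text \<open>The corner of \<open>\<epsilon> i\<close> contains \<open>base i i 0\<close>, an element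
  with a coordinate 1; it exists since c > 0.\<close>

lemma eps_neq_0: "\<epsilon> i \<noteq> \<zero>"
proof
  assume e: "\<epsilon> i = \<zero>"
  have "base i i 0 = \<epsilon> i \<otimes> base i i 0" using base_left[OF c_pos] by simp
  also have "\<dots> = \<zero>" using e base_closed[OF c_pos] by simp
  finally show False using co_base[OF c_pos c_pos, of i i] co_0 by simp
qed

text \<open>The corner ring of an idempotent is local: after division by the scalar t the element
  has the form f - m with m in \<open>J 1\<close>, and f - m is inverted by the geometric series of
  m, which is finite since \<open>J N\<close> is zero.\<close>

lemma local_inverse:
  assumes f: "f = \<epsilon> j" and a: "a \<in> carrier R" "f \<otimes> a = a" "a \<otimes> f = a"
    and t: "t \<noteq> 0" "b \<in> J 1" "a = \<kappa> t \<otimes> f \<oplus> b"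
  obtains u where "u \<in> carrier R" "f \<otimes> u = u" "u \<otimes> a = f" "a \<otimes> u = f"
proof -
  have fc: "f \<in> carrier R" "f \<otimes> f = f" using f eps_closed eps_idem by auto
  have bc: "b \<in> carrier R" using t(2) J_sub by auto
  define a' where "a' = \<kappa> (inverse t) \<otimes> a"
  define m where "m = \<kappa> (- inverse t) \<otimes> b"
  have mJ: "m \<in> J 1" using t(2) J_scale m_def by simp
  then have mc: "m \<in> carrier R" using J_sub by auto
  have \<kappa>i: "\<kappa> (inverse t) \<otimes> (\<kappa> t \<otimes> f) = f"
  proof -
    have "\<kappa> (inverse t) \<otimes> \<kappa> t = \<one>" using t(1) \<kappa>_mult[of "inverse t" t] \<kappa>_one by simp
    then show ?thesis using fc \<kappa>_closed m_assoc[of "\<kappa> (inverse t)" "\<kappa> t" f] by simp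
  qed
  have ac: "a' \<in> carrier R" using a \<kappa>_closed a'_def by simp
  have m': "\<ominus> m = \<kappa> (inverse t) \<otimes> b" unfolding m_def \<kappa>_uminus using \<kappa>_closed bc by (simp add: l_minus)
  have a': "a' = f \<ominus> m"
    unfolding a'_def t(3) a_minus_def m' using \<kappa>i fc bc by (simp add: \<kappa>_closed r_distr)
  have fa: "f \<otimes> a' = a'" "a' \<otimes> f = a'"
  proof -
    have "f \<otimes> a' = (f \<otimes> \<kappa> (inverse t)) \<otimes> a" unfolding a'_def using fc a \<kappa>_closed by (simp add: m_assoc)
    also have "\<dots> = \<kappa> (inverse t) \<otimes> (f \<otimes> a)" using fc a \<kappa>_closed \<kappa>_central[OF fc(1)] by (metis m_assoc)
    finally show "f \<otimes> a' = a'" using a a'_def by simp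
    show "a' \<otimes> f = a'" unfolding a'_def using a fc \<kappa>_closed by (simp add: m_assoc)
  qed
  have ma: "m = f \<ominus> a'" unfolding a' using fc mc
    by (simp add: a_minus_def minus_add r_neg1 r_neg2)
  have fm: "f \<otimes> m = m" "m \<otimes> f = m"
    unfolding ma a_minus_def using fc ac fa by (simp_all add: r_distr l_distr r_minus l_minus)
  \<comment> \<open>Powers of \<open>m\<close> inside the corner, starting with its unit
    \<open>f\<close> instead of \<one>; \<open>u\<close> collects the partial sums of the
    series.\<close>
  define pw where "pw = rec_nat f (\<lambda>_ x. m \<otimes> x)"
  have pw: "pw 0 = f" "pw (Suc k) = m \<otimes> pw k" for k by (simp_all add: pw_def)
  define u where "u = rec_nat \<zero> (\<lambda>k x. x \<oplus> pw k)"
  have u: "u 0 = \<zero>" "u (Suc k) = u k \<oplus> pw k" for k by (simp_all add: u_def)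
  have pJ: "pw k \<in> J k" for k
    by (induction k) (use pw fc mJ J_0 J_mult in auto)
  then have pc: "pw k \<in> carrier R" for k using J_sub by blast
  have fp: "f \<otimes> pw k = pw k" "pw k \<otimes> m = m \<otimes> pw k" for k
    by (induction k) (use pw fc fm mc pc in \<open>auto simp: m_assoc simp flip: m_assoc[of f]\<close>)
  have uc: "u k \<in> carrier R" "f \<otimes> u k = u k" for k
    by (induction k) (use u pc fc fp in \<open>auto simp: r_distr\<close>)
  have pf: "pw k \<otimes> f = pw k" for k
    by (induction k) (use pw fc fm mc pc in \<open>auto simp: m_assoc\<close>)
  have 1: "a' \<otimes> pw k = pw k \<ominus> pw (Suc k)" "pw k \<otimes> a' = pw k \<ominus> pw (Suc k)" for k
    unfolding a' a_minus_def pw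
    using fp pf fc mc pc by (simp_all add: l_distr r_distr l_minus r_minus)
  have "a' \<otimes> u k \<oplus> pw k = f \<and> u k \<otimes> a' \<oplus> pw k = f" for k
  proof (induction k)
    case 0
    then show ?case using u pw ac fc by simp
  next
    case (Suc k)
    have "a' \<otimes> u (Suc k) \<oplus> pw (Suc k) = a' \<otimes> u k \<oplus> (pw k \<ominus> pw (Suc k)) \<oplus> pw (Suc k)"
      using 1(1)[of k] u ac uc pc by (simp add: r_distr)
    also have "\<dots> = a' \<otimes> u k \<oplus> pw k"
      using ac uc[of k] pc[of k] pc[of "Suc k"] by (simp add: a_minus_def a_assoc l_neg)
    finally have 2: "a' \<otimes> u (Suc k) \<oplus> pw (Suc k) = a' \<otimes> u k \<oplus> pw k" .
    have "u (Suc k) \<otimes> a' \<oplus> pw (Suc k) = u k \<otimes> a' \<oplus> (pw k \<ominus> pw (Suc k)) \<oplus> pw (Suc k)"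
      using 1(2)[of k] u ac uc pc by (simp add: l_distr)
    also have "\<dots> = u k \<otimes> a' \<oplus> pw k"
      using ac uc[of k] pc[of k] pc[of "Suc k"] by (simp add: a_minus_def a_assoc l_neg)
    finally show ?case using 2 Suc by simp
  qed
  moreover have "pw N = \<zero>" using pJ[of N] J_last by simp
  ultimately have U: "a' \<otimes> u N = f" "u N \<otimes> a' = f" using ac uc by (metis m_closed r_zero)+
  show thesis
  proof (rule that[of "\<kappa> (inverse t) \<otimes> u N"])
    have k: "\<kappa> (inverse t) \<in> carrier R" by (rule \<kappa>_closed)
    show "\<kappa> (inverse t) \<otimes> u N \<in> carrier R" using k uc by simp
    have "f \<otimes> (\<kappa> (inverse t) \<otimes> u N) = \<kappa> (inverse t) \<otimes> (f \<otimes> u N)"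
      using k uc(1) fc \<kappa>_central[OF fc(1)] by (metis m_assoc)
    then show "f \<otimes> (\<kappa> (inverse t) \<otimes> u N) = \<kappa> (inverse t) \<otimes> u N" using uc by simp
    have "\<kappa> (inverse t) \<otimes> u N \<otimes> a = u N \<otimes> a'"
      unfolding a'_def using k uc(1) a \<kappa>_central[OF uc(1)] by (metis m_assoc)
    then show "\<kappa> (inverse t) \<otimes> u N \<otimes> a = f" using U by simp
    have "a \<otimes> (\<kappa> (inverse t) \<otimes> u N) = a' \<otimes> u N"
      unfolding a'_def using k uc(1) a \<kappa>_central[OF a(1)] by (metis m_assoc)
    then show "a \<otimes> (\<kappa> (inverse t) \<otimes> u N) = f" using U by simp
  qed
qed

subsection \<open>Standard projective modules\<close>

text \<open>The direct sum of the modules \<epsilon> i R for i in I, as functions that vanish off I.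
  Repeated summands have congruent indices, so that disjoint unions of index sets become direct
  sums.\<close>

definition std :: "nat set \<Rightarrow> 'a rmod"
  where "std I = \<lparr>
    carrier = {x. \<forall>i. x i \<in> carrier R \<and> \<epsilon> i \<otimes> x i = x i \<and> (i \<notin> I \<longrightarrow> x i = \<zero>)},
    monoid.mult = undefined, one = undefined,
    zero = (\<lambda>i. \<zero>), add = (\<lambda>x y i. x i \<oplus> y i), ract = (\<lambda>x a i. x i \<otimes> a)\<rparr>"

lemma std_simps [simp]:
  "\<zero>\<^bsub>std I\<^esub> = (\<lambda>i. \<zero>)" "x \<oplus>\<^bsub>std I\<^esub> y = (\<lambda>i. x i \<oplus> y i)" "ract (std I) x a = (\<lambda>i. x i \<otimes> a)"
  by (simp_all add: std_def)

lemma std_mem: "x \<in> carrier (std I) \<longleftrightarrow> (\<forall>i. x i \<in> carrier R \<and> \<epsilon> i \<otimes> x i = x i \<and> (i \<notin> I \<longrightarrow> x i = \<zero>))"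
  by (simp add: std_def)

lemma stdD:
  assumes "x \<in> carrier (std I)"
  shows "x i \<in> carrier R" "\<epsilon> i \<otimes> x i = x i" "i \<notin> I \<Longrightarrow> x i = \<zero>"
  using assms by (auto simp: std_mem)

lemma rmd_std: "rmd (std I)"
proof -
  have "abelian_group (std I)"
  proof (rule abelian_groupI)
    fix x assume x: "x \<in> carrier (std I)"
    show "\<exists>y\<in>carrier (std I). y \<oplus>\<^bsub>std I\<^esub> x = \<zero>\<^bsub>std I\<^esub>"
      by (rule bexI[of _ "\<lambda>i. \<ominus> x i"]) (use stdD[OF x] eps_closed in \<open>auto simp: l_neg std_mem r_minus\<close>)
    fix y assume y: "y \<in> carrier (std I)"
    show "x \<oplus>\<^bsub>std I\<^esub> y \<in> carrier (std I)" "x \<oplus>\<^bsub>std I\<^esub> y = y \<oplus>\<^bsub>std I\<^esub> x" "\<zero>\<^bsub>std I\<^esub> \<oplus>\<^bsub>std I\<^esub> x = x"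
      using stdD[OF x] stdD[OF y] eps_closed by (auto simp: std_mem r_distr a_comm)
    fix z assume z: "z \<in> carrier (std I)"
    show "x \<oplus>\<^bsub>std I\<^esub> y \<oplus>\<^bsub>std I\<^esub> z = x \<oplus>\<^bsub>std I\<^esub> (y \<oplus>\<^bsub>std I\<^esub> z)"
      using stdD[OF x] stdD[OF y] stdD[OF z] by (auto simp: a_assoc)
  qed (auto simp: std_mem eps_closed)
  moreover have "right_module_axioms R (std I)"
  proof
    fix x assume x: "x \<in> carrier (std I)"
    show "ract (std I) x \<one> = x" using stdD[OF x] by simp
    fix a assume a: "a \<in> carrier R"
    show "ract (std I) x a \<in> carrier (std I)"
      using stdD[OF x] a eps_closed by (simp add: std_mem flip: m_assoc)
    fix b assume b: "b \<in> carrier R"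
    show "ract (std I) x (a \<oplus> b) = ract (std I) x a \<oplus>\<^bsub>std I\<^esub> ract (std I) x b"
      "ract (std I) x (a \<otimes> b) = ract (std I) (ract (std I) x a) b"
      using stdD[OF x] a b by (simp_all add: r_distr m_assoc)
  next
    fix x y a assume x: "x \<in> carrier (std I)" and y: "y \<in> carrier (std I)" and a: "a \<in> carrier R"
    show "ract (std I) (x \<oplus>\<^bsub>std I\<^esub> y) a = ract (std I) x a \<oplus>\<^bsub>std I\<^esub> ract (std I) y a"
      using stdD[OF x] stdD[OF y] a by (simp add: l_distr)
  qed
  ultimately show ?thesis by (simp add: right_module_def ring_axioms)
qed

lemma std_neg: "x \<in> carrier (std I) \<Longrightarrow> \<ominus>\<^bsub>std I\<^esub> x = (\<lambda>i. \<ominus> x i)"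
  by (rule sym, rule m_eq_minus[OF rmd_std])
    (auto simp: l_neg std_mem r_minus eps_closed)

definition sgl :: "nat \<Rightarrow> 'a \<Rightarrow> nat \<Rightarrow> 'a"
  where "sgl i a = (\<lambda>j. if j = i then a else \<zero>)"

lemma sgl_mem: "i \<in> I \<Longrightarrow> a \<in> carrier R \<Longrightarrow> \<epsilon> i \<otimes> a = a \<Longrightarrow> sgl i a \<in> carrier (std I)"
  by (auto simp: sgl_def std_mem eps_closed)

lemma sgl_eps_mem: "i \<in> I \<Longrightarrow> sgl i (\<epsilon> i) \<in> carrier (std I)"
  by (rule sgl_mem) (auto simp: eps_closed eps_idem)

text \<open>Hom(\<epsilon> i R, \<epsilon> j R) is the corner \<epsilon> j R \<epsilon> i: the image
  of the generator is fixed by \<epsilon> i on the right because the generator is. These values are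
  the entries of the matrix of f.\<close>

lemma rhom_entry:
  assumes f: "f \<in> rhom R (std I) (std I')" and i: "i \<in> I"
  shows "f (sgl i (\<epsilon> i)) j \<in> carrier R" "\<epsilon> j \<otimes> f (sgl i (\<epsilon> i)) j = f (sgl i (\<epsilon> i)) j"
    "f (sgl i (\<epsilon> i)) j \<otimes> \<epsilon> i = f (sgl i (\<epsilon> i)) j"
proof -
  have m: "f (sgl i (\<epsilon> i)) \<in> carrier (std I')" using rhom_closed[OF f sgl_eps_mem[OF i]] .
  then show "f (sgl i (\<epsilon> i)) j \<in> carrier R" "\<epsilon> j \<otimes> f (sgl i (\<epsilon> i)) j = f (sgl i (\<epsilon> i)) j"
    using stdD[OF m] by auto
  have "sgl i (\<epsilon> i) = ract (std I) (sgl i (\<epsilon> i)) (\<epsilon> i)"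
    by (auto simp: sgl_def eps_idem eps_closed)
  then show "f (sgl i (\<epsilon> i)) j \<otimes> \<epsilon> i = f (sgl i (\<epsilon> i)) j"
    using rhom_act[OF f sgl_eps_mem[OF i] eps_closed[of i]] by (metis std_simps(3))
qed

lemma rhom_sgl:
  assumes f: "f \<in> rhom R (std I) (std I')" and i: "i \<in> I" and a: "a \<in> carrier R" "\<epsilon> i \<otimes> a = a"
  shows "f (sgl i a) j = f (sgl i (\<epsilon> i)) j \<otimes> a"
proof -
  have "sgl i a = ract (std I) (sgl i (\<epsilon> i)) a"
    using a by (auto simp: sgl_def)
  then show ?thesis using rhom_act[OF f sgl_eps_mem[OF i] a(1)] by simp
qed

lemma rhom_expand:
  assumes f: "f \<in> rhom R (std I) (std I')" and I: "finite I" and x: "x \<in> carrier (std I)"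
  shows "f x j = (\<Oplus>i\<in>I. f (sgl i (\<epsilon> i)) j \<otimes> x i)"
proof -
  \<comment> \<open>Generalised to arguments supported in a smaller set \<open>K\<close>, on which
    the induction runs while f and I stay fixed.\<close>
  have "f x j = (\<Oplus>i\<in>K. f (sgl i (\<epsilon> i)) j \<otimes> x i)"
    if "finite K" "K \<subseteq> I" "x \<in> carrier (std I)" "\<And>i. i \<notin> K \<Longrightarrow> x i = \<zero>" for K x
    using that
  proof (induction K arbitrary: x rule: finite_induct)
    case empty
    then have "x = \<zero>\<^bsub>std I\<^esub>" by auto
    then show ?case using rhom_0[OF rmd_std rmd_std f] by simp
  next
    case (insert k K)
    note xc = stdD[OF insert.prems(2)]
    define y where "y = x(k := \<zero>)"
    have k: "k \<in> I" using insert by auto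
    have y: "y \<in> carrier (std I)" using xc by (auto simp: y_def std_mem eps_closed)
    have IH: "f y j = (\<Oplus>i\<in>K. f (sgl i (\<epsilon> i)) j \<otimes> y i)"
    proof (rule insert.IH)
      show "y i = \<zero>" if "i \<notin> K" for i using that insert.prems(3) by (simp add: y_def)
    qed (use insert.prems y in auto)
    have "(\<Oplus>i\<in>K. f (sgl i (\<epsilon> i)) j \<otimes> y i) = (\<Oplus>i\<in>K. f (sgl i (\<epsilon> i)) j \<otimes> x i)"
      by (rule finsum_cong') (use insert in \<open>auto simp: y_def rhom_entry[OF f] xc\<close>)
    moreover have "x = sgl k (x k) \<oplus>\<^bsub>std I\<^esub> y" using xc by (auto simp: sgl_def y_def)
    moreover have s: "sgl k (x k) \<in> carrier (std I)" by (rule sgl_mem) (use k xc in auto)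
    ultimately have "f x j = f (sgl k (\<epsilon> k)) j \<otimes> x k \<oplus> (\<Oplus>i\<in>K. f (sgl i (\<epsilon> i)) j \<otimes> x i)"
      using rhom_add[OF f s y] IH rhom_sgl[OF f k xc(1,2)] by simp
    also have "\<dots> = (\<Oplus>i\<in>insert k K. f (sgl i (\<epsilon> i)) j \<otimes> x i)"
      by (rule finsum_insert[symmetric]) (use insert in \<open>auto simp: rhom_entry[OF f] xc\<close>)
    finally show ?case .
  qed
  from this[OF I subset_refl x] stdD(3)[OF x] show ?thesis by auto
qed

definition mmap :: "nat set \<Rightarrow> nat set \<Rightarrow> (nat \<Rightarrow> nat \<Rightarrow> 'a) \<Rightarrow> (nat \<Rightarrow> 'a) \<Rightarrow> nat \<Rightarrow> 'a"
  where "mmap I I' A x = (\<lambda>j. if j \<in> I' then (\<Oplus>i\<in>I. A j i \<otimes> x i) else \<zero>)"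

lemma mmap_rhom:
  assumes I: "finite I"
    and A: "\<And>i j. i \<in> I \<Longrightarrow> j \<in> I' \<Longrightarrow> A j i \<in> carrier R \<and> \<epsilon> j \<otimes> A j i = A j i"
  shows "mmap I I' A \<in> rhom R (std I) (std I')"
proof (rule rhomI)
  fix x assume x: "x \<in> carrier (std I)"
  note xc = stdD[OF x]
  have Ax: "j \<in> I' \<Longrightarrow> (\<lambda>i. A j i \<otimes> x i) \<in> I \<rightarrow> carrier R" for j using A xc by auto
  show "mmap I I' A x \<in> carrier (std I')"
    unfolding std_mem
  proof (intro allI conjI impI)
    fix j
    show "mmap I I' A x j \<in> carrier R" using Ax by (auto simp: mmap_def intro: finsum_closed)
    show "\<epsilon> j \<otimes> mmap I I' A x j = mmap I I' A x j"
    proof (cases "j \<in> I'")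
      case True
      have "\<epsilon> j \<otimes> (\<Oplus>i\<in>I. A j i \<otimes> x i) = (\<Oplus>i\<in>I. \<epsilon> j \<otimes> (A j i \<otimes> x i))"
        by (rule finsum_rdistr[OF I eps_closed Ax[OF True]])
      also have "\<dots> = (\<Oplus>i\<in>I. A j i \<otimes> x i)"
        by (rule finsum_cong') (use A xc True eps_closed in \<open>auto simp flip: m_assoc\<close>)
      finally show ?thesis using True by (simp add: mmap_def)
    qed (simp add: mmap_def eps_closed)
  qed (simp add: mmap_def)
  fix a assume a: "a \<in> carrier R"
  show "mmap I I' A (ract (std I) x a) = ract (std I') (mmap I I' A x) a"
  proof
    fix j
    show "mmap I I' A (ract (std I) x a) j = ract (std I') (mmap I I' A x) a j"
    proof (cases "j \<in> I'")
      case True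
      have "(\<Oplus>i\<in>I. A j i \<otimes> x i) \<otimes> a = (\<Oplus>i\<in>I. A j i \<otimes> x i \<otimes> a)"
        by (rule finsum_ldistr[OF I a Ax[OF True]])
      also have "\<dots> = (\<Oplus>i\<in>I. A j i \<otimes> (x i \<otimes> a))"
        by (rule finsum_cong') (use A xc True a in \<open>auto simp: m_assoc\<close>)
      finally show ?thesis using True by (simp add: mmap_def)
    qed (use a in \<open>simp add: mmap_def\<close>)
  qed
next
  fix x y assume x: "x \<in> carrier (std I)" and y: "y \<in> carrier (std I)"
  note xc = stdD[OF x] and yc = stdD[OF y]
  have "(\<Oplus>i\<in>I. A j i \<otimes> (x i \<oplus> y i)) = (\<Oplus>i\<in>I. A j i \<otimes> x i) \<oplus> (\<Oplus>i\<in>I. A j i \<otimes> y i)" if "j \<in> I'" for j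
  proof -
    have "(\<Oplus>i\<in>I. A j i \<otimes> (x i \<oplus> y i)) = (\<Oplus>i\<in>I. A j i \<otimes> x i \<oplus> A j i \<otimes> y i)"
      by (rule finsum_cong') (use A xc yc that in \<open>auto simp: r_distr\<close>)
    also have "\<dots> = (\<Oplus>i\<in>I. A j i \<otimes> x i) \<oplus> (\<Oplus>i\<in>I. A j i \<otimes> y i)"
      by (rule finsum_addf) (use A xc yc that in auto)
    finally show ?thesis .
  qed
  then show "mmap I I' A (x \<oplus>\<^bsub>std I\<^esub> y) = mmap I I' A x \<oplus>\<^bsub>std I'\<^esub> mmap I I' A y"
    by (auto simp: mmap_def fun_eq_iff)
qed

lemma fgp_std:
  assumes "finite I"
  shows "fg_projective R (std I)"
proof -
  from assms obtain m where m: "I \<subseteq> {..<m}" using finite_nat_iff_bounded by blast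
  have s: "(\<lambda>x. x) \<in> rhom R (std I) (free_rmod R m)"
  proof (rule rhomI)
    fix x assume x: "x \<in> carrier (std I)"
    have "x i = \<zero>" if "i \<ge> m" for i
    proof (rule stdD(3)[OF x])
      show "i \<notin> I" using m that by (meson lessThan_iff linorder_not_less subsetD)
    qed
    then show "x \<in> carrier (free_rmod R m)" using stdD[OF x] by simp
  qed (simp_all del: free_rmod_simps(1))
  have r: "(\<lambda>y i. if i \<in> I then \<epsilon> i \<otimes> y i else \<zero>) \<in> rhom R (free_rmod R m) (std I)"
  proof (rule rhomI)
    fix x assume "x \<in> carrier (free_rmod R m)"
    note xc = free_carrier[OF this]
    show "(\<lambda>i. if i \<in> I then \<epsilon> i \<otimes> x i else \<zero>) \<in> carrier (std I)"
      using xc by (auto simp: std_mem eps_closed eps_eps)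
    show "(\<lambda>i. if i \<in> I then \<epsilon> i \<otimes> (ract (free_rmod R m) x a) i else \<zero>) =
      ract (std I) (\<lambda>i. if i \<in> I then \<epsilon> i \<otimes> x i else \<zero>) a" if "a \<in> carrier R" for a
      using xc that by (auto simp: fun_eq_iff m_assoc eps_closed)
    fix y assume "y \<in> carrier (free_rmod R m)"
    note yc = free_carrier[OF this]
    show "(\<lambda>i. if i \<in> I then \<epsilon> i \<otimes> (x \<oplus>\<^bsub>free_rmod R m\<^esub> y) i else \<zero>) =
      (\<lambda>i. if i \<in> I then \<epsilon> i \<otimes> x i else \<zero>) \<oplus>\<^bsub>std I\<^esub>
      (\<lambda>i. if i \<in> I then \<epsilon> i \<otimes> y i else \<zero>)"
      using xc yc by (auto simp: fun_eq_iff r_distr eps_closed)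
  qed
  have "(\<lambda>i. if i \<in> I then \<epsilon> i \<otimes> x i else \<zero>) = x" if "x \<in> carrier (std I)" for x
    using stdD[OF that] by auto
  then show ?thesis unfolding fg_projective_def
    by (intro conjI rmd_std exI[of _ m] bexI[OF _ s] bexI[OF _ r]) simp
qed

text \<open>R is the sum of the \<epsilon> e R over e < n, because these idempotents sum to one. The
  indices from l * n to l * n + n - 1 carry the l-th copy of R, by periodicity of the
  idempotents.\<close>

lemma free_retract_std:
  obtains s r where "s \<in> rhom R (free_rmod R m) (std {..<m * n})" "r \<in> rhom R (std {..<m * n}) (free_rmod R m)"
    "\<And>x. x \<in> carrier (free_rmod R m) \<Longrightarrow> r (s x) = x"
proof -
  define s where "s x = (\<lambda>i. if i < m * n then \<epsilon> i \<otimes> x (i div n) else \<zero>)" for x :: "nat \<Rightarrow> 'a"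
  define r where "r y = (\<lambda>l. if l < m then (\<Oplus>e\<in>{..<n}. y (l * n + e)) else \<zero>)" for y :: "nat \<Rightarrow> 'a"
  have s: "s \<in> rhom R (free_rmod R m) (std {..<m * n})"
    unfolding s_def
  proof (rule rhomI)
    fix x assume "x \<in> carrier (free_rmod R m)"
    note xc = free_carrier[OF this]
    show "(\<lambda>i. if i < m * n then \<epsilon> i \<otimes> x (i div n) else \<zero>) \<in> carrier (std {..<m * n})"
      using xc by (auto simp: std_mem eps_closed eps_eps)
    show "(\<lambda>i. if i < m * n then \<epsilon> i \<otimes> (ract (free_rmod R m) x a) (i div n) else \<zero>) =
      ract (std {..<m * n}) (\<lambda>i. if i < m * n then \<epsilon> i \<otimes> x (i div n) else \<zero>) a" if "a \<in> carrier R" for a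
      using xc that by (auto simp: fun_eq_iff m_assoc eps_closed)
    fix y assume "y \<in> carrier (free_rmod R m)"
    note yc = free_carrier[OF this]
    show "(\<lambda>i. if i < m * n then \<epsilon> i \<otimes> (x \<oplus>\<^bsub>free_rmod R m\<^esub> y) (i div n) else \<zero>) =
      (\<lambda>i. if i < m * n then \<epsilon> i \<otimes> x (i div n) else \<zero>) \<oplus>\<^bsub>std {..<m * n}\<^esub>
      (\<lambda>i. if i < m * n then \<epsilon> i \<otimes> y (i div n) else \<zero>)"
      using xc yc by (auto simp: fun_eq_iff r_distr eps_closed)
  qed
  have r: "r \<in> rhom R (std {..<m * n}) (free_rmod R m)"
  proof (rule rhomI)
    fix x assume x: "x \<in> carrier (std {..<m * n})"
    note xc = stdD[OF x]
    show "r x \<in> carrier (free_rmod R m)" using xc by (auto simp: r_def intro!: finsum_closed)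
    fix a assume a: "a \<in> carrier R"
    show "r (ract (std {..<m * n}) x a) = ract (free_rmod R m) (r x) a"
      using xc a by (auto simp: r_def fun_eq_iff finsum_ldistr)
  next
    fix x y assume x: "x \<in> carrier (std {..<m * n})" and y: "y \<in> carrier (std {..<m * n})"
    note xc = stdD[OF x] and yc = stdD[OF y]
    show "r (x \<oplus>\<^bsub>std {..<m * n}\<^esub> y) = r x \<oplus>\<^bsub>free_rmod R m\<^esub> r y"
      using xc yc by (auto simp: r_def fun_eq_iff)
  qed
  have "r (s x) = x" if x: "x \<in> carrier (free_rmod R m)" for x
  proof
    fix l
    show "r (s x) l = x l"
    proof (cases "l < m")
      case True
      note xc = free_carrier[OF x]
      have "(\<Oplus>e\<in>{..<n}. s x (l * n + e)) = (\<Oplus>e\<in>{..<n}. \<epsilon> e \<otimes> x l)"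
      proof (rule finsum_cong')
        fix e assume e: "e \<in> {..<n}"
        have "l * n + e < Suc l * n" using e by simp
        also have "\<dots> \<le> m * n" using True by (intro mult_le_mono1) simp
        finally have "l * n + e < m * n" .
        then show "s x (l * n + e) = \<epsilon> e \<otimes> x l"
          using e by (auto simp: s_def intro!: arg_cong2[where f = "(\<otimes>)"] eps_cong)
      qed (use xc eps_closed in auto)
      also have "\<dots> = (\<Oplus>e\<in>{..<n}. \<epsilon> e) \<otimes> x l"
        by (rule finsum_ldistr[symmetric]) (use xc eps_closed in auto)
      finally show ?thesis using True xc by (simp add: r_def eps_sum)
    qed (use x in \<open>simp add: r_def\<close>)
  qed
  with s r show ?thesis by (rule that)
qed

end

section \<open>Submodules, and the splitting of projective modules and complexes into standard
  ones\<close>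

context base_ring
begin

text \<open>Closure under negatives comes from the action of \<ominus> \<one>.\<close>

lemma rmd_sub:
  assumes M: "rmd M" and S: "S \<subseteq> carrier M" "\<zero>\<^bsub>M\<^esub> \<in> S"
    and add: "\<And>x y. x \<in> S \<Longrightarrow> y \<in> S \<Longrightarrow> x \<oplus>\<^bsub>M\<^esub> y \<in> S"
    and act: "\<And>x a. x \<in> S \<Longrightarrow> a \<in> carrier R \<Longrightarrow> ract M x a \<in> S"
  shows "rmd (M\<lparr>carrier := S\<rparr>)"
proof -
  have in_M: "x \<in> carrier M" if "x \<in> S" for x using S that by auto
  have neg: "\<ominus>\<^bsub>M\<^esub> x = ract M x (\<ominus> \<one>)" if "x \<in> S" for x
  proof (rule sym, rule m_eq_minus[OF M])
    have "ract M x (\<ominus> \<one>) \<oplus>\<^bsub>M\<^esub> x = ract M x (\<ominus> \<one> \<oplus> \<one>)"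
      using in_M[OF that] by (simp add: right_module.ract_add_right[OF M] right_module.ract_one[OF M])
    also have "\<dots> = ract M x \<zero>" by (simp add: l_neg)
    also have "\<dots> = \<zero>\<^bsub>M\<^esub>"
      using right_module.ract_add_right[OF M in_M[OF that], of \<zero> \<zero>] m_ract[OF M in_M[OF that], of \<zero>]
      by (metis l_zero m_cancel[OF M] m_r_zero[OF M] m_zero[OF M] zero_closed)
    finally show "ract M x (\<ominus> \<one>) \<oplus>\<^bsub>M\<^esub> x = \<zero>\<^bsub>M\<^esub>" .
  qed (use in_M[OF that] m_ract[OF M] in auto)
  have "abelian_group (M\<lparr>carrier := S\<rparr>)"
  proof (rule abelian_groupI)
    fix x assume "x \<in> carrier (M\<lparr>carrier := S\<rparr>)"
    then have x: "x \<in> S" by simp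
    have "\<ominus>\<^bsub>M\<^esub> x \<in> S" using neg[OF x] act[OF x] by simp
    then show "\<exists>y\<in>carrier (M\<lparr>carrier := S\<rparr>). y \<oplus>\<^bsub>M\<lparr>carrier := S\<rparr>\<^esub> x = \<zero>\<^bsub>M\<lparr>carrier := S\<rparr>\<^esub>"
      using in_M[OF x] by (intro bexI[of _ "\<ominus>\<^bsub>M\<^esub> x"]) (simp_all add: m_l_neg[OF M])
  qed (use S add in_M in \<open>simp_all add: m_assoc'[OF M] m_comm'[OF M] m_lcomm'[OF M] m_l_zero[OF M] m_r_zero[OF M]\<close>)
  moreover have "right_module_axioms R (M\<lparr>carrier := S\<rparr>)"
    by unfold_locales (use in_M act in \<open>simp_all add: right_module.ract_add_left[OF M] right_module.ract_add_right[OF M]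
      right_module.ract_mult[OF M] right_module.ract_one[OF M]\<close>)
  ultimately show ?thesis by (simp add: right_module_def ring_axioms)
qed

lemma rhom_sub_dom: "f \<in> rhom R M N \<Longrightarrow> S \<subseteq> carrier M \<Longrightarrow> f \<in> rhom R (M\<lparr>carrier := S\<rparr>) N"
  by (auto simp: rhom_def subset_eq)

lemma rhom_sub_cod: "f \<in> rhom R M N \<Longrightarrow> (\<And>x. x \<in> carrier M \<Longrightarrow> f x \<in> S) \<Longrightarrow> f \<in> rhom R M (N\<lparr>carrier := S\<rparr>)"
  by (auto simp: rhom_def)

lemma rhom_sub_incl: "f \<in> rhom R M (N\<lparr>carrier := S\<rparr>) \<Longrightarrow> S \<subseteq> carrier N \<Longrightarrow> f \<in> rhom R M N"
  by (auto simp: rhom_def)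

definition miso :: "'a rmod \<Rightarrow> 'a rmod \<Rightarrow> bool"
  where "miso M M' \<longleftrightarrow> (\<exists>f \<in> rhom R M M'. \<exists>g \<in> rhom R M' M.
    (\<forall>x \<in> carrier M. g (f x) = x) \<and> (\<forall>y \<in> carrier M'. f (g y) = y))"

end

context cartan_alg
begin

lemma std_mono: "x \<in> carrier (std I) \<Longrightarrow> I \<subseteq> I' \<Longrightarrow> x \<in> carrier (std I')"
  by (auto simp: std_mem)

lemma J_finsum: "finite I \<Longrightarrow> (\<And>i. i \<in> I \<Longrightarrow> f i \<in> J k) \<Longrightarrow> (\<Oplus>i\<in>I. f i) \<in> J k"
proof (induction I rule: finite_induct)
  case (insert i I)
  have "(\<Oplus>i\<in>insert i I. f i) = f i \<oplus> (\<Oplus>i\<in>I. f i)"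
    by (rule finsum_insert) (use insert J_sub in auto)
  then show ?case using insert J_add by auto
qed (simp add: J_zero)

text \<open>
  Split off a standard summand as long as the idempotent \<open>s r\<close> has an entry outside the radical;
  if it has none, it is nilpotent, hence zero.
\<close>

lemma retract_std:
  assumes "finite I" "rmd P" "s \<in> rhom R P (std I)" "r \<in> rhom R (std I) P" "\<And>y. y \<in> carrier P \<Longrightarrow> r (s y) = y"
  shows "\<exists>I' \<subseteq> I. miso P (std I')"
  using assms
proof (induction "card I" arbitrary: I P s r rule: less_induct)
  case less
  note I = less.prems(1) and P = less.prems(2) and s = less.prems(3) and r = less.prems(4) and rs = less.prems(5)
  define E where "E x = s (r x)" for x
  have E: "E \<in> rhom R (std I) (std I)" unfolding E_def[abs_def] by (rule rhom_comp[OF r s])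
  have EE: "E (E x) = E x" if "x \<in> carrier (std I)" for x
    using rs[OF rhom_closed[OF r that]] by (simp add: E_def)
  let ?e = "\<lambda>j i. E (sgl i (\<epsilon> i)) j"
  show ?case
  proof (cases "\<forall>i\<in>I. \<forall>j\<in>I. ?e j i \<in> J 1")
    case True
    \<comment> \<open>Each application of E raises the order by one, but E (E x) = E x; so the
      entries lie in every \<open>J k\<close>.\<close>
    have EJ: "E x j \<in> J k" if "x \<in> carrier (std I)" for x j k
    proof (induction k arbitrary: j)
      case 0
      show ?case using stdD(1)[OF rhom_closed[OF E that]] by (simp add: J_0)
    next
      case (Suc k)
      have Ex: "E x \<in> carrier (std I)" by (rule rhom_closed[OF E that])
      show ?case
      proof (cases "j \<in> I")
        case j: True
        have "E x j = E (E x) j" using EE[OF that] by simp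
        also have "\<dots> = (\<Oplus>i\<in>I. ?e j i \<otimes> E x i)" by (rule rhom_expand[OF E I Ex])
        also have "\<dots> \<in> J (Suc k)" by (rule J_finsum[OF I]) (use True j Suc J_mult in auto)
        finally show ?thesis .
      qed (use stdD(3)[OF Ex] J_zero in simp)
    qed
    have Ez: "E x = (\<lambda>j. \<zero>)" if "x \<in> carrier (std I)" for x
      using EJ[OF that, of _ N] J_last by auto
    have sy: "s y = \<zero>\<^bsub>std I\<^esub>" if "y \<in> carrier P" for y
    proof -
      have "s y = E (s y)" unfolding E_def rs[OF that] ..
      then show ?thesis using Ez[OF rhom_closed[OF s that]] by simp
    qed
    have z: "y = \<zero>\<^bsub>P\<^esub>" if "y \<in> carrier P" for y
      using rs[OF that] sy[OF that] rhom_0[OF rmd_std P r] by simp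
    have "miso P (std {})"
      unfolding miso_def
    proof (intro bexI conjI ballI)
      show "(\<lambda>x. \<zero>\<^bsub>std {}\<^esub>) \<in> rhom R P (std {})" by (rule rhom_zero[OF rmd_std])
      show "(\<lambda>x. \<zero>\<^bsub>P\<^esub>) \<in> rhom R (std {}) P" by (rule rhom_zero[OF P])
    qed (use z in \<open>auto simp: std_mem\<close>)
    then show ?thesis by blast
  next
    case False
    then obtain i j where ij: "i \<in> I" "j \<in> I" "?e j i \<notin> J 1" by blast
    define a where "a = ?e j i"
    have a: "a \<in> carrier R" "\<epsilon> j \<otimes> a = a" "a \<otimes> \<epsilon> i = a" using rhom_entry[OF E ij(1)] by (auto simp: a_def)
    from J_local[OF a] ij(3) obtain t b where tb: "j mod n = i mod n" "t \<noteq> 0" "b \<in> J 1" "a = \<kappa> t \<otimes> \<epsilon> j \<oplus> b"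
      by (auto simp: a_def)
    have eij: "\<epsilon> i = \<epsilon> j" using eps_cong[OF tb(1)] by simp
    obtain u where u: "u \<in> carrier R" "\<epsilon> j \<otimes> u = u" "u \<otimes> a = \<epsilon> j" "a \<otimes> u = \<epsilon> j"
      using local_inverse[OF refl a(1,2) _ tb(2-4)] a(3) eij by metis
    \<comment> \<open>The entry \<open>a\<close> is invertible in the corner, with inverse
      \<open>u\<close>. Hence \<epsilon> j R maps into P through the i-th generator and back through
      the j-th coordinate followed by \<open>u\<close>, and the composite is the identity.\<close>
    define \<alpha> where "\<alpha> x = r (sgl i (x j))" for x :: "nat \<Rightarrow> 'a"
    define \<beta> where "\<beta> y = sgl j (u \<otimes> s y j)" for y
    have sg: "(\<lambda>x. sgl i (x j)) \<in> rhom R (std {j}) (std I)"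
      by (rule rhomI) (auto simp: sgl_def std_mem ij eps_closed eij fun_eq_iff)
    have \<alpha>: "\<alpha> \<in> rhom R (std {j}) P" unfolding \<alpha>_def[abs_def] by (rule rhom_comp[OF sg r])
    have "(\<lambda>x. sgl j (u \<otimes> x j)) \<in> rhom R (std I) (std {j})"
      by (rule rhomI) (auto simp: sgl_def std_mem u eps_closed fun_eq_iff r_distr simp flip: m_assoc)
    from rhom_comp[OF s this] have \<beta>: "\<beta> \<in> rhom R P (std {j})" unfolding \<beta>_def[abs_def] .
    have s\<alpha>: "s (\<alpha> x) j = a \<otimes> x j" if "x \<in> carrier (std {j})" for x
      unfolding \<alpha>_def using rhom_sgl[OF E ij(1)] stdD[OF that, of j] eij by (simp add: E_def a_def)
    have \<beta>\<alpha>: "\<beta> (\<alpha> x) = x" if "x \<in> carrier (std {j})" for x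
    proof -
      have "u \<otimes> (a \<otimes> x j) = x j" using stdD[OF that, of j] a u by (metis m_assoc)
      then show ?thesis using s\<alpha>[OF that] stdD(3)[OF that] by (auto simp: \<beta>_def sgl_def fun_eq_iff)
    qed
    \<comment> \<open>The complementary summand: elements whose image under \<open>s\<close> has no
      j-th coordinate. It is a retract of the sum over I - {j}, so the induction hypothesis applies
      to it.\<close>
    define S where "S = {y \<in> carrier P. s y j = \<zero>}"
    define P' where "P' = P\<lparr>carrier := S\<rparr>"
    have S: "S \<subseteq> carrier P" by (auto simp: S_def)
    have P': "rmd P'" unfolding P'_def
    proof (rule rmd_sub[OF P S])
      show "\<zero>\<^bsub>P\<^esub> \<in> S" using rhom_0[OF P rmd_std s] m_zero[OF P] by (simp add: S_def)
    qed (auto simp: S_def m_closed'[OF P] m_ract[OF P] rhom_add[OF s] rhom_act[OF s])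
    define \<pi> where "\<pi> y = y \<oplus>\<^bsub>P\<^esub> (\<ominus>\<^bsub>P\<^esub> \<alpha> (\<beta> y))" for y
    have \<pi>: "\<pi> \<in> rhom R P P" unfolding \<pi>_def[abs_def]
      by (rule rhom_plus[OF P rhom_id rhom_uminus[OF P rhom_comp[OF \<beta> \<alpha>]]])
    have \<pi>S: "\<pi> y \<in> S" if y: "y \<in> carrier P" for y
    proof -
      have c: "\<beta> y \<in> carrier (std {j})" "\<alpha> (\<beta> y) \<in> carrier P" "s (\<alpha> (\<beta> y)) \<in> carrier (std I)" "s y \<in> carrier (std I)"
        using rhom_closed[OF s rhom_closed[OF \<alpha> rhom_closed[OF \<beta> y]]] rhom_closed[OF \<beta> y]
          rhom_closed[OF \<alpha> rhom_closed[OF \<beta> y]] rhom_closed[OF s y] by simp_all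
      have "a \<otimes> (u \<otimes> s y j) = s y j" using stdD[OF c(4), of j] a u by (metis m_assoc)
      then have "s (\<alpha> (\<beta> y)) j = s y j" using s\<alpha>[OF c(1)] by (simp add: \<beta>_def sgl_def)
      moreover have "s (\<pi> y) = s y \<oplus>\<^bsub>std I\<^esub> (\<ominus>\<^bsub>std I\<^esub> s (\<alpha> (\<beta> y)))"
        unfolding \<pi>_def using rhom_add[OF s y m_neg_closed[OF P c(2)]] rhom_neg[OF P rmd_std s c(2)] by simp
      ultimately have "s (\<pi> y) j = \<zero>" using std_neg[OF c(3)] stdD[OF c(4)] by (simp add: r_neg)
      then show ?thesis using rhom_closed[OF \<pi> y] by (simp add: S_def)
    qed
    have \<pi>': "\<pi> \<in> rhom R P P'" unfolding P'_def by (rule rhom_sub_cod[OF \<pi> \<pi>S])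
    have \<beta>S: "\<beta> y = \<zero>\<^bsub>std {j}\<^esub>" if "y \<in> S" for y using that u by (auto simp: \<beta>_def S_def sgl_def)
    have \<alpha>0: "\<alpha> \<zero>\<^bsub>std {j}\<^esub> = \<zero>\<^bsub>P\<^esub>" by (rule rhom_0[OF rmd_std P \<alpha>])
    have \<pi>id: "\<pi> y = y" if "y \<in> S" for y
    proof -
      have "y \<in> carrier P" using that S by auto
      then show ?thesis unfolding \<pi>_def \<beta>S[OF that] \<alpha>0 by (simp add: m_minus_zero m_r_zero P)
    qed
    have \<pi>\<alpha>: "\<pi> (\<alpha> x) = \<zero>\<^bsub>P\<^esub>" if "x \<in> carrier (std {j})" for x
      using \<beta>\<alpha>[OF that] rhom_closed[OF \<alpha> that] by (simp add: \<pi>_def m_r_neg P)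
    have P'c: "carrier P' = S" by (simp add: P'_def)
    have s': "s \<in> rhom R P' (std (I - {j}))"
    proof (rule rhomI)
      show "s x \<in> carrier (std (I - {j}))" if "x \<in> carrier P'" for x
        using that stdD[OF rhom_closed[OF s, of x]] S by (auto simp: P'c std_mem S_def)
    qed (use rhom_add[OF s] rhom_act[OF s] S in \<open>auto simp: P'_def subset_eq\<close>)
    have "r \<in> rhom R (std (I - {j})) P"
      by (rule rhomI) (use rhom_closed[OF r] rhom_add[OF r] rhom_act[OF r] std_mono[of _ "I - {j}" I] in auto)
    note r' = rhom_comp[OF this \<pi>']
    have "\<exists>I' \<subseteq> I - {j}. miso P' (std I')"
    proof (rule less.hyps[OF _ _ P' s' r'])
      show "card (I - {j}) < card I" using ij I by (meson card_Diff1_less)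
      show "\<pi> (r (s y)) = y" if "y \<in> carrier P'" for y
        using that rs \<pi>id S by (auto simp: P'c)
    qed (use I in auto)
    then obtain I' f g where I': "I' \<subseteq> I - {j}" and f: "f \<in> rhom R P' (std I')" and g: "g \<in> rhom R (std I') P'"
      and fg: "\<And>x. x \<in> carrier P' \<Longrightarrow> g (f x) = x" "\<And>y. y \<in> carrier (std I') \<Longrightarrow> f (g y) = y"
      unfolding miso_def by blast
    have jI': "j \<notin> I'" using I' by auto
    define F where "F y = \<beta> y \<oplus>\<^bsub>std (insert j I')\<^esub> f (\<pi> y)" for y
    define G where "G x = \<alpha> (\<lambda>k. if k = j then x k else \<zero>) \<oplus>\<^bsub>P\<^esub> g (\<lambda>k. if k \<in> I' then x k else \<zero>)" for x
    have inc: "f' \<in> rhom R M (std K) \<Longrightarrow> K \<subseteq> K' \<Longrightarrow> f' \<in> rhom R M (std K')" for f' K K' and M :: "'a rmod"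
      by (auto simp: rhom_def intro: std_mono)
    have F: "F \<in> rhom R P (std (insert j I'))"
      unfolding F_def[abs_def]
      by (rule rhom_plus[OF rmd_std inc[OF \<beta>] inc[OF rhom_comp[OF \<pi>' f]]]) auto
    have res: "(\<lambda>x k. if k \<in> K then x k else \<zero>) \<in> rhom R (std K') (std K)" if "K \<subseteq> K'" for K K'
      by (rule rhomI) (use that in \<open>auto simp: std_mem eps_closed fun_eq_iff\<close>)
    have res1: "(\<lambda>x k. if k = j then x k else \<zero>) \<in> rhom R (std (insert j I')) (std {j})"
      using res[of "{j}" "insert j I'"] by simp
    have res2: "(\<lambda>x k. if k \<in> I' then x k else \<zero>) \<in> rhom R (std (insert j I')) (std I')"
      by (rule res) auto
    have gP: "g \<in> rhom R (std I') P" using g S unfolding P'_def by (rule rhom_sub_incl)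
    have G: "G \<in> rhom R (std (insert j I')) P"
      unfolding G_def[abs_def] by (rule rhom_plus[OF P rhom_comp[OF res1 \<alpha>] rhom_comp[OF res2 gP]])
    have "G (F y) = y" if y: "y \<in> carrier P" for y
    proof -
      have c: "\<beta> y \<in> carrier (std {j})" "f (\<pi> y) \<in> carrier (std I')"
        using rhom_closed[OF \<beta> y] rhom_closed[OF f, of "\<pi> y"] \<pi>S[OF y] by (simp_all add: P'c)
      have "(\<lambda>k. if k = j then F y k else \<zero>) = \<beta> y"
        using stdD[OF c(1)] stdD[OF c(2)] jI' by (auto simp: F_def fun_eq_iff)
      moreover have "(\<lambda>k. if k \<in> I' then F y k else \<zero>) = f (\<pi> y)"
      proof
        fix k show "(if k \<in> I' then F y k else \<zero>) = f (\<pi> y) k"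
          using stdD[OF c(1), of k] stdD[OF c(2), of k] jI' by (cases "k = j") (auto simp: F_def)
      qed
      ultimately have "G (F y) = \<alpha> (\<beta> y) \<oplus>\<^bsub>P\<^esub> \<pi> y" using fg(1)[of "\<pi> y"] \<pi>S[OF y] by (simp add: G_def P'c)
      also have "\<dots> = y" unfolding \<pi>_def using y rhom_closed[OF \<alpha> c(1)]
        by (simp add: m_simps m_lcomm' P)
      finally show ?thesis .
    qed
    moreover have "F (G x) = x" if x: "x \<in> carrier (std (insert j I'))" for x
    proof -
      let ?x = "\<lambda>k. if k = j then x k else \<zero>" and ?y = "\<lambda>k. if k \<in> I' then x k else \<zero>"
      have c: "?x \<in> carrier (std {j})" "?y \<in> carrier (std I')"
        using rhom_closed[OF res1 x] rhom_closed[OF res2 x] by auto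
      have gy: "g ?y \<in> S" using rhom_closed[OF g c(2)] by (simp add: P'c)
      then have gyP: "g ?y \<in> carrier P" using S by auto
      have ax: "\<alpha> ?x \<in> carrier P" by (rule rhom_closed[OF \<alpha> c(1)])
      have 1: "\<beta> (G x) = ?x"
        unfolding G_def rhom_add[OF \<beta> ax gyP] \<beta>\<alpha>[OF c(1)] \<beta>S[OF gy] using stdD[OF c(1)] by (simp add: fun_eq_iff)
      have "\<pi> (G x) = \<pi> (\<alpha> ?x) \<oplus>\<^bsub>P\<^esub> \<pi> (g ?y)" unfolding G_def by (rule rhom_add[OF \<pi> ax gyP])
      also have "\<dots> = g ?y" unfolding \<pi>\<alpha>[OF c(1)] \<pi>id[OF gy] using gyP P by (simp add: m_l_zero)
      finally have 2: "f (\<pi> (G x)) = ?y" using fg(2)[OF c(2)] by simp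
      show ?thesis
      proof
        fix k show "F (G x) k = x k"
          using stdD[OF x, of k] jI' unfolding F_def 1 2 by auto
      qed
    qed
    ultimately have "miso P (std (insert j I'))" unfolding miso_def using F G by blast
    then show ?thesis using I' ij by blast
  qed
qed

lemma fgp_miso:
  assumes "fg_projective R P"
  obtains I where "finite I" "miso P (std I)"
proof -
  from assms obtain m s r where P: "rmd P" and s: "s \<in> rhom R P (free_rmod R m)" "r \<in> rhom R (free_rmod R m) P"
    "\<And>x. x \<in> carrier P \<Longrightarrow> r (s x) = x" unfolding fg_projective_def by blast
  obtain s' r' where s': "s' \<in> rhom R (free_rmod R m) (std {..<m * n})" "r' \<in> rhom R (std {..<m * n}) (free_rmod R m)"
    "\<And>x. x \<in> carrier (free_rmod R m) \<Longrightarrow> r' (s' x) = x" using free_retract_std by blast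
  have "\<exists>I' \<subseteq> {..<m * n}. miso P (std I')"
    by (rule retract_std[OF _ P rhom_comp[OF s(1) s'(1)] rhom_comp[OF s'(2) s(2)]])
      (use s s' rhom_closed[OF s(1)] in auto)
  then show ?thesis using that finite_subset by blast
qed

text \<open>Normal form of the objects of the homotopy category: all terms are standard, with
  finitely many indices in total. Coordinates and Euler characteristics are defined for complexes in
  this form.\<close>

definition shaped :: "'a cplx \<Rightarrow> (int \<Rightarrow> nat set) \<Rightarrow> bool"
  where "shaped U I \<longleftrightarrow> cx U \<and> (\<forall>p. obj U p = std (I p)) \<and> (\<forall>p. finite (I p)) \<and> finite {p. I p \<noteq> {}}"

lemma sgl_neq_0: "sgl i (\<epsilon> i) \<noteq> (\<lambda>i. \<zero>)"
  using eps_neq_0 by (metis sgl_def)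

lemma shaped_Kb:
  assumes "shaped U I"
  shows "U \<in> Kb_proj R"
proof -
  note U = assms[unfolded shaped_def]
  let ?S = "{p. I p \<noteq> {}}"
  have "\<exists>a b. \<forall>p\<in>?S. a \<le> p \<and> p \<le> b"
  proof (cases "?S = {}")
    case False
    then show ?thesis using U by (intro exI[of _ "Min ?S"] exI[of _ "Max ?S"]) auto
  qed auto
  then obtain a b where "\<forall>p\<in>?S. a \<le> p \<and> p \<le> b" by blast
  then have ab: "I p = {}" if "p < a \<or> b < p" for p using that by force
  have "carrier (std {}) = {\<zero>\<^bsub>std {}\<^esub>}" by (auto simp: std_mem eps_closed fun_eq_iff)
  then have "\<forall>p. p < a \<or> b < p \<longrightarrow> carrier (obj U p) = {\<zero>\<^bsub>obj U p\<^esub>}"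
    using ab U by (simp del: std_simps(1))
  then show ?thesis using U fgp_std unfolding Kb_proj_def cx_def by auto
qed

text \<open>Each term is replaced by an isomorphic standard module and the differential is
  transported; the result is isomorphic already as a complex.\<close>

lemma exists_shaped:
  assumes "U \<in> Kb_proj R"
  obtains U' I where "shaped U' I" "isomorphic R U U'"
proof -
  have "\<exists>I f g. finite I \<and> f \<in> rhom R (obj U p) (std I) \<and> g \<in> rhom R (std I) (obj U p) \<and>
    (\<forall>x\<in>carrier (obj U p). g (f x) = x) \<and> (\<forall>y\<in>carrier (std I). f (g y) = y)" for p
  proof -
    have "fg_projective R (obj U p)" using assms by (simp add: Kb_proj_def)
    then obtain I where I: "finite I" "miso (obj U p) (std I)" by (rule fgp_miso)
    from I(2)[unfolded miso_def] obtain f g where "f \<in> rhom R (obj U p) (std I)" "g \<in> rhom R (std I) (obj U p)"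
      "\<forall>x\<in>carrier (obj U p). g (f x) = x" "\<forall>y\<in>carrier (std I). f (g y) = y" by blast
    with I(1) show ?thesis by (intro exI conjI)
  qed
  then obtain I f g where I: "\<And>p. finite (I p)" and f: "\<And>p. f p \<in> rhom R (obj U p) (std (I p))"
    and g: "\<And>p. g p \<in> rhom R (std (I p)) (obj U p)"
    and gf: "\<And>p x. x \<in> carrier (obj U p) \<Longrightarrow> g p (f p x) = x" and fg: "\<And>p y. y \<in> carrier (std (I p)) \<Longrightarrow> f p (g p y) = y"
    by metis
  note U = Kb_cx[OF assms]
  define U' where "U' = \<lparr>obj = (\<lambda>p. std (I p)), dif = (\<lambda>p x. f (p + 1) (dif U p (g p x)))\<rparr>"
  have U's [simp]: "obj U' p = std (I p)" "dif U' p x = f (p + 1) (dif U p (g p x))" for p x by (simp_all add: U'_def)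
  have U': "cx U'"
    unfolding cx_def
  proof (intro conjI allI ballI)
    fix p show "rmd (obj U' p)" by (simp add: rmd_std)
    have "(\<lambda>x. f (p + 1) (dif U p (g p x))) \<in> rhom R (std (I p)) (std (I (p + 1)))"
      by (rule rhom_comp[OF rhom_comp[OF g cx_dif[OF U]] f])
    then show "dif U' p \<in> rhom R (obj U' p) (obj U' (p + 1))" by (simp add: U'_def)
    fix x assume "x \<in> carrier (obj U' p)"
    then have x: "g p x \<in> carrier (obj U p)" using rhom_closed[OF g] by simp
    show "dif U' (p + 1) (dif U' p x) = \<zero>\<^bsub>obj U' (p + 2)\<^esub>"
      using gf[OF rhom_closed[OF cx_dif[OF U] x]] cx_dd[OF U x] rhom_0[OF cx_rmd[OF U] rmd_std f, of "p + 2"]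
      by (simp add: add.commute[of 2])
  qed
  obtain a b where ab: "\<And>p. p < a \<or> b < p \<Longrightarrow> carrier (obj U p) = {\<zero>\<^bsub>obj U p\<^esub>}"
    using assms unfolding Kb_proj_def by blast
  \<comment> \<open>A zero term can only have the empty index set, since the generators of standard
    modules are nonzero.\<close>
  have "I p = {}" if "p < a \<or> b < p" for p
  proof (rule ccontr)
    assume "I p \<noteq> {}"
    then obtain i where i: "i \<in> I p" by auto
    note m = sgl_eps_mem[OF i]
    have "g p (sgl i (\<epsilon> i)) = \<zero>\<^bsub>obj U p\<^esub>" using rhom_closed[OF g m] ab[OF that] by simp
    then have "sgl i (\<epsilon> i) = \<zero>\<^bsub>std (I p)\<^esub>" using fg[OF m] rhom_0[OF cx_rmd[OF U] rmd_std f] by metis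
    then show False using sgl_neq_0 by simp
  qed
  then have "{p. I p \<noteq> {}} \<subseteq> {a..b}" by force
  then have "finite {p. I p \<noteq> {}}" by (rule finite_subset) simp
  then have sh: "shaped U' I" using U' I by (simp add: shaped_def)
  have fc: "f \<in> chain_maps R U U'" by (rule cmI) (use f gf in auto)
  have gc: "g \<in> chain_maps R U' U"
    by (rule cmI) (use g gf rhom_closed[OF g] rhom_closed[OF cx_dif[OF U]] in auto)
  have "isomorphic R U U'" by (rule isoI_strict[OF U U' fc gc]) (use gf fg in auto)
  with sh show ?thesis by (rule that)
qed

end

section \<open>The Euler form\<close>

context cartan_alg
begin

lemma co_finsum: "finite B \<Longrightarrow> f \<in> B \<rightarrow> carrier R \<Longrightarrow> co i j b (\<Oplus>x\<in>B. f x) = (\<Sum>x\<in>B. co i j b (f x))"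
  by (induction B rule: finite_induct) (auto simp: co_0 co_add)

lemma co_uminus: "x \<in> carrier R \<Longrightarrow> co i j b (\<ominus> x) = - co i j b x"
  using co_add[of "\<ominus> x" x i j b] co_0[of i j b] by (simp add: l_neg eq_neg_iff_add_eq_0)

definition lincomb :: "nat \<Rightarrow> nat \<Rightarrow> (nat \<Rightarrow> 'k) \<Rightarrow> 'a"
  where "lincomb i j w = (\<Oplus>b\<in>{..<c}. \<kappa> (w b) \<otimes> base i j b)"

lemma lincomb_terms: "(\<lambda>b. \<kappa> (w b) \<otimes> base i j b) \<in> {..<c} \<rightarrow> carrier R"
  using \<kappa>_closed base_closed by auto

lemma lincomb_closed: "lincomb i j w \<in> carrier R"
  unfolding lincomb_def by (rule finsum_closed[OF lincomb_terms])

lemma lincomb_left: "\<epsilon> i \<otimes> lincomb i j w = lincomb i j w"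
proof -
  have "\<epsilon> i \<otimes> lincomb i j w = (\<Oplus>b\<in>{..<c}. \<epsilon> i \<otimes> (\<kappa> (w b) \<otimes> base i j b))"
    unfolding lincomb_def by (rule finsum_rdistr[OF _ eps_closed lincomb_terms]) simp
  also have "\<dots> = lincomb i j w"
    unfolding lincomb_def
  proof (rule finsum_cong')
    fix b assume b: "b \<in> {..<c}"
    have "\<epsilon> i \<otimes> (\<kappa> (w b) \<otimes> base i j b) = \<kappa> (w b) \<otimes> (\<epsilon> i \<otimes> base i j b)"
      using b \<kappa>_closed base_closed eps_closed \<kappa>_central[OF eps_closed] by (metis lessThan_iff m_assoc)
    then show "\<epsilon> i \<otimes> (\<kappa> (w b) \<otimes> base i j b) = \<kappa> (w b) \<otimes> base i j b" using b base_left by simp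
  qed (use lincomb_terms in auto)
  finally show ?thesis .
qed

lemma lincomb_right: "lincomb i j w \<otimes> \<epsilon> j = lincomb i j w"
proof -
  have "lincomb i j w \<otimes> \<epsilon> j = (\<Oplus>b\<in>{..<c}. (\<kappa> (w b) \<otimes> base i j b) \<otimes> \<epsilon> j)"
    unfolding lincomb_def by (rule finsum_ldistr[OF _ eps_closed lincomb_terms]) simp
  also have "\<dots> = lincomb i j w"
    unfolding lincomb_def
    by (rule finsum_cong') (use lincomb_terms \<kappa>_closed base_closed eps_closed base_right in \<open>auto simp: m_assoc\<close>)
  finally show ?thesis .
qed

lemma co_lincomb: 
  assumes "b < c" shows "co i j b (lincomb i j w) = w b"
proof -
  have "co i j b (lincomb i j w) = (\<Sum>b'<c. co i j b (\<kappa> (w b') \<otimes> base i j b'))"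
    unfolding lincomb_def by (rule co_finsum[OF _ lincomb_terms]) simp
  also have "\<dots> = (\<Sum>b'<c. if b = b' then w b' else 0)"
    using assms by (intro sum.cong) (auto simp: co_scale base_closed co_base)
  finally show ?thesis using assms by simp
qed

text \<open>The difference of the two sides lies in the corner and has zero coordinates, so
  \<open>co_inj\<close> applies to it.\<close>

lemma lincomb_co:
  assumes a: "a \<in> carrier R" "\<epsilon> i \<otimes> a = a" "a \<otimes> \<epsilon> j = a"
  shows "lincomb i j (\<lambda>b. co i j b a) = a"
proof -
  let ?l = "lincomb i j (\<lambda>b. co i j b a)"
  note l = lincomb_closed[of i j] lincomb_left[of i j] lincomb_right[of i j]
  have "?l \<oplus> \<ominus> a = \<zero>"
    by (rule co_inj[of _ i j]) (use a l eps_closed in \<open>auto simp: r_distr l_distr r_minus l_minus co_add co_uminus co_lincomb\<close>)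
  then show ?thesis using a l by (metis a_inv_closed minus_equality minus_minus)
qed

lemma lincomb_add: "lincomb i j (\<lambda>b. w b + w' b) = lincomb i j w \<oplus> lincomb i j w'"
  unfolding lincomb_def
  by (subst finsum_addf[symmetric, OF lincomb_terms lincomb_terms], rule finsum_cong')
    (use \<kappa>_closed base_closed in \<open>auto simp: \<kappa>_add l_distr\<close>)

lemma lincomb_scale: "lincomb i j (\<lambda>b. t * w b) = \<kappa> t \<otimes> lincomb i j w"
  unfolding lincomb_def
  by (subst finsum_rdistr[OF _ \<kappa>_closed lincomb_terms], simp, rule finsum_cong')
    (use \<kappa>_closed base_closed in \<open>auto simp: \<kappa>_mult m_assoc\<close>)

lemma mmap_entry:
  assumes "finite I" "\<And>i j. i \<in> I \<Longrightarrow> j \<in> I' \<Longrightarrow> A j i \<in> carrier R \<and> A j i \<otimes> \<epsilon> i = A j i" "i \<in> I" "j \<in> I'"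
  shows "mmap I I' A (sgl i (\<epsilon> i)) j = A j i"
proof -
  have "(\<Oplus>i'\<in>I. A j i' \<otimes> sgl i (\<epsilon> i) i') = (\<Oplus>i'\<in>I. if i = i' then A j i' else \<zero>)"
    by (rule finsum_cong') (use assms in \<open>auto simp: sgl_def\<close>)
  also have "\<dots> = A j i" by (rule finsum_singleton) (use assms in auto)
  finally show ?thesis using assms by (simp add: mmap_def)
qed

type_synonym coord = "int \<times> int \<times> nat \<times> nat \<times> nat"

text \<open>Families of homomorphisms \<open>X\<^sup>p \<rightarrow> Y\<^sup>q\<close> between shaped complexes, in coordinates.\<close>

definition to_fam :: "(int \<Rightarrow> nat set) \<Rightarrow> (int \<Rightarrow> nat set) \<Rightarrow> (coord \<Rightarrow> 'k) \<Rightarrow> int \<Rightarrow> int \<Rightarrow> (nat \<Rightarrow> 'a) \<Rightarrow> nat \<Rightarrow> 'a"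
  where "to_fam I I' v p q = mmap (I p) (I' q) (\<lambda>j i. lincomb j i (\<lambda>b. v (p, q, i, j, b)))"

text \<open>The entry of a homomorphism from \<epsilon> i R to \<epsilon> j R lies in the corner
  \<epsilon> j R \<epsilon> i, hence the exchanged order in \<open>co j i b\<close>.\<close>

definition of_fam :: "(int \<Rightarrow> nat set) \<Rightarrow> (int \<Rightarrow> nat set) \<Rightarrow> (int \<Rightarrow> int \<Rightarrow> (nat \<Rightarrow> 'a) \<Rightarrow> nat \<Rightarrow> 'a) \<Rightarrow> coord \<Rightarrow> 'k"
  where "of_fam I I' f = (\<lambda>(p, q, i, j, b).
    if i \<in> I p \<and> j \<in> I' q \<and> b < c then co j i b (f p q (sgl i (\<epsilon> i)) j) else 0)"

definition coords :: "(int \<Rightarrow> nat set) \<Rightarrow> (int \<Rightarrow> nat set) \<Rightarrow> coord set"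
  where "coords I I' = {(p, q, i, j, b). i \<in> I p \<and> j \<in> I' q \<and> b < c}"

definition rfam :: "(int \<Rightarrow> nat set) \<Rightarrow> (int \<Rightarrow> nat set) \<Rightarrow> (int \<Rightarrow> int \<Rightarrow> (nat \<Rightarrow> 'a) \<Rightarrow> nat \<Rightarrow> 'a) \<Rightarrow> bool"
  where "rfam I I' f \<longleftrightarrow> (\<forall>p q. f p q \<in> rhom R (std (I p)) (std (I' q)))"

lemma to_fam_rhom: "finite (I p) \<Longrightarrow> to_fam I I' v p q \<in> rhom R (std (I p)) (std (I' q))"
  unfolding to_fam_def by (rule mmap_rhom) (auto simp: lincomb_closed lincomb_left)

lemma to_fam_rfam: "(\<And>p. finite (I p)) \<Longrightarrow> rfam I I' (to_fam I I' v)"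
  by (simp add: rfam_def to_fam_rhom)

lemma of_fam_supported: "of_fam I I' f \<in> supported (coords I I')"
  by (auto simp: of_fam_def coords_def supported_def)

lemma to_of_fam:
  assumes I: "finite (I p)" and f: "f p q \<in> rhom R (std (I p)) (std (I' q))" and x: "x \<in> carrier (std (I p))"
  shows "to_fam I I' (of_fam I I' f) p q x = f p q x"
proof
  fix j
  note t = to_fam_rhom[where I = I and I' = I' and p = p and q = q and v = "of_fam I I' f", OF I]
  show "to_fam I I' (of_fam I I' f) p q x j = f p q x j"
  proof (cases "j \<in> I' q")
    case True
    have "f p q (sgl i (\<epsilon> i)) j = lincomb j i (\<lambda>b. of_fam I I' f (p, q, i, j, b))" if i: "i \<in> I p" for i
    proof -
      have "lincomb j i (\<lambda>b. of_fam I I' f (p, q, i, j, b)) = lincomb j i (\<lambda>b. co j i b (f p q (sgl i (\<epsilon> i)) j))"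
        unfolding lincomb_def
        by (rule finsum_cong') (use True i \<kappa>_closed base_closed in \<open>auto simp: of_fam_def\<close>)
      then show ?thesis using lincomb_co rhom_entry[OF f i] by simp
    qed
    then show ?thesis using True unfolding to_fam_def mmap_def rhom_expand[OF f I x]
      by (auto intro!: finsum_cong' simp: lincomb_closed stdD[OF x])
  next
    case False
    then show ?thesis using stdD(3)[OF rhom_closed[OF f x] False] by (simp add: to_fam_def mmap_def)
  qed
qed

lemma of_to_fam:
  assumes I: "\<And>p. finite (I p)" and v: "v \<in> supported (coords I I')"
  shows "of_fam I I' (to_fam I I' v) = v"
proof
  fix k :: coord
  obtain p q i j b where k: "k = (p, q, i, j, b)" by (cases k) auto
  show "of_fam I I' (to_fam I I' v) k = v k"
  proof (cases "k \<in> coords I I'")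
    case True
    then have h: "i \<in> I p" "j \<in> I' q" "b < c" by (auto simp: coords_def k)
    have "to_fam I I' v p q (sgl i (\<epsilon> i)) j = lincomb j i (\<lambda>b. v (p, q, i, j, b))"
      unfolding to_fam_def by (rule mmap_entry[OF I _ h(1,2)]) (simp add: lincomb_closed lincomb_right)
    with h show ?thesis by (simp add: of_fam_def k co_lincomb)
  next
    case False
    then show ?thesis using v by (auto simp: of_fam_def coords_def supported_def k)
  qed
qed

lemma to_fam_add: 
  assumes I: "finite (I p)" and x: "x \<in> carrier (std (I p))"
  shows "to_fam I I' (u + v) p q x = to_fam I I' u p q x \<oplus>\<^bsub>std (I' q)\<^esub> to_fam I I' v p q x"
proof
  fix j
  have "(\<Oplus>i\<in>I p. lincomb j i (\<lambda>b. (u + v) (p, q, i, j, b)) \<otimes> x i) =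
    (\<Oplus>i\<in>I p. lincomb j i (\<lambda>b. u (p, q, i, j, b)) \<otimes> x i \<oplus> lincomb j i (\<lambda>b. v (p, q, i, j, b)) \<otimes> x i)"
    by (rule finsum_cong') (auto simp: lincomb_add lincomb_closed stdD[OF x] l_distr)
  also have "\<dots> = (\<Oplus>i\<in>I p. lincomb j i (\<lambda>b. u (p, q, i, j, b)) \<otimes> x i) \<oplus> (\<Oplus>i\<in>I p. lincomb j i (\<lambda>b. v (p, q, i, j, b)) \<otimes> x i)"
    by (rule finsum_addf) (auto simp: lincomb_closed stdD[OF x])
  finally show "to_fam I I' (u + v) p q x j = (to_fam I I' u p q x \<oplus>\<^bsub>std (I' q)\<^esub> to_fam I I' v p q x) j"
    by (simp add: to_fam_def mmap_def)
qed

lemma to_fam_scale: 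
  assumes I: "finite (I p)" and x: "x \<in> carrier (std (I p))"
  shows "to_fam I I' (fscale t v) p q x = ract (std (I' q)) (to_fam I I' v p q x) (\<kappa> t)"
proof
  fix j
  have c: "(\<lambda>i. lincomb j i (\<lambda>b. v (p, q, i, j, b)) \<otimes> x i) \<in> I p \<rightarrow> carrier R"
    by (auto simp: lincomb_closed stdD[OF x])
  have "(\<Oplus>i\<in>I p. lincomb j i (\<lambda>b. fscale t v (p, q, i, j, b)) \<otimes> x i) =
    (\<Oplus>i\<in>I p. \<kappa> t \<otimes> (lincomb j i (\<lambda>b. v (p, q, i, j, b)) \<otimes> x i))"
    by (rule finsum_cong') (auto simp: fscale_def lincomb_scale lincomb_closed stdD[OF x] \<kappa>_closed m_assoc)
  also have "\<dots> = \<kappa> t \<otimes> (\<Oplus>i\<in>I p. lincomb j i (\<lambda>b. v (p, q, i, j, b)) \<otimes> x i)"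
    by (rule finsum_rdistr[symmetric, OF I \<kappa>_closed c])
  also have "\<dots> = (\<Oplus>i\<in>I p. lincomb j i (\<lambda>b. v (p, q, i, j, b)) \<otimes> x i) \<otimes> \<kappa> t"
    by (rule \<kappa>_central[OF finsum_closed[OF c]])
  finally show "to_fam I I' (fscale t v) p q x j = ract (std (I' q)) (to_fam I I' v p q x) (\<kappa> t) j"
    by (simp add: to_fam_def mmap_def \<kappa>_closed)
qed

lemma of_fam_cong:
  assumes "\<And>p q x. x \<in> carrier (std (I p)) \<Longrightarrow> f p q x = g p q x"
  shows "of_fam I I' f = of_fam I I' g"
  using assms[OF sgl_eps_mem] by (auto simp: of_fam_def fun_eq_iff)

lemma rfam_entry: "rfam I I' f \<Longrightarrow> i \<in> I p \<Longrightarrow> f p q (sgl i (\<epsilon> i)) j \<in> carrier R"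
  unfolding rfam_def by (metis rhom_entry(1))

lemma of_fam_add:
  assumes "rfam I I' f" "rfam I I' g"
  shows "of_fam I I' (\<lambda>p q x. f p q x \<oplus>\<^bsub>std (I' q)\<^esub> g p q x) = of_fam I I' f + of_fam I I' g"
  by (auto simp: of_fam_def fun_eq_iff co_add rfam_entry[OF assms(1)] rfam_entry[OF assms(2)])

lemma of_fam_scale:
  assumes "rfam I I' f"
  shows "of_fam I I' (\<lambda>p q x. ract (std (I' q)) (f p q x) (\<kappa> t)) = fscale t (of_fam I I' f)"
  by (auto simp: of_fam_def fun_eq_iff fscale_def co_scale rfam_entry[OF assms] simp flip: \<kappa>_central)

lemma to_fam_zero: 
  assumes "finite (I p)" "x \<in> carrier (std (I p))" "\<And>i j b. v (p, q, i, j, b) = 0"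
  shows "to_fam I I' v p q x = \<zero>\<^bsub>std (I' q)\<^esub>"
proof -
  have "lincomb j i (\<lambda>b. 0) = \<zero>" for i j
    using lincomb_scale[of j i 0 "\<lambda>_. 0"] lincomb_closed by (simp add: \<kappa>_0)
  then show ?thesis using assms stdD(1)[OF assms(2)] by (auto simp: to_fam_def mmap_def fun_eq_iff cong: finsum_cong)
qed

subsection \<open>The total Hom complex\<close>

text \<open>The total Hom complex is only used with its degrees taken modulo \<open>2\<close>.\<close>

definition hdif :: "'a cplx \<Rightarrow> 'a cplx \<Rightarrow> (int \<Rightarrow> int \<Rightarrow> (nat \<Rightarrow> 'a) \<Rightarrow> nat \<Rightarrow> 'a) \<Rightarrow> int \<Rightarrow> int \<Rightarrow> (nat \<Rightarrow> 'a) \<Rightarrow> nat \<Rightarrow> 'a"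
  where "hdif X Y f p q x = dif Y (q - 1) (f p (q - 1) x) \<oplus>\<^bsub>obj Y q\<^esub>
    (if even (q - p) then f (p + 1) q (dif X p x) else \<ominus>\<^bsub>obj Y q\<^esub> f (p + 1) q (dif X p x))"

lemma of_fam_eq_0:
  assumes "finite (I p)" "f p q \<in> rhom R (std (I p)) (std (I' q))" "of_fam I I' f = 0" "x \<in> carrier (std (I p))"
  shows "f p q x = \<zero>\<^bsub>std (I' q)\<^esub>"
  using to_of_fam[where f = f and I = I and I' = I', OF assms(1,2,4)]
    to_fam_zero[where v = "of_fam I I' f" and I = I and I' = I', OF assms(1,4), of q] assms(3) by simp


lemma shapedD:
  assumes "shaped X I"
  shows "cx X" "obj X p = std (I p)" "finite (I p)" "finite {p. I p \<noteq> {}}"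
  using assms by (auto simp: shaped_def)

lemma shaped_dif:
  assumes "shaped X I"
  shows "dif X p \<in> rhom R (std (I p)) (std (I (p + 1)))" "dif X (p - 1) \<in> rhom R (std (I (p - 1))) (std (I p))"
  using cx_dif[of X p] cx_dif'[of X p] shapedD[OF assms] by auto

lemma rfam_closed: "rfam I I' f \<Longrightarrow> x \<in> carrier (std (I p)) \<Longrightarrow> f p q x \<in> carrier (std (I' q))"
  unfolding rfam_def by (metis rhom_closed)

lemma rfam_rhom: "rfam I I' f \<Longrightarrow> f p q \<in> rhom R (std (I p)) (std (I' q))"
  by (simp add: rfam_def)

lemma hdif_rfam:
  assumes "shaped X I" "shaped Y I'" "rfam I I' f"
  shows "rfam I I' (hdif X Y f)"
  unfolding rfam_def
proof (intro allI)
  fix p q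
  have 1: "(\<lambda>x. dif Y (q - 1) (f p (q - 1) x)) \<in> rhom R (std (I p)) (std (I' q))"
    by (rule rhom_comp[OF rfam_rhom[OF assms(3)] shaped_dif(2)[OF assms(2)]])
  have 2: "(\<lambda>x. f (p + 1) q (dif X p x)) \<in> rhom R (std (I p)) (std (I' q))"
    by (rule rhom_comp[OF shaped_dif(1)[OF assms(1)] rfam_rhom[OF assms(3)]])
  show "hdif X Y f p q \<in> rhom R (std (I p)) (std (I' q))"
    using rhom_plus[OF rmd_std 1 2] rhom_plus[OF rmd_std 1 rhom_uminus[OF rmd_std 2]]
    unfolding hdif_def[abs_def] shapedD(2)[OF assms(2)] by (cases "even (q - p)") simp_all
qed

lemma hdif_cong:
  assumes "shaped X I" "\<And>p q x. x \<in> carrier (std (I p)) \<Longrightarrow> f p q x = g p q x" "x \<in> carrier (std (I p))"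
  shows "hdif X Y f p q x = hdif X Y g p q x"
  using assms(2)[OF assms(3)] assms(2)[OF rhom_closed[OF shaped_dif(1)[OF assms(1)] assms(3)]]
  by (simp add: hdif_def)

lemma hdif_add:
  assumes "shaped X I" "shaped Y I'" "rfam I I' f" "rfam I I' g" "x \<in> carrier (std (I p))"
  shows "hdif X Y (\<lambda>p q x. f p q x \<oplus>\<^bsub>std (I' q)\<^esub> g p q x) p q x = hdif X Y f p q x \<oplus>\<^bsub>std (I' q)\<^esub> hdif X Y g p q x"
proof -
  have d: "dif X p x \<in> carrier (std (I (p + 1)))" by (rule rhom_closed[OF shaped_dif(1)[OF assms(1)] assms(5)])
  note c = rfam_closed[OF assms(3)] rfam_closed[OF assms(4)] rhom_closed[OF shaped_dif(2)[OF assms(2)]]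
  show ?thesis
    unfolding hdif_def shapedD(2)[OF assms(2)] rhom_add[OF shaped_dif(2)[OF assms(2)] c(1)[OF assms(5)] c(2)[OF assms(5)]]
    using c(1)[OF d] c(2)[OF d] c(3)[OF c(1)[OF assms(5)]] c(3)[OF c(2)[OF assms(5)]]
    by (simp add: m_simps m_ac rmd_std del: std_simps)
qed

lemma hdif_scale:
  assumes "shaped X I" "shaped Y I'" "rfam I I' f" "x \<in> carrier (std (I p))" "a \<in> carrier R"
  shows "hdif X Y (\<lambda>p q x. ract (std (I' q)) (f p q x) a) p q x = ract (std (I' q)) (hdif X Y f p q x) a"
proof -
  have d: "dif X p x \<in> carrier (std (I (p + 1)))" by (rule rhom_closed[OF shaped_dif(1)[OF assms(1)] assms(4)])
  note c = rfam_closed[OF assms(3)] rhom_closed[OF shaped_dif(2)[OF assms(2)]]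
  show ?thesis
    unfolding hdif_def shapedD(2)[OF assms(2)] rhom_act[OF shaped_dif(2)[OF assms(2)] c(1)[OF assms(4)] assms(5)]
    using c(1)[OF d] c(2)[OF c(1)[OF assms(4)]] assms(5)
    by (simp add: m_simps right_module.ract_add_left[OF rmd_std] m_ract_neg rmd_std del: std_simps)
qed

text \<open>The two mixed terms d f d carry opposite signs, because each application changes the
  parity of q - p; the remaining terms contain d d.\<close>

lemma hdif_hdif:
  assumes X: "shaped X I" and Y: "shaped Y I'" and f: "rfam I I' f" and x: "x \<in> carrier (std (I p))"
  shows "hdif X Y (hdif X Y f) p q x = \<zero>\<^bsub>std (I' q)\<^esub>"
proof -
  have d: "dif X p x \<in> carrier (std (I (p + 1)))" by (rule rhom_closed[OF shaped_dif(1)[OF X] x])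
  have dd: "dif X (p + 1) (dif X p x) = \<zero>\<^bsub>std (I (p + 2))\<^esub>"
    using cx_dd[OF shapedD(1)[OF X]] x by (simp add: shapedD(2)[OF X])
  note c = rfam_closed[OF f] note D = rhom_closed[OF shaped_dif(2)[OF Y]]
  have e: "q - 1 - 1 = q - 2" "p + 1 + 1 = p + 2" by simp_all
  have c1: "f p (q - 2) x \<in> carrier (std (I' (q - 1 - 1)))" using c[OF x, of "q - 2"] by simp
  have c2: "f (p + 1) (q - 1) (dif X p x) \<in> carrier (std (I' (q - 1)))" by (rule c[OF d])
  have c3: "dif Y (q - 1 - 1) (f p (q - 2) x) \<in> carrier (std (I' (q - 1)))" by (rule D[OF c1])
  have dy: "dif Y (q - 1) (dif Y (q - 1 - 1) (f p (q - 2) x)) = \<zero>\<^bsub>std (I' q)\<^esub>"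
    using cx_dd'[OF shapedD(1)[OF Y], of "f p (q - 2) x" "q - 1"] c1 by (simp add: shapedD(2)[OF Y] e)
  have f0: "f (p + 2) q \<zero>\<^bsub>std (I (p + 2))\<^esub> = \<zero>\<^bsub>std (I' q)\<^esub>" by (rule rhom_0[OF rmd_std rmd_std rfam_rhom[OF f]])
  have c4: "dif Y (q - 1) (f (p + 1) (q - 1) (dif X p x)) \<in> carrier (std (I' q))" by (rule D[OF c2])
  have *: "hdif X Y f (p + 1) q (dif X p x) = dif Y (q - 1) (f (p + 1) (q - 1) (dif X p x))"
    unfolding hdif_def shapedD(2)[OF Y] dd e f0 using c4 by (simp add: m_simps rmd_std del: std_simps)
  have **: "dif Y (q - 1) (hdif X Y f p (q - 1) x) =
    (if even (q - p) then \<ominus>\<^bsub>std (I' q)\<^esub> dif Y (q - 1) (f (p + 1) (q - 1) (dif X p x))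
      else dif Y (q - 1) (f (p + 1) (q - 1) (dif X p x)))"
  proof -
    have "hdif X Y f p (q - 1) x = dif Y (q - 1 - 1) (f p (q - 2) x) \<oplus>\<^bsub>std (I' (q - 1))\<^esub>
      (if even (q - p) then \<ominus>\<^bsub>std (I' (q - 1))\<^esub> f (p + 1) (q - 1) (dif X p x) else f (p + 1) (q - 1) (dif X p x))"
      unfolding hdif_def shapedD(2)[OF Y] e by simp
    then show ?thesis
      using rhom_add[OF shaped_dif(2)[OF Y] c3 c2] rhom_add[OF shaped_dif(2)[OF Y] c3 m_neg_closed[OF rmd_std c2]]
        rhom_neg[OF rmd_std rmd_std shaped_dif(2)[OF Y] c2] dy c4
      by (simp add: m_simps rmd_std del: std_simps)
  qed
  show ?thesis
    unfolding hdif_def[of X Y "hdif X Y f"] shapedD(2)[OF Y] * **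
    using c4 by (simp add: m_simps rmd_std del: std_simps)
qed

text \<open>The differential \<open>hdif\<close> in coordinates: an endomorphism of one function
  space, to which the linear algebra applies.\<close>

definition coord_dif :: "'a cplx \<Rightarrow> 'a cplx \<Rightarrow> (int \<Rightarrow> nat set) \<Rightarrow> (int \<Rightarrow> nat set) \<Rightarrow> (coord \<Rightarrow> 'k) \<Rightarrow> coord \<Rightarrow> 'k"
  where "coord_dif X Y I I' v = of_fam I I' (hdif X Y (to_fam I I' v))"

lemma coord_dif_linear:
  assumes X: "shaped X I" and Y: "shaped Y I'"
  shows "flinear (coord_dif X Y I I')"
  unfolding flinear_def
proof (intro conjI allI)
  note fin = shapedD(3)[OF X]
  note t = to_fam_rfam[of I I', OF fin]
  fix u v
  have "coord_dif X Y I I' (u + v) = of_fam I I' (hdif X Y (\<lambda>p q x. to_fam I I' u p q x \<oplus>\<^bsub>std (I' q)\<^esub> to_fam I I' v p q x))"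
    unfolding coord_dif_def by (rule of_fam_cong, rule hdif_cong[OF X]) (auto simp: to_fam_add[OF fin] simp del: std_simps)
  also have "\<dots> = of_fam I I' (\<lambda>p q x. hdif X Y (to_fam I I' u) p q x \<oplus>\<^bsub>std (I' q)\<^esub> hdif X Y (to_fam I I' v) p q x)"
    by (rule of_fam_cong) (rule hdif_add[OF X Y t t])
  also have "\<dots> = coord_dif X Y I I' u + coord_dif X Y I I' v"
    unfolding coord_dif_def by (rule of_fam_add[OF hdif_rfam[OF X Y t] hdif_rfam[OF X Y t]])
  finally show "coord_dif X Y I I' (u + v) = coord_dif X Y I I' u + coord_dif X Y I I' v" .
  fix s
  have "coord_dif X Y I I' (fscale s v) = of_fam I I' (hdif X Y (\<lambda>p q x. ract (std (I' q)) (to_fam I I' v p q x) (\<kappa> s)))"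
    unfolding coord_dif_def by (rule of_fam_cong, rule hdif_cong[OF X]) (auto simp: to_fam_scale[OF fin] simp del: std_simps)
  also have "\<dots> = of_fam I I' (\<lambda>p q x. ract (std (I' q)) (hdif X Y (to_fam I I' v) p q x) (\<kappa> s))"
    by (rule of_fam_cong) (rule hdif_scale[OF X Y t _ \<kappa>_closed])
  also have "\<dots> = fscale s (coord_dif X Y I I' v)"
    unfolding coord_dif_def by (rule of_fam_scale[OF hdif_rfam[OF X Y t]])
  finally show "coord_dif X Y I I' (fscale s v) = fscale s (coord_dif X Y I I' v)" .
qed

lemma coord_dif_of_fam:
  assumes X: "shaped X I" and f: "rfam I I' f"
  shows "coord_dif X Y I I' (of_fam I I' f) = of_fam I I' (hdif X Y f)"
  unfolding coord_dif_def
  by (rule of_fam_cong, rule hdif_cong[OF X])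
    (auto intro: to_of_fam[OF shapedD(3)[OF X] rfam_rhom[OF f]])

end

section \<open>Dimension count in the folded Hom complex\<close>

context cartan_alg
begin

definition parity_coords :: "(int \<Rightarrow> nat set) \<Rightarrow> (int \<Rightarrow> nat set) \<Rightarrow> bool \<Rightarrow> coord set"
  where "parity_coords I I' e = {(p, q, i, j, b). i \<in> I p \<and> j \<in> I' q \<and> b < c \<and> (even (q - p) = e)}"

text \<open>The number s(X) of the overview, read off from the index sets of a standard
  model.\<close>

definition euler :: "(int \<Rightarrow> nat set) \<Rightarrow> int"
  where "euler I = (\<Sum>p | I p \<noteq> {}. (if even p then 1 else - 1) * int (card (I p)))"

lemma coords_Sigma:
  "coords I I' = Sigma {p. I p \<noteq> {}} (\<lambda>p. Sigma {q. I' q \<noteq> {}} (\<lambda>q. I p \<times> I' q \<times> {..<c}))"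
  by (auto simp: coords_def)

lemma finite_coords: "shaped X I \<Longrightarrow> shaped Y I' \<Longrightarrow> finite (coords I I')"
  unfolding coords_Sigma by (auto simp: shaped_def)

lemma parity_coords_split:
  "coords I I' = parity_coords I I' True \<union> parity_coords I I' False"
  "parity_coords I I' True \<inter> parity_coords I I' False = {}"
  by (auto simp: coords_def parity_coords_def)

lemma finite_parity_coords: "shaped X I \<Longrightarrow> shaped Y I' \<Longrightarrow> finite (parity_coords I I' e)"
  using finite_coords[of X I Y I'] parity_coords_split(1)[of I I'] by (cases e) auto

text \<open>Both sides are the sum of the signs (-1)^(p+q) over all coordinates. It factors because
  each pair of indices i, j carries the same number c of basis elements; this is where the equality
  of all Cartan entries enters.\<close>

lemma card_parity_coords:
  assumes X: "shaped X I" and Y: "shaped Y I'"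
  shows "int (card (parity_coords I I' True)) - int (card (parity_coords I I' False)) = int c * euler I * euler I'"
proof -
  let ?sg = "\<lambda>p::int. if even p then 1 else - 1 :: int"
  let ?s = "\<lambda>(p, q, r :: nat \<times> nat \<times> nat). ?sg p * ?sg q"
  have "(\<Sum>k\<in>coords I I'. ?s k) = (\<Sum>k\<in>parity_coords I I' True. ?s k) + (\<Sum>k\<in>parity_coords I I' False. ?s k)"
    unfolding parity_coords_split(1)[of I I']
    by (rule sum.union_disjoint) (use finite_parity_coords[OF X Y] parity_coords_split(2) in auto)
  also have "(\<Sum>k\<in>parity_coords I I' True. ?s k) = (\<Sum>k\<in>parity_coords I I' True. 1)"
    by (rule sum.cong) (auto simp: parity_coords_def)
  also have "(\<Sum>k\<in>parity_coords I I' False. ?s k) = (\<Sum>k\<in>parity_coords I I' False. - 1)"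
    by (rule sum.cong) (auto simp: parity_coords_def)
  finally have 1: "(\<Sum>k\<in>coords I I'. ?s k) = int (card (parity_coords I I' True)) - int (card (parity_coords I I' False))"
    by simp
  have fin: "finite {p. I p \<noteq> {}}" "finite {q. I' q \<noteq> {}}" "\<And>p. finite (I p)" "\<And>q. finite (I' q)"
    using X Y by (auto simp: shaped_def)
  have "(\<Sum>k\<in>coords I I'. ?s k) = (\<Sum>p | I p \<noteq> {}. \<Sum>q | I' q \<noteq> {}. \<Sum>k\<in>I p \<times> I' q \<times> {..<c}. ?sg p * ?sg q)"
    unfolding coords_Sigma
    by (subst sum.Sigma[symmetric], use fin in auto)
      (intro sum.cong refl, subst sum.Sigma[symmetric], use fin in \<open>auto intro: finite_SigmaI sum.cong simp: case_prod_beta\<close>)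
  also have "\<dots> = (\<Sum>p | I p \<noteq> {}. \<Sum>q | I' q \<noteq> {}. int c * ((?sg p * int (card (I p))) * (?sg q * int (card (I' q)))))"
    by (intro sum.cong refl) (simp add: card_cartesian_product)
  also have "\<dots> = int c * (euler I * euler I')"
    unfolding euler_def sum_product by (simp only: sum_distrib_left)
  finally show ?thesis using 1 by (simp add: mult.assoc)
qed

lemma of_fam_parity:
  assumes "\<And>p q x. x \<in> carrier (std (I p)) \<Longrightarrow> even (q - p) \<noteq> e \<Longrightarrow> f p q x = \<zero>\<^bsub>std (I' q)\<^esub>"
  shows "of_fam I I' f \<in> supported (parity_coords I I' e)"
  using assms[OF sgl_eps_mem] by (auto simp: supported_def parity_coords_def of_fam_def co_0)

lemma to_fam_parity:
  assumes "v \<in> supported (parity_coords I I' e)" "finite (I p)" "x \<in> carrier (std (I p))" "even (q - p) \<noteq> e"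
  shows "to_fam I I' v p q x = \<zero>\<^bsub>std (I' q)\<^esub>"
  by (rule to_fam_zero[where I = I and p = p, OF assms(2,3)]) (use assms in \<open>auto simp: supported_def parity_coords_def\<close>)

lemma hdif_parity:
  assumes X: "shaped X I" and Y: "shaped Y I'"
    and f: "\<And>p q x. x \<in> carrier (std (I p)) \<Longrightarrow> even (q - p) \<noteq> e \<Longrightarrow> f p q x = \<zero>\<^bsub>std (I' q)\<^esub>"
    and x: "x \<in> carrier (std (I p))" and e: "even (q - p) = e"
  shows "hdif X Y f p q x = \<zero>\<^bsub>std (I' q)\<^esub>"
proof -
  have d: "dif X p x \<in> carrier (std (I (p + 1)))" by (rule rhom_closed[OF shaped_dif(1)[OF X] x])
  have 1: "f p (q - 1) x = \<zero>\<^bsub>std (I' (q - 1))\<^esub>" by (rule f[OF x]) (use e in \<open>cases e; simp\<close>)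
  have 2: "f (p + 1) q (dif X p x) = \<zero>\<^bsub>std (I' q)\<^esub>" by (rule f[OF d]) (use e in \<open>cases e; simp\<close>)
  show ?thesis
    unfolding hdif_def 1 2 shapedD(2)[OF Y] rhom_0[OF rmd_std rmd_std shaped_dif(2)[OF Y]]
    using m_minus_zero[OF rmd_std, of "I' q"] m_l_zero[OF rmd_std m_zero[OF rmd_std], of "I' q"] by simp
qed

lemma coord_dif_parity:
  assumes X: "shaped X I" and Y: "shaped Y I'" and v: "v \<in> supported (parity_coords I I' e)"
  shows "coord_dif X Y I I' v \<in> supported (parity_coords I I' (\<not> e))"
  unfolding coord_dif_def
  by (rule of_fam_parity, rule hdif_parity[OF X Y to_fam_parity[OF v shapedD(3)[OF X]]]) auto

lemma coord_dif_sq: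
  assumes X: "shaped X I" and Y: "shaped Y I'"
  shows "coord_dif X Y I I' (coord_dif X Y I I' v) = 0"
proof -
  note t = to_fam_rfam[of I I' v, OF shapedD(3)[OF X]]
  have "coord_dif X Y I I' (coord_dif X Y I I' v) = of_fam I I' (hdif X Y (hdif X Y (to_fam I I' v)))"
    unfolding coord_dif_def[of X Y I I' v] by (rule coord_dif_of_fam[OF X hdif_rfam[OF X Y t]])
  also have "\<dots> = of_fam I I' (\<lambda>p q x. \<zero>\<^bsub>std (I' q)\<^esub>)"
    by (rule of_fam_cong) (rule hdif_hdif[OF X Y t])
  also have "\<dots> = 0" by (auto simp: of_fam_def fun_eq_iff co_0)
  finally show ?thesis .
qed

lemma parity_supported_coords: "v \<in> supported (parity_coords I I' e) \<Longrightarrow> v \<in> supported (coords I I')"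
  by (auto simp: supported_def parity_coords_def coords_def)

lemma to_of_rfam:
  "(\<And>p. finite (I p)) \<Longrightarrow> rfam I I' f \<Longrightarrow> x \<in> carrier (std (I p)) \<Longrightarrow> to_fam I I' (of_fam I I' f) p q x = f p q x"
  by (rule to_of_fam) (auto simp: rfam_def)

text \<open>An odd cocycle splits by degree into chain maps from X to Y[m] with m odd, in particular
  m \<noteq> 0. Orthogonality provides null-homotopies, which are reassembled into an even
  cochain.\<close>

lemma coord_dif_exact:
  assumes X: "shaped X I" and Y: "shaped Y I'" and o: "orth X Y"
    and v: "v \<in> supported (parity_coords I I' False)" and dv: "coord_dif X Y I I' v = 0"
  shows "v \<in> coord_dif X Y I I' ` supported (parity_coords I I' True)"
proof -
  note finI = shapedD(3)[OF X] and oX = shapedD(2)[OF X] and oY = shapedD(2)[OF Y]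
  note cX = shapedD(1)[OF X] and cY = shapedD(1)[OF Y]
  define f where "f = to_fam I I' v"
  have f: "rfam I I' f" unfolding f_def by (rule to_fam_rfam[OF finI])
  have hf: "hdif X Y f p q x = \<zero>\<^bsub>std (I' q)\<^esub>" if "x \<in> carrier (std (I p))" for p q x
  proof -
    have "of_fam I I' (hdif X Y f) = 0" using dv by (simp add: coord_dif_def f_def)
    from of_fam_eq_0[where I = I and p = p and q = q and f = "hdif X Y f" and I' = I',
        OF finI rfam_rhom[OF hdif_rfam[OF X Y f]] this that] show ?thesis .
  qed
  \<comment> \<open>In the even degree m + 1 the vanishing of \<open>hdif\<close> reads d f + f d =
    0, which is compatibility with the differential -d of an odd shift.\<close>
  have cm: "(\<lambda>p. f p (p + m)) \<in> chain_maps R X (shift m Y)" if m: "odd m" for m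
  proof (rule cmI)
    show "f p (p + m) \<in> rhom R (obj X p) (obj (shift m Y) p)" for p
      using rfam_rhom[OF f] by (simp add: oX oY)
    fix p x assume "x \<in> carrier (obj X p)"
    then have x: "x \<in> carrier (std (I p))" by (simp add: oX)
    have dx: "dif X p x \<in> carrier (std (I (p + 1)))" by (rule rhom_closed[OF shaped_dif(1)[OF X] x])
    have e: "p + m + 1 - 1 = p + m" "even (p + m + 1 - p)" using m by auto
    have c: "dif Y (p + m) (f p (p + m) x) \<in> carrier (std (I' (p + m + 1)))"
      by (rule rhom_closed[OF shaped_dif(1)[OF Y] rfam_closed[OF f x]])
    have h: "dif Y (p + m) (f p (p + m) x) \<oplus>\<^bsub>std (I' (p + m + 1))\<^esub> f (p + 1) (p + m + 1) (dif X p x) = \<zero>\<^bsub>std (I' (p + m + 1))\<^esub>"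
      using hf[OF x, of "p + m + 1"] e unfolding hdif_def oY by simp
    have "f (p + 1) (p + m + 1) (dif X p x) = \<ominus>\<^bsub>std (I' (p + m + 1))\<^esub> dif Y (p + m) (f p (p + m) x)"
      by (rule m_eq_minus[OF rmd_std rfam_closed[OF f dx] c],
          subst m_comm'[OF rmd_std rfam_closed[OF f dx] c], rule h)
    then show "f (p + 1) (p + 1 + m) (dif X p x) = dif (shift m Y) p (f p (p + m) x)"
      using m by (simp add: oY add.assoc add.commute[of 1])
  qed
  have "\<exists>s. is_htpy X (shift m Y) s \<and> (\<forall>p. \<forall>x\<in>carrier (std (I p)).
    f p (p + m) x = htpy_map X (shift m Y) s p x)" if m: "odd m" for m
  proof -
    have "m \<noteq> 0" using m by auto
    then have "htp X (shift m Y) (\<lambda>p. f p (p + m)) (czero (shift m Y))"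
      using o[unfolded orth_def, rule_format, OF _ cm[OF m]] by simp
    then obtain s where s: "is_htpy X (shift m Y) s" "\<And>p x. x \<in> carrier (obj X p) \<Longrightarrow>
      f p (p + m) x = czero (shift m Y) p x \<oplus>\<^bsub>obj (shift m Y) p\<^esub> htpy_map X (shift m Y) s p x"
      unfolding htp_def by blast
    have "f p (p + m) x = htpy_map X (shift m Y) s p x" if "x \<in> carrier (std (I p))" for p x
      using s(2)[of x p] that htpy_map_closed[OF cX cx_shift[OF cY] s(1), of x p]
      unfolding czero_def by (simp add: oX oY m_l_zero[OF rmd_std] del: std_simps)
    with s(1) show ?thesis by blast
  qed
  then obtain s where s: "\<And>m. odd m \<Longrightarrow> is_htpy X (shift m Y) (s m)"
    "\<And>m p x. odd m \<Longrightarrow> x \<in> carrier (std (I p)) \<Longrightarrow> f p (p + m) x = htpy_map X (shift m Y) (s m) p x"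
    by metis
  have sh: "s (q - p + 1) p \<in> rhom R (std (I p)) (std (I' q))" if "even (q - p)" for p q
  proof -
    have "odd (q - p + 1)" using that by simp
    from s(1)[OF this] have "s (q - p + 1) p \<in> rhom R (obj X p) (obj (shift (q - p + 1) Y) (p - 1))"
      unfolding is_htpy_def by blast
    then show ?thesis by (simp add: oX oY)
  qed
  \<comment> \<open>A homotopy into an odd shift contributes - d s + s d, while \<open>hdif\<close>
    in odd degrees is d u - u d; hence u = - s. The index q - p + 1 appears because s lowers the
    degree by one.\<close>
  define u where "u p q x = (if even (q - p) then \<ominus>\<^bsub>std (I' q)\<^esub> s (q - p + 1) p x else \<zero>\<^bsub>std (I' q)\<^esub>)" for p q x
  have u: "rfam I I' u"
    unfolding rfam_def u_def[abs_def]
  proof (intro allI)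
    fix p q show "(\<lambda>x. if even (q - p) then \<ominus>\<^bsub>std (I' q)\<^esub> s (q - p + 1) p x else \<zero>\<^bsub>std (I' q)\<^esub>) \<in> rhom R (std (I p)) (std (I' q))"
      using rhom_uminus[OF rmd_std sh] rhom_zero[OF rmd_std] by (cases "even (q - p)") simp_all
  qed
  have fu: "f p q x = hdif X Y u p q x" if x: "x \<in> carrier (std (I p))" for p q x
  proof (cases "even (q - p)")
    case True
    have "f p q x = \<zero>\<^bsub>std (I' q)\<^esub>" unfolding f_def by (rule to_fam_parity[OF v finI x]) (use True in simp)
    moreover have "hdif X Y u p q x = \<zero>\<^bsub>std (I' q)\<^esub>"
      by (rule hdif_parity[OF X Y, where e = True]) (use True x in \<open>auto simp: u_def\<close>)
    ultimately show ?thesis by simp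
  next
    case False
    define m where "m = q - p"
    have m: "odd m" "q = p + m" using False by (auto simp: m_def)
    have dx: "dif X p x \<in> carrier (std (I (p + 1)))" by (rule rhom_closed[OF shaped_dif(1)[OF X] x])
    have s1: "s m p x \<in> carrier (std (I' (q - 1)))" 
      using rhom_closed[OF sh[of "q - 1" p] x] False by (simp add: m_def)
    have s2: "s m (p + 1) (dif X p x) \<in> carrier (std (I' q))"
      using rhom_closed[OF sh[of q "p + 1"] dx] False by (simp add: m_def)
    have u1: "u p (q - 1) x = \<ominus>\<^bsub>std (I' (q - 1))\<^esub> s m p x" using False by (simp add: u_def m_def)
    have u2: "u (p + 1) q (dif X p x) = \<ominus>\<^bsub>std (I' q)\<^esub> s m (p + 1) (dif X p x)" using False by (simp add: u_def m_def)
    have "hdif X Y u p q x = \<ominus>\<^bsub>std (I' q)\<^esub> dif Y (q - 1) (s m p x) \<oplus>\<^bsub>std (I' q)\<^esub> s m (p + 1) (dif X p x)"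
      unfolding hdif_def u1 u2 oY rhom_neg[OF rmd_std rmd_std shaped_dif(2)[OF Y] s1]
      using False s2 by (simp add: m_minus_minus[OF rmd_std])
    moreover have "htpy_map X (shift m Y) (s m) p x =
      \<ominus>\<^bsub>std (I' q)\<^esub> dif Y (q - 1) (s m p x) \<oplus>\<^bsub>std (I' q)\<^esub> s m (p + 1) (dif X p x)"
      unfolding htpy_map_def using m by (simp add: oY algebra_simps)
    ultimately show ?thesis using s(2)[OF m(1) x] m(2) by simp
  qed
  have "of_fam I I' u \<in> supported (parity_coords I I' True)"
    by (rule of_fam_parity) (auto simp: u_def)
  moreover have "v = coord_dif X Y I I' (of_fam I I' u)"
  proof -
    have "v = of_fam I I' f" unfolding f_def using of_to_fam[OF finI parity_supported_coords[OF v]] by simp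
    also have "\<dots> = of_fam I I' (hdif X Y u)" by (rule of_fam_cong) (rule fu)
    finally show ?thesis using coord_dif_of_fam[OF X u] by simp
  qed
  ultimately show ?thesis by blast
qed

text \<open>Exactness at the odd term turns c s(X) s(Y) into the dimension of the even cohomology.
  If the product is zero, every even cocycle is a coboundary, in particular the chain map f placed
  on the diagonal.\<close>

theorem euler_form:
  assumes X: "shaped X I" and Y: "shaped Y I'" and o: "orth X Y"
  shows "0 \<le> euler I * euler I'"
    and "euler I * euler I' = 0 \<Longrightarrow> f \<in> chain_maps R X Y \<Longrightarrow> htp X Y f (czero Y)"
proof -
  let ?S = "parity_coords I I'"
  note fin = finite_parity_coords[OF X Y]
  note oX = shapedD(2)[OF X] and oY = shapedD(2)[OF Y] and finI = shapedD(3)[OF X]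
  have cl: "coord_dif X Y I I' ` supported (?S True) \<subseteq> supported (?S False)"
    "coord_dif X Y I I' ` supported (?S False) \<subseteq> supported (?S True)"
    using coord_dif_parity[OF X Y, of _ True] coord_dif_parity[OF X Y, of _ False] by auto
  note T = exactness_transfer[OF fin fin coord_dif_linear[OF X Y] cl coord_dif_sq[OF X Y] coord_dif_sq[OF X Y]]
  have T1: "card (?S False) \<le> card (?S True)"
    by (rule T(1)) (rule coord_dif_exact[OF X Y o])
  note C = card_parity_coords[OF X Y]
  have "0 \<le> int c * (euler I * euler I')" using T1 C by (simp add: mult.assoc)
  then show "0 \<le> euler I * euler I'" using c_pos by (simp add: zero_le_mult_iff)
  assume z: "euler I * euler I' = 0" and f: "f \<in> chain_maps R X Y"
  have eq: "card (?S True) = card (?S False)" using C unfolding mult.assoc z by simp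
  define F where "F p q x = (if q = p then f p x else \<zero>\<^bsub>std (I' q)\<^esub>)" for p q x
  have F: "rfam I I' F"
    unfolding rfam_def
  proof (intro allI)
    fix p q show "F p q \<in> rhom R (std (I p)) (std (I' q))"
      using cm_rhom[OF f, of p] rhom_zero[OF rmd_std[of "I' q"]]
      unfolding F_def[abs_def] by (cases "q = p") (simp_all add: oX oY)
  qed
  have dF: "hdif X Y F p q x = \<zero>\<^bsub>std (I' q)\<^esub>" if x: "x \<in> carrier (std (I p))" for p q x
  proof -
    have d: "dif X p x \<in> carrier (std (I (p + 1)))" by (rule rhom_closed[OF shaped_dif(1)[OF X] x])
    show ?thesis
    proof (cases "q = p + 1")
      case True
      have "dif Y p (f p x) \<in> carrier (std (I' (p + 1)))"
        by (rule rhom_closed[OF shaped_dif(1)[OF Y]]) (use cm_closed[OF f, of x p] x in \<open>simp add: oX oY\<close>)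
      then show ?thesis unfolding True hdif_def oY
        using cm_dif[OF f, of x p] x by (simp add: F_def oX m_r_neg[OF rmd_std] del: std_simps)
    next
      case False
      then have "F p (q - 1) x = \<zero>\<^bsub>std (I' (q - 1))\<^esub>" "F (p + 1) q (dif X p x) = \<zero>\<^bsub>std (I' q)\<^esub>"
        by (auto simp: F_def)
      then show ?thesis unfolding hdif_def oY using rhom_0[OF rmd_std rmd_std shaped_dif(2)[OF Y]]
        by (simp add: m_simps rmd_std del: std_simps)
    qed
  qed
  have "of_fam I I' F \<in> supported (?S True)" by (rule of_fam_parity) (auto simp: F_def)
  moreover have "coord_dif X Y I I' (of_fam I I' F) = 0"
  proof -
    have "of_fam I I' (hdif X Y F) = of_fam I I' (\<lambda>p q x. \<zero>\<^bsub>std (I' q)\<^esub>)" by (rule of_fam_cong) (rule dF)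
    also have "\<dots> = 0" by (auto simp: of_fam_def fun_eq_iff co_0)
    finally show ?thesis using coord_dif_of_fam[OF X F] by simp
  qed
  ultimately have "of_fam I I' F \<in> coord_dif X Y I I' ` supported (?S False)"
    by (intro T(2)[OF _ eq]) (auto intro: coord_dif_exact[OF X Y o])
  then obtain u where u: "u \<in> supported (?S False)" "of_fam I I' F = coord_dif X Y I I' u" by blast
  let ?u = "to_fam I I' u"
  note ur = to_fam_rfam[of I I' u, OF finI]
  have Fu: "F p q x = hdif X Y ?u p q x" if "x \<in> carrier (std (I p))" for p q x
    using to_of_rfam[OF finI F that] to_of_rfam[OF finI hdif_rfam[OF X Y ur] that] u(2)
    unfolding coord_dif_def by metis
  show "htp X Y f (czero Y)"
  proof (rule htpI)
    \<comment> \<open>On the diagonal q = p the coboundary of u is the homotopy formula for the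
      components of u of degree -1.\<close>
    show "is_htpy X Y (\<lambda>p. ?u p (p - 1))"
      unfolding is_htpy_def using rfam_rhom[OF ur] by (simp add: oX oY)
    fix p x assume "x \<in> carrier (obj X p)"
    then have x: "x \<in> carrier (std (I p))" by (simp add: oX)
    have "f p x = hdif X Y ?u p p x" using Fu[OF x, of p] by (simp add: F_def)
    also have "\<dots> = htpy_map X Y (\<lambda>p. ?u p (p - 1)) p x" by (simp add: hdif_def htpy_map_def)
    finally show "f p x = czero Y p x \<oplus>\<^bsub>obj Y p\<^esub> htpy_map X Y (\<lambda>p. ?u p (p - 1)) p x"
      using cm_closed[OF f, of x p] x by (simp add: czero_def oX oY m_l_zero[OF rmd_std] del: std_simps)
  qed
qed

end

section \<open>A Fitting lemma for indecomposable complexes\<close>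

context base_ring
begin

definition cpow :: "'a cmap \<Rightarrow> nat \<Rightarrow> 'a cmap"
  where "cpow f k = (\<lambda>p. f p ^^ k)"

lemma cpow_simps [simp]: "cpow f 0 = cid" "cpow f (Suc k) p x = f p (cpow f k p x)"
  by (simp_all add: cpow_def cid_def fun_eq_iff)

lemma cpow_Suc: "cpow f (Suc k) = f \<bullet> cpow f k"
  by (simp add: ccomp_def fun_eq_iff)

lemma cpow_swap: "cpow f k p (f p x) = f p (cpow f k p x)"
  by (simp add: cpow_def funpow_swap1)

lemma cpow_add: "cpow f (k + l) p x = cpow f k p (cpow f l p x)"
  by (simp add: cpow_def funpow_add)

lemma cm_cpow: "f \<in> chain_maps R X X \<Longrightarrow> cpow f k \<in> chain_maps R X X"
proof (induction k)
  case (Suc k)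
  then show ?case unfolding cpow_Suc by (intro cm_comp)
qed (simp add: cm_id)

definition sub_cplx :: "'a cplx \<Rightarrow> 'a cmap \<Rightarrow> 'a cplx"
  where "sub_cplx X e = \<lparr>obj = (\<lambda>p. (obj X p)\<lparr>carrier := e p ` carrier (obj X p)\<rparr>), dif = dif X\<rparr>"

lemma sub_cplx_simps [simp]:
  "obj (sub_cplx X e) p = (obj X p)\<lparr>carrier := e p ` carrier (obj X p)\<rparr>" "dif (sub_cplx X e) = dif X"
  by (simp_all add: sub_cplx_def)

text \<open>Idempotent on the nose and not only up to homotopy, so that its images are direct
  summands of the terms and hence projective.\<close>

definition idem :: "'a cplx \<Rightarrow> 'a cmap \<Rightarrow> bool"
  where "idem X e \<longleftrightarrow> e \<in> chain_maps R X X \<and> (\<forall>p. \<forall>x \<in> carrier (obj X p). e p (e p x) = e p x)"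

lemma image_idem:
  assumes X: "X \<in> Kb_proj R" and ie: "idem X e"
  shows "sub_cplx X e \<in> Kb_proj R" "e \<in> chain_maps R X (sub_cplx X e)" "cid \<in> chain_maps R (sub_cplx X e) X"
proof -
  have e: "e \<in> chain_maps R X X" and ee: "\<And>p x. x \<in> carrier (obj X p) \<Longrightarrow> e p (e p x) = e p x"
    using ie by (auto simp: idem_def)
  note cX = Kb_cx[OF X]
  let ?S = "\<lambda>p. e p ` carrier (obj X p)"
  have S: "?S p \<subseteq> carrier (obj X p)" for p using cm_closed[OF e] by auto
  have rS: "rmd (obj (sub_cplx X e) p)" for p
    unfolding sub_cplx_simps
  proof (rule rmd_sub[OF cx_rmd[OF cX] S])
    show "\<zero>\<^bsub>obj X p\<^esub> \<in> ?S p"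
      using rhom_0[OF cx_rmd[OF cX] cx_rmd[OF cX] cm_rhom[OF e]] m_zero[OF cx_rmd[OF cX]] by (metis imageI)
    show "x \<oplus>\<^bsub>obj X p\<^esub> y \<in> ?S p" if xy: "x \<in> ?S p" "y \<in> ?S p" for x y
    proof -
      from xy obtain u v where "x = e p u" "u \<in> carrier (obj X p)" "y = e p v" "v \<in> carrier (obj X p)" by auto
      then show ?thesis
        using rhom_add[OF cm_rhom[OF e], of u p v] m_closed'[OF cx_rmd[OF cX], of u p v]
        by (intro image_eqI[of _ _ "u \<oplus>\<^bsub>obj X p\<^esub> v"]) simp_all
    qed
    show "ract (obj X p) x a \<in> ?S p" if x: "x \<in> ?S p" and a: "a \<in> carrier R" for x a
    proof -
      from x obtain u where "x = e p u" "u \<in> carrier (obj X p)" by auto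
      then show ?thesis
        using rhom_act[OF cm_rhom[OF e], of u p a] m_ract[OF cx_rmd[OF cX], of u p a] a
        by (intro image_eqI[of _ _ "ract (obj X p) u a"]) simp_all
    qed
  qed
  have eS: "e p \<in> rhom R (obj X p) (obj (sub_cplx X e) p)" for p
    unfolding sub_cplx_simps by (rule rhom_sub_cod[OF cm_rhom[OF e]]) auto
  have iS: "(\<lambda>x. x) \<in> rhom R (obj (sub_cplx X e) p) (obj X p)" for p
    unfolding sub_cplx_simps by (rule rhom_sub_dom[OF rhom_id S])
  have eid: "e p x = x" if "x \<in> ?S p" for p x using that ee by auto
  have dS: "dif X p \<in> rhom R (obj (sub_cplx X e) p) (obj (sub_cplx X e) (p + 1))" for p
    unfolding sub_cplx_simps
  proof (rule rhom_sub_cod[OF rhom_sub_dom[OF cx_dif[OF cX] S]])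
    fix x assume "x \<in> carrier ((obj X p)\<lparr>carrier := ?S p\<rparr>)"
    then have x: "x \<in> ?S p" by simp
    have xc: "x \<in> carrier (obj X p)" using x S by blast
    have "dif X p x = e (p + 1) (dif X p x)" using cm_dif[OF e xc] eid[OF x] by simp
    then show "dif X p x \<in> ?S (p + 1)" using rhom_closed[OF cx_dif[OF cX] xc] by (rule image_eqI)
  qed
  have fg: "fg_projective R (obj (sub_cplx X e) p)" for p
  proof -
    have "fg_projective R (obj X p)" using X by (simp add: Kb_proj_def)
    then obtain m s r where sr: "s \<in> rhom R (obj X p) (free_rmod R m)" "r \<in> rhom R (free_rmod R m) (obj X p)"
      "\<And>x. x \<in> carrier (obj X p) \<Longrightarrow> r (s x) = x" unfolding fg_projective_def by blast
    show ?thesis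
      unfolding fg_projective_def
    proof (intro conjI rS exI bexI ballI)
      show "s \<in> rhom R (obj (sub_cplx X e) p) (free_rmod R m)" using rhom_comp[OF iS sr(1)] .
      show "(\<lambda>x. e p (r x)) \<in> rhom R (free_rmod R m) (obj (sub_cplx X e) p)" by (rule rhom_comp[OF sr(2) eS])
      show "e p (r (s x)) = x" if "x \<in> carrier (obj (sub_cplx X e) p)" for x
      proof -
        have x: "x \<in> ?S p" using that by simp
        then have "x \<in> carrier (obj X p)" using S by blast
        then show ?thesis using sr(3) eid[OF x] by simp
      qed
    qed
  qed
  obtain a b where ab: "\<And>p. p < a \<or> b < p \<Longrightarrow> carrier (obj X p) = {\<zero>\<^bsub>obj X p\<^esub>}"
    using X unfolding Kb_proj_def by blast
  have "carrier (obj (sub_cplx X e) p) = {\<zero>\<^bsub>obj (sub_cplx X e) p\<^esub>}" if "p < a \<or> b < p" for p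
    using ab[OF that] rhom_0[OF cx_rmd[OF cX] cx_rmd[OF cX] cm_rhom[OF e]] by simp
  moreover have "dif X (p + 1) (dif X p x) = \<zero>\<^bsub>obj X (p + 2)\<^esub>" if "x \<in> ?S p" for p x
    using cx_dd[OF cX, of x p] that S by blast
  ultimately show "sub_cplx X e \<in> Kb_proj R"
    unfolding Kb_proj_def using fg dS by (intro CollectI conjI allI ballI exI[of _ a] exI[of _ b]) simp_all
  show "e \<in> chain_maps R X (sub_cplx X e)"
    by (rule cmI[OF eS]) (simp add: cm_dif[OF e])
  show "cid \<in> chain_maps R (sub_cplx X e) X"
    by (rule cmI) (use iS in \<open>simp_all add: cid_def\<close>)
qed

text \<open>The idempotent factors through its image.\<close>

lemma sub_null:
  assumes X: "X \<in> Kb_proj R" and ie: "idem X e" and n: "nullobj (sub_cplx X e)"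
  shows "htp X X e (czero X)"
  using null_comp[OF Kb_cx[OF X] Kb_cx[OF image_idem(1)[OF X ie]] Kb_cx[OF X] n image_idem(2,3)[OF X ie]] by simp

text \<open>X is the sum of the images of e and 1 - e; the alternative depends on which of the two
  is contractible.\<close>

lemma indecomposable_idem:
  assumes X: "indecomposable R X" and ie: "idem X e"
  shows "htp X X e (czero X) \<or> htp X X e cid"
proof -
  have e: "e \<in> chain_maps R X X" and ee: "\<And>p x. x \<in> carrier (obj X p) \<Longrightarrow> e p (e p x) = e p x"
    using ie by (auto simp: idem_def)
  have K: "X \<in> Kb_proj R" using X by (simp add: indecomposable_def)
  note cX = Kb_cx[OF K] note rX = cx_rmd[OF cX]
  define e' where "e' = cplus X cid (cneg X e)"
  have e': "e' \<in> chain_maps R X X" unfolding e'_def by (intro cm_plus cm_neg cX cm_id e)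
  have e's: "e' p x = x \<oplus>\<^bsub>obj X p\<^esub> (\<ominus>\<^bsub>obj X p\<^esub> e p x)" for p x by (simp add: e'_def cplus_def cneg_def cid_def)
  have ec: "e p x \<in> carrier (obj X p)" if "x \<in> carrier (obj X p)" for p x by (rule cm_closed[OF e that])
  have e'c: "e' p x \<in> carrier (obj X p)" if "x \<in> carrier (obj X p)" for p x by (rule cm_closed[OF e' that])
  have e'e: "e' p (e p x) = \<zero>\<^bsub>obj X p\<^esub>" if "x \<in> carrier (obj X p)" for p x
    using ec[OF that] ee[OF that] by (simp add: e's m_r_neg rX)
  have ee0: "e p (e' p x) = \<zero>\<^bsub>obj X p\<^esub>" if "x \<in> carrier (obj X p)" for p x
    unfolding e's using that ec[OF that] ee[OF that]
      rhom_add[OF cm_rhom[OF e] that m_neg_closed[OF rX ec[OF that]]] rhom_neg[OF rX rX cm_rhom[OF e] ec[OF that]]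
    by (simp add: m_r_neg rX)
  have e'e': "e' p (e' p x) = e' p x" if "x \<in> carrier (obj X p)" for p x
    using ee0[OF that] e'c[OF that] unfolding e's[of p "e' p x"] by (simp add: m_minus_zero m_r_zero rX)
  have sum: "e p x \<oplus>\<^bsub>obj X p\<^esub> e' p x = x" if "x \<in> carrier (obj X p)" for p x
    unfolding e's using that ec[OF that] by (simp add: m_simps m_lcomm' rX)
  have ie': "idem X e'" using e' e'e' by (simp add: idem_def)
  note I = image_idem[OF K ie] and I' = image_idem[OF K ie']
  let ?A = "sub_cplx X e" and ?B = "sub_cplx X e'"
  note cA = Kb_cx[OF I(1)] and cB = Kb_cx[OF I'(1)]
  define F where "F = (\<lambda>p x. pair (e p x) (e' p x))"
  define H where "H = (\<lambda>p z. lft z \<oplus>\<^bsub>obj X p\<^esub> rgt z)"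
  have F: "F \<in> chain_maps R X (sum_cplx ?A ?B)"
  proof (rule cmI)
    show "F p \<in> rhom R (obj X p) (obj (sum_cplx ?A ?B) p)" for p
      unfolding F_def sum_cplx_simps by (rule rhom_pair[OF cm_rhom[OF I(2)] cm_rhom[OF I'(2)]])
  qed (simp add: F_def cm_dif[OF e] cm_dif[OF e'])
  have H: "H \<in> chain_maps R (sum_cplx ?A ?B) X"
  proof (rule cmI)
    show "H p \<in> rhom R (obj (sum_cplx ?A ?B) p) (obj X p)" for p
      using rhom_plus[OF rX rhom_comp[OF rhom_lft cm_rhom[OF I(3)]] rhom_comp[OF rhom_rgt cm_rhom[OF I'(3)]]]
      unfolding H_def sum_cplx_simps cid_def .
    fix p z assume "z \<in> carrier (obj (sum_cplx ?A ?B) p)"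
    then have "lft z \<in> carrier (obj X p)" "rgt z \<in> carrier (obj X p)" using ec e'c by auto
    then show "H (p + 1) (dif (sum_cplx ?A ?B) p z) = dif X p (H p z)"
      by (simp add: H_def rhom_add[OF cx_dif[OF cX]])
  qed
  have iso: "isomorphic R X (sum_cplx ?A ?B)"
  proof (rule isoI_strict[OF cX cx_sum[OF cA cB] F H])
    show "H p (F p x) = x" if "x \<in> carrier (obj X p)" for p x
      using sum[OF that] by (simp add: H_def F_def)
    fix p z assume "z \<in> carrier (obj (sum_cplx ?A ?B) p)"
    then obtain x y where xy: "x \<in> carrier (obj X p)" "lft z = e p x" "y \<in> carrier (obj X p)" "rgt z = e' p y" by auto
    have "e p (H p z) = lft z"
      unfolding H_def xy rhom_add[OF cm_rhom[OF e] ec[OF xy(1)] e'c[OF xy(3)]]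
      using ee[OF xy(1)] ee0[OF xy(3)] ec[OF xy(1)] by (simp add: m_r_zero rX)
    moreover have "e' p (H p z) = rgt z"
      unfolding H_def xy rhom_add[OF cm_rhom[OF e'] ec[OF xy(1)] e'c[OF xy(3)]]
      using e'e'[OF xy(3)] e'e[OF xy(1)] e'c[OF xy(3)] by (simp add: m_l_zero rX)
    ultimately show "F p (H p z) = z" by (simp add: F_def)
  qed
  from X I(1) I'(1) iso have "isomorphic R ?A (zero_cplx R) \<or> isomorphic R ?B (zero_cplx R)"
    unfolding indecomposable_def by blast
  then consider "nullobj ?A" | "nullobj ?B" using null_iff cA cB by blast
  then show ?thesis
  proof cases
    case 1
    then show ?thesis using sub_null[OF K ie] by blast
  next
    case 2
    have z: "htp X X e' (czero X)" by (rule sub_null[OF K ie' 2])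
    have mz: "mp X X (czero X)" by (rule cm_mp[OF cm_zero[OF cX cX]])
    have "htp X X (cplus X e e') (cplus X e (czero X))"
      by (rule htp_plus[OF cX cX cm_mp[OF e] mz htp_refl[OF cX cX cm_mp[OF e]] z])
    moreover have "htp X X (cplus X e (czero X)) e"
      by (rule htp_eq[OF cX cX cm_mp[OF e]]) (simp add: cplus_def czero_def ec m_r_zero rX)
    moreover have "htp X X cid (cplus X e e')"
      by (rule htp_eq[OF cX cX cm_mp[OF cm_plus[OF cX e e']]]) (simp add: cplus_def cid_def sum)
    ultimately have "htp X X cid e"
      using htp_trans[OF cX cX cm_mp[OF e]] htp_trans[OF cX cX cm_mp[OF cm_plus[OF cX e cm_zero[OF cX cX]]]] by blast
    then show ?thesis using htp_sym[OF cX cX cm_mp[OF e]] by blast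
  qed
qed

lemma indecomposable_iso:
  assumes "indecomposable R X" "Y \<in> Kb_proj R" "isomorphic R X Y"
  shows "indecomposable R Y"
proof -
  have K: "X \<in> Kb_proj R" using assms by (simp add: indecomposable_def)
  have "isomorphic R X (sum_cplx A B)" if "A \<in> Kb_proj R" "B \<in> Kb_proj R" "isomorphic R Y (sum_cplx A B)" for A B
    using iso_trans[OF Kb_cx[OF K] Kb_cx[OF assms(2)] cx_sum[OF Kb_cx Kb_cx] assms(3)] that by blast
  moreover have "\<not> isomorphic R Y (zero_cplx R)"
    using iso_trans[OF Kb_cx[OF K] Kb_cx[OF assms(2)] cx_zero assms(3)] assms(1) by (auto simp: indecomposable_def)
  ultimately show ?thesis using assms unfolding indecomposable_def by blast
qed

lemma indec_not_null: "indecomposable R X \<Longrightarrow> \<not> nullobj X"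
  using null_iff[OF Kb_cx] by (auto simp: indecomposable_def)

end

section \<open>Powers of endomorphisms, and the exchange property of indecomposable
  complexes\<close>

context cartan_alg
begin

definition csmul :: "'a cplx \<Rightarrow> 'k \<Rightarrow> 'a cmap \<Rightarrow> 'a cmap"
  where "csmul X t f = (\<lambda>p x. ract (obj X p) (f p x) (\<kappa> t))"

text \<open>Right multiplication by \<open>\<kappa> t\<close> is a homomorphism of right modules
  since \<open>\<kappa> t\<close> is central.\<close>

lemma rhom_scalar:
  assumes M: "rmd M" shows "(\<lambda>x. ract M x (\<kappa> t)) \<in> rhom R M M"
proof (rule rhomI)
  fix x a assume x: "x \<in> carrier M" and a: "a \<in> carrier R"
  show "ract M (ract M x a) (\<kappa> t) = ract M (ract M x (\<kappa> t)) a"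
    using right_module.ract_mult[OF M x a \<kappa>_closed] right_module.ract_mult[OF M x \<kappa>_closed a] \<kappa>_central[OF a] by simp
qed (use M \<kappa>_closed in \<open>simp_all add: m_ract right_module.ract_add_left\<close>)

lemma cm_csmul: "cx Y \<Longrightarrow> f \<in> chain_maps R X Y \<Longrightarrow> csmul Y t f \<in> chain_maps R X Y"
  unfolding csmul_def
  by (rule cmI) (auto intro: rhom_comp[OF cm_rhom rhom_scalar[OF cx_rmd]]
      simp: cm_dif rhom_act[OF cx_dif] cm_closed \<kappa>_closed)

text \<open>The powers of f lie in a finite-dimensional space, so a nontrivial combination of them
  vanishes. Division by its lowest nonzero coefficient gives f^m = f^(m+1) g with g a polynomial in
  f. The relation holds strictly and not only up to homotopy.\<close>

lemma power_relation:
  assumes X: "shaped X I" and f: "f \<in> chain_maps R X X"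
  obtains m g where "g \<in> chain_maps R X X"
    "\<forall>p. \<forall>x \<in> carrier (obj X p). g p (f p x) = f p (g p x)"
    "\<forall>p. \<forall>x \<in> carrier (obj X p). cpow f m p x = cpow f (Suc m) p (g p x)"
proof -
  note cX = shapedD(1)[OF X] and oX = shapedD(2)[OF X] and finI = shapedD(3)[OF X]
  note rX = cx_rmd[OF cX]
  \<comment> \<open>A chain map as a family concentrated on the diagonal, so that it has
    coordinates.\<close>
  define F where "F h = (\<lambda>p q x. if q = p then h p x else \<zero>\<^bsub>std (I q)\<^esub>)" for h :: "'a cmap"
  have F: "rfam I I (F h)" if h: "h \<in> chain_maps R X X" for h
    unfolding rfam_def
  proof (intro allI)
    fix p q show "F h p q \<in> rhom R (std (I p)) (std (I q))"
      using cm_rhom[OF h, of p] rhom_zero[OF rmd_std[of "I q"]]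
      unfolding F_def by (cases "q = p") (simp_all add: oX)
  qed
  define v where "v k = of_fam I I (F (cpow f k))" for k
  obtain N d where Nd: "(\<Sum>k\<le>N. fscale (d k) (v k)) = 0" "\<exists>k\<le>N. d k \<noteq> 0"
    by (rule supported_dependency[OF finite_coords[OF X X], of v]) (auto simp: v_def of_fam_supported)
  \<comment> \<open>The partial sum of d_i f^i over i < k, built by recursion because chain maps are
    added with the module operations of X.\<close>
  define Q where "Q = rec_nat (czero X) (\<lambda>k h. cplus X h (csmul X (d k) (cpow f k)))"
  have Q: "Q 0 = czero X" "Q (Suc k) = cplus X (Q k) (csmul X (d k) (cpow f k))" for k by (simp_all add: Q_def)
  have Qc: "Q k \<in> chain_maps R X X" for k
    by (induction k) (auto simp: Q intro!: cm_zero cm_plus cm_csmul cm_cpow cX f)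
  have Fz: "of_fam I I (F (czero X)) = 0"
    by (auto simp: of_fam_def fun_eq_iff F_def czero_def oX co_0)
  have QS: "of_fam I I (F (Q k)) = (\<Sum>k<k. fscale (d k) (v k))" for k
  proof (induction k)
    case (Suc k)
    have "of_fam I I (F (Q (Suc k))) = of_fam I I (\<lambda>p q x. F (Q k) p q x \<oplus>\<^bsub>std (I q)\<^esub> ract (std (I q)) (F (cpow f k) p q x) (\<kappa> (d k)))"
      by (rule of_fam_cong) (auto simp: Q F_def cplus_def csmul_def oX m_ract_zero[OF rmd_std \<kappa>_closed]
          m_l_zero[OF rmd_std m_zero[OF rmd_std]] simp del: std_simps)
    also have "\<dots> = of_fam I I (F (Q k)) + of_fam I I (\<lambda>p q x. ract (std (I q)) (F (cpow f k) p q x) (\<kappa> (d k)))"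
    proof (rule of_fam_add[OF F[OF Qc]])
      show "rfam I I (\<lambda>p q x. ract (std (I q)) (F (cpow f k) p q x) (\<kappa> (d k)))"
        unfolding rfam_def using rhom_comp[OF rfam_rhom[OF F[OF cm_cpow[OF f]]] rhom_scalar[OF rmd_std]] by blast
    qed
    also have "\<dots> = (\<Sum>k<k. fscale (d k) (v k)) + fscale (d k) (v k)"
      unfolding Suc v_def[of k] by (subst of_fam_scale[OF F[OF cm_cpow[OF f]]]) simp
    finally show ?case by simp
  qed (simp add: Q Fz)
  have QN: "Q (Suc N) p x = \<zero>\<^bsub>obj X p\<^esub>" if x: "x \<in> carrier (obj X p)" for p x
  proof -
    have "of_fam I I (F (Q (Suc N))) = 0" using Nd(1) unfolding QS lessThan_Suc_atMost .
    from of_fam_eq_0[where I = I and p = p and q = p and f = "F (Q (Suc N))" and I' = I and x = x,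
        OF finI rfam_rhom[OF F[OF Qc]] this] show ?thesis using x by (simp add: F_def oX)
  qed
  \<comment> \<open>The lowest index with a nonzero coefficient; the partial sums up to it vanish,
    see \<open>Qm\<close>.\<close>
  define m where "m = (LEAST k. d k \<noteq> 0)"
  from Nd(2) obtain k0 where k0: "k0 \<le> N" "d k0 \<noteq> 0" by blast
  have m1: "d m \<noteq> 0" unfolding m_def by (rule LeastI[of "\<lambda>k. d k \<noteq> 0", OF k0(2)])
  have m2: "d k = 0" if "k < m" for k using not_less_Least[of k "\<lambda>k. d k \<noteq> 0"] that unfolding m_def by simp
  have m3: "m \<le> N" unfolding m_def by (rule order_trans[OF Least_le[of "\<lambda>k. d k \<noteq> 0", OF k0(2)] k0(1)])
  note m = m1 m2 m3
  have pc: "cpow f k p x \<in> carrier (obj X p)" if "x \<in> carrier (obj X p)" for k p x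
    by (rule cm_closed[OF cm_cpow[OF f] that])
  have ract0: "ract (obj X p) y (\<kappa> 0) = \<zero>\<^bsub>obj X p\<^esub>" if y: "y \<in> carrier (obj X p)" for p y
  proof -
    have "ract (obj X p) y (\<kappa> 0) = ract (obj X p) y (\<kappa> 0) \<oplus>\<^bsub>obj X p\<^esub> ract (obj X p) y (\<kappa> 0)"
      using right_module.ract_add_right[OF rX y \<kappa>_closed[of 0] \<kappa>_closed[of 0]] \<kappa>_add[of 0 0] by simp
    then show ?thesis using m_cancel[OF rX] m_ract[OF rX y \<kappa>_closed] m_zero[OF rX] m_r_zero[OF rX] by metis
  qed
  have Qm: "Q k p x = \<zero>\<^bsub>obj X p\<^esub>" if "k \<le> m" "x \<in> carrier (obj X p)" for k p x
    using that(1)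
  proof (induction k)
    case (Suc k)
    then show ?case using that(2) m(2)[of k] pc[OF that(2)] ract0
      by (simp add: Q cplus_def csmul_def m_r_zero m_zero rX)
  qed (simp add: Q czero_def)
  \<comment> \<open>The tail of the polynomial with f^(m+1) taken out, so that Q (m + 1 + r) = d_m
    f^m + f^(m+1) W_r.\<close>
  define W where "W = rec_nat (czero X) (\<lambda>r h. cplus X h (csmul X (d (Suc m + r)) (cpow f r)))"
  have W: "W 0 = czero X" "W (Suc r) = cplus X (W r) (csmul X (d (Suc m + r)) (cpow f r))" for r by (simp_all add: W_def)
  have Wc: "W r \<in> chain_maps R X X" for r
    by (induction r) (auto simp: W intro!: cm_zero cm_plus cm_csmul cm_cpow cX f)
  note fh = cm_rhom[OF f] note ph = cm_rhom[OF cm_cpow[OF f]]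
  have Wf: "W r p (f p x) = f p (W r p x)" if x: "x \<in> carrier (obj X p)" for r p x
  proof (induction r)
    case 0
    then show ?case using rhom_0[OF rX rX fh] by (simp add: W czero_def)
  next
    case (Suc r)
    show ?case
      unfolding W cplus_def csmul_def
        rhom_add[OF fh cm_closed[OF Wc x] m_ract[OF rX pc[OF x] \<kappa>_closed]] rhom_act[OF fh pc[OF x] \<kappa>_closed]
      using Suc by (simp add: cpow_swap)
  qed
  have QW: "Q (Suc m + r) p x = ract (obj X p) (cpow f m p x) (\<kappa> (d m)) \<oplus>\<^bsub>obj X p\<^esub> cpow f (Suc m) p (W r p x)"
    if x: "x \<in> carrier (obj X p)" for r p x
  proof (induction r)
    case 0
    then show ?case using Qm[OF order_refl x] rhom_0[OF rX rX ph, of "Suc m" p] m_ract[OF rX pc[OF x] \<kappa>_closed]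
      by (simp add: Q W czero_def cplus_def csmul_def m_l_zero m_r_zero m_ract rX \<kappa>_closed del: cpow_simps(2))
  next
    case (Suc r)
    have "cpow f (Suc m) p (W (Suc r) p x) = cpow f (Suc m) p (W r p x) \<oplus>\<^bsub>obj X p\<^esub> ract (obj X p) (cpow f (Suc m + r) p x) (\<kappa> (d (Suc m + r)))"
      unfolding W cplus_def csmul_def cpow_add
      using rhom_add[OF ph[of "Suc m" p] cm_closed[OF Wc x] m_ract[OF rX pc[OF x] \<kappa>_closed]]
        rhom_act[OF ph[of "Suc m" p] pc[OF x] \<kappa>_closed] by simp
    moreover have "Q (Suc m + Suc r) p x = Q (Suc m + r) p x \<oplus>\<^bsub>obj X p\<^esub> ract (obj X p) (cpow f (Suc m + r) p x) (\<kappa> (d (Suc m + r)))"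
      using Q(2)[of "Suc m + r"] by (simp add: cplus_def csmul_def del: cpow_simps(2))
    ultimately show ?case
      unfolding Suc using pc[OF cm_closed[OF Wc x]] m_ract[OF rX pc[OF x] \<kappa>_closed]
      by (simp add: m_assoc' rX del: cpow_simps(2))
  qed
  \<comment> \<open>Since Q (N + 1) = 0, the tail with r = N - m gives d_m f^m = f^(m+1) h.\<close>
  define h where "h = cneg X (W (N - m))"
  have hc: "h \<in> chain_maps R X X" unfolding h_def by (rule cm_neg[OF cX Wc])
  define g where "g = csmul X (inverse (d m)) h"
  have gc: "g \<in> chain_maps R X X" unfolding g_def by (rule cm_csmul[OF cX hc])
  show thesis
  proof (rule that[OF gc]; intro allI ballI)
    fix p x assume x: "x \<in> carrier (obj X p)"
    note wc = cm_closed[OF Wc x]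
    show "g p (f p x) = f p (g p x)"
      using x wc by (simp add: g_def h_def csmul_def cneg_def Wf rhom_act[OF fh] rhom_neg[OF rX rX fh] m_neg_closed rX \<kappa>_closed)
    have e: "Suc m + (N - m) = Suc N" using m by simp
    let ?y = "cpow f m p x"
    have y: "?y \<in> carrier (obj X p)" by (rule pc[OF x])
    have "ract (obj X p) ?y (\<kappa> (d m)) \<oplus>\<^bsub>obj X p\<^esub> cpow f (Suc m) p (W (N - m) p x) = \<zero>\<^bsub>obj X p\<^esub>"
      using QW[OF x, of "N - m"] QN[OF x] unfolding e by simp
    then have 1: "ract (obj X p) ?y (\<kappa> (d m)) = cpow f (Suc m) p (h p x)"
      using m_eq_minus[OF rX m_ract[OF rX y \<kappa>_closed] pc[OF wc]] rhom_neg[OF rX rX ph wc]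
      by (simp add: h_def cneg_def del: cpow_simps(2))
    have "?y = ract (obj X p) (ract (obj X p) ?y (\<kappa> (d m))) (\<kappa> (inverse (d m)))"
      using right_module.ract_mult[OF rX y \<kappa>_closed \<kappa>_closed, of "d m" "inverse (d m)"] m(1) \<kappa>_mult[of "d m" "inverse (d m)"]
        right_module.ract_one[OF rX y] \<kappa>_one by simp
    also have "\<dots> = cpow f (Suc m) p (g p x)"
      unfolding 1 g_def csmul_def using rhom_act[OF ph[of "Suc m" p] cm_closed[OF hc x] \<kappa>_closed] by simp
    finally show "?y = cpow f (Suc m) p (g p x)" .
  qed
qed

text \<open>From f^m = f^(m+1) g with commuting f and g, the composite f^m g^m is a strict
  idempotent; indecomposability makes it homotopic to 0 or 1. In the first case f^m is
  null-homotopic, in the second f is invertible.\<close>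

lemma fitting:
  assumes X: "shaped X I" and ind: "indecomposable R X" and f: "f \<in> chain_maps R X X"
  shows "(\<exists>g \<in> chain_maps R X X. htp X X (g \<bullet> f) cid \<and> htp X X (f \<bullet> g) cid) \<or> (\<exists>m. htp X X (cpow f m) (czero X))"
proof -
  note cX = shapedD(1)[OF X]
  obtain m0 g where g: "g \<in> chain_maps R X X"
    and gf: "\<And>p x. x \<in> carrier (obj X p) \<Longrightarrow> g p (f p x) = f p (g p x)"
    and m0: "\<And>p x. x \<in> carrier (obj X p) \<Longrightarrow> cpow f m0 p x = cpow f (Suc m0) p (g p x)"
    using power_relation[OF X f] by (metis (no_types))
  \<comment> \<open>Raised by one so that f^m contains a factor f, from which the inverse of f is
    read off at the end.\<close>
  define m where "m = Suc m0"
  have m: "cpow f m p x = cpow f (Suc m) p (g p x)" if "x \<in> carrier (obj X p)" for p x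
    using m0[OF that] by (simp add: m_def)
  note gc = cm_closed[OF cm_cpow[OF g]]
  have gfk: "cpow g l p (f p x) = f p (cpow g l p x)" if "x \<in> carrier (obj X p)" for l p x
    by (induction l) (use that gf gc in \<open>auto simp: cid_def\<close>)
  have comm: "cpow g l p (cpow f k p x) = cpow f k p (cpow g l p x)" if "x \<in> carrier (obj X p)" for k l p x
    by (induction k) (use that gfk cm_closed[OF cm_cpow[OF f] that] in \<open>auto simp: cid_def\<close>)
  \<comment> \<open>Iterating the relation gives f^m = f^(m+l) g^l; the case l = m will yield f^m =
    f^m e.\<close>
  have mk: "cpow f m p x = cpow f (m + l) p (cpow g l p x)" if x: "x \<in> carrier (obj X p)" for l p x
  proof (induction l)
    case (Suc l)
    have "cpow f (m + l) p (cpow g l p x) = cpow f (l + m) p (cpow g l p x)" by (simp add: add.commute)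
    also have "\<dots> = cpow f l p (cpow f m p (cpow g l p x))" by (rule cpow_add)
    also have "\<dots> = cpow f l p (cpow f (Suc m) p (g p (cpow g l p x)))" unfolding m[OF gc[OF x]] ..
    also have "\<dots> = cpow f (m + Suc l) p (cpow g (Suc l) p x)"
      unfolding cpow_add[symmetric] by (simp add: add.commute)
    finally show ?case using Suc by simp
  qed (simp add: cid_def)
  define e where "e = cpow f m \<bullet> cpow g m"
  have ec: "e \<in> chain_maps R X X" unfolding e_def by (rule cm_comp[OF cm_cpow[OF g] cm_cpow[OF f]])
  have fe: "cpow f m p (e p x) = cpow f m p x" if "x \<in> carrier (obj X p)" for p x
    using mk[OF that, of m] by (simp add: e_def ccomp_def cpow_add)
  have ge: "e p (e p x) = e p x" if x: "x \<in> carrier (obj X p)" for p x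
  proof -
    have xe: "e p x \<in> carrier (obj X p)" by (rule cm_closed[OF ec x])
    have "e p (e p x) = cpow g m p (cpow f m p (e p x))" using comm[OF xe] by (simp add: e_def ccomp_def)
    also have "\<dots> = e p x" unfolding fe[OF x] using comm[OF x] by (simp add: e_def ccomp_def)
    finally show ?thesis .
  qed
  have "idem X e" using ec ge by (simp add: idem_def)
  from indecomposable_idem[OF ind this] show ?thesis
  proof
    assume z: "htp X X e (czero X)"
    have "htp X X (cpow f m \<bullet> e) (cpow f m \<bullet> (czero X \<bullet> cid))"
      unfolding ccomp_cid by (rule htp_comp_left[OF cX cX cX cm_mp[OF cm_zero[OF cX cX]] z cm_cpow[OF f]])
    then have "htp X X (cpow f m \<bullet> e) (czero X)"
      using htp_trans[OF cX cX cm_mp[OF cm_zero[OF cX cX]]] zero_comp[OF cX cX cX cm_cpow[OF f]] by blast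
    moreover have "htp X X (cpow f m) (cpow f m \<bullet> e)"
      by (rule htp_eq[OF cX cX cm_mp[OF cm_comp[OF ec cm_cpow[OF f]]]]) (simp add: ccomp_def fe)
    ultimately show ?thesis using htp_trans[OF cX cX cm_mp[OF cm_zero[OF cX cX]]] by blast
  next
    assume id: "htp X X e cid"
    \<comment> \<open>A factor f of \<open>e\<close> is removed: f h is \<open>e\<close> by
      definition, and h f agrees with \<open>e\<close> because f commutes with g.\<close>
    define h where "h = cpow f m0 \<bullet> cpow g m"
    have h: "h \<in> chain_maps R X X" unfolding h_def by (rule cm_comp[OF cm_cpow[OF g] cm_cpow[OF f]])
    have 1: "f \<bullet> h = e" by (simp add: h_def e_def ccomp_def m_def fun_eq_iff)
    have "htp X X (h \<bullet> f) e"
      by (rule htp_eq[OF cX cX cm_mp[OF ec]])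
        (simp add: h_def e_def ccomp_def gfk cpow_swap m_def del: cpow_simps(2), simp)
    then have "htp X X (h \<bullet> f) cid" using htp_trans[OF cX cX cm_mp[OF cm_id] _ id] by blast
    then show ?thesis using h id 1 by auto
  qed
qed

text \<open>The identity of X is u + v with u passing through Z and v through W. By Fitting, u is
  invertible, or it is nilpotent and then v = 1 - u has a left inverse, the geometric series of u;
  all this up to homotopy.\<close>

lemma retr_sum_cases:
  assumes X: "shaped X I" and ind: "indecomposable R X" and Z: "cx Z" and W: "cx W" and r: "retr X (sum_cplx Z W)"
  shows "retr X Z \<or> retr X W"
proof -
  note cX = shapedD(1)[OF X] and S = cx_sum[OF Z W] note rX = cx_rmd[OF cX]
  obtain a b where ab: "a \<in> chain_maps R X (sum_cplx Z W)" "b \<in> chain_maps R (sum_cplx Z W) X" "htp X X (b \<bullet> a) cid"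
    using r unfolding retr_def by blast
  define a1 a2 b1 b2 where "a1 = cprl \<bullet> a" and "a2 = cprr \<bullet> a" and "b1 = b \<bullet> cinl W" and "b2 = b \<bullet> cinr Z"
  have c: "a1 \<in> chain_maps R X Z" "a2 \<in> chain_maps R X W" "b1 \<in> chain_maps R Z X" "b2 \<in> chain_maps R W X"
    unfolding a1_def a2_def b1_def b2_def
    using cm_comp[OF ab(1) cm_prl] cm_comp[OF ab(1) cm_prr] cm_comp[OF cm_inl[OF W] ab(2)] cm_comp[OF cm_inr[OF Z] ab(2)]
    by simp_all
  define u v where "u = b1 \<bullet> a1" and "v = b2 \<bullet> a2"
  have uv: "u \<in> chain_maps R X X" "v \<in> chain_maps R X X" unfolding u_def v_def by (rule cm_comp[OF c(1,3)], rule cm_comp[OF c(2,4)])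
  have uvid: "htp X X (cplus X u v) cid"
  proof -
    have "htp X X (cplus X u v) (b \<bullet> a)"
    proof (rule htp_eq[OF cX cX cm_mp[OF cm_comp[OF ab(1,2)]]])
      fix p x assume x: "x \<in> carrier (obj X p)"
      have y: "lft (a p x) \<in> carrier (obj Z p)" "rgt (a p x) \<in> carrier (obj W p)"
        using cm_closed[OF ab(1) x] by auto
      have "b p (a p x) = b p (pair (lft (a p x)) \<zero>\<^bsub>obj W p\<^esub> \<oplus>\<^bsub>sum_rmod (obj Z p) (obj W p)\<^esub> pair \<zero>\<^bsub>obj Z p\<^esub> (rgt (a p x)))"
        using y by (simp add: m_l_zero m_r_zero cx_rmd[OF Z] cx_rmd[OF W])
      also have "\<dots> = cplus X u v p x"
        using rhom_add[OF cm_rhom[OF ab(2)], of "pair (lft (a p x)) \<zero>\<^bsub>obj W p\<^esub>" p "pair \<zero>\<^bsub>obj Z p\<^esub> (rgt (a p x))"] y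
        by (simp add: m_zero cx_rmd[OF Z] cx_rmd[OF W] cplus_def u_def v_def b1_def a1_def b2_def a2_def ccomp_def cprl_def cprr_def cinl_def cinr_def)
      finally show "cplus X u v p x = (b \<bullet> a) p x" by (simp add: ccomp_def)
    qed
    then show ?thesis using htp_trans[OF cX cX cm_mp[OF cm_id] _ ab(3)] by blast
  qed
  from fitting[OF X ind uv(1)] show ?thesis
  proof (elim disjE bexE exE conjE)
    fix g assume "g \<in> chain_maps R X X" "htp X X (g \<bullet> u) cid"
    then have "retr X Z" unfolding retr_def u_def
      by (intro bexI[OF _ c(1)] bexI[of _ "g \<bullet> b1"]) (auto simp: ccomp_assoc intro: cm_comp c)
    then show ?thesis ..
  next
    fix m assume z: "htp X X (cpow u m) (czero X)"
    \<comment> \<open>The partial sums 1 + u + ... + u^(k-1) in Horner form. By induction, u + v = 1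
      gives G_k v + u^k = 1 up to homotopy.\<close>
    define G where "G = rec_nat (czero X) (\<lambda>_ h. cplus X cid (u \<bullet> h))"
    have G: "G 0 = czero X" "G (Suc k) = cplus X cid (u \<bullet> G k)" for k by (simp_all add: G_def)
    have Gc: "G k \<in> chain_maps R X X" for k
      by (induction k) (auto simp: G intro!: cm_zero cX cm_plus cm_id cm_comp uv)
    have Gv: "htp X X (cplus X (G k \<bullet> v) (cpow u k)) cid" for k
    proof (induction k)
      case 0
      show ?case
        by (rule htp_eq[OF cX cX cm_mp[OF cm_id]]) (simp add: G cplus_def ccomp_def czero_def cid_def m_l_zero rX)
    next
      case (Suc k)
      let ?q = "cplus X (G k \<bullet> v) (cpow u k)"
      have qc: "?q \<in> chain_maps R X X" by (rule cm_plus[OF cX cm_comp[OF uv(2) Gc] cm_cpow[OF uv(1)]])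
      have "htp X X (cplus X v (u \<bullet> ?q)) (cplus X v (u \<bullet> cid))"
        by (rule htp_plus[OF cX cX cm_mp[OF uv(2)] _ htp_refl[OF cX cX cm_mp[OF uv(2)]]
              htp_comp_left[OF cX cX cX cm_mp[OF cm_id] Suc uv(1)]]) (simp add: cm_mp uv)
      moreover have "htp X X (cplus X v (u \<bullet> cid)) (cplus X u v)"
        by (rule htp_eq[OF cX cX cm_mp[OF cm_plus[OF cX uv]]])
          (simp add: cplus_def m_comm'[OF rX] cm_closed[OF uv(1)] cm_closed[OF uv(2)])
      moreover have "htp X X (cplus X (G (Suc k) \<bullet> v) (cpow u (Suc k))) (cplus X v (u \<bullet> ?q))"
      proof (rule htp_eq[OF cX cX cm_mp[OF cm_plus[OF cX uv(2) cm_comp[OF qc uv(1)]]]])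
        fix p x assume x: "x \<in> carrier (obj X p)"
        note vx = cm_closed[OF uv(2) x] note gx = cm_closed[OF Gc vx] note px = cm_closed[OF cm_cpow[OF uv(1)] x]
        show "cplus X (G (Suc k) \<bullet> v) (cpow u (Suc k)) p x = cplus X v (u \<bullet> ?q) p x"
          unfolding G cplus_def ccomp_def cid_def rhom_add[OF cm_rhom[OF uv(1)] gx px]
          using vx cm_closed[OF uv(1) gx] cm_closed[OF uv(1) px] by (simp add: m_assoc'[OF rX])
      qed
      ultimately show ?case using htp_trans[OF cX cX] cm_mp uvid
        by (meson cX cm_comp cm_id cm_plus qc uv)
    qed
    have gv: "G m \<bullet> v \<in> chain_maps R X X" by (rule cm_comp[OF uv(2) Gc])
    have "htp X X (cplus X (G m \<bullet> v) (cpow u m)) (cplus X (G m \<bullet> v) (czero X))"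
      by (rule htp_plus[OF cX cX cm_mp[OF gv] cm_mp[OF cm_zero[OF cX cX]] htp_refl[OF cX cX cm_mp[OF gv]] z])
    moreover have "htp X X (cplus X (G m \<bullet> v) (czero X)) (G m \<bullet> v)"
      by (rule htp_eq[OF cX cX cm_mp[OF gv]]) (simp add: cplus_def czero_def m_r_zero rX cm_closed[OF gv])
    ultimately have 1: "htp X X (cplus X (G m \<bullet> v) (cpow u m)) (G m \<bullet> v)"
      using htp_trans[OF cX cX cm_mp[OF gv]] by blast
    have "htp X X (G m \<bullet> v) (cplus X (G m \<bullet> v) (cpow u m))" by (rule htp_sym[OF cX cX cm_mp[OF gv] 1])
    then have "htp X X (G m \<bullet> v) cid" using htp_trans[OF cX cX cm_mp[OF cm_id] _ Gv] by blast
    then have "retr X W" unfolding retr_def v_def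
      by (intro bexI[OF _ c(2)] bexI[of _ "G m \<bullet> b2"]) (auto simp: ccomp_assoc intro: cm_comp c Gc)
    then show ?thesis ..
  qed
qed

text \<open>With b a = 1 up to homotopy, u = a b is idempotent. If it is invertible, it is the
  identity; if it is nilpotent, then 1 = (b a)^(k+1) = b u^k a shows that X is contractible.\<close>

lemma retr_indec_iso:
  assumes cX: "cx X" and nX: "\<not> nullobj X" and Z: "shaped Z I" and ind: "indecomposable R Z" and r: "retr X Z"
  shows "isomorphic R X Z"
proof -
  note cZ = shapedD(1)[OF Z]
  obtain a b where ab: "a \<in> chain_maps R X Z" "b \<in> chain_maps R Z X" "htp X X (b \<bullet> a) cid"
    using r unfolding retr_def by blast
  define u where "u = a \<bullet> b"
  have u: "u \<in> chain_maps R Z Z" unfolding u_def by (rule cm_comp[OF ab(2,1)])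
  from fitting[OF Z ind u] show ?thesis
  proof (elim disjE bexE exE conjE)
    fix g assume g: "g \<in> chain_maps R Z Z" "htp Z Z (g \<bullet> u) cid"
    have "htp Z X (b \<bullet> a \<bullet> b) (cid \<bullet> b)" by (rule htp_comp_right[OF cZ cX cX ab(3,2)])
    from htp_comp_left[OF cZ cX cZ _ this ab(1)] have "htp Z Z (a \<bullet> (b \<bullet> a \<bullet> b)) (a \<bullet> (cid \<bullet> b))"
      by (simp add: cm_mp[OF ab(2)])
    then have uu: "htp Z Z (u \<bullet> u) u" by (simp add: u_def ccomp_assoc)
    have 1: "htp Z Z (g \<bullet> (u \<bullet> u)) (g \<bullet> u)" by (rule htp_comp_left[OF cZ cZ cZ cm_mp[OF u] uu g(1)])
    have 2: "htp Z Z (g \<bullet> u \<bullet> u) (cid \<bullet> u)" by (rule htp_comp_right[OF cZ cZ cZ g(2) u])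
    have "htp Z Z u (g \<bullet> u \<bullet> u)" using htp_sym[OF cZ cZ cm_mp[OF u]] 2 by simp
    moreover have "htp Z Z (g \<bullet> u \<bullet> u) cid"
      using htp_trans[OF cZ cZ cm_mp[OF cm_id] _ g(2)] 1 by (simp add: ccomp_assoc)
    ultimately have "htp Z Z u cid" using htp_trans[OF cZ cZ cm_mp[OF cm_id]] by blast
    then show ?thesis using isoI[OF cX cZ ab(1,2,3)] by (simp add: u_def)
  next
    fix m assume z: "htp Z Z (cpow u m) (czero Z)"
    have pc: "b \<bullet> cpow u k \<bullet> a \<in> chain_maps R X X" for k
      by (rule cm_comp[OF ab(1) cm_comp[OF cm_cpow[OF u] ab(2)]])
    have "htp X X (b \<bullet> cpow u k \<bullet> a) cid" for k
    proof (induction k)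
      case (Suc k)
      have e: "b \<bullet> cpow u (Suc k) \<bullet> a = (b \<bullet> a) \<bullet> (b \<bullet> cpow u k \<bullet> a)"
        by (simp add: ccomp_def u_def fun_eq_iff)
      have "htp X X ((b \<bullet> a) \<bullet> (b \<bullet> cpow u k \<bullet> a)) (cid \<bullet> (b \<bullet> cpow u k \<bullet> a))"
        by (rule htp_comp_right[OF cX cX cX ab(3) pc])
      then show ?case unfolding e using htp_trans[OF cX cX cm_mp[OF cm_id] _ Suc] by simp
    qed (use ab(3) in simp)
    then have 1: "htp X X (b \<bullet> (cpow u m \<bullet> a)) cid" by (simp add: ccomp_assoc)
    have "htp X X (b \<bullet> (cpow u m \<bullet> a)) (b \<bullet> (czero Z \<bullet> a))"
      by (rule htp_comp_left[OF cX cZ cX _ htp_comp_right[OF cX cZ cZ z ab(1)] ab(2)])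
        (intro cm_mp cm_comp[OF ab(1)] cm_zero cZ)
    then have 2: "htp X X (b \<bullet> (cpow u m \<bullet> a)) (czero X)"
      using htp_trans[OF cX cX cm_mp[OF cm_zero[OF cX cX]]] zero_comp[OF cX cZ cX ab(2)] by blast
    have "htp X X cid (b \<bullet> (cpow u m \<bullet> a))" by (rule htp_sym[OF cX cX cm_mp[OF cm_id] 1])
    then have "nullobj X" unfolding nullobj_def
      using htp_trans[OF cX cX cm_mp[OF cm_zero[OF cX cX]] _ 2] by blast
    then show ?thesis using nX by simp
  qed
qed

end

section \<open>The algebra as a tilting complex\<close>

context base_ring
begin

lemma fgp_sum:
  assumes "fg_projective R P" "fg_projective R Q"
  shows "fg_projective R (sum_rmod P Q)"
proof -
  from assms obtain m s r where P: "rmd P" and s: "s \<in> rhom R P (free_rmod R m)" and r: "r \<in> rhom R (free_rmod R m) P"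
    and rs: "\<And>x. x \<in> carrier P \<Longrightarrow> r (s x) = x" unfolding fg_projective_def by blast
  from assms obtain l s' r' where Q: "rmd Q" and s': "s' \<in> rhom R Q (free_rmod R l)" and r': "r' \<in> rhom R (free_rmod R l) Q"
    and rs': "\<And>x. x \<in> carrier Q \<Longrightarrow> r' (s' x) = x" unfolding fg_projective_def by blast
  \<comment> \<open>The two embeddings are concatenated, the second one moved up by m places;
    \<open>A\<close> and \<open>B\<close> read off the two blocks.\<close>
  define S where "S z = (\<lambda>i. if i < m then s (lft z) i else s' (rgt z) (i - m))" for z
  define A where "A y = (\<lambda>i. if i < m then y i else \<zero>)" for y :: "nat \<Rightarrow> 'a"
  define B where "B y = (\<lambda>i. y (i + m))" for y :: "nat \<Rightarrow> 'a"
  have A: "A \<in> rhom R (free_rmod R (m + l)) (free_rmod R m)"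
    by (rule rhomI) (auto simp: A_def fun_eq_iff)
  have B: "B \<in> rhom R (free_rmod R (m + l)) (free_rmod R l)"
    by (rule rhomI) (auto simp: B_def fun_eq_iff)
  have S: "S \<in> rhom R (sum_rmod P Q) (free_rmod R (m + l))"
  proof (rule rhomI)
    fix x assume "x \<in> carrier (sum_rmod P Q)"
    then have x: "lft x \<in> carrier P" "rgt x \<in> carrier Q" by auto
    have c: "s (lft x) \<in> carrier (free_rmod R m)" "s' (rgt x) \<in> carrier (free_rmod R l)"
      using rhom_closed[OF s x(1)] rhom_closed[OF s' x(2)] by auto
    show "S x \<in> carrier (free_rmod R (m + l))" using c by (auto simp: S_def)
    show "S (ract (sum_rmod P Q) x a) = ract (free_rmod R (m + l)) (S x) a" if a: "a \<in> carrier R" for a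
      using rhom_act[OF s x(1) a] rhom_act[OF s' x(2) a] by (auto simp: S_def fun_eq_iff)
    fix y assume "y \<in> carrier (sum_rmod P Q)"
    then have y: "lft y \<in> carrier P" "rgt y \<in> carrier Q" by auto
    show "S (x \<oplus>\<^bsub>sum_rmod P Q\<^esub> y) = S x \<oplus>\<^bsub>free_rmod R (m + l)\<^esub> S y"
      using rhom_add[OF s x(1) y(1)] rhom_add[OF s' x(2) y(2)] by (auto simp: S_def fun_eq_iff)
  qed
  have rA: "r (A (S z)) = lft z" "r' (B (S z)) = rgt z" if "lft z \<in> carrier P" "rgt z \<in> carrier Q" for z
  proof -
    have c: "s (lft z) \<in> carrier (free_rmod R m)" using rhom_closed[OF s that(1)] .
    have "A (S z) = s (lft z)" using c by (auto simp: A_def S_def fun_eq_iff)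
    then show "r (A (S z)) = lft z" using rs that by simp
    have "B (S z) = s' (rgt z)" by (auto simp: B_def S_def)
    then show "r' (B (S z)) = rgt z" using rs' that by simp
  qed
  show ?thesis
    unfolding fg_projective_def
  proof (intro conjI rmd_sum P Q exI bexI ballI)
    show "S \<in> rhom R (sum_rmod P Q) (free_rmod R (m + l))" by (rule S)
    show "(\<lambda>y. pair (r (A y)) (r' (B y))) \<in> rhom R (free_rmod R (m + l)) (sum_rmod P Q)"
      by (rule rhom_pair[OF rhom_comp[OF A r] rhom_comp[OF B r']])
  qed (simp add: rA)
qed

lemma cone_Kb:
  assumes X: "X \<in> Kb_proj R" and Y: "Y \<in> Kb_proj R" and f: "f \<in> chain_maps R X Y"
  shows "cone X Y f \<in> Kb_proj R"
proof -
  note C = cx_cone[OF Kb_cx[OF X] Kb_cx[OF Y] f]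
  obtain a b where ab: "\<And>p. p < a \<or> b < p \<Longrightarrow> carrier (obj X p) = {\<zero>\<^bsub>obj X p\<^esub>}"
    using X unfolding Kb_proj_def by blast
  obtain a' b' where ab': "\<And>p. p < a' \<or> b' < p \<Longrightarrow> carrier (obj Y p) = {\<zero>\<^bsub>obj Y p\<^esub>}"
    using Y unfolding Kb_proj_def by blast
  have "carrier (obj (cone X Y f) p) = {\<zero>\<^bsub>obj (cone X Y f) p\<^esub>}" if "p < min (a - 1) a' \<or> max b b' < p" for p
    using ab[of "p + 1"] ab'[of p] that by (auto intro: pair_eqI)
  moreover have "fg_projective R (obj (cone X Y f) p)" for p
    using fgp_sum X Y by (simp add: Kb_proj_def)
  ultimately show ?thesis
    unfolding Kb_proj_def using C unfolding cx_def
    by (intro CollectI conjI allI ballI exI[of _ "min (a - 1) a'"] exI[of _ "max b b'"]) auto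
qed

lemma sum_Kb: "X \<in> Kb_proj R \<Longrightarrow> Y \<in> Kb_proj R \<Longrightarrow> sum_cplx X Y \<in> Kb_proj R"
proof -
  assume X: "X \<in> Kb_proj R" and Y: "Y \<in> Kb_proj R"
  note C = cx_sum[OF Kb_cx[OF X] Kb_cx[OF Y]]
  obtain a b where ab: "\<And>p. p < a \<or> b < p \<Longrightarrow> carrier (obj X p) = {\<zero>\<^bsub>obj X p\<^esub>}"
    using X unfolding Kb_proj_def by blast
  obtain a' b' where ab': "\<And>p. p < a' \<or> b' < p \<Longrightarrow> carrier (obj Y p) = {\<zero>\<^bsub>obj Y p\<^esub>}"
    using Y unfolding Kb_proj_def by blast
  have "carrier (obj (sum_cplx X Y) p) = {\<zero>\<^bsub>obj (sum_cplx X Y) p\<^esub>}" if "p < min a a' \<or> max b b' < p" for p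
    using ab[of p] ab'[of p] that by (auto intro: pair_eqI)
  moreover have "fg_projective R (obj (sum_cplx X Y) p)" for p
    using fgp_sum X Y by (simp add: Kb_proj_def)
  ultimately show ?thesis
    unfolding Kb_proj_def using C unfolding cx_def
    by (intro CollectI conjI allI ballI exI[of _ "min a a'"] exI[of _ "max b b'"]) auto
qed

lemma cm_cone_incl:
  assumes "cx X" "cx Y" "f \<in> chain_maps R X Y"
  shows "cone_incl X \<in> chain_maps R Y (cone X Y f)"
proof (rule cmI)
  have rX: "rmd (obj X p)" "rmd (obj Y p)" for p using assms cx_rmd by auto
  show "cone_incl X p \<in> rhom R (obj Y p) (obj (cone X Y f) p)" for p
    using rhom_pair[OF rhom_zero[OF rX(1)] rhom_id] by (simp add: cone_incl_def)
  fix p y assume y: "y \<in> carrier (obj Y p)"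
  show "cone_incl X (p + 1) (dif Y p y) = dif (cone X Y f) p (cone_incl X p y)"
    using y rhom_closed[OF cx_dif[OF assms(2)] y] rhom_0[OF rX(1,1) cx_dif[OF assms(1)], of "p + 1"]
      rhom_0[OF rX cm_rhom[OF assms(3)]]
    by (simp add: cone_incl_def m_minus_zero m_l_zero rX add.assoc)
qed

lemma cm_cone_proj: "cone_proj \<in> chain_maps R (cone X Y f) (shift 1 X)"
  by (rule cmI) (simp_all add: cone_proj_def rhom_lft add.assoc)

lemma cone_triangle:
  assumes X: "X \<in> Kb_proj R" and Y: "Y \<in> Kb_proj R" and f: "f \<in> chain_maps R X Y"
  shows "triangle R X Y (cone X Y f) f (cone_incl X) cone_proj"
proof -
  note cX = Kb_cx[OF X] and cY = Kb_cx[OF Y]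
  note K = cone_Kb[OF X Y f] note cC = Kb_cx[OF K]
  note ci = cm_cone_incl[OF cX cY f] and cp = cm_cone_proj[of X Y f]
  have h: "homotopic R A B g g" if "cx A" "cx B" "g \<in> chain_maps R A B" for A B g
    using homotopic_iff[OF that(1,2) cm_mp[OF that(3)] cm_mp[OF that(3)]] htp_refl[OF that(1,2) cm_mp[OF that(3)]] by simp
  have id: "is_iso R A A cid" if "cx A" for A
    unfolding is_iso_def using h[OF that that cm_id] by (auto simp: cm_id)
  show ?thesis
    unfolding triangle_def
  proof (intro conjI X Y K f ci cp bexI exI)
    show "is_iso R X X cid" "is_iso R Y Y cid" "is_iso R (cone X Y f) (cone X Y f) cid" by (intro id cX cY cC)+
    show "homotopic R X Y (cid \<bullet> f) (f \<bullet> cid)" using h[OF cX cY f] by simp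
    show "homotopic R Y (cone X Y f) (cid \<bullet> cone_incl X) (cone_incl X \<bullet> cid)" using h[OF cY cC ci] by simp
    show "homotopic R (cone X Y f) (shift 1 X) (shift_map 1 cid \<bullet> cone_proj) (cone_proj \<bullet> cid)"
      using h[OF cC cx_shift[OF cX] cp] by (simp add: shift_map_cid)
  qed (use X Y f in auto)
qed

lemma thick_cone: "thick_subcat R S \<Longrightarrow> X \<in> S \<Longrightarrow> Y \<in> S \<Longrightarrow> f \<in> chain_maps R X Y \<Longrightarrow> cone X Y f \<in> S"
  using cone_triangle unfolding thick_subcat_def by (meson subsetD)

end

section \<open>Complexes concentrated in one degree and their indecomposable summands\<close>

context cartan_alg
begin

text \<open>With I = {..<n} this is the algebra itself placed in degree k, that is A[-k], because
  the idempotents with index below n sum to one.\<close>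

definition stalk :: "int \<Rightarrow> nat set \<Rightarrow> 'a cplx"
  where "stalk k I = \<lparr>obj = (\<lambda>p. std (if p = k then I else {})), dif = (\<lambda>p x i. \<zero>)\<rparr>"

lemma stalk_simps [simp]:
  "obj (stalk k I) p = std (if p = k then I else {})" "dif (stalk k I) p x = (\<lambda>i. \<zero>)"
  by (simp_all add: stalk_def)

lemma std_empty: "x \<in> carrier (std {}) \<longleftrightarrow> x = (\<lambda>i. \<zero>)"
  by (auto simp: std_mem eps_closed fun_eq_iff)

lemma stalk_shaped: "finite I \<Longrightarrow> shaped (stalk k I) (\<lambda>p. if p = k then I else {})"
proof -
  assume "finite I"
  have "(\<lambda>x i. \<zero>) \<in> rhom R M (std I')" for I' and M :: "'a rmod" using rhom_zero[OF rmd_std] by simp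
  then have "cx (stalk k I)" by (simp add: cx_def rmd_std stalk_def)
  then show ?thesis using \<open>finite I\<close> by (simp add: shaped_def)
qed

lemma cx_stalk: "finite I \<Longrightarrow> cx (stalk k I)" using stalk_shaped by (simp add: shaped_def)

lemma stalk_Kb: "finite I \<Longrightarrow> stalk k I \<in> Kb_proj R" using stalk_shaped shaped_Kb by blast

lemma stalk_off: "p \<noteq> k \<Longrightarrow> x \<in> carrier (obj (stalk k I) p) \<Longrightarrow> x = (\<lambda>i. \<zero>)"
  by (simp add: std_empty)

lemma stalk_cm_off: 
  assumes "f \<in> chain_maps R (stalk k I) (stalk k I')" "p \<noteq> k" "x \<in> carrier (obj (stalk k I) p)"
  shows "f p x = (\<lambda>i. \<zero>)"
  using stalk_off[OF assms(2) cm_closed[OF assms(1,3)]] .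

text \<open>Every homotopy between complexes in one and the same degree passes through a zero
  term.\<close>

lemma stalk_htp:
  assumes "finite I" "finite I'" "htp (stalk k I) (stalk k I') f g" "g \<in> chain_maps R (stalk k I) (stalk k I')"
    "x \<in> carrier (std I)"
  shows "f k x = g k x"
proof -
  obtain s where s: "is_htpy (stalk k I) (stalk k I') s"
    "\<And>p x. x \<in> carrier (obj (stalk k I) p) \<Longrightarrow> f p x = g p x \<oplus>\<^bsub>obj (stalk k I') p\<^esub> htpy_map (stalk k I) (stalk k I') s p x"
    using assms(3) unfolding htp_def by blast
  have "s (k + 1) \<in> rhom R (obj (stalk k I) (k + 1)) (obj (stalk k I') (k + 1 - 1))"
    using s(1) unfolding is_htpy_def by blast
  then have "s (k + 1) \<in> rhom R (std {}) (std I')" by simp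
  from rhom_0[OF rmd_std rmd_std this] have "htpy_map (stalk k I) (stalk k I') s k x = (\<lambda>i. \<zero>)"
    by (simp add: htpy_map_def)
  then show ?thesis using s(2)[of x k] assms(5) cm_closed[OF assms(4), of x k] stdD(1)[of "g k x" I'] by simp
qed

lemma stalk_htpI:
  assumes "finite I" "finite I'" "f \<in> chain_maps R (stalk k I) (stalk k I')" "g \<in> chain_maps R (stalk k I) (stalk k I')"
    "\<And>x. x \<in> carrier (std I) \<Longrightarrow> f k x = g k x"
  shows "htp (stalk k I) (stalk k I') f g"
proof (rule htp_eq[OF cx_stalk[OF assms(1)] cx_stalk[OF assms(2)] cm_mp[OF assms(4)]])
  fix p x assume x: "x \<in> carrier (obj (stalk k I) p)"
  show "f p x = g p x"
  proof (cases "p = k")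
    case True
    then show ?thesis using assms(5)[of x] x by simp
  next
    case False
    then show ?thesis using stalk_cm_off[OF assms(3) False x] stalk_cm_off[OF assms(4) False x] by simp
  qed
qed

lemma stalk_orth:
  assumes I: "finite I" shows "orth (stalk k I) (stalk k I)"
  unfolding orth_def
proof (intro allI impI ballI)
  fix i f assume i: "i \<noteq> (0::int)" and f: "f \<in> chain_maps R (stalk k I) (shift i (stalk k I))"
  note c = cx_stalk[OF I, of k]
  show "htp (stalk k I) (shift i (stalk k I)) f (czero (shift i (stalk k I)))"
  proof (rule htp_eq[OF c cx_shift[OF c] cm_mp[OF cm_zero[OF c cx_shift[OF c]]]])
    fix p x assume x: "x \<in> carrier (obj (stalk k I) p)"
    show "f p x = czero (shift i (stalk k I)) p x"
    proof (cases "p = k")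
      case True
      then have "p + i \<noteq> k" using i by simp
      then have "f p x = (\<lambda>i. \<zero>)" using stalk_off[of "p + i" k "f p x" I] cm_closed[OF f x] by simp
      then show ?thesis by (simp add: czero_def)
    next
      case False
      then have "x = \<zero>\<^bsub>obj (stalk k I) p\<^esub>" using stalk_off[OF False x] by simp
      then show ?thesis using rhom_0[OF cx_rmd[OF c] cx_rmd[OF cx_shift[OF c]] cm_rhom[OF f]] by (simp add: czero_def)
    qed
  qed
qed

lemma stalk_map:
  assumes "h \<in> rhom R (std I) (std I')" 
  shows "(\<lambda>p x. if p = k then h x else (\<lambda>i. \<zero>)) \<in> chain_maps R (stalk k I) (stalk k I')"
proof (rule cmI)
  fix p
  show "(\<lambda>x. if p = k then h x else (\<lambda>i. \<zero>)) \<in> rhom R (obj (stalk k I) p) (obj (stalk k I') p)"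
    using assms rhom_zero[OF rmd_std[of "{}"]] by (cases "p = k") simp_all
qed (use rhom_0[OF rmd_std rmd_std assms] in simp)

lemma stalk_iso:
  assumes "finite I" "finite I'" "miso (std I) (std I')"
  shows "isomorphic R (stalk k I) (stalk k I')"
proof -
  obtain f g where f: "f \<in> rhom R (std I) (std I')" and g: "g \<in> rhom R (std I') (std I)"
    and fg: "\<And>x. x \<in> carrier (std I) \<Longrightarrow> g (f x) = x" "\<And>y. y \<in> carrier (std I') \<Longrightarrow> f (g y) = y"
    using assms(3) unfolding miso_def by blast
  show ?thesis
    by (rule isoI_strict[OF cx_stalk[OF assms(1)] cx_stalk[OF assms(2)] stalk_map[OF f] stalk_map[OF g]])
      (use fg in \<open>auto simp: std_empty split: if_splits\<close>)
qed

definition res :: "nat set \<Rightarrow> (nat \<Rightarrow> 'a) \<Rightarrow> nat \<Rightarrow> 'a"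
  where "res K x = (\<lambda>i. if i \<in> K then x i else \<zero>)"

lemma res_rhom: "K \<subseteq> K' \<Longrightarrow> res K \<in> rhom R (std K') (std K)"
  by (rule rhomI) (auto simp: std_mem eps_closed fun_eq_iff res_def)

lemma incl_rhom: "K \<subseteq> K' \<Longrightarrow> (\<lambda>x. x) \<in> rhom R (std K) (std K')"
  by (rule rhomI) (auto intro: std_mono)

lemma stalk_union:
  assumes I: "finite I" "finite I'" "I \<inter> I' = {}"
  shows "isomorphic R (stalk k (I \<union> I')) (sum_cplx (stalk k I) (stalk k I'))"
proof -
  let ?A = "\<lambda>p. if p = k then I else {}" and ?B = "\<lambda>p. if p = k then I' else {}"
  define F where "F = (\<lambda>p x. pair (res (?A p) x) (res (?B p) x))"
  define H where "H = (\<lambda>(p::int) z i. lft z i \<oplus> rgt z i)"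
  have F: "F \<in> chain_maps R (stalk k (I \<union> I')) (sum_cplx (stalk k I) (stalk k I'))"
  proof (rule cmI)
    fix p
    have "res (?A p) \<in> rhom R (std (if p = k then I \<union> I' else {})) (std (?A p))"
      "res (?B p) \<in> rhom R (std (if p = k then I \<union> I' else {})) (std (?B p))"
      by (rule res_rhom, simp)+
    from rhom_pair[OF this] show "F p \<in> rhom R (obj (stalk k (I \<union> I')) p) (obj (sum_cplx (stalk k I) (stalk k I')) p)"
      by (simp add: F_def)
  qed (simp add: F_def res_def)
  have H: "H \<in> chain_maps R (sum_cplx (stalk k I) (stalk k I')) (stalk k (I \<union> I'))"
  proof (rule cmI)
    fix p
    have *: "(\<lambda>x. x) \<in> rhom R (std (?A p)) (std (if p = k then I \<union> I' else {}))"
      "(\<lambda>x. x) \<in> rhom R (std (?B p)) (std (if p = k then I \<union> I' else {}))"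
      by (rule incl_rhom, simp)+
    show "H p \<in> rhom R (obj (sum_cplx (stalk k I) (stalk k I')) p) (obj (stalk k (I \<union> I')) p)"
      using rhom_plus[OF rmd_std rhom_comp[OF rhom_lft *(1)] rhom_comp[OF rhom_rgt *(2)]]
      by (simp add: H_def)
  qed (simp add: H_def)
  have res: "res K x i \<oplus> res K' x i = x i" if "x \<in> carrier (std (K \<union> K'))" "K \<inter> K' = {}" for K K' x i
    using stdD[OF that(1), of i] that(2) by (auto simp: res_def)
  show ?thesis
  proof (rule isoI_strict[OF cx_stalk cx_sum[OF cx_stalk cx_stalk] F H])
    fix p x assume x: "x \<in> carrier (obj (stalk k (I \<union> I')) p)"
    then have "x \<in> carrier (std (?A p \<union> ?B p))" by (cases "p = k") auto
    from res[OF this] show "H p (F p x) = x" using I by (auto simp: H_def F_def)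
  next
    fix p z assume "z \<in> carrier (obj (sum_cplx (stalk k I) (stalk k I')) p)"
    then have z: "lft z \<in> carrier (std (?A p))" "rgt z \<in> carrier (std (?B p))" by auto
    have d: "i \<in> ?A p \<Longrightarrow> i \<notin> ?B p" for i using I by (auto split: if_splits)
    show "F p (H p z) = z"
    proof (rule pair_eqI)
      show "lft (F p (H p z)) = lft z"
      proof
        fix i show "lft (F p (H p z)) i = lft z i"
          using stdD[OF z(1), of i] stdD[OF z(2), of i] d[of i] by (cases "i \<in> ?A p") (simp_all add: F_def H_def res_def)
      qed
      show "rgt (F p (H p z)) = rgt z"
      proof
        fix i show "rgt (F p (H p z)) i = rgt z i"
          using stdD[OF z(1), of i] stdD[OF z(2), of i] d[of i] by (cases "i \<in> ?B p") (auto simp: F_def H_def res_def)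
      qed
    qed
  qed (use I in auto)
qed

lemma stalk_empty_null: "nullobj (stalk k {})"
  unfolding nullobj_def
  by (rule htp_eq) (auto simp: cx_stalk cid_def czero_def mp_def std_empty)

lemma stalk_not_null:
  assumes "finite I" "I \<noteq> {}" shows "\<not> nullobj (stalk k I)"
proof
  assume n: "nullobj (stalk k I)"
  obtain i where i: "i \<in> I" using assms by auto
  have "cid k (sgl i (\<epsilon> i)) = czero (stalk k I) k (sgl i (\<epsilon> i))"
    by (rule stalk_htp[OF assms(1,1) n[unfolded nullobj_def] cm_zero[OF cx_stalk cx_stalk] sgl_eps_mem[OF i]]) (rule assms)+
  then show False using sgl_neq_0 by (simp add: cid_def czero_def)
qed

text \<open>The corner is local: an idempotent in \<open>J 1\<close> lies in every
  \<open>J k\<close> and is zero, and an invertible idempotent is the unit.\<close>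

lemma idem_entry:
  assumes a: "a \<in> carrier R" "\<epsilon> i \<otimes> a = a" "a \<otimes> \<epsilon> i = a" "a \<otimes> a = a"
  shows "a = \<zero> \<or> a = \<epsilon> i"
proof (cases "a \<in> J 1")
  case True
  have "a \<in> J k" for k
    by (induction k) (use a J_0 J_mult[OF True] in \<open>auto, metis\<close>)
  from this[of N] show ?thesis using J_last by simp
next
  case False
  with J_local[OF a(1-3)] obtain t b where "t \<noteq> 0" "b \<in> J 1" "a = \<kappa> t \<otimes> \<epsilon> i \<oplus> b" by blast
  from local_inverse[OF refl a(1-3) this] obtain u where u: "u \<in> carrier R" "u \<otimes> a = \<epsilon> i" by blast
  have "\<epsilon> i = u \<otimes> (a \<otimes> a)" using u a by simp
  also have "\<dots> = \<epsilon> i \<otimes> a" using u a(1) m_assoc by metis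
  finally show ?thesis using a by simp
qed

text \<open>A decomposition writes the unit of the local ring \<epsilon> i R \<epsilon> i as a sum
  of two idempotents. One of them is zero, and the summand to which it belongs is
  contractible.\<close>

lemma stalk_single_indec: "indecomposable R (stalk k {i})"
  unfolding indecomposable_def
proof (intro conjI ballI impI)
  let ?X = "stalk k {i}"
  have fin: "finite {i}" by simp
  note cX = cx_stalk[OF fin, of k]
  show "?X \<in> Kb_proj R" by (rule stalk_Kb[OF fin])
  show "\<not> isomorphic R ?X (zero_cplx R)" using null_iff[OF cX] stalk_not_null[OF fin] by simp
  fix A B assume K: "A \<in> Kb_proj R" "B \<in> Kb_proj R" and iso: "isomorphic R ?X (sum_cplx A B)"
  note cA = Kb_cx[OF K(1)] and cB = Kb_cx[OF K(2)] note S = cx_sum[OF cA cB]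
  obtain F G where F: "F \<in> chain_maps R ?X (sum_cplx A B)" and G: "G \<in> chain_maps R (sum_cplx A B) ?X"
    and GF: "htp ?X ?X (G \<bullet> F) cid" and FG: "htp (sum_cplx A B) (sum_cplx A B) (F \<bullet> G) cid"
    by (rule isoE[OF iso cX S])
  \<comment> \<open>Both summands C are treated at once. The idempotent of C is transported to an
    endomorphism e of the stalk complex; its entry is idempotent in the corner, and if the entry is
    zero, the identity of C is null-homotopic.\<close>
  have main: "e k (sgl i (\<epsilon> i)) i = \<zero> \<or> e k (sgl i (\<epsilon> i)) i = \<epsilon> i" "e k (sgl i (\<epsilon> i)) i = \<zero> \<Longrightarrow> nullobj C"
    if C: "cx C" and i: "\<iota> \<in> chain_maps R C (sum_cplx A B)" and p: "\<pi> \<in> chain_maps R (sum_cplx A B) C"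
      and pi: "\<pi> \<bullet> \<iota> = cid" and e: "e = (G \<bullet> \<iota>) \<bullet> (\<pi> \<bullet> F)" for C \<iota> \<pi> e
  proof -
    define \<alpha> \<beta> where "\<alpha> = G \<bullet> \<iota>" and "\<beta> = \<pi> \<bullet> F"
    have \<alpha>: "\<alpha> \<in> chain_maps R C ?X" unfolding \<alpha>_def by (rule cm_comp[OF i G])
    have \<beta>: "\<beta> \<in> chain_maps R ?X C" unfolding \<beta>_def by (rule cm_comp[OF F p])
    have ec: "e \<in> chain_maps R ?X ?X" unfolding e using cm_comp[OF \<beta> \<alpha>] by (simp add: \<alpha>_def \<beta>_def)
    have "htp C C (\<pi> \<bullet> (F \<bullet> G \<bullet> \<iota>)) (\<pi> \<bullet> (cid \<bullet> \<iota>))"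
      by (rule htp_comp_left[OF C S C _ htp_comp_right[OF C S S FG i] p]) (simp add: cm_mp[OF i])
    then have ba: "htp C C (\<beta> \<bullet> \<alpha>) cid" using pi by (simp add: \<alpha>_def \<beta>_def ccomp_assoc)
    have "htp ?X ?X (\<alpha> \<bullet> (\<beta> \<bullet> \<alpha> \<bullet> \<beta>)) (\<alpha> \<bullet> (cid \<bullet> \<beta>))"
      by (rule htp_comp_left[OF cX C cX _ htp_comp_right[OF cX C C ba \<beta>] \<alpha>]) (simp add: cm_mp[OF \<beta>])
    then have ee: "htp ?X ?X (e \<bullet> e) e" unfolding e by (simp add: \<alpha>_def \<beta>_def ccomp_assoc)
    have eh: "e k \<in> rhom R (std {i}) (std {i})" using cm_rhom[OF ec, of k] by simp
    define a where "a = e k (sgl i (\<epsilon> i)) i"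
    have ac: "a \<in> carrier R" "\<epsilon> i \<otimes> a = a" "a \<otimes> \<epsilon> i = a"
      using rhom_entry[OF eh, of i i] by (simp_all add: a_def)
    have em: "e k x = sgl i (a \<otimes> x i)" if x: "x \<in> carrier (std {i})" for x
    proof
      fix j
      have "x = sgl i (x i)" using stdD(3)[OF x] by (auto simp: sgl_def fun_eq_iff)
      then show "e k x j = sgl i (a \<otimes> x i) j"
        using rhom_sgl[OF eh _ stdD(1)[OF x] stdD(2)[OF x], of i] stdD(3)[OF rhom_closed[OF eh x], of j]
        by (cases "j = i") (auto simp: sgl_def a_def)
    qed
    note s = sgl_eps_mem[of i "{i}", simplified]
    have "e k (e k (sgl i (\<epsilon> i))) = e k (sgl i (\<epsilon> i))"
      using stalk_htp[OF fin fin ee ec s] by (simp add: ccomp_def)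
    then have "e k (e k (sgl i (\<epsilon> i))) i = e k (sgl i (\<epsilon> i)) i" by simp
    then have "a \<otimes> a = a"
      unfolding em[OF rhom_closed[OF eh s]] a_def[symmetric] by (simp add: sgl_def)
    from idem_entry[OF ac this] show "e k (sgl i (\<epsilon> i)) i = \<zero> \<or> e k (sgl i (\<epsilon> i)) i = \<epsilon> i" by (simp add: a_def)
    assume "e k (sgl i (\<epsilon> i)) i = \<zero>"
    then have "a = \<zero>" by (simp add: a_def)
    then have e0: "htp ?X ?X e (czero ?X)"
      by (intro stalk_htpI[OF fin fin ec cm_zero[OF cX cX]]) (simp add: em czero_def sgl_def stdD)
    have "htp C C (\<beta> \<bullet> (e \<bullet> \<alpha>)) (\<beta> \<bullet> (czero ?X \<bullet> \<alpha>))"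
      by (rule htp_comp_left[OF C cX C _ htp_comp_right[OF C cX cX e0 \<alpha>] \<beta>])
        (rule cm_mp[OF cm_comp[OF \<alpha> cm_zero[OF cX cX]]])
    then have z: "htp C C (\<beta> \<bullet> (e \<bullet> \<alpha>)) (czero C)"
      using htp_trans[OF C C cm_mp[OF cm_zero[OF C C]]] zero_comp[OF C cX C \<beta>] by blast
    have bc: "\<beta> \<bullet> \<alpha> \<in> chain_maps R C C" by (rule cm_comp[OF \<alpha> \<beta>])
    have "htp C C (\<beta> \<bullet> \<alpha> \<bullet> (\<beta> \<bullet> \<alpha>)) (cid \<bullet> (\<beta> \<bullet> \<alpha>))" by (rule htp_comp_right[OF C C C ba bc])
    then have "htp C C (\<beta> \<bullet> (e \<bullet> \<alpha>)) (\<beta> \<bullet> \<alpha>)" unfolding e by (simp add: \<alpha>_def \<beta>_def ccomp_assoc)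
    then have "htp C C (\<beta> \<bullet> (e \<bullet> \<alpha>)) cid" using htp_trans[OF C C cm_mp[OF cm_id] _ ba] by blast
    then have "htp C C cid (\<beta> \<bullet> (e \<bullet> \<alpha>))" by (rule htp_sym[OF C C cm_mp[OF cm_id]])
    then show "nullobj C" unfolding nullobj_def
      using htp_trans[OF C C cm_mp[OF cm_zero[OF C C]] _ z] by blast
  qed
  have p1: "cprl \<bullet> cinl B = cid" "cprr \<bullet> cinr A = cid"
    by (simp_all add: ccomp_def cprl_def cinl_def cprr_def cinr_def cid_def)
  define e1 e2 where "e1 = (G \<bullet> cinl B) \<bullet> (cprl \<bullet> F)" and "e2 = (G \<bullet> cinr A) \<bullet> (cprr \<bullet> F)"
  note m1 = main[OF cA cm_inl[OF cB] cm_prl p1(1) e1_def] and m2 = main[OF cB cm_inr[OF cA] cm_prr p1(2) e2_def]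
  let ?s = "sgl i (\<epsilon> i)"
  note s = sgl_eps_mem[of i "{i}", simplified]
  have s': "?s \<in> carrier (obj ?X k)" using s by simp
  have y: "lft (F k ?s) \<in> carrier (obj A k)" "rgt (F k ?s) \<in> carrier (obj B k)"
    using cm_closed[OF F s'] by auto
  have "?s = G k (F k ?s)" using stalk_htp[OF fin fin GF cm_id s] by (simp add: ccomp_def cid_def)
  also have "F k ?s = pair (lft (F k ?s)) \<zero>\<^bsub>obj B k\<^esub> \<oplus>\<^bsub>sum_rmod (obj A k) (obj B k)\<^esub> pair \<zero>\<^bsub>obj A k\<^esub> (rgt (F k ?s))"
    using y by (simp add: m_l_zero m_r_zero cx_rmd[OF cA] cx_rmd[OF cB])
  also have "G k \<dots> = e1 k ?s \<oplus>\<^bsub>obj ?X k\<^esub> e2 k ?s"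
    using rhom_add[OF cm_rhom[OF G], of "pair (lft (F k ?s)) \<zero>\<^bsub>obj B k\<^esub>" k "pair \<zero>\<^bsub>obj A k\<^esub> (rgt (F k ?s))"] y
    by (simp add: m_zero cx_rmd[OF cA] cx_rmd[OF cB] e1_def e2_def ccomp_def cprl_def cprr_def cinl_def cinr_def del: stalk_simps)
  finally have "?s i = (e1 k ?s \<oplus>\<^bsub>obj ?X k\<^esub> e2 k ?s) i" by (rule arg_cong)
  then have sum: "\<epsilon> i = e1 k ?s i \<oplus> e2 k ?s i" by (simp add: sgl_def)
  have "e1 k ?s i = \<zero> \<or> e2 k ?s i = \<zero>"
  proof (rule ccontr)
    assume "\<not> ?thesis"
    then have "e1 k ?s i = \<epsilon> i" "e2 k ?s i = \<epsilon> i" using m1(1) m2(1) by auto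
    then have "\<epsilon> i = \<epsilon> i \<oplus> \<epsilon> i" using sum by simp
    then have "\<epsilon> i = \<zero>" using eps_closed[of i] by (metis local.add.r_cancel_one')
    then show False using eps_neq_0 by simp
  qed
  then show "isomorphic R A (zero_cplx R) \<or> isomorphic R B (zero_cplx R)"
    using m1(2) m2(2) null_iff[OF cA] null_iff[OF cB] by blast
qed

text \<open>Entries between inequivalent idempotents lie in \<open>J 1\<close>. Entries b and d of
  mutually inverse maps satisfy d b = \<epsilon> i and would put \<epsilon> i into every
  \<open>J (2 * r)\<close>.\<close>

lemma stalk_single_not_iso:
  assumes "i mod n \<noteq> j mod n"
  shows "\<not> isomorphic R (stalk k {i}) (stalk k {j})"
proof
  assume iso: "isomorphic R (stalk k {i}) (stalk k {j})"
  have fin: "finite {l}" for l :: nat by simp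
  obtain F G where F: "F \<in> chain_maps R (stalk k {i}) (stalk k {j})" and G: "G \<in> chain_maps R (stalk k {j}) (stalk k {i})"
    and GF: "htp (stalk k {i}) (stalk k {i}) (G \<bullet> F) cid"
    by (rule isoE[OF iso cx_stalk[OF fin] cx_stalk[OF fin]])
  have f: "F k \<in> rhom R (std {i}) (std {j})" and g: "G k \<in> rhom R (std {j}) (std {i})"
    using cm_rhom[OF F, of k] cm_rhom[OF G, of k] by auto
  define b d where "b = F k (sgl i (\<epsilon> i)) j" and "d = G k (sgl j (\<epsilon> j)) i"
  have b: "b \<in> carrier R" "\<epsilon> j \<otimes> b = b" "b \<otimes> \<epsilon> i = b" using rhom_entry[OF f, of i j] by (auto simp: b_def)
  have d: "d \<in> carrier R" "\<epsilon> i \<otimes> d = d" "d \<otimes> \<epsilon> j = d" using rhom_entry[OF g, of j i] by (auto simp: d_def)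
  have bJ: "b \<in> J 1" and dJ: "d \<in> J 1" using J_local[OF b] J_local[OF d] assms by auto
  note s = sgl_eps_mem[of i "{i}", simplified]
  have Fs: "F k (sgl i (\<epsilon> i)) = sgl j b"
    using stdD(3)[OF rhom_closed[OF f s]] by (auto simp: sgl_def b_def fun_eq_iff)
  have "G k (F k (sgl i (\<epsilon> i))) = sgl i (\<epsilon> i)" using stalk_htp[OF fin fin GF cm_id s] by (simp add: ccomp_def cid_def)
  then have "G k (sgl j b) i = \<epsilon> i" unfolding Fs by (simp add: sgl_def)
  then have db: "d \<otimes> b = \<epsilon> i" using rhom_sgl[OF g _ b(1,2), of i] by (simp add: d_def)
  have 1: "\<epsilon> i \<in> J (2 * r) \<and> b \<in> J (2 * r + 1)" for r
  proof (induction r)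
    case 0
    then show ?case using eps_closed J_0 bJ by simp
  next
    case (Suc r)
    have e: "\<epsilon> i \<in> J (2 * Suc r)" using J_mult[OF dJ, of b "2 * r + 1"] Suc db by simp
    moreover have "b \<in> J (2 * Suc r + 1)" using J_mult[OF bJ e] b by simp
    ultimately show ?case by simp
  qed
  \<comment> \<open>If N is odd, it is b that vanishes first, and then \<epsilon> i = d b vanishes
    as well.\<close>
  have "\<epsilon> i = \<zero>"
  proof (cases "even N")
    case True
    then show ?thesis using 1[of "N div 2"] J_last by simp
  next
    case False
    then have "b = \<zero>" using 1[of "N div 2"] J_last by simp
    then show ?thesis using db d by simp
  qed
  then show False using eps_neq_0 by simp
qed

lemma stalk_sum_list:
  "distinct is \<Longrightarrow> isomorphic R (stalk k (set is)) (sum_list_cplx R (map (\<lambda>i. stalk k {i}) is)) \<and>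
    cx (sum_list_cplx R (map (\<lambda>i. stalk k {i}) is))"
proof (induction "is")
  case Nil
  then show ?case using null_iff[OF cx_stalk, of "{}" k] stalk_empty_null cx_zero by (simp add: sum_list_cplx_def)
next
  case (Cons i js)
  let ?L = "sum_list_cplx R (map (\<lambda>i. stalk k {i}) js)"
  have fin: "finite {i}" "finite (set js)" by auto
  note c = cx_stalk[OF fin(1), of k] cx_stalk[OF fin(2), of k]
  have IH: "isomorphic R (stalk k (set js)) ?L" "cx ?L" using Cons by auto
  have e: "sum_list_cplx R (map (\<lambda>i. stalk k {i}) (i # js)) = sum_cplx (stalk k {i}) ?L" by (simp add: sum_list_cplx_def)
  have 1: "isomorphic R (stalk k (set (i # js))) (sum_cplx (stalk k {i}) (stalk k (set js)))"
    using stalk_union[OF fin, of k] Cons.prems by simp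
  have 2: "isomorphic R (sum_cplx (stalk k {i}) (stalk k (set js))) (sum_cplx (stalk k {i}) ?L)"
    by (rule iso_sum[OF c c(1) IH(2) iso_refl[OF c(1)] IH(1)])
  have "cx (stalk k (set (i # js)))" by (rule cx_stalk) simp
  then show ?case unfolding e using iso_trans[OF _ cx_sum[OF c] cx_sum[OF c(1) IH(2)] 1 2] cx_sum[OF c(1) IH(2)] by simp
qed

lemma stalk_basic: "basic R (stalk k {..<n})"
  unfolding basic_def
proof (intro exI[of _ "map (\<lambda>i. stalk k {i}) [0..<n]"] conjI allI impI ballI)
  show "indecomposable R X" if "X \<in> set (map (\<lambda>i. stalk k {i}) [0..<n])" for X
    using that stalk_single_indec by auto
  show "\<not> isomorphic R (map (\<lambda>i. stalk k {i}) [0..<n] ! i) (map (\<lambda>i. stalk k {i}) [0..<n] ! j)"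
    if "i < j \<and> j < length (map (\<lambda>i. stalk k {i}) [0..<n])" for i j
    using that stalk_single_not_iso[of i j k] by simp
  show "isomorphic R (stalk k {..<n}) (sum_list_cplx R (map (\<lambda>i. stalk k {i}) [0..<n]))"
    using stalk_sum_list[of "[0..<n]" k] by (simp add: atLeast0LessThan)
qed

end

context base_ring
begin

text \<open>The inverse of a degreewise bijective chain map commutes with the differentials
  automatically.\<close>

lemma isoI_bij:
  assumes "cx X" "cx Y" and f: "f \<in> chain_maps R X Y" and g: "\<And>p. g p \<in> rhom R (obj Y p) (obj X p)"
    and gf: "\<And>p x. x \<in> carrier (obj X p) \<Longrightarrow> g p (f p x) = x"
    and fg: "\<And>p y. y \<in> carrier (obj Y p) \<Longrightarrow> f p (g p y) = y"
  shows "isomorphic R X Y"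
proof (rule isoI_strict[OF assms(1,2) f _ gf fg])
  show "g \<in> chain_maps R Y X"
  proof (rule cmI[OF g])
    fix p y assume y: "y \<in> carrier (obj Y p)"
    have x: "g p y \<in> carrier (obj X p)" by (rule rhom_closed[OF g y])
    have "g (p + 1) (dif Y p y) = g (p + 1) (dif Y p (f p (g p y)))" using fg[OF y] by simp
    also have "\<dots> = g (p + 1) (f (p + 1) (dif X p (g p y)))" using cm_dif[OF f x] by simp
    also have "\<dots> = dif X p (g p y)" by (rule gf[OF rhom_closed[OF cx_dif[OF assms(1)] x]])
    finally show "g (p + 1) (dif Y p y) = dif X p (g p y)" .
  qed
qed

lemma cx_sum_list: "(\<And>X. X \<in> set Xs \<Longrightarrow> cx X) \<Longrightarrow> cx (sum_list_cplx R Xs)"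
  by (induction Xs) (auto simp: sum_list_cplx_def cx_zero intro: cx_sum)

lemma sum_list_Cons: "sum_list_cplx R (X # Xs) = sum_cplx X (sum_list_cplx R Xs)"
  by (simp add: sum_list_cplx_def)

lemma retr_sum_list: "(\<And>X. X \<in> set Xs \<Longrightarrow> cx X) \<Longrightarrow> X \<in> set Xs \<Longrightarrow> retr X (sum_list_cplx R Xs)"
proof (induction Xs)
  case (Cons Y Ys)
  have c: "cx X" "cx Y" "cx (sum_list_cplx R Ys)" using Cons.prems by (auto intro: cx_sum_list)
  show ?case
  proof (cases "X = Y")
    case True
    then show ?thesis unfolding sum_list_Cons using retr_sum_l[OF c(2,3)] by simp
  next
    case False
    then have "retr X (sum_list_cplx R Ys)" using Cons by auto
    then show ?thesis unfolding sum_list_Cons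
      using retr_trans[OF c(1,3) cx_sum[OF c(2,3)] _ retr_sum_r[OF c(2,3)]] by blast
  qed
qed simp

end

section \<open>Generation of the homotopy category by the algebra\<close>

context cartan_alg
begin

text \<open>Nothing nonzero maps into the lowest degree p0, so dropping an index i there leaves a
  subcomplex U'. U is the cone of the differential restricted to \<epsilon> i R; this module is
  placed in degree p0 + 1, since the cone moves it back to p0.\<close>

lemma peel:
  assumes U: "shaped U I" and low: "\<And>p. p < p0 \<Longrightarrow> I p = {}" and i: "i \<in> I p0"
  obtains U' f where "shaped U' (\<lambda>p. if p = p0 then I p0 - {i} else I p)"
    "f \<in> chain_maps R (stalk (p0 + 1) {i}) U'" "isomorphic R (cone (stalk (p0 + 1) {i}) U' f) U"
proof -
  note oU = shapedD(2)[OF U] and dU = shaped_dif(1)[OF U] and cU = shapedD(1)[OF U]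
  define I' where "I' = (\<lambda>p. if p = p0 then I p0 - {i} else I p)"
  define U' where "U' = \<lparr>obj = (\<lambda>p. std (I' p)), dif = dif U\<rparr>"
  have U's [simp]: "obj U' p = std (I' p)" "dif U' = dif U" for p by (simp_all add: U'_def)
  have sub: "I' p \<subseteq> I p" for p by (auto simp: I'_def)
  have dd: "dif U (p + 1) (dif U p x) = (\<lambda>j. \<zero>)" if "x \<in> carrier (std (I p))" for p x
    using cx_dd[OF cU, of x p] that by (simp add: oU)
  have d': "dif U p \<in> rhom R (std (I' p)) (std (I' (p + 1)))" for p
  proof (rule rhomI)
    fix x assume x': "x \<in> carrier (std (I' p))"
    then have x: "x \<in> carrier (std (I p))" using std_mono sub by blast
    \<comment> \<open>Only the differential that ends in degree p0 could leave the smaller module,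
      and its source is zero.\<close>
    show "dif U p x \<in> carrier (std (I' (p + 1)))"
    proof (cases "p + 1 = p0")
      case True
      then have "x = \<zero>\<^bsub>std (I p)\<^esub>" using x low[of p] by (simp add: std_empty)
      then have "dif U p x = (\<lambda>j. \<zero>)" using rhom_0[OF rmd_std rmd_std dU] by simp
      then show ?thesis using m_zero[OF rmd_std, of "I' (p + 1)"] by simp
    next
      case False
      then show ?thesis using rhom_closed[OF dU x] by (simp add: I'_def)
    qed
    show "dif U p (ract (std (I' p)) x a) = ract (std (I' (p + 1))) (dif U p x) a" if "a \<in> carrier R" for a
      using rhom_act[OF dU x that] by simp
    fix y assume "y \<in> carrier (std (I' p))"
    then have y: "y \<in> carrier (std (I p))" using std_mono sub by blast
    show "dif U p (x \<oplus>\<^bsub>std (I' p)\<^esub> y) = dif U p x \<oplus>\<^bsub>std (I' (p + 1))\<^esub> dif U p y"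
      using rhom_add[OF dU x y] by simp
  qed
  have cU': "cx U'" unfolding cx_def
    using d' dd std_mono[OF _ sub] by (simp add: rmd_std) 
  have "{p. I' p \<noteq> {}} \<subseteq> {p. I p \<noteq> {}}" using sub by blast
  then have "finite {p. I' p \<noteq> {}}" using shapedD(4)[OF U] by (rule finite_subset)
  then have sh: "shaped U' I'"
    using cU' shapedD(3)[OF U] by (simp add: shaped_def I'_def)
  let ?S = "stalk (p0 + 1) {i}"
  have i0: "{i} \<subseteq> I p0" using i by simp
  define f where "f = (\<lambda>p x. if p = p0 + 1 then dif U p0 x else (\<lambda>j. \<zero>))"
  have cS: "cx ?S" by (rule cx_stalk) simp
  have e1: "I' (p0 + 1) = I (p0 + 1)" by (simp add: I'_def)
  have f: "f \<in> chain_maps R ?S U'"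
  proof (rule cmI)
    fix p
    show "f p \<in> rhom R (obj ?S p) (obj U' p)"
    proof (cases "p = p0 + 1")
      case True
      then show ?thesis using rhom_comp[OF incl_rhom[OF i0] dU[of p0]] by (simp add: f_def e1)
    next
      case False
      then show ?thesis using rhom_zero[OF rmd_std[of "I' p"]] by (simp add: f_def)
    qed
    fix x assume x: "x \<in> carrier (obj ?S p)"
    have z: "dif U p (\<lambda>j. \<zero>) = (\<lambda>j. \<zero>)" for p using rhom_0[OF rmd_std rmd_std dU, of p] by simp
    have "f (p + 1) (\<lambda>j. \<zero>) = (\<lambda>j. \<zero>)" using z[of p0] by (simp add: f_def)
    moreover have "dif U p (f p x) = (\<lambda>j. \<zero>)"
    proof (cases "p = p0 + 1")
      case True
      then have "x \<in> carrier (std (I p0))" using x std_mono[OF _ i0] by simp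
      then show ?thesis using dd True by (simp add: f_def)
    qed (simp add: f_def z)
    ultimately show "f (p + 1) (dif ?S p x) = dif U' p (f p x)" by simp
  qed
  let ?C = "cone ?S U' f"
  note C = cx_cone[OF cS cU' f]
  \<comment> \<open>The indices that the stalk complex contributes to the cone in degree p; together
    with \<open>I' p\<close> they partition \<open>I p\<close>.\<close>
  define K where "K = (\<lambda>p. if p = p0 then {i} else {})"
  have KI: "K p \<union> I' p = I p" "K p \<inter> I' p = {}" for p using i by (auto simp: K_def I'_def)
  have oC: "obj ?C p = sum_rmod (std (K p)) (std (I' p))" for p by (simp add: K_def)
  define H where "H = (\<lambda>(p::int) z (j::nat). lft z j \<oplus> rgt z j)"
  have H: "H \<in> chain_maps R ?C U"
  proof (rule cmI)
    fix p
    have *: "(\<lambda>x. x) \<in> rhom R (std (K p)) (std (I p))" "(\<lambda>x. x) \<in> rhom R (std (I' p)) (std (I p))"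
      by (rule incl_rhom, use KI in blast)+
    show "H p \<in> rhom R (obj ?C p) (obj U p)"
      using rhom_plus[OF rmd_std rhom_comp[OF rhom_lft *(1)] rhom_comp[OF rhom_rgt *(2)]]
      unfolding oC by (simp add: H_def oU)
    fix z assume "z \<in> carrier (obj ?C p)"
    then have z: "lft z \<in> carrier (std (K p))" "rgt z \<in> carrier (std (I' p))" unfolding oC by auto
    have z': "lft z \<in> carrier (std (I p))" "rgt z \<in> carrier (std (I p))"
      using rhom_closed[OF *(1) z(1)] rhom_closed[OF *(2) z(2)] by auto
    have fl: "f (p + 1) (lft z) = dif U p (lft z)"
    proof (cases "p = p0")
      case False
      then have "lft z = \<zero>\<^bsub>std (I p)\<^esub>" using z(1) by (simp add: K_def std_empty)
      then show ?thesis using rhom_0[OF rmd_std rmd_std dU, of p] False by (simp add: f_def)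
    qed (simp add: f_def)
    have dc: "dif U p (lft z) \<in> carrier (std (I (p + 1)))" "dif U p (rgt z) \<in> carrier (std (I (p + 1)))"
      using rhom_closed[OF dU z'(1)] rhom_closed[OF dU z'(2)] by auto
    have n: "\<ominus>\<^bsub>std I''\<^esub> (\<lambda>j. \<zero>) = (\<lambda>j. \<zero>)" for I'' using m_minus_zero[OF rmd_std, of I''] by simp
    have "H (p + 1) (dif ?C p z) = (\<lambda>j. dif U p (lft z) j \<oplus> dif U p (rgt z) j)"
      using dc stdD(1)[OF dc(1)] stdD(1)[OF dc(2)] by (simp add: H_def fl n)
    also have "\<dots> = dif U p (H p z)" using rhom_add[OF dU z'] by (simp add: H_def)
    finally show "H (p + 1) (dif ?C p z) = dif U p (H p z)" .
  qed
  have iso: "isomorphic R ?C U"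
  proof (rule isoI_bij[OF C cU H])
    fix p
    show "(\<lambda>x. pair (res (K p) x) (res (I' p) x)) \<in> rhom R (obj U p) (obj ?C p)"
      unfolding oC oU by (intro rhom_pair res_rhom) (use KI in blast)+
    show "H p (pair (res (K p) x) (res (I' p) x)) = x" if "x \<in> carrier (obj U p)" for x
    proof
      fix j
      have x: "x \<in> carrier (std (I p))" using that by (simp add: oU)
      show "H p (pair (res (K p) x) (res (I' p) x)) j = x j"
        using stdD[OF x, of j] KI(1)[of p] KI(2)[of p] by (auto simp: H_def res_def)
    qed
    fix z assume "z \<in> carrier (obj ?C p)"
    then have z: "lft z \<in> carrier (std (K p))" "rgt z \<in> carrier (std (I' p))" unfolding oC by auto
    show "pair (res (K p) (H p z)) (res (I' p) (H p z)) = z"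
    proof (rule pair_eqI)
      show "lft (pair (res (K p) (H p z)) (res (I' p) (H p z))) = lft z"
      proof
        fix j show "lft (pair (res (K p) (H p z)) (res (I' p) (H p z))) j = lft z j"
          using stdD[OF z(1), of j] stdD[OF z(2), of j] KI(2)[of p] by (auto simp: H_def res_def)
      qed
      show "rgt (pair (res (K p) (H p z)) (res (I' p) (H p z))) = rgt z"
      proof
        fix j show "rgt (pair (res (K p) (H p z)) (res (I' p) (H p z))) j = rgt z j"
          using stdD[OF z(1), of j] stdD[OF z(2), of j] KI(2)[of p] by (auto simp: H_def res_def)
      qed
    qed
  qed
  show thesis by (rule that[OF _ f iso]) (use sh in \<open>simp add: I'_def\<close>)
qed

lemma shift_stalk: "shift j (stalk k I) = stalk (k - j) I"
proof -
  have n: "\<ominus>\<^bsub>std I''\<^esub> (\<lambda>j. \<zero>) = (\<lambda>j. \<zero>)" for I'' using m_minus_zero[OF rmd_std, of I''] by simp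
  have e: "p + j = k \<longleftrightarrow> p = k - j" for p by auto
  show ?thesis by (simp add: shift_def stalk_def n e cong: if_cong)
qed

lemma miso_single:
  assumes "\<epsilon> i = \<epsilon> j" shows "miso (std {i}) (std {j})"
proof -
  have h: "(\<lambda>x. sgl j' (x i')) \<in> rhom R (std {i'}) (std {j'})" if "\<epsilon> i' = \<epsilon> j'" for i' j'
    by (rule rhomI) (auto simp: sgl_def std_mem eps_closed that[symmetric] fun_eq_iff)
  have e: "sgl i' (sgl j' (x i') j') = x" if "x \<in> carrier (std {i'})" for i' j' x
    using stdD(3)[OF that] by (auto simp: sgl_def fun_eq_iff)
  show ?thesis unfolding miso_def
    by (rule bexI[OF _ h[OF assms]], rule bexI[OF _ h[OF assms[symmetric]]]) (simp add: e)
qed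

text \<open>A thick subcategory that contains the algebra contains its indecomposable summands and
  all their shifts. A shaped complex is built from these by finitely many cones, by induction on the
  total number of indices.\<close>

lemma stalk_generates:
  assumes S: "thick_subcat R S" and T: "stalk k {..<n} \<in> S"
  shows "S = Kb_proj R"
proof
  show SK: "S \<subseteq> Kb_proj R" using S by (simp add: thick_subcat_def)
  have iso: "X \<in> S \<Longrightarrow> Y \<in> Kb_proj R \<Longrightarrow> isomorphic R X Y \<Longrightarrow> Y \<in> S" for X Y
    using S unfolding thick_subcat_def by blast
  have summand: "X \<in> Kb_proj R \<Longrightarrow> Y \<in> Kb_proj R \<Longrightarrow> sum_cplx X Y \<in> S \<Longrightarrow> X \<in> S" for X Y
    using S unfolding thick_subcat_def by blast
  have sh: "X \<in> S \<Longrightarrow> shift j X \<in> S" for X j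
    using S unfolding thick_subcat_def by blast
  have fin: "finite {i}" for i :: nat by simp
  have 1: "stalk k {i} \<in> S" if "i < n" for i
  proof (rule summand[OF stalk_Kb stalk_Kb])
    have fin2: "finite ({..<n} - {i})" by simp
    have e: "{i} \<union> ({..<n} - {i}) = {..<n}" using that by auto
    have "isomorphic R (stalk k {..<n}) (sum_cplx (stalk k {i}) (stalk k ({..<n} - {i})))"
      using stalk_union[OF fin fin2, of i k] unfolding e by simp
    from iso[OF T sum_Kb[OF stalk_Kb[OF fin] stalk_Kb[OF fin2]] this]
    show "sum_cplx (stalk k {i}) (stalk k ({..<n} - {i})) \<in> S" .
  qed simp_all
  have 2: "stalk q {i} \<in> S" for q i
  proof -
    \<comment> \<open>Indices beyond n are reduced by periodicity: equal idempotents give isomorphic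
      modules.\<close>
    have "i mod n < n" using n_ge_2 by simp
    from sh[OF 1[OF this], of "k - q"] have "stalk q {i mod n} \<in> S" by (simp add: shift_stalk)
    from iso[OF this stalk_Kb[OF fin] stalk_iso[OF fin fin miso_single[OF eps_mod]]] show ?thesis .
  qed
  have 3: "U \<in> S" if "shaped U I" for U I
    using that
  proof (induction "card (Sigma {p. I p \<noteq> {}} I)" arbitrary: U I rule: less_induct)
    case less
    note U = less.prems
    show ?case
    proof (cases "{p. I p \<noteq> {}} = {}")
      case True
      then have "I p = {}" for p by blast
      then have "nullobj U" unfolding nullobj_def
        using shapedD(1,2)[OF U] by (intro htp_eq) (auto simp: cid_def czero_def mp_def std_empty)
      then have "isomorphic R U (zero_cplx R)" using null_iff[OF shapedD(1)[OF U]] by simp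
      then have "isomorphic R (zero_cplx R) U" using iso_sym[OF shapedD(1)[OF U] cx_zero] by blast
      moreover have "zero_cplx R \<in> S" using S by (simp add: thick_subcat_def)
      ultimately show ?thesis using iso shaped_Kb[OF U] by blast
    next
      case False
      define p0 where "p0 = Min {p. I p \<noteq> {}}"
      have p0: "I p0 \<noteq> {}" using Min_in[OF shapedD(4)[OF U] False] by (simp add: p0_def)
      have low: "I p = {}" if "p < p0" for p
      proof (rule ccontr)
        assume "I p \<noteq> {}"
        then have "p0 \<le> p" unfolding p0_def using Min_le[OF shapedD(4)[OF U]] by simp
        then show False using that by simp
      qed
      obtain i where i: "i \<in> I p0" using p0 by blast
      define I' where "I' = (\<lambda>p. if p = p0 then I p0 - {i} else I p)"
      obtain U' f where U': "shaped U' I'" "f \<in> chain_maps R (stalk (p0 + 1) {i}) U'"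
        "isomorphic R (cone (stalk (p0 + 1) {i}) U' f) U"
        using peel[OF U low i] unfolding I'_def by blast
      have "Sigma {p. I' p \<noteq> {}} I' = Sigma {p. I p \<noteq> {}} I - {(p0, i)}"
        by (auto simp: I'_def split: if_splits)
      moreover have "finite (Sigma {p. I p \<noteq> {}} I)" using shapedD(3,4)[OF U] by blast
      moreover have "(p0, i) \<in> Sigma {p. I p \<noteq> {}} I" using i by blast
      ultimately have "card (Sigma {p. I' p \<noteq> {}} I') < card (Sigma {p. I p \<noteq> {}} I)"
        by (simp only: card_Diff1_less)
      from less.hyps[OF this U'(1)] have "U' \<in> S" .
      from iso[OF thick_cone[OF S 2 this U'(2)] shaped_Kb[OF U] U'(3)] show ?thesis .
    qed
  qed
  show "Kb_proj R \<subseteq> S"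
  proof
    fix U assume U: "U \<in> Kb_proj R"
    obtain U' I where U': "shaped U' I" "isomorphic R U U'" by (rule exists_shaped[OF U])
    have "isomorphic R U' U" by (rule iso_sym[OF Kb_cx[OF U] shapedD(1)[OF U'(1)] U'(2)])
    from iso[OF 3[OF U'(1)] U this] show "U \<in> S" .
  qed
qed

lemma stalk_tilting: "basic_tilting R (stalk k {..<n})"
proof -
  have fin: "finite {..<n}" by simp
  note c = cx_stalk[OF fin, of k]
  have "homotopic R (stalk k {..<n}) (shift i (stalk k {..<n})) f (czero (shift i (stalk k {..<n})))"
    if "i \<noteq> 0" "f \<in> chain_maps R (stalk k {..<n}) (shift i (stalk k {..<n}))" for i f
    using stalk_orth[OF fin, of k] that homotopic_iff[OF c cx_shift[OF c] cm_mp[OF that(2)] cm_mp[OF cm_zero[OF c cx_shift[OF c]]]]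
    unfolding orth_def by blast
  then have "tilting R (stalk k {..<n})"
    unfolding tilting_def using stalk_Kb[OF fin] stalk_generates by blast
  then show ?thesis using stalk_basic by (simp add: basic_tilting_def)
qed

section \<open>The sign of a tilting complex\<close>

text \<open>Standard models of two summands inherit orthogonality to themselves and to each other. A
  model with s = 0 that is orthogonal to itself would have a null-homotopic identity; so both
  numbers are nonzero, and their product is nonnegative by the Euler form.\<close>

lemma same_sign:
  assumes U: "cx U" "orth U U" and X: "X \<in> Kb_proj R" "retr X U" "\<not> nullobj X" "shaped X' I" "isomorphic R X X'"
    and Y: "Y \<in> Kb_proj R" "retr Y U" "\<not> nullobj Y" "shaped Y' I'" "isomorphic R Y Y'"
  shows "0 < euler I * euler I'"
proof -
  have r: "cx A' \<and> retr A' U \<and> \<not> nullobj A'" if "A \<in> Kb_proj R" "retr A U" "\<not> nullobj A" "shaped A' K" "isomorphic R A A'" for A A' K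
  proof -
    note c = Kb_cx[OF that(1)] shapedD(1)[OF that(4)]
    have "retr A' A" by (rule iso_retr[OF c(2,1) iso_sym[OF c that(5)]])
    then have "retr A' U" using retr_trans[OF c(2,1) U(1) _ that(2)] by blast
    moreover have "\<not> nullobj A'" using iso_null[OF c that(5)] that(3) by simp
    ultimately show ?thesis using c by blast
  qed
  note rX = r[OF X] and rY = r[OF Y]
  have o: "orth X' X'" "orth Y' Y'" "orth X' Y'"
    using orth_retr[OF U(1,1) _ _ U(2)] rX rY by blast+
  have nz: "euler K \<noteq> 0" if "shaped A K" "orth A A" "\<not> nullobj A" for A K
    using euler_form(2)[OF that(1,1,2) _ cm_id] that(3) by (auto simp: nullobj_def)
  have "euler I \<noteq> 0" "euler I' \<noteq> 0" using nz X(4) Y(4) o rX rY by blast+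
  then show ?thesis using euler_form(1)[OF X(4) Y(4) o(3)] by (simp add: less_le)
qed

text \<open>Asks for one model with positive characteristic; \<open>same_sign\<close> carries this
  over to every model of a nonzero summand of the same tilting complex.\<close>

definition positive :: "'a cplx \<Rightarrow> bool"
  where "positive M \<longleftrightarrow> (\<exists>M' I. shaped M' I \<and> isomorphic R M M' \<and> 0 < euler I)"

text \<open>The exchange property is applied copy by copy; the empty sum is contractible and has no
  indecomposable retract.\<close>

lemma retr_replicate:
  assumes X: "shaped X I" and ind: "indecomposable R X" and M: "cx M" 
  shows "retr X (sum_list_cplx R (replicate l M)) \<Longrightarrow> retr X M"
proof (induction l)
  case 0
  then have "nullobj X" using retr_nullobj[OF shapedD(1)[OF X] cx_zero _ nullobj_zero] by (simp add: sum_list_cplx_def)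
  then show ?case using indec_not_null[OF ind] by simp
next
  case (Suc l)
  have "cx (sum_list_cplx R (replicate l M))" by (rule cx_sum_list) (use M in auto)
  from retr_sum_cases[OF X ind M this] Suc show ?case by (auto simp: sum_list_Cons)
qed

lemma retr_iso:
  assumes X: "indecomposable R X" and Y: "indecomposable R Y" and r: "retr X Y"
  shows "isomorphic R X Y"
proof -
  have K: "X \<in> Kb_proj R" "Y \<in> Kb_proj R" using X Y by (auto simp: indecomposable_def)
  note c = K[THEN Kb_cx]
  obtain Y' I where Y': "shaped Y' I" "isomorphic R Y Y'" by (rule exists_shaped[OF K(2)])
  note cY' = shapedD(1)[OF Y'(1)]
  have "retr X Y'" using retr_trans[OF c cY' r iso_retr[OF c(2) cY' Y'(2)]] .
  from retr_indec_iso[OF c(1) indec_not_null[OF X] Y'(1) indecomposable_iso[OF Y shaped_Kb[OF Y'(1)] Y'(2)] this]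
  have "isomorphic R X Y'" .
  then show ?thesis using iso_trans[OF c(1) cY' c(2) _ iso_sym[OF c(2) cY' Y'(2)]] by blast
qed

lemma retr_cases:
  assumes X: "indecomposable R X" and Z: "cx Z" and W: "cx W" and r: "retr X (sum_cplx Z W)"
  shows "retr X Z \<or> retr X W"
proof -
  have K: "X \<in> Kb_proj R" using X by (simp add: indecomposable_def)
  note c = Kb_cx[OF K]
  obtain X' I where X': "shaped X' I" "isomorphic R X X'" by (rule exists_shaped[OF K])
  note cX' = shapedD(1)[OF X'(1)]
  have r': "retr X X'" "retr X' X" using iso_retr[OF c cX' X'(2)] iso_retr[OF cX' c iso_sym[OF c cX' X'(2)]] by auto
  have "retr X' Z \<or> retr X' W"
    by (rule retr_sum_cases[OF X'(1) indecomposable_iso[OF X shaped_Kb[OF X'(1)] X'(2)] Z W])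
      (rule retr_trans[OF cX' c cx_sum[OF Z W] r'(2) r])
  then show ?thesis using retr_trans[OF c cX' Z r'(1)] retr_trans[OF c cX' W r'(1)] by blast
qed

text \<open>X is a retract of a finite sum of copies of M, hence of a single copy.\<close>

lemma retr_add_closure:
  assumes X: "indecomposable R X" and M: "M \<in> Kb_proj R" and M': "M' \<in> add_closure R M" and iso: "isomorphic R X M'"
  shows "retr X M"
proof -
  have K: "X \<in> Kb_proj R" using X by (simp add: indecomposable_def)
  note c = Kb_cx[OF K] and cM = Kb_cx[OF M]
  obtain X' I where X': "shaped X' I" "isomorphic R X X'" by (rule exists_shaped[OF K])
  note cX' = shapedD(1)[OF X'(1)]
  obtain N' l where N': "M' \<in> Kb_proj R" "N' \<in> Kb_proj R" "isomorphic R (sum_cplx M' N') (sum_list_cplx R (replicate l M))"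
    using M' unfolding add_closure_def by blast
  note cN = N'(1,2)[THEN Kb_cx]
  have cL: "cx (sum_list_cplx R (replicate l M))" by (rule cx_sum_list) (use cM in auto)
  have 1: "retr M' (sum_list_cplx R (replicate l M))"
    by (rule retr_trans[OF cN(1) cx_sum[OF cN] cL retr_sum_l[OF cN] iso_retr[OF cx_sum[OF cN] cL N'(3)]])
  have "isomorphic R X' M'" by (rule iso_trans[OF cX' c cN(1) iso_sym[OF c cX' X'(2)] iso])
  from retr_trans[OF cX' cN(1) cL iso_retr[OF cX' cN(1) this] 1]
  have "retr X' M" by (rule retr_replicate[OF X'(1) indecomposable_iso[OF X shaped_Kb[OF X'(1)] X'(2)] cM])
  then show ?thesis using retr_trans[OF c cX' cM iso_retr[OF c cX' X'(2)]] by blast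
qed

text \<open>
  Along a sequence of mutations some nonzero summand keeps a positive Euler characteristic. The last
  clause excludes mutations of an indecomposable tilting complex \<open>T\<close>, which would lead to \<open>T[1]\<close>.
\<close>

definition mut_inv :: "'a cplx \<Rightarrow> bool"
  where "mut_inv U \<longleftrightarrow> U \<in> Kb_proj R \<and> (\<exists>M \<in> Kb_proj R. \<not> nullobj M \<and> retr M U \<and> positive M) \<and>
    (basic_tilting R U \<longrightarrow> \<not> indecomposable R U)"

text \<open>The common part of left and right mutations: their triangles enter only through the
  consequence \<open>isomorphic R X M'\<close> of Y = 0.\<close>

lemma mutation_step:
  assumes inv: "mut_inv U" and bt: "basic_tilting R U" and X: "indecomposable R X" and M: "M \<in> Kb_proj R"
    and U: "isomorphic R U (sum_cplx X M)" and V: "V \<in> Kb_proj R" "isomorphic R V (sum_cplx Y M)" and Y: "Y \<in> Kb_proj R"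
    and M': "M' \<in> add_closure R M" and XM': "nullobj Y \<Longrightarrow> isomorphic R X M'"
  shows "mut_inv V"
proof -
  have K: "U \<in> Kb_proj R" "X \<in> Kb_proj R" using inv X by (auto simp: mut_inv_def indecomposable_def)
  note cU = Kb_cx[OF K(1)] and cX = Kb_cx[OF K(2)] and cM = Kb_cx[OF M] and cV = Kb_cx[OF V(1)] and cY = Kb_cx[OF Y]
  note cXM = cx_sum[OF cX cM] and cYM = cx_sum[OF cY cM]
  have nU: "\<not> indecomposable R U" using inv bt by (simp add: mut_inv_def)
  \<comment> \<open>If M were zero, U would be isomorphic to X and thus indecomposable.\<close>
  have Mn: "\<not> nullobj M"
  proof
    assume "nullobj M"
    from iso_trans[OF cU cXM cX U sum_null_r[OF cX cM this]] have "isomorphic R U X" .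
    from indecomposable_iso[OF X K(1) iso_sym[OF cU cX this]] nU show False by simp
  qed
  have o: "orth U U" using bt tilting_orth by (simp add: basic_tilting_def)
  have rM: "retr M U"
    by (rule retr_trans[OF cM cXM cU retr_sum_r[OF cX cM] iso_retr[OF cXM cU iso_sym[OF cU cXM U]]])
  \<comment> \<open>M and the positive summand recorded by the invariant are both nonzero summands
    of the tilting complex U, so their signs agree.\<close>
  have pM: "positive M"
  proof -
    obtain M0 M1 I where M0: "M0 \<in> Kb_proj R" "retr M0 U" "\<not> nullobj M0" "shaped M1 I" "isomorphic R M0 M1" "0 < euler I"
      using inv unfolding mut_inv_def positive_def by blast
    obtain M2 I2 where M2: "shaped M2 I2" "isomorphic R M M2" by (rule exists_shaped[OF M])
    have "0 < euler I * euler I2" by (rule same_sign[OF cU o M0(1-5) M rM Mn M2])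
    then have "0 < euler I2" using M0(6) by (simp add: zero_less_mult_iff)
    then show ?thesis using M2 unfolding positive_def by blast
  qed
  have rV: "retr M V"
    by (rule retr_trans[OF cM cYM cV retr_sum_r[OF cY cM] iso_retr[OF cYM cV iso_sym[OF cV cYM V(2)]]])
  \<comment> \<open>An indecomposable V forces Y = 0, so M is isomorphic to V and indecomposable,
    and X is isomorphic to M. Then all members of the list \<open>Xs\<close> that shows U to be
    basic are isomorphic to M, and the list has at most one member. Length 0 contradicts M \<noteq>
    0, and length 1 would make U indecomposable.\<close>
  have "\<not> indecomposable R V"
  proof
    assume iV: "indecomposable R V"
    then have "isomorphic R Y (zero_cplx R) \<or> isomorphic R M (zero_cplx R)"
      using V(2) Y M unfolding indecomposable_def by blast
    then have nY: "nullobj Y" using Mn null_iff[OF cM] null_iff[OF cY] by blast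
    have "isomorphic R V M" by (rule iso_trans[OF cV cYM cM V(2) sum_null_l[OF cY cM nY]])
    then have iM: "indecomposable R M" by (rule indecomposable_iso[OF iV M])
    have "retr X M" by (rule retr_add_closure[OF X M M' XM'[OF nY]])
    then have XM: "isomorphic R X M" by (rule retr_iso[OF X iM])
    obtain Xs where Xs: "\<forall>X \<in> set Xs. indecomposable R X"
      "\<forall>i j. i < j \<and> j < length Xs \<longrightarrow> \<not> isomorphic R (Xs ! i) (Xs ! j)"
      "isomorphic R U (sum_list_cplx R Xs)" using bt unfolding basic_tilting_def basic_def by blast
    have cXs: "cx Z" if "Z \<in> set Xs" for Z using Xs(1) that Kb_cx unfolding indecomposable_def by blast
    note cL = cx_sum_list[of Xs, OF cXs]
    have ZM: "isomorphic R Z M" if Z: "Z \<in> set Xs" for Z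
    proof -
      have iZ: "indecomposable R Z" using Xs(1) Z by blast
      note cZ = cXs[OF Z]
      have "retr Z U"
        by (rule retr_trans[OF cZ cL cU retr_sum_list[OF cXs Z] iso_retr[OF cL cU iso_sym[OF cU cL Xs(3)]]])
      from retr_trans[OF cZ cU cXM this iso_retr[OF cU cXM U]] have "retr Z X \<or> retr Z M"
        by (rule retr_cases[OF iZ cX cM])
      then show ?thesis
        using retr_iso[OF iZ X] retr_iso[OF iZ iM] iso_trans[OF cZ cX cM _ XM] by blast
    qed
    consider "Xs = []" | Z where "Xs = [Z]" | Z W Ys where "Xs = Z # W # Ys"
      by (metis neq_Nil_conv)
    then show False
    proof cases
      case 1
      then have "nullobj U" using Xs(3) null_iff[OF cU] by (simp add: sum_list_cplx_def)
      then show False using retr_nullobj[OF cM cU rM] Mn by simp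
    next
      case 2
      note cZ = cXs[of Z, unfolded 2, simplified]
      have "isomorphic R U (sum_cplx Z (zero_cplx R))" using Xs(3) 2 by (simp add: sum_list_cplx_def)
      from iso_trans[OF cU cx_sum[OF cZ cx_zero] cZ this sum_null_r[OF cZ cx_zero nullobj_zero]]
      have "isomorphic R U Z" .
      from iso_sym[OF cU cZ this] have "isomorphic R Z U" .
      then show False using indecomposable_iso[OF _ K(1)] Xs(1) 2 nU by auto
    next
      case 3
      have z: "Z \<in> set Xs" "W \<in> set Xs" using 3 by auto
      have "isomorphic R Z W"
        by (rule iso_trans[OF cXs[OF z(1)] cM cXs[OF z(2)] ZM[OF z(1)] iso_sym[OF cXs[OF z(2)] cM ZM[OF z(2)]]])
      moreover have "\<not> isomorphic R (Xs ! 0) (Xs ! 1)" using Xs(2)[rule_format, of 0 1] 3 by simp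
      ultimately show False using 3 by simp
    qed
  qed
  then show ?thesis unfolding mut_inv_def using V(1) M Mn rV pM by blast
qed

lemma left_mutation_inv: "mut_inv U \<Longrightarrow> left_mutation R U V \<Longrightarrow> mut_inv V"
proof -
  assume inv: "mut_inv U" and "left_mutation R U V"
  then obtain X M M' Y f g h where h: "basic_tilting R U" "V \<in> Kb_proj R" "indecomposable R X" "M \<in> Kb_proj R"
    "isomorphic R U (sum_cplx X M)" "min_left_approx R M X M' f" "triangle R X M' Y f g h" "isomorphic R V (sum_cplx Y M)"
    unfolding left_mutation_def by blast
  have Y: "Y \<in> Kb_proj R" using h(7) by (simp add: triangle_def)
  have M': "M' \<in> add_closure R M" using h(6) by (simp add: min_left_approx_def)
  show ?thesis by (rule mutation_step[OF inv h(1,3,4,5,2,8) Y M' triangle_third_null[OF h(7)]])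
qed

lemma right_mutation_inv: "mut_inv U \<Longrightarrow> right_mutation R U V \<Longrightarrow> mut_inv V"
proof -
  assume inv: "mut_inv U" and "right_mutation R U V"
  then obtain X M M' Y f g h where h: "basic_tilting R U" "V \<in> Kb_proj R" "indecomposable R X" "M \<in> Kb_proj R"
    "isomorphic R U (sum_cplx X M)" "min_right_approx R M X M' f" "triangle R Y M' X g f h" "isomorphic R V (sum_cplx Y M)"
    unfolding right_mutation_def by blast
  have K: "Y \<in> Kb_proj R" "X \<in> Kb_proj R" "M' \<in> Kb_proj R" using h(7) by (simp_all add: triangle_def)
  have M': "M' \<in> add_closure R M" using h(6) by (simp add: min_right_approx_def)
  have "isomorphic R X M'" if "nullobj Y"
    using iso_sym[OF Kb_cx[OF K(3)] Kb_cx[OF K(2)] triangle_first_null[OF h(7) that]] .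
  then show ?thesis by (rule mutation_step[OF inv h(1,3,4,5,2,8) K(1) M'])
qed

lemma euler_stalk: "finite I \<Longrightarrow> euler (\<lambda>p. if p = k then I else {}) = (if even k then 1 else - 1) * int (card I)"
proof -
  assume "finite I"
  have "euler (\<lambda>p. if p = k then I else {}) =
    (\<Sum>p\<in>{k}. (if even p then 1 else - 1) * int (card (if p = k then I else {})))"
    unfolding euler_def by (rule sum.mono_neutral_left) (auto split: if_splits)
  then show ?thesis by simp
qed

theorem not_tilting_connected: "\<not> tilting_connected R"
proof
  assume "tilting_connected R"
  \<comment> \<open>The two complexes to be separated are the algebra in degree 0 and in degree 1;
    moving it by one degree reverses the sign of the Euler characteristic.\<close>
  let ?T = "\<lambda>k. stalk k {..<n}"
  have fin: "finite {..<n}" by simp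
  from \<open>tilting_connected R\<close> obtain V where
    V: "(\<lambda>U V. left_mutation R U V \<or> right_mutation R U V)\<^sup>*\<^sup>* (?T 0) V" "isomorphic R V (?T 1)"
    unfolding tilting_connected_def using stalk_tilting by blast
  note c = cx_stalk[OF fin] and K = stalk_Kb[OF fin] and sh = stalk_shaped[OF fin]
  have ne: "{..<n} \<noteq> {}" using n_ge_2 by (metis lessThan_empty_iff not_numeral_le_zero)
  note nn = stalk_not_null[OF fin ne]
  have "mut_inv (?T 0)"
    unfolding mut_inv_def
  proof (intro conjI impI K bexI)
    show "\<not> nullobj (?T 0)" by (rule nn)
    show "retr (?T 0) (?T 0)" by (rule iso_retr[OF c c iso_refl[OF c]])
    show "positive (?T 0)" unfolding positive_def
      using sh[of 0] iso_refl[OF c] euler_stalk[OF fin, of 0] n_ge_2 by (intro exI conjI) auto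
    show "\<not> indecomposable R (?T 0)"
    proof
      assume ind: "indecomposable R (?T 0)"
      let ?A = "stalk 0 {0}" and ?B = "stalk 0 ({..<n} - {0})"
      have f: "finite {0::nat}" "finite ({..<n} - {0})" by auto
      have e: "{0} \<union> ({..<n} - {0}) = {..<n}" using n_ge_2 by auto
      have "isomorphic R (?T 0) (sum_cplx ?A ?B)" using stalk_union[OF f, of 0] unfolding e by simp
      then have "isomorphic R ?A (zero_cplx R) \<or> isomorphic R ?B (zero_cplx R)"
        using ind stalk_Kb[OF f(1)] stalk_Kb[OF f(2)] unfolding indecomposable_def by blast
      moreover have "1 \<in> {..<n} - {0}" using n_ge_2 by auto
      ultimately show False
        using null_iff[OF cx_stalk[OF f(1)], of 0] null_iff[OF cx_stalk[OF f(2)], of 0]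
          stalk_not_null[OF f(1), of 0] stalk_not_null[OF f(2), of 0] by blast
    qed
  qed (rule K)
  with V(1) have "mut_inv V"
    by (induction rule: rtranclp_induct) (auto intro: left_mutation_inv right_mutation_inv)
  then obtain M M' I where VK: "V \<in> Kb_proj R" and M: "M \<in> Kb_proj R" "retr M V" "\<not> nullobj M" "shaped M' I" "isomorphic R M M'" "0 < euler I"
    unfolding mut_inv_def positive_def by blast
  \<comment> \<open>A positive summand of V becomes a summand of the algebra in degree 1, whose
    characteristic is negative.\<close>
  have "retr M (?T 1)" by (rule retr_trans[OF Kb_cx[OF M(1)] Kb_cx[OF VK] c M(2) iso_retr[OF Kb_cx[OF VK] c V(2)]])
  from same_sign[OF c stalk_orth[OF fin] M(1) this M(3-5) K iso_retr[OF c c iso_refl[OF c]] nn sh iso_refl[OF c]]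
  have "0 < euler I * euler (\<lambda>p. if p = 1 then {..<n} else {})" .
  then show False using M(6) euler_stalk[OF fin, of 1] by (simp add: zero_less_mult_iff mult_less_0_iff)
qed

end

section \<open>The path algebra\<close>

context brauer_graph
begin

lemma edge_in_edges: "h \<in> halves G \<Longrightarrow> edge_of G h \<in> edges G"
  by (simp add: edges_def)

lemma arrows_halves: "h \<in> arrows G \<Longrightarrow> h \<in> halves G"
  by (simp add: arrows_def)

lemma nxt_closed: "h \<in> halves G \<Longrightarrow> nxt G h \<in> halves G"
  using nxt_bij by (auto simp: bij_betw_def)

lemma walk_start: "is_walk G e hs \<Longrightarrow> e \<in> edges G"
  by (cases hs) (auto simp: edge_in_edges arrows_halves)

lemma walk_end_edges: "is_walk G e hs \<Longrightarrow> walk_end G e hs \<in> edges G"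
  by (induction hs arbitrary: e) auto

lemma walk_end_append: "walk_end G e (xs @ ys) = walk_end G (walk_end G e xs) ys"
  by (induction xs arbitrary: e) auto

lemma walk_append: "is_walk G e (xs @ ys) \<longleftrightarrow> is_walk G e xs \<and> is_walk G (walk_end G e xs) ys"
  by (induction xs arbitrary: e) (auto dest: walk_start)

abbreviation PA :: "('h path \<Rightarrow> 'k::field) ring"
  where "PA \<equiv> path_algebra G"

lemma PA_carrier: "f \<in> carrier PA \<longleftrightarrow> finite {p. f p \<noteq> 0} \<and> {p. f p \<noteq> 0} \<subseteq> paths G"
  by (simp add: path_algebra_def)

lemma PA_zero_outside: "f \<in> carrier PA \<Longrightarrow> \<not> is_walk G e hs \<Longrightarrow> f (e, hs) = 0"
  by (auto simp: PA_carrier paths_def)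

lemma PA_simps [simp]:
  "\<zero>\<^bsub>PA\<^esub> = (\<lambda>p. 0)" "f \<oplus>\<^bsub>PA\<^esub> g = (\<lambda>p. f p + g p)"
  "\<one>\<^bsub>PA\<^esub> = (\<lambda>(e, hs). if e \<in> edges G \<and> hs = [] then 1 else 0)"
  by (simp_all add: path_algebra_def)

lemma PA_mult: "(f \<otimes>\<^bsub>PA\<^esub> g) (e, hs) = (\<Sum>i\<le>length hs. f (e, take i hs) * g (walk_end G e (take i hs), drop i hs))"
  by (simp add: path_algebra_def)

lemma PA_mult_closed:
  fixes f g :: "'h path \<Rightarrow> 'k::field"
  assumes f: "f \<in> carrier PA" and g: "g \<in> carrier PA"
  shows "f \<otimes>\<^bsub>PA\<^esub> g \<in> carrier PA"
proof -
  let ?F = "{p. f p \<noteq> 0}" and ?G = "{p. g p \<noteq> 0}"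
  have nz: "\<exists>i \<le> length hs. f (e, take i hs) \<noteq> 0 \<and> g (walk_end G e (take i hs), drop i hs) \<noteq> 0"
    if "(f \<otimes>\<^bsub>PA\<^esub> g) (e, hs) \<noteq> 0" for e hs
  proof (rule ccontr)
    assume "\<not> ?thesis"
    then have "(f \<otimes>\<^bsub>PA\<^esub> g) (e, hs) = 0" unfolding PA_mult by (intro sum.neutral) auto
    then show False using that by simp
  qed
  \<comment> \<open>Every path in the support of a product is a concatenation of paths from the two
    supports.\<close>
  have "{p. (f \<otimes>\<^bsub>PA\<^esub> g) p \<noteq> 0} \<subseteq> (\<lambda>((e, xs), (e', ys)). (e, xs @ ys)) ` (?F \<times> ?G)"
  proof
    fix p assume p: "p \<in> {p. (f \<otimes>\<^bsub>PA\<^esub> g) p \<noteq> 0}"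
    obtain e hs where ph: "p = (e, hs)" by (cases p)
    from p obtain i where i: "f (e, take i hs) \<noteq> 0" "g (walk_end G e (take i hs), drop i hs) \<noteq> 0"
      using nz[of e hs] by (auto simp: ph)
    then show "p \<in> (\<lambda>((e, xs), (e', ys)). (e, xs @ ys)) ` (?F \<times> ?G)"
      by (intro image_eqI[of _ _ "((e, take i hs), (walk_end G e (take i hs), drop i hs))"]) (auto simp: ph)
  qed
  moreover have "finite ((\<lambda>((e, xs), (e', ys)). (e, xs @ ys)) ` (?F \<times> ?G))"
    using f g by (auto simp: PA_carrier)
  ultimately have fin: "finite {p. (f \<otimes>\<^bsub>PA\<^esub> g) p \<noteq> 0}" by (rule finite_subset)
  have "is_walk G e hs" if "(f \<otimes>\<^bsub>PA\<^esub> g) (e, hs) \<noteq> 0" for e hs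
  proof -
    from nz[OF that] obtain i where "f (e, take i hs) \<noteq> 0" "g (walk_end G e (take i hs), drop i hs) \<noteq> 0" by blast
    then have "is_walk G e (take i hs)" "is_walk G (walk_end G e (take i hs)) (drop i hs)"
      using PA_zero_outside f g by blast+
    then have "is_walk G e (take i hs @ drop i hs)" by (simp only: walk_append simp_thms)
    then show ?thesis by simp
  qed
  then show ?thesis using fin by (auto simp: PA_carrier paths_def)
qed

text \<open>Both sides sum over the ways to cut a path into three pieces; the triangular sum is
  reindexed by the lengths of the first two pieces.\<close>

lemma PA_mult_assoc:
  fixes f g h :: "'h path \<Rightarrow> 'k::field"
  shows "f \<otimes>\<^bsub>PA\<^esub> g \<otimes>\<^bsub>PA\<^esub> h = f \<otimes>\<^bsub>PA\<^esub> (g \<otimes>\<^bsub>PA\<^esub> h)"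
proof
  fix p :: "'h path" obtain e hs where p: "p = (e, hs)" by (cases p)
  let ?t = "\<lambda>a b. f (e, take a hs) * g (walk_end G e (take a hs), take b (drop a hs)) *
      h (walk_end G e (take (a + b) hs), drop (a + b) hs)"
  have "(f \<otimes>\<^bsub>PA\<^esub> g \<otimes>\<^bsub>PA\<^esub> h) (e, hs) = (\<Sum>i\<le>length hs. \<Sum>j\<le>i. ?t j (i - j))"
    unfolding PA_mult
    by (rule sum.cong) (auto simp: PA_mult sum_distrib_right min_absorb1 min_absorb2 drop_take intro!: sum.cong)
  also have "\<dots> = (\<Sum>(a, b) | a + b \<le> length hs. ?t a b)" by (rule sum.triangle_reindex_eq[symmetric])
  also have "\<dots> = (\<Sum>a\<le>length hs. \<Sum>b\<le>length hs - a. ?t a b)"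
    by (subst sum.Sigma, simp, simp, rule sum.cong) auto
  also have "\<dots> = (f \<otimes>\<^bsub>PA\<^esub> (g \<otimes>\<^bsub>PA\<^esub> h)) (e, hs)"
    unfolding PA_mult
    by (rule sum.cong) (auto simp: PA_mult sum_distrib_left mult.assoc add.commute take_add walk_end_append intro!: sum.cong)
  finally show "(f \<otimes>\<^bsub>PA\<^esub> g \<otimes>\<^bsub>PA\<^esub> h) p = (f \<otimes>\<^bsub>PA\<^esub> (g \<otimes>\<^bsub>PA\<^esub> h)) p" by (simp add: p)
qed

text \<open>The scalar t as t times the sum of all trivial paths; this is the structure map of the
  K-algebra.\<close>

definition scal :: "'k::field \<Rightarrow> 'h path \<Rightarrow> 'k"
  where "scal t = (\<lambda>(e, hs). if e \<in> edges G \<and> hs = [] then t else 0)"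

lemma finite_edges: "finite (edges G)"
  by (simp add: edges_def finite_halves)

lemma scal_closed: "scal t \<in> carrier PA"
proof -
  have "{p. scal t p \<noteq> 0} \<subseteq> (\<lambda>e. (e, [])) ` edges G" by (auto simp: scal_def split: if_splits)
  then show ?thesis unfolding PA_carrier using finite_edges by (auto simp: paths_def intro: finite_subset)
qed

lemma scal_mult: "f \<in> carrier PA \<Longrightarrow> scal t \<otimes>\<^bsub>PA\<^esub> f = (\<lambda>p. t * f p)"
proof
  fix p :: "'h path" assume f: "f \<in> carrier PA"
  obtain e hs where p: "p = (e, hs)" by (cases p)
  have "(scal t \<otimes>\<^bsub>PA\<^esub> f) (e, hs) = (\<Sum>i\<in>{0}. scal t (e, take i hs) * f (walk_end G e (take i hs), drop i hs))"
    unfolding PA_mult by (rule sum.mono_neutral_right) (auto simp: scal_def)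
  also have "\<dots> = t * f (e, hs)" using PA_zero_outside[OF f, of e hs] walk_start[of e hs] by (auto simp: scal_def)
  finally show "(scal t \<otimes>\<^bsub>PA\<^esub> f) p = t * f p" by (simp add: p)
qed

lemma mult_scal: "f \<in> carrier PA \<Longrightarrow> f \<otimes>\<^bsub>PA\<^esub> scal t = (\<lambda>p. t * f p)"
proof
  fix p :: "'h path" assume f: "f \<in> carrier PA"
  obtain e hs where p: "p = (e, hs)" by (cases p)
  have "(f \<otimes>\<^bsub>PA\<^esub> scal t) (e, hs) = (\<Sum>i\<in>{length hs}. f (e, take i hs) * scal t (walk_end G e (take i hs), drop i hs))"
    unfolding PA_mult by (rule sum.mono_neutral_right) (auto simp: scal_def)
  also have "\<dots> = t * f (e, hs)" using PA_zero_outside[OF f, of e hs] walk_end_edges[of e hs] by (auto simp: scal_def)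
  finally show "(f \<otimes>\<^bsub>PA\<^esub> scal t) p = t * f p" by (simp add: p)
qed

lemma PA_one: "\<one>\<^bsub>PA\<^esub> = scal 1" by (simp add: scal_def)

lemma smult_closed: "f \<in> carrier PA \<Longrightarrow> (\<lambda>p. t * f p) \<in> carrier PA"
  using PA_mult_closed[OF scal_closed, of f t] scal_mult[of f t] by simp

lemma ring_PA: "ring (PA :: ('h path \<Rightarrow> 'k::field) ring)"
proof (rule ringI)
  show "abelian_group (PA :: ('h path \<Rightarrow> 'k) ring)"
  proof (rule abelian_groupI)
    fix f g :: "'h path \<Rightarrow> 'k" assume fg: "f \<in> carrier PA" "g \<in> carrier PA"
    have "{p. f p + g p \<noteq> 0} \<subseteq> {p. f p \<noteq> 0} \<union> {p. g p \<noteq> 0}" by auto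
    then show "f \<oplus>\<^bsub>PA\<^esub> g \<in> carrier PA" using fg unfolding PA_carrier
      by (auto intro: finite_subset)
  next
    fix f :: "'h path \<Rightarrow> 'k" assume "f \<in> carrier PA"
    then show "\<exists>g\<in>carrier PA. g \<oplus>\<^bsub>PA\<^esub> f = \<zero>\<^bsub>PA\<^esub>"
      by (intro bexI[of _ "\<lambda>p. (- 1) * f p"] smult_closed) auto
  qed (auto simp: PA_carrier add.assoc add.commute)
  show "Group.monoid (PA :: ('h path \<Rightarrow> 'k) ring)"
  proof (rule monoidI)
    show "\<one>\<^bsub>PA\<^esub> \<in> carrier (PA :: ('h path \<Rightarrow> 'k) ring)" unfolding PA_one by (rule scal_closed)
    show "\<one>\<^bsub>PA\<^esub> \<otimes>\<^bsub>PA\<^esub> f = f" "f \<otimes>\<^bsub>PA\<^esub> \<one>\<^bsub>PA\<^esub> = f" if "f \<in> carrier PA" for f :: "'h path \<Rightarrow> 'k"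
      unfolding PA_one using that by (simp_all add: scal_mult mult_scal)
  qed (auto simp: PA_mult_closed PA_mult_assoc)
  fix f g h :: "'h path \<Rightarrow> 'k"
  show "(f \<oplus>\<^bsub>PA\<^esub> g) \<otimes>\<^bsub>PA\<^esub> h = f \<otimes>\<^bsub>PA\<^esub> h \<oplus>\<^bsub>PA\<^esub> g \<otimes>\<^bsub>PA\<^esub> h" "h \<otimes>\<^bsub>PA\<^esub> (f \<oplus>\<^bsub>PA\<^esub> g) = h \<otimes>\<^bsub>PA\<^esub> f \<oplus>\<^bsub>PA\<^esub> h \<otimes>\<^bsub>PA\<^esub> g"
    by (auto simp: fun_eq_iff PA_mult algebra_simps sum.distrib)
qed

lemma path_elem_closed: "is_walk G e hs \<Longrightarrow> path_elem (e, hs) \<in> carrier PA"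
  by (auto simp: PA_carrier path_elem_def paths_def)

lemma path_elem_mult:
  "path_elem (e, xs) \<otimes>\<^bsub>PA\<^esub> path_elem (walk_end G e xs, ys) = (path_elem (e, xs @ ys) :: 'h path \<Rightarrow> 'k::field)"
proof
  fix p :: "'h path" obtain e' hs where p: "p = (e', hs)" by (cases p)
  have "(path_elem (e, xs) \<otimes>\<^bsub>PA\<^esub> path_elem (walk_end G e xs, ys)) (e', hs) =
    (\<Sum>i\<le>length hs. if i = length xs then (if e' = e \<and> hs = xs @ ys then 1 else 0 :: 'k) else 0)"
    unfolding PA_mult
  proof (rule sum.cong)
    fix i assume i: "i \<in> {..length hs}"
    show "path_elem (e, xs) (e', take i hs) * path_elem (walk_end G e xs, ys) (walk_end G e' (take i hs), drop i hs) =
      (if i = length xs then (if e' = e \<and> hs = xs @ ys then 1 else 0 :: 'k) else 0)"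
    proof (cases "e' = e \<and> take i hs = xs \<and> drop i hs = ys")
      case True
      have "hs = xs @ ys" using append_take_drop_id[of i hs] True by simp
      moreover have "length (take i hs) = i" using i by simp
      then have "i = length xs" using True by simp
      ultimately have 1: "(if i = length xs then (if e' = e \<and> hs = xs @ ys then 1 else 0 :: 'k) else 0) = 1"
        using True by simp
      have "path_elem (e, xs) (e', take i hs) = (1 :: 'k)"
        "path_elem (walk_end G e xs, ys) (walk_end G e' (take i hs), drop i hs) = (1 :: 'k)"
        unfolding path_elem_def using True by simp_all
      then show ?thesis unfolding 1 by simp
    next
      case False
      have n: "i = length xs \<Longrightarrow> e' = e \<Longrightarrow> hs \<noteq> xs @ ys" using False by auto
      have 1: "(if i = length xs then (if e' = e \<and> hs = xs @ ys then 1 else 0 :: 'k) else 0) = 0"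
        by (simp split: if_split) (use n in blast)
      have "(e', take i hs) \<noteq> (e, xs) \<or> drop i hs \<noteq> ys" using False by blast
      then have "path_elem (e, xs) (e', take i hs) = (0 :: 'k) \<or>
        path_elem (walk_end G e xs, ys) (walk_end G e' (take i hs), drop i hs) = (0 :: 'k)"
        unfolding path_elem_def by simp
      then show ?thesis unfolding 1 mult_eq_0_iff .
    qed
  qed simp
  also have "\<dots> = path_elem (e, xs @ ys) (e', hs)" by (auto simp: path_elem_def)
  finally show "(path_elem (e, xs) \<otimes>\<^bsub>PA\<^esub> path_elem (walk_end G e xs, ys)) p = (path_elem (e, xs @ ys) p :: 'k)" by (simp add: p)
qed

text \<open>Trivial paths act as projections; together with \<open>mult_end\<close> this cuts out
  the corners of the algebra.\<close>

lemma start_mult: "(path_elem (e, []) \<otimes>\<^bsub>PA\<^esub> f) (e', hs) = (if e' = e then f (e', hs) else 0)"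
proof -
  have "(path_elem (e, []) \<otimes>\<^bsub>PA\<^esub> f) (e', hs) =
    (\<Sum>i\<in>{0}. path_elem (e, []) (e', take i hs) * f (walk_end G e' (take i hs), drop i hs))"
    unfolding PA_mult by (rule sum.mono_neutral_right) (auto simp: path_elem_def)
  then show ?thesis by (simp add: path_elem_def)
qed

lemma mult_end: "(f \<otimes>\<^bsub>PA\<^esub> path_elem (e, [])) (e', hs) = (if walk_end G e' hs = e then f (e', hs) else 0)"
proof -
  have "(f \<otimes>\<^bsub>PA\<^esub> path_elem (e, [])) (e', hs) =
    (\<Sum>i\<in>{length hs}. f (e', take i hs) * path_elem (e, []) (walk_end G e' (take i hs), drop i hs))"
    unfolding PA_mult by (rule sum.mono_neutral_right) (auto simp: path_elem_def)
  then show ?thesis by (simp add: path_elem_def)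
qed

end

section \<open>The defining ideal\<close>

context brauer_graph
begin

text \<open>The arc of length j that starts at h and follows the cyclic order at its vertex. Apart
  from arcs, all paths are zero in the algebra, see \<open>path_dichotomy\<close>.\<close>

definition chain :: "'h \<Rightarrow> nat \<Rightarrow> 'h list"
  where "chain h j = map (\<lambda>i. (nxt G ^^ i) h) [0..<j]"

text \<open>The length of the m(v)-th power of the cycle \<open>C\<^sub>h\<close>.\<close>

definition full :: "'h \<Rightarrow> nat"
  where "full h = mlt G (vert G h) * val G (vert G h)"

lemma npow_closed: "h \<in> halves G \<Longrightarrow> (nxt G ^^ i) h \<in> halves G"
  by (induction i) (auto simp: nxt_closed)

lemma npow_vert: "h \<in> halves G \<Longrightarrow> vert G ((nxt G ^^ i) h) = vert G h"
  by (induction i) (auto simp: nxt_vert npow_closed)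

lemma npow_inj: "h \<in> halves G \<Longrightarrow> k \<in> halves G \<Longrightarrow> (nxt G ^^ i) h = (nxt G ^^ i) k \<Longrightarrow> h = k"
proof (induction i)
  case (Suc i)
  have "inj_on (nxt G) (halves G)" using nxt_bij by (simp add: bij_betw_def)
  then show ?case using Suc npow_closed by (auto dest: inj_onD)
qed simp

lemma npow_add: "(nxt G ^^ (i + j)) h = (nxt G ^^ i) ((nxt G ^^ j) h)"
  by (simp add: funpow_add)

lemma val_pos: "h \<in> halves G \<Longrightarrow> 0 < val G (vert G h)"
  unfolding val_def using finite_halves by (intro card_gt_0_iff[THEN iffD2]) auto

text \<open>By the pigeonhole principle the iterates return to h after some r steps, r at most the
  valency. By transitivity the first r iterates are all half-edges at the vertex, so r is the
  valency and nothing is repeated.\<close>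

lemma nxt_orbit:
  assumes h: "h \<in> halves G"
  shows "(nxt G ^^ val G (vert G h)) h = h"
    and "bij_betw (\<lambda>i. (nxt G ^^ i) h) {..<val G (vert G h)} {k \<in> halves G. vert G k = vert G h}"
proof -
  let ?H = "{k \<in> halves G. vert G k = vert G h}" and ?v = "val G (vert G h)"
  let ?p = "\<lambda>i. (nxt G ^^ i) h"
  have fin: "finite ?H" and card: "card ?H = ?v" using finite_halves by (auto simp: val_def)
  have img: "?p ` A \<subseteq> ?H" for A using h npow_closed npow_vert by auto
  have "\<not> inj_on ?p {..?v}"
  proof
    assume "inj_on ?p {..?v}"
    then have "card {..?v} \<le> card ?H" using card_inj_on_le[OF _ img fin] by blast
    then show False using card by simp
  qed
  then obtain i j where ij: "i < j" "j \<le> ?v" "?p i = ?p j"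
    unfolding inj_on_def by (metis atMost_iff linorder_neqE_nat)
  define r where "r = j - i"
  have "(nxt G ^^ i) (?p r) = (nxt G ^^ i) h" using ij npow_add[of i r h] by (simp add: r_def)
  then have r: "?p r = h" using npow_inj npow_closed h by blast
  have r0: "0 < r" "r \<le> ?v" using ij by (auto simp: r_def)
  have "?H \<subseteq> ?p ` {..<r}"
  proof
    fix k assume "k \<in> ?H"
    then obtain m where m: "?p m = k" using nxt_cyclic[OF h, of k] by auto
    have "?p (m mod r) = k" using funpow_mod_eq[OF r, of m] m by simp
    then show "k \<in> ?p ` {..<r}" using r0(1) by (intro image_eqI[of _ _ "m mod r"]) auto
  qed
  then have 1: "?p ` {..<r} = ?H" using img by blast
  have "?v \<le> r" using card card_image_le[of "{..<r}" ?p] unfolding 1 by simp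
  then have rv: "r = ?v" using r0 by simp
  then show "?p ?v = h" using r by simp
  have "inj_on ?p {..<?v}" using 1 card unfolding rv by (intro eq_card_imp_inj_on) auto
  then show "bij_betw ?p {..<?v} ?H" using 1 unfolding rv bij_betw_def by blast
qed

lemma full_pos: "h \<in> halves G \<Longrightarrow> 0 < full h"
  using mlt_pos[OF vert_closed] val_pos by (fastforce simp: full_def)

lemma npow_full: "h \<in> halves G \<Longrightarrow> (nxt G ^^ full h) h = h"
  using funpow_mod_eq[OF nxt_orbit(1), of h "full h"] by (simp add: full_def)

lemma full_npow: "h \<in> halves G \<Longrightarrow> full ((nxt G ^^ i) h) = full h"
  by (simp add: full_def npow_vert)

lemma chain_length [simp]: "length (chain h j) = j" by (simp add: chain_def)

lemma chain_0 [simp]: "chain h 0 = []" by (simp add: chain_def)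

lemma chain_Suc: "chain h (Suc j) = h # chain (nxt G h) j"
  unfolding chain_def by (simp add: upt_conv_Cons map_Suc_upt[symmetric] funpow_swap1 del: upt_Suc)

lemma chain_add: "chain h (a + b) = chain h a @ chain ((nxt G ^^ a) h) b"
  by (induction a arbitrary: h) (auto simp: chain_Suc funpow_swap1)

lemma chain_eq_iff: "chain h j = chain h' j' \<longleftrightarrow> j = j' \<and> (j = 0 \<or> h = h')"
proof
  assume e: "chain h j = chain h' j'"
  then have "j = j'" by (metis chain_length)
  then show "j = j' \<and> (j = 0 \<or> h = h')" using e by (cases j) (auto simp: chain_Suc)
qed auto

lemma take_chain: "i \<le> j \<Longrightarrow> take i (chain h j) = chain h i"
  using chain_add[of h i "j - i"] by simp

lemma drop_chain: "i \<le> j \<Longrightarrow> drop i (chain h j) = chain ((nxt G ^^ i) h) (j - i)"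
  using chain_add[of h i "j - i"] by simp

lemma walk_end_chain: "walk_end G (edge_of G h) (chain h j) = edge_of G ((nxt G ^^ j) h)"
  by (induction j arbitrary: h) (auto simp: chain_Suc funpow_swap1)

lemma cyc_pow_chain: "h \<in> halves G \<Longrightarrow> cyc_pow G h = chain h (full h)"
proof -
  assume h: "h \<in> halves G"
  have "concat (replicate m (cyc G h)) = chain h (m * val G (vert G h))" for m
    by (induction m) (use chain_add[of h "val G (vert G h)"] nxt_orbit(1)[OF h] in \<open>auto simp: cyc_def chain_def[symmetric]\<close>)
  then show ?thesis by (simp add: cyc_pow_def full_def)
qed

text \<open>Cutting an arc yields two arcs, so the coordinates of a product at arcs involve only
  coordinates at arcs.\<close>

lemma mult_chain:
  "(f \<otimes>\<^bsub>PA\<^esub> g) (edge_of G h, chain h j) =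
    (\<Sum>i\<le>j. f (edge_of G h, chain h i) * g (edge_of G ((nxt G ^^ i) h), chain ((nxt G ^^ i) h) (j - i)))"
  unfolding PA_mult by (rule sum.cong) (auto simp: take_chain drop_chain walk_end_chain)

definition loop_path :: "'h \<Rightarrow> 'h path"
  where "loop_path h = (edge_of G h, chain h (full h))"

text \<open>The ideal of relations, described by the vanishing of coordinates.\<close>

definition rel_ideal :: "('h path \<Rightarrow> 'k::field) set"
  where "rel_ideal = {f \<in> carrier PA.
    (\<forall>h \<in> halves G. \<forall>j < full h. f (edge_of G h, chain h j) = 0) \<and>
    (\<forall>h \<in> halves G. f (loop_path h) + f (loop_path (opp G h)) = 0)}"

lemma edge_of_opp: "h \<in> halves G \<Longrightarrow> edge_of G (opp G h) = edge_of G h"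
  by (auto simp: edge_of_def opp_opp)

lemma loop_path_eq: "h \<in> halves G \<Longrightarrow> loop_path h = loop_path h' \<longleftrightarrow> h = h'"
  using full_pos[of h] by (auto simp: loop_path_def chain_eq_iff)

lemma arc_neq_loop:
  "h' \<in> halves G \<Longrightarrow> j < full h' \<Longrightarrow> h \<in> halves G \<Longrightarrow> (e, chain h' j) \<noteq> loop_path h"
  using full_pos[of h] by (auto simp: loop_path_def chain_eq_iff)

text \<open>Coordinates at arcs shorter than a full cycle vanish. Hence the coordinate of a product
  at a full cycle has a single term, the old coordinate times the value of the other factor at a
  trivial path. This value depends on the edge alone, so both cycles of an edge are scaled
  alike.\<close>

lemma rel_ideal_ideal: "ideal rel_ideal (PA :: ('h path \<Rightarrow> 'k::field) ring)"
proof (rule idealI[OF ring_PA])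
  interpret P: ring "PA :: ('h path \<Rightarrow> 'k) ring" by (rule ring_PA)
  show "subgroup rel_ideal (add_monoid (PA :: ('h path \<Rightarrow> 'k) ring))"
  proof (rule P.add.subgroupI)
    show "rel_ideal \<subseteq> carrier (PA :: ('h path \<Rightarrow> 'k) ring)" by (auto simp: rel_ideal_def)
    have "(\<lambda>p. 0) \<in> (rel_ideal :: ('h path \<Rightarrow> 'k) set)" using P.zero_closed by (simp add: rel_ideal_def)
    then show "(rel_ideal :: ('h path \<Rightarrow> 'k) set) \<noteq> {}" by blast
    fix f assume f: "f \<in> (rel_ideal :: ('h path \<Rightarrow> 'k) set)"
    have "\<ominus>\<^bsub>PA\<^esub> f = (\<lambda>p. (- 1) * f p)"
      by (rule P.minus_equality) (use f smult_closed[of f "- 1"] in \<open>auto simp: rel_ideal_def\<close>)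
    moreover have "f (loop_path (opp G h)) = - f (loop_path h)" if "h \<in> halves G" for h
      using f that by (auto simp: rel_ideal_def add_eq_0_iff)
    ultimately show "\<ominus>\<^bsub>PA\<^esub> f \<in> rel_ideal" using f smult_closed[of f "- 1"]
      by (simp add: rel_ideal_def)
    fix g assume g: "g \<in> (rel_ideal :: ('h path \<Rightarrow> 'k) set)"
    have "f (loop_path h) + g (loop_path h) + (f (loop_path (opp G h)) + g (loop_path (opp G h))) = 0" if "h \<in> halves G" for h
    proof -
      have "f (loop_path h) + g (loop_path h) + (f (loop_path (opp G h)) + g (loop_path (opp G h))) =
        (f (loop_path h) + f (loop_path (opp G h))) + (g (loop_path h) + g (loop_path (opp G h)))" by simp
      also have "\<dots> = 0" using f g that by (simp add: rel_ideal_def)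
      finally show ?thesis .
    qed
    then show "f \<oplus>\<^bsub>PA\<^esub> g \<in> rel_ideal" using f g P.a_closed[of f g] by (simp add: rel_ideal_def)
  qed
  fix f g :: "'h path \<Rightarrow> 'k" assume f: "f \<in> rel_ideal" and g: "g \<in> carrier PA"
  have fc: "f \<in> carrier PA" and arc: "\<And>h j. h \<in> halves G \<Longrightarrow> j < full h \<Longrightarrow> f (edge_of G h, chain h j) = 0"
    and lp: "\<And>h. h \<in> halves G \<Longrightarrow> f (loop_path h) + f (loop_path (opp G h)) = 0"
    using f by (auto simp: rel_ideal_def)
  have arc': "f (edge_of G ((nxt G ^^ i) h), chain ((nxt G ^^ i) h) j) = 0" if "h \<in> halves G" "j < full h" for h i j
    by (rule arc) (use that npow_closed full_npow in auto)
  have gl: "(g \<otimes>\<^bsub>PA\<^esub> f) (loop_path h) = g (edge_of G h, []) * f (loop_path h)" if h: "h \<in> halves G" for h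
  proof -
    have "(g \<otimes>\<^bsub>PA\<^esub> f) (loop_path h) = (\<Sum>i\<in>{0}. g (edge_of G h, chain h i) *
      f (edge_of G ((nxt G ^^ i) h), chain ((nxt G ^^ i) h) (full h - i)))"
      unfolding loop_path_def mult_chain
      by (rule sum.mono_neutral_right) (use h arc' full_pos[OF h] in auto)
    then show ?thesis by (simp add: loop_path_def)
  qed
  have lg: "(f \<otimes>\<^bsub>PA\<^esub> g) (loop_path h) = f (loop_path h) * g (edge_of G h, [])" if h: "h \<in> halves G" for h
  proof -
    have "(f \<otimes>\<^bsub>PA\<^esub> g) (loop_path h) = (\<Sum>i\<in>{full h}. f (edge_of G h, chain h i) *
      g (edge_of G ((nxt G ^^ i) h), chain ((nxt G ^^ i) h) (full h - i)))"
      unfolding loop_path_def mult_chain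
      by (rule sum.mono_neutral_right) (use h arc in auto)
    then show ?thesis using npow_full[OF h] by (simp add: loop_path_def)
  qed
  show "g \<otimes>\<^bsub>PA\<^esub> f \<in> rel_ideal"
    unfolding rel_ideal_def
  proof (intro CollectI conjI ballI allI impI)
    show "g \<otimes>\<^bsub>PA\<^esub> f \<in> carrier PA" by (rule P.m_closed[OF g fc])
    fix h assume h: "h \<in> halves G"
    show "(g \<otimes>\<^bsub>PA\<^esub> f) (edge_of G h, chain h j) = 0" if "j < full h" for j
      unfolding mult_chain by (rule sum.neutral) (use h arc' that in auto)
    show "(g \<otimes>\<^bsub>PA\<^esub> f) (loop_path h) + (g \<otimes>\<^bsub>PA\<^esub> f) (loop_path (opp G h)) = 0"
      unfolding gl[OF h] gl[OF opp_closed[OF h]] edge_of_opp[OF h] using lp[OF h]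
      by (simp flip: distrib_left)
  qed
  show "f \<otimes>\<^bsub>PA\<^esub> g \<in> rel_ideal"
    unfolding rel_ideal_def
  proof (intro CollectI conjI ballI allI impI)
    show "f \<otimes>\<^bsub>PA\<^esub> g \<in> carrier PA" by (rule P.m_closed[OF fc g])
    fix h assume h: "h \<in> halves G"
    show "(f \<otimes>\<^bsub>PA\<^esub> g) (edge_of G h, chain h j) = 0" if "j < full h" for j
      unfolding mult_chain by (rule sum.neutral) (use h arc that in auto)
    show "(f \<otimes>\<^bsub>PA\<^esub> g) (loop_path h) + (f \<otimes>\<^bsub>PA\<^esub> g) (loop_path (opp G h)) = 0"
      unfolding lg[OF h] lg[OF opp_closed[OF h]] edge_of_opp[OF h] using lp[OF h]
      by (simp flip: distrib_right)
  qed
qed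

text \<open>A path that follows successors throughout is an arc; any failure is a pair as in the
  third family of relations.\<close>

lemma walk_dichotomy:
  "is_walk G e hs \<Longrightarrow> hs \<noteq> [] \<Longrightarrow>
    hs = chain (hd hs) (length hs) \<or> (\<exists>xs h k ys. hs = xs @ [h, k] @ ys \<and> k \<noteq> nxt G h)"
proof (induction hs arbitrary: e)
  case (Cons h hs)
  show ?case
  proof (cases hs)
    case Nil
    then show ?thesis by (simp add: chain_Suc)
  next
    case (Cons k ks)
    from Cons.IH[of "edge_of G (nxt G h)"] Cons.prems Cons
    consider "hs = chain (hd hs) (length hs)" | xs h' k' ys where "hs = xs @ [h', k'] @ ys" "k' \<noteq> nxt G h'" by auto
    then show ?thesis
    proof cases
      case 1
      show ?thesis
      proof (cases "k = nxt G h")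
        case True
        then show ?thesis using 1 Cons by (simp add: chain_Suc)
      next
        case False
        then have "h # hs = [] @ [h, k] @ ks \<and> k \<noteq> nxt G h" using Cons by simp
        then show ?thesis by blast
      qed
    next
      case 2
      then have "h # hs = (h # xs) @ [h', k'] @ ys \<and> k' \<noteq> nxt G h'" by simp
      then show ?thesis by blast
    qed
  qed
qed simp

end

text \<open>Both cycles of each edge are defined, so the relations have a uniform shape. In the
  graphs of the theorem all half-edges give arrows because all valencies are at least 2.\<close>

locale brauer_all_arrows = brauer_graph G for G :: "('v, 'h) bgraph" +
  assumes arrows_all: "arrows G = halves G"
begin

lemma is_walk_chain: "h \<in> halves G \<Longrightarrow> is_walk G (edge_of G h) (chain h j)"
  by (induction j arbitrary: h) (auto simp: chain_Suc edge_in_edges arrows_all nxt_closed)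

text \<open>The paths in the second and third family are not arcs of length at most
  \<open>full\<close>, so the coordinates that define \<open>rel_ideal\<close> do not see them. In
  the first family the coefficients 1 and -1 cancel.\<close>

lemma relations_rel_ideal: "relations G \<subseteq> (rel_ideal :: ('h path \<Rightarrow> 'k::field) set)"
proof
  fix f :: "'h path \<Rightarrow> 'k" assume "f \<in> relations G"
  then consider (loop) h where "h \<in> halves G" "f = (\<lambda>p. path_elem (loop_path h) p - path_elem (loop_path (opp G h)) p)"
    | (long) h where "h \<in> halves G" "f = path_elem (edge_of G h, chain h (full h) @ [h])"
    | (bad) h k where "h \<in> halves G" "k \<in> halves G" "edge_of G k = edge_of G (nxt G h)" "k \<noteq> nxt G h"
        "f = path_elem (edge_of G h, [h, k])"
    unfolding relations_def arrows_all by (auto simp: cyc_pow_chain opp_closed loop_path_def)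
  then show "f \<in> rel_ideal"
  proof cases
    case loop
    note o = opp_closed[OF loop(1)]
    interpret P: ring "PA :: ('h path \<Rightarrow> 'k) ring" by (rule ring_PA)
    have c: "path_elem (loop_path h) \<in> carrier (PA :: ('h path \<Rightarrow> 'k) ring)" if "h \<in> halves G" for h
      unfolding loop_path_def by (rule path_elem_closed[OF is_walk_chain[OF that]])
    have "f = path_elem (loop_path h) \<oplus>\<^bsub>PA\<^esub> (\<lambda>p. (- 1) * path_elem (loop_path (opp G h)) p)" by (simp add: loop fun_eq_iff)
    then have "f \<in> carrier PA" using P.a_closed[OF c[OF loop(1)] smult_closed[OF c[OF o], of "- 1"]] by simp
    moreover have "f (edge_of G h', chain h' j) = 0" if "h' \<in> halves G" "j < full h'" for h' j
      using arc_neq_loop[OF that loop(1)] arc_neq_loop[OF that o] by (simp add: loop path_elem_def)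
    moreover have "f (loop_path h') + f (loop_path (opp G h')) = 0" if h': "h' \<in> halves G" for h'
    proof -
      have e: "loop_path h' = loop_path h \<longleftrightarrow> h' = h" "loop_path h' = loop_path (opp G h) \<longleftrightarrow> h' = opp G h"
        "loop_path (opp G h') = loop_path h \<longleftrightarrow> h' = opp G h" "loop_path (opp G h') = loop_path (opp G h) \<longleftrightarrow> h' = h"
        using loop_path_eq[OF h'] loop_path_eq[OF opp_closed[OF h']] opp_opp[OF h'] opp_opp[OF loop(1)] by metis+
      show ?thesis using opp_neq[OF loop(1)] unfolding loop(2) path_elem_def e by auto
    qed
    ultimately show ?thesis by (simp add: rel_ideal_def)
  next
    case long
    have "is_walk G (edge_of G h) (chain h (full h) @ [h])"
      unfolding walk_append walk_end_chain npow_full[OF long(1)]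
      using is_walk_chain[OF long(1)] long(1) by (simp add: arrows_all edge_in_edges nxt_closed)
    then have fc: "f \<in> carrier PA" using path_elem_closed long by blast
    have "chain h (full h) @ [h] = chain h (Suc (full h))"
      using chain_add[of h "full h" 1] npow_full[OF long(1)] by (simp add: chain_Suc)
    then have ne: "(e, chain h' j) \<noteq> (edge_of G h, chain h (full h) @ [h])" if "h' \<in> halves G" "j \<le> full h'" for e h' j
      using that by (auto simp: chain_eq_iff)
    show ?thesis using fc ne opp_closed by (auto simp: rel_ideal_def long path_elem_def loop_path_def)
  next
    case bad
    have fc: "f \<in> carrier PA"
      unfolding bad(5) by (rule path_elem_closed) (use bad in \<open>simp add: arrows_all edge_in_edges nxt_closed\<close>)
    have ne: "chain h' j \<noteq> [h, k]" for h' j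
    proof
      assume e: "chain h' j = [h, k]"
      have "j = 2" using arg_cong[OF e, of length] by simp
      then show False using e bad(4) by (auto simp: numeral_2_eq_2 chain_Suc)
    qed
    show ?thesis using fc ne by (auto simp: rel_ideal_def bad path_elem_def loop_path_def)
  qed
qed

lemma relations_carrier: "relations G \<subseteq> carrier (PA :: ('h path \<Rightarrow> 'k::field) ring)"
  using relations_rel_ideal by (auto simp: rel_ideal_def)

lemma Idl_ideal: "ideal (Idl\<^bsub>PA\<^esub> (relations G)) (PA :: ('h path \<Rightarrow> 'k::field) ring)"
  by (rule ring.genideal_ideal[OF ring_PA relations_carrier])

lemma relations_Idl: "relations G \<subseteq> Idl\<^bsub>PA\<^esub> (relations G :: ('h path \<Rightarrow> 'k::field) set)"
  by (rule ring.genideal_self[OF ring_PA relations_carrier])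

lemma Idl_smult: "f \<in> Idl\<^bsub>PA\<^esub> (relations G) \<Longrightarrow> (\<lambda>p. t * f p) \<in> Idl\<^bsub>PA\<^esub> (relations G :: ('h path \<Rightarrow> 'k::field) set)"
  using ideal.I_l_closed[OF Idl_ideal _ scal_closed, of f t] ideal.Icarr[OF Idl_ideal, of f] by (simp add: scal_mult)

text \<open>Modulo the relations a path vanishes if it contains a pair of non-consecutive arrows or
  is an arc longer than a full cycle.\<close>

lemma path_dichotomy:
  assumes w: "is_walk G e hs"
  shows "(\<exists>h \<in> halves G. \<exists>j \<le> full h. e = edge_of G h \<and> hs = chain h j) \<or>
    path_elem (e, hs) \<in> Idl\<^bsub>PA\<^esub> (relations G :: ('h path \<Rightarrow> 'k::field) set)"
proof (cases "hs = []")
  case True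
  have "e \<in> edges G" using walk_start[OF w] .
  then obtain h where "h \<in> halves G" "e = edge_of G h" by (auto simp: edges_def)
  then show ?thesis using True by (intro disjI1 bexI[of _ h] exI[of _ 0]) auto
next
  case False
  let ?I = "Idl\<^bsub>PA\<^esub> (relations G :: ('h path \<Rightarrow> 'k) set)"
  note Il = ideal.I_l_closed[OF Idl_ideal] and Ir = ideal.I_r_closed[OF Idl_ideal]
  from walk_dichotomy[OF w False] show ?thesis
  proof (elim disjE exE conjE)
    assume ch: "hs = chain (hd hs) (length hs)"
    define h j where "h = hd hs" and "j = length hs"
    have hs: "hs = chain h j" using ch by (simp add: h_def j_def)
    have h: "h \<in> halves G" "e = edge_of G h" using w False by (cases hs; auto simp: h_def arrows_all)+
    show ?thesis
    proof (cases "j \<le> full h")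
      case True
      then show ?thesis using h hs by blast
    next
      case jf: False
      \<comment> \<open>A longer arc is the full cycle, then its first arrow, which together form a
        relation, and then an arc of length r.\<close>
      define r where "r = j - Suc (full h)"
      have j: "j = full h + Suc r" using jf by (simp add: r_def)
      have "hs = chain h (full h) @ chain h (Suc r)" unfolding hs j chain_add npow_full[OF h(1)] ..
      then have hs2: "hs = (chain h (full h) @ [h]) @ chain (nxt G h) r" by (simp add: chain_Suc)
      have "path_elem (edge_of G h, chain h (full h) @ [h]) \<in> (relations G :: ('h path \<Rightarrow> 'k) set)"
        unfolding relations_def arrows_all using h(1) cyc_pow_chain[OF h(1)] by auto
      then have a: "path_elem (e, chain h (full h) @ [h]) \<in> ?I" using relations_Idl h(2) by blast
      have "is_walk G (walk_end G e (chain h (full h) @ [h])) (chain (nxt G h) r)"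
        using w unfolding hs2 walk_append by blast
      from Ir[OF a path_elem_closed[OF this]] have "path_elem (e, hs) \<in> ?I" unfolding path_elem_mult hs2 .
      then show ?thesis ..
    qed
  next
    fix xs h k ys assume hs: "hs = xs @ [h, k] @ ys" and k: "k \<noteq> nxt G h"
    have w1: "is_walk G e xs" and w2: "is_walk G (walk_end G e xs) ([h, k] @ ys)" using w unfolding hs walk_append by auto
    then have hk: "h \<in> halves G" "k \<in> halves G" "edge_of G h = walk_end G e xs" "edge_of G k = edge_of G (nxt G h)"
      by (auto simp: arrows_all)
    have "path_elem (edge_of G h, [h, k]) \<in> (relations G :: ('h path \<Rightarrow> 'k) set)"
      unfolding relations_def arrows_all using hk k by blast
    then have a: "path_elem (walk_end G e xs, [h, k]) \<in> ?I" using relations_Idl hk(3) by auto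
    have "is_walk G (walk_end G (walk_end G e xs) [h, k]) ys" using w2 unfolding walk_append by blast
    from Ir[OF a path_elem_closed[OF this]] have "path_elem (walk_end G e xs, [h, k] @ ys) \<in> ?I" unfolding path_elem_mult .
    from Il[OF this path_elem_closed[OF w1]] have "path_elem (e, hs) \<in> ?I" unfolding path_elem_mult hs .
    then show ?thesis ..
  qed
qed

text \<open>Induction on the size of the support: subtract an element g of the generated ideal,
  supported within the support of f, that agrees with f at a chosen path.\<close>

lemma rel_ideal_Idl: "f \<in> rel_ideal \<Longrightarrow> f \<in> Idl\<^bsub>PA\<^esub> (relations G :: ('h path \<Rightarrow> 'k::field) set)"
proof (induction "card {p. f p \<noteq> 0}" arbitrary: f rule: less_induct)
  case less
  let ?I = "Idl\<^bsub>PA\<^esub> (relations G :: ('h path \<Rightarrow> 'k) set)"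
  interpret I: ideal ?I "PA :: ('h path \<Rightarrow> 'k) ring" by (rule Idl_ideal)
  interpret R: ideal rel_ideal "PA :: ('h path \<Rightarrow> 'k) ring" by (rule rel_ideal_ideal)
  have f: "f \<in> carrier PA" "\<And>h j. h \<in> halves G \<Longrightarrow> j < full h \<Longrightarrow> f (edge_of G h, chain h j) = 0"
    "\<And>h. h \<in> halves G \<Longrightarrow> f (loop_path h) + f (loop_path (opp G h)) = 0"
    using less.prems unfolding rel_ideal_def by blast+
  have fin: "finite {p. f p \<noteq> 0}" using f(1) by (simp add: PA_carrier)
  show ?case
  proof (cases "{p. f p \<noteq> 0} = {}")
    case True
    then have "f = \<zero>\<^bsub>PA\<^esub>" by auto
    then show ?thesis using additive_subgroup.zero_closed[OF ideal.axioms(1)[OF Idl_ideal]] by simp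
  next
    case False
    then obtain e hs where p: "f (e, hs) \<noteq> 0" by auto
    then have w: "is_walk G e hs" using PA_zero_outside[OF f(1)] by blast
    have "\<exists>g \<in> ?I. (\<forall>p. f p = 0 \<longrightarrow> g p = 0) \<and> f (e, hs) = g (e, hs) \<and> g \<in> rel_ideal"
      using path_dichotomy[OF w, where ?'k = 'k]
    proof
      assume "\<exists>h \<in> halves G. \<exists>j \<le> full h. e = edge_of G h \<and> hs = chain h j"
      then obtain h j where h: "h \<in> halves G" "j \<le> full h" "e = edge_of G h" "hs = chain h j" by blast
      then have j: "j = full h" using f(2)[of h j] p by (cases "j < full h") auto
      then have lp: "(e, hs) = loop_path h" using h by (simp add: loop_path_def)
      \<comment> \<open>A full cycle cannot be removed by itself; a multiple of the difference of
        the two cycles of the edge is subtracted. Both lie in the support of f, as their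
        coefficients are opposite.\<close>
      define g where "g = (\<lambda>q. f (loop_path h) * (path_elem (loop_path h) q - path_elem (loop_path (opp G h)) q))"
      have "(\<lambda>q. path_elem (loop_path h) q - path_elem (loop_path (opp G h)) q) \<in> (relations G :: ('h path \<Rightarrow> 'k) set)"
        unfolding relations_def arrows_all loop_path_def cyc_pow_chain[OF h(1), symmetric]
          cyc_pow_chain[OF opp_closed[OF h(1)], symmetric]
        using h(1) opp_closed[OF h(1)] by blast
      then have "(\<lambda>q. path_elem (loop_path h) q - path_elem (loop_path (opp G h)) q) \<in> ?I" using relations_Idl by blast
      from Idl_smult[OF this, of "f (loop_path h)"] have gI: "g \<in> ?I" by (simp add: g_def)
      have "?I \<subseteq> rel_ideal" by (rule ring.genideal_minimal[OF ring_PA rel_ideal_ideal relations_rel_ideal])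
      then have gR: "g \<in> rel_ideal" using gI by blast
      have n1: "f (loop_path h) \<noteq> 0" using p lp by simp
      have n2: "f (loop_path (opp G h)) \<noteq> 0" using f(3)[OF h(1)] n1 by (metis add.right_neutral)
      have ne: "loop_path h \<noteq> loop_path (opp G h)" using loop_path_eq[OF h(1)] opp_neq[OF h(1)] by auto
      have z: "g q = 0" if "f q = 0" for q
      proof -
        have "q \<noteq> loop_path h" "q \<noteq> loop_path (opp G h)" using that n1 n2 by metis+
        then show ?thesis by (simp add: g_def path_elem_def)
      qed
      have "g (loop_path h) = f (loop_path h)" using ne by (simp add: g_def path_elem_def)
      then show ?thesis unfolding lp using gI gR z by (intro bexI[OF _ gI]) simp
    next
      assume a: "path_elem (e, hs) \<in> ?I"
      have "(\<lambda>q. f (e, hs) * path_elem (e, hs) q) \<in> ?I" by (rule Idl_smult[OF a])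
      moreover have "?I \<subseteq> rel_ideal" by (rule ring.genideal_minimal[OF ring_PA rel_ideal_ideal relations_rel_ideal])
      ultimately have "(\<lambda>q. f (e, hs) * path_elem (e, hs) q) \<in> rel_ideal" by blast
      moreover have "f (e, hs) * path_elem (e, hs) q = 0" if "f q = 0" for q
        using that by (cases "q = (e, hs)") (simp_all add: path_elem_def)
      moreover have "f (e, hs) * path_elem (e, hs) (e, hs) = f (e, hs)" by (simp add: path_elem_def)
      ultimately show ?thesis using \<open>(\<lambda>q. f (e, hs) * path_elem (e, hs) q) \<in> ?I\<close>
        by (intro bexI[of _ "\<lambda>q. f (e, hs) * path_elem (e, hs) q"]) simp_all
    qed
    then obtain g where g: "g \<in> ?I" "\<And>p. f p = 0 \<Longrightarrow> g p = 0" "f (e, hs) = g (e, hs)" "g \<in> rel_ideal" by blast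
    define f' where "f' = (\<lambda>p. f p + (- 1) * g p)"
    have "(\<lambda>p. (- 1) * g p) \<in> ?I" by (rule Idl_smult[OF g(1)])
    moreover have "?I \<subseteq> rel_ideal" by (rule ring.genideal_minimal[OF ring_PA rel_ideal_ideal relations_rel_ideal])
    ultimately have "(\<lambda>p. (- 1) * g p) \<in> rel_ideal" by blast
    then have f'R: "f' \<in> rel_ideal" using R.a_closed[OF less.prems, of "\<lambda>p. (- 1) * g p"] by (simp add: f'_def)
    have "{p. f' p \<noteq> 0} \<subset> {p. f p \<noteq> 0}"
    proof
      show "{p. f' p \<noteq> 0} \<subseteq> {p. f p \<noteq> 0}" using g(2) by (auto simp: f'_def)
      have "(e, hs) \<in> {p. f p \<noteq> 0}" "(e, hs) \<notin> {p. f' p \<noteq> 0}" using p g(3) by (auto simp: f'_def)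
      then show "{p. f' p \<noteq> 0} \<noteq> {p. f p \<noteq> 0}" by blast
    qed
    from less.hyps[OF psubset_card_mono[OF fin this] f'R] have "f' \<in> ?I" .
    from additive_subgroup.a_closed[OF ideal.axioms(1)[OF Idl_ideal] this g(1)] show ?thesis by (simp add: f'_def)
  qed
qed

lemma Idl_eq: "Idl\<^bsub>PA\<^esub> (relations G) = (rel_ideal :: ('h path \<Rightarrow> 'k::field) set)"
  using rel_ideal_Idl ring.genideal_minimal[OF ring_PA rel_ideal_ideal relations_rel_ideal] by blast

end

section \<open>Brauer graph algebras with a constant Cartan matrix\<close>

context brauer_graph
begin

text \<open>
  A label \<open>(h, j)\<close> stands for the subpath of length \<open>j\<close> of \<open>C\<^sub>h\<^bsup>m(v)\<^esup>\<close>; of the two labels of full length at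
  an edge, one stands for the socle element and the other for the trivial path.
\<close>

definition labels :: "'h set \<Rightarrow> 'h set \<Rightarrow> ('h \<times> nat) set"
  where "labels e e' = {(h, j). h \<in> e \<and> 1 \<le> j \<and> j \<le> full h \<and> edge_of G ((nxt G ^^ j) h) = e'}"

text \<open>An arbitrary choice of one half of every edge: it decides which of the two labels of
  full length stands for the socle element.\<close>

definition dist_half :: "'h set \<Rightarrow> 'h"
  where "dist_half e = (SOME h. h \<in> e)"

definition label_path :: "'h \<times> nat \<Rightarrow> 'h path"
  where "label_path = (\<lambda>(h, j). if j < full h then (edge_of G h, chain h j)
    else if h = dist_half (edge_of G h) then loop_path h else (edge_of G h, []))"

text \<open>Functionals dual to the paths \<open>label_path\<close>. The two cycles of an edge
  become equal in the algebra, so their coefficients are added.\<close>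

definition label_coord :: "'h \<times> nat \<Rightarrow> ('h path \<Rightarrow> 'k::field) \<Rightarrow> 'k"
  where "label_coord = (\<lambda>(h, j) f. if j < full h then f (edge_of G h, chain h j)
    else if h = dist_half (edge_of G h) then f (loop_path h) + f (loop_path (opp G h))
    else f (edge_of G h, []))"

lemma dist_half_cases: "h \<in> halves G \<Longrightarrow> dist_half (edge_of G h) = h \<or> dist_half (edge_of G h) = opp G h"
  using someI[of "\<lambda>k. k \<in> edge_of G h" h] by (auto simp: dist_half_def edge_of_def)

lemma edge_member: "e \<in> edges G \<Longrightarrow> h \<in> e \<Longrightarrow> h \<in> halves G \<and> edge_of G h = e"
  by (auto simp: edges_def edge_of_def opp_closed opp_opp)

lemma label_coord_add: "label_coord l (\<lambda>p. f p + g p) = label_coord l f + label_coord l g"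
  by (cases l) (simp add: label_coord_def)

lemma label_coord_scale: "label_coord l (\<lambda>p. t * f p) = t * label_coord l f"
  by (cases l) (simp add: label_coord_def distrib_left)

lemma label_coord_rel: "h \<in> halves G \<Longrightarrow> f \<in> rel_ideal \<Longrightarrow> label_coord (h, j) f = 0"
proof -
  assume h: "h \<in> halves G" and f: "f \<in> rel_ideal"
  have arc: "f (edge_of G h, chain h l) = 0" if "l < full h" for l using f h that unfolding rel_ideal_def by blast
  have "f (loop_path h) + f (loop_path (opp G h)) = 0" using f h unfolding rel_ideal_def by blast
  then show ?thesis using arc[OF full_pos[OF h]] arc by (simp add: label_coord_def)
qed

text \<open>The labels see every coordinate that defines the ideal; the trivial path at an edge is
  seen by the label of full length at the half-edge that is not chosen. With
  \<open>label_coord_rel\<close> this makes the coordinates injective on the quotient.\<close>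

lemma rel_ideal_label_coord:
  assumes f: "f \<in> carrier PA" and z: "\<And>h j. h \<in> halves G \<Longrightarrow> 1 \<le> j \<Longrightarrow> j \<le> full h \<Longrightarrow> label_coord (h, j) f = 0"
  shows "f \<in> rel_ideal"
proof -
  have arc: "f (edge_of G h, chain h j) = 0" if h: "h \<in> halves G" "j < full h" for h j
  proof (cases "j = 0")
    case True
    define k where "k = opp G (dist_half (edge_of G h))"
    have k: "k \<in> halves G" "edge_of G k = edge_of G h" "k \<noteq> dist_half (edge_of G k)"
    proof -
      have "k = h \<or> k = opp G h" using dist_half_cases[OF h(1)] opp_opp[OF h(1)] by (auto simp: k_def)
      then show kc: "k \<in> halves G" and ke: "edge_of G k = edge_of G h"
        using h(1) opp_closed[OF h(1)] edge_of_opp[OF h(1)] by auto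
      have "dist_half (edge_of G h) \<in> halves G" using dist_half_cases[OF h(1)] h(1) opp_closed[OF h(1)] by auto
      then show "k \<noteq> dist_half (edge_of G k)" unfolding ke using opp_neq by (simp add: k_def)
    qed
    have "label_coord (k, full k) f = 0" using z[OF k(1)] full_pos[OF k(1)] by simp
    then show ?thesis using k True by (simp add: label_coord_def)
  next
    case False
    then show ?thesis using z[OF h(1), of j] h(2) by (simp add: label_coord_def)
  qed
  have "f (loop_path h) + f (loop_path (opp G h)) = 0" if h: "h \<in> halves G" for h
  proof -
    define k where "k = dist_half (edge_of G h)"
    have k: "k = h \<or> k = opp G h" using dist_half_cases[OF h] by (simp add: k_def)
    then have kh: "k \<in> halves G" "edge_of G k = edge_of G h" using h opp_closed edge_of_opp by auto
    have "label_coord (k, full k) f = 0" using z[OF kh(1)] full_pos[OF kh(1)] by simp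
    then have "f (loop_path k) + f (loop_path (opp G k)) = 0" using kh by (simp add: label_coord_def k_def)
    then show ?thesis using k opp_opp[OF h] by (auto simp: add.commute)
  qed
  with f arc show ?thesis unfolding rel_ideal_def by blast
qed

text \<open>Duality of coordinates and label paths: nontrivial arcs are determined by their first
  half-edge and their length, and at each edge only one cycle and the trivial path occur in full
  length.\<close>

lemma label_coord_path:
  assumes h: "h \<in> halves G" "1 \<le> j" "j \<le> full h" and h': "h' \<in> halves G" "1 \<le> j'" "j' \<le> full h'"
  shows "label_coord (h, j) (path_elem (label_path (h', j'))) = (if h = h' \<and> j = j' then 1 else 0 :: 'k::field)"
proof -
  have ne: "loop_path k \<noteq> (e, [])" if "k \<in> halves G" for k e
    using full_pos[OF that] by (auto simp: loop_path_def dest!: arg_cong[of _ _ length])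
  note o = opp_closed[OF h(1)]
  consider (arc) "j < full h" | (loop) "j = full h" "h = dist_half (edge_of G h)" | (triv) "j = full h" "h \<noteq> dist_half (edge_of G h)"
    using h(3) by linarith
  then show ?thesis
  proof cases
    case arc
    have a: "label_coord (h, j) (path_elem (label_path (h', j')) :: 'h path \<Rightarrow> 'k) = path_elem (label_path (h', j')) (edge_of G h, chain h j)"
      using arc by (simp add: label_coord_def)
    have "(edge_of G h, chain h j) = label_path (h', j') \<longleftrightarrow> h = h' \<and> j = j'"
      using h h' arc arc_neq_loop[OF h(1) arc h'(1)]
      by (auto simp: label_path_def chain_eq_iff dest!: arg_cong[of _ _ length])
    then show ?thesis unfolding a unfolding path_elem_def by simp
  next
    case loop
    have a: "label_coord (h, j) (path_elem (label_path (h', j')) :: 'h path \<Rightarrow> 'k) =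
      path_elem (label_path (h', j')) (loop_path h) + path_elem (label_path (h', j')) (loop_path (opp G h))"
      using loop by (simp add: label_coord_def)
    consider "j' < full h'" | "j' = full h'" "h' = dist_half (edge_of G h')" | "j' = full h'" "h' \<noteq> dist_half (edge_of G h')"
      using h'(3) by linarith
    then show ?thesis
    proof cases
      case 1
      then show ?thesis unfolding a unfolding path_elem_def label_path_def
        using arc_neq_loop[OF h'(1) 1 h(1), of "edge_of G h'"] arc_neq_loop[OF h'(1) 1 o, of "edge_of G h'"] loop(1) by auto
    next
      case 2
      then have l: "label_path (h', j') = loop_path h'" by (simp add: label_path_def)
      have no: "opp G h \<noteq> h'"
      proof
        assume "opp G h = h'"
        then have "edge_of G h' = edge_of G h" using edge_of_opp[OF h(1)] by simp
        then have "h' = h" using 2(2) loop(2) by simp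
        then show False using \<open>opp G h = h'\<close> opp_neq[OF h(1)] by simp
      qed
      show ?thesis unfolding a unfolding path_elem_def l loop_path_eq[OF h(1)] loop_path_eq[OF o]
        using no loop(1) 2(1) by simp
    next
      case 3
      then have l: "label_path (h', j') = (edge_of G h', [])" by (simp add: label_path_def)
      have "\<not> (h = h' \<and> j = j')" using loop(2) 3(2) by auto
      then show ?thesis unfolding a unfolding path_elem_def l using ne[OF h(1)] ne[OF o] by simp
    qed
  next
    case triv
    have a: "label_coord (h, j) (path_elem (label_path (h', j')) :: 'h path \<Rightarrow> 'k) = path_elem (label_path (h', j')) (edge_of G h, [])"
      using triv by (simp add: label_coord_def)
    have "(edge_of G h, []) = label_path (h', j') \<longleftrightarrow> h = h' \<and> j = j'"
    proof (cases "j' = full h' \<and> h' \<noteq> dist_half (edge_of G h')")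
      case True
      then have l: "label_path (h', j') = (edge_of G h', [])" by (simp add: label_path_def)
      have "edge_of G h = edge_of G h' \<longleftrightarrow> h = h'"
      proof
        assume e: "edge_of G h = edge_of G h'"
        then show "h = h'" using dist_half_cases[OF h(1)] dist_half_cases[OF h'(1)] triv(2) True opp_opp[OF h(1)] opp_opp[OF h'(1)]
          by metis
      qed simp
      then show ?thesis unfolding l using triv(1) True by auto
    next
      case False
      then have "label_path (h', j') = (edge_of G h', chain h' j') \<or> label_path (h', j') = loop_path h'"
        using h'(3) by (auto simp: label_path_def)
      moreover have "chain h' j' \<noteq> []" using h'(2) by (metis chain_length list.size(3) not_one_le_zero)
      ultimately have "(edge_of G h, []) \<noteq> label_path (h', j')" using ne[OF h'(1), of "edge_of G h"] by auto
      then show ?thesis using False triv by auto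
    qed
    then show ?thesis unfolding a unfolding path_elem_def by simp
  qed
qed

lemma label_path_ends:
  assumes h: "h \<in> halves G" "j \<le> full h"
  shows "fst (label_path (h, j)) = edge_of G h"
    "walk_end G (fst (label_path (h, j))) (snd (label_path (h, j))) = edge_of G ((nxt G ^^ j) h)"
proof -
  have j: "\<not> j < full h \<Longrightarrow> j = full h" using h by simp
  show "fst (label_path (h, j)) = edge_of G h" by (simp add: label_path_def loop_path_def)
  show "walk_end G (fst (label_path (h, j))) (snd (label_path (h, j))) = edge_of G ((nxt G ^^ j) h)"
    using j npow_full[OF h(1)] by (auto simp: label_path_def loop_path_def walk_end_chain)
qed

end

text \<open>The constant c is the common entry of the Cartan matrix, expressed as a number of
  labels.\<close>

locale brauer_uniform = brauer_all_arrows G for G :: "('v, 'h) bgraph" +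
  fixes c :: nat
  assumes c_pos: "0 < c" and edges_ge_2: "2 \<le> card (edges G)"
    and labels_card: "e \<in> edges G \<Longrightarrow> e' \<in> edges G \<Longrightarrow> card (labels e e') = c"
begin

text \<open>A periodic enumeration of the edges, since the abstract setting indexes idempotents by
  all natural numbers.\<close>

definition nth_edge :: "nat \<Rightarrow> 'h set"
  where "nth_edge i = (SOME f. bij_betw f {..<card (edges G)} (edges G)) (i mod card (edges G))"

definition nth_label :: "nat \<Rightarrow> nat \<Rightarrow> nat \<Rightarrow> 'h \<times> nat"
  where "nth_label i j = (SOME f. bij_betw f {..<c} (labels (nth_edge i) (nth_edge j)))"

lemma nth_edge_bij: "bij_betw nth_edge {..<card (edges G)} (edges G)"
proof -
  let ?f = "SOME f. bij_betw f {..<card (edges G)} (edges G)"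
  have "\<exists>f. bij_betw f {..<card (edges G)} (edges G)"
    using ex_bij_betw_nat_finite[OF finite_edges] by (simp add: atLeast0LessThan)
  then have "bij_betw ?f {..<card (edges G)} (edges G)" by (rule someI_ex)
  then show ?thesis by (rule bij_betw_cong[THEN iffD1, rotated]) (simp add: nth_edge_def)
qed

lemma nth_edge_mod: "nth_edge (i mod card (edges G)) = nth_edge i"
  by (simp add: nth_edge_def)

lemma nth_edge_closed: "nth_edge i \<in> edges G"
proof -
  have "i mod card (edges G) \<in> {..<card (edges G)}" using edges_ge_2 by simp
  then have "nth_edge (i mod card (edges G)) \<in> edges G" using nth_edge_bij by (auto simp: bij_betw_def)
  then show ?thesis by (simp add: nth_edge_mod)
qed

lemma nth_edge_eq: "nth_edge i = nth_edge j \<longleftrightarrow> i mod card (edges G) = j mod card (edges G)"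
proof
  assume "nth_edge i = nth_edge j"
  then have "nth_edge (i mod card (edges G)) = nth_edge (j mod card (edges G))" by (simp add: nth_edge_mod)
  moreover have "l mod card (edges G) \<in> {..<card (edges G)}" for l using edges_ge_2 by simp
  moreover have "inj_on nth_edge {..<card (edges G)}" using nth_edge_bij by (simp add: bij_betw_def)
  ultimately show "i mod card (edges G) = j mod card (edges G)" by (auto dest: inj_onD)
qed (metis nth_edge_mod)

lemma nth_label_bij: "bij_betw (nth_label i j) {..<c} (labels (nth_edge i) (nth_edge j))"
proof -
  have c: "card (labels (nth_edge i) (nth_edge j)) = c" by (rule labels_card[OF nth_edge_closed nth_edge_closed])
  then have "finite (labels (nth_edge i) (nth_edge j))" using c_pos card_gt_0_iff by metis
  from ex_bij_betw_nat_finite[OF this] have "\<exists>f. bij_betw f {..<c} (labels (nth_edge i) (nth_edge j))"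
    using c by (simp add: atLeast0LessThan)
  then show ?thesis unfolding nth_label_def by (rule someI_ex)
qed

lemma nth_label:
  assumes "b < c"
  obtains h l where "nth_label i j b = (h, l)" "h \<in> halves G" "edge_of G h = nth_edge i" "1 \<le> l" "l \<le> full h"
    "edge_of G ((nxt G ^^ l) h) = nth_edge j"
proof -
  have "nth_label i j b \<in> labels (nth_edge i) (nth_edge j)" using nth_label_bij assms by (auto simp: bij_betw_def)
  then obtain h l where "nth_label i j b = (h, l)" "h \<in> nth_edge i" "1 \<le> l" "l \<le> full h"
    "edge_of G ((nxt G ^^ l) h) = nth_edge j" by (auto simp: labels_def)
  then show ?thesis using that edge_member[OF nth_edge_closed] by blast
qed

lemma nth_label_surj:
  assumes "h \<in> halves G" "edge_of G h = nth_edge i" "1 \<le> l" "l \<le> full h" "edge_of G ((nxt G ^^ l) h) = nth_edge j"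
  obtains b where "b < c" "nth_label i j b = (h, l)"
proof -
  have "h \<in> edge_of G h" by (simp add: edge_of_def)
  then have "(h, l) \<in> labels (nth_edge i) (nth_edge j)" using assms by (simp add: labels_def)
  then have "(h, l) \<in> nth_label i j ` {..<c}" using nth_label_bij by (simp add: bij_betw_def)
  then show ?thesis using that by force
qed

lemma nth_label_inj: "b < c \<Longrightarrow> b' < c \<Longrightarrow> nth_label i j b = nth_label i j b' \<Longrightarrow> b = b'"
  using nth_label_bij[of i j] by (auto simp: bij_betw_def inj_on_def)

subsection \<open>The quotient\<close>

definition quo :: "('h path \<Rightarrow> 'k::field) \<Rightarrow> ('h path \<Rightarrow> 'k) set"
  where "quo f = rel_ideal +>\<^bsub>PA\<^esub> f"

abbreviation BA :: "('h path \<Rightarrow> 'k::field) set ring"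
  where "BA \<equiv> brauer_graph_algebra G"

lemma BA_eq: "BA = PA Quot rel_ideal"
  by (simp add: brauer_graph_algebra_def Idl_eq)

lemma ring_BA: "ring (BA :: ('h path \<Rightarrow> 'k::field) set ring)"
  unfolding BA_eq by (rule ideal.quotient_is_ring[OF rel_ideal_ideal])

lemma quo_hom: "(quo :: ('h path \<Rightarrow> 'k::field) \<Rightarrow> _) \<in> ring_hom PA BA"
  unfolding BA_eq quo_def[abs_def] by (rule ideal.rcos_ring_hom[OF rel_ideal_ideal])

lemma quo_closed: "f \<in> carrier PA \<Longrightarrow> quo f \<in> carrier BA"
  by (rule ring_hom_closed[OF quo_hom])

lemma quo_add: "f \<in> carrier PA \<Longrightarrow> g \<in> carrier PA \<Longrightarrow> quo f \<oplus>\<^bsub>BA\<^esub> quo g = quo (\<lambda>p. f p + g p)"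
  using ring_hom_add[OF quo_hom, of f g] by simp

lemma quo_mult: "f \<in> carrier PA \<Longrightarrow> g \<in> carrier PA \<Longrightarrow> quo f \<otimes>\<^bsub>BA\<^esub> quo g = quo (f \<otimes>\<^bsub>PA\<^esub> g)"
  by (rule ring_hom_mult[OF quo_hom, symmetric])

lemma quo_one: "quo (scal 1) = \<one>\<^bsub>BA\<^esub>"
  unfolding PA_one[symmetric] by (rule ring_hom_one[OF quo_hom])

lemma quo_eq:
  fixes f g :: "'h path \<Rightarrow> 'k::field"
  assumes fg: "f \<in> carrier PA" "g \<in> carrier PA"
  shows "quo f = quo g \<longleftrightarrow> (\<lambda>p. f p + (- 1) * g p) \<in> rel_ideal"
proof -
  have "\<ominus>\<^bsub>PA\<^esub> g = (\<lambda>p. (- 1) * g p)"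
    by (rule abelian_group.minus_equality[OF ring.is_abelian_group[OF ring_PA]]) (use fg smult_closed[of g "- 1"] in auto)
  then have m: "f \<ominus>\<^bsub>PA\<^esub> g = (\<lambda>p. f p + (- 1) * g p)" by (simp add: a_minus_def)
  interpret I: abelian_subgroup rel_ideal "PA :: ('h path \<Rightarrow> 'k) ring"
    by (rule abelian_subgroupI3[OF ideal.axioms(1)[OF rel_ideal_ideal] ring.is_abelian_group[OF ring_PA]])
  have "quo f = quo g \<longleftrightarrow> f \<in> quo g"
    unfolding quo_def using I.a_repr_independence'[of f g] I.a_rcos_self[OF fg(1)] fg(2) by metis
  also have "\<dots> \<longleftrightarrow> f \<ominus>\<^bsub>PA\<^esub> g \<in> rel_ideal"
    unfolding quo_def by (rule I.a_rcos_module_minus[OF ring_PA fg(2,1)])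
  finally show ?thesis unfolding m .
qed

lemma BA_cases:
  assumes "x \<in> carrier BA" obtains f where "f \<in> carrier PA" "x = quo f"
  using assms by (auto simp: BA_eq FactRing_def A_RCOSETS_def' quo_def)

lemma quo_zero: "quo (\<lambda>p. 0) = \<zero>\<^bsub>BA\<^esub>"
  using ring_hom_zero[OF quo_hom ring_PA ring_BA] by simp

lemma zero_closed_PA: "(\<lambda>p. 0) \<in> carrier PA"
  by (simp add: PA_carrier)

lemma quo_eq_zero: "f \<in> carrier PA \<Longrightarrow> quo f = \<zero>\<^bsub>BA\<^esub> \<longleftrightarrow> f \<in> rel_ideal"
  using quo_eq[OF _ zero_closed_PA, of f] by (simp add: quo_zero)

definition rep :: "('h path \<Rightarrow> 'k::field) set \<Rightarrow> 'h path \<Rightarrow> 'k"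
  where "rep x = (SOME f. f \<in> carrier PA \<and> quo f = x)"

text \<open>Computed on an arbitrary representative; \<open>coord_quo\<close> shows that the choice
  does not matter. The value 0 for b \<ge> c keeps additivity and homogeneity valid for every
  b.\<close>

definition coord :: "nat \<Rightarrow> nat \<Rightarrow> nat \<Rightarrow> ('h path \<Rightarrow> 'k::field) set \<Rightarrow> 'k"
  where "coord i j b x = (if b < c then label_coord (nth_label i j b) (rep x) else 0)"

lemma coord_quo:
  assumes f: "f \<in> carrier PA" and b: "b < c"
  shows "coord i j b (quo f) = label_coord (nth_label i j b) f"
proof -
  obtain h l where l: "nth_label i j b = (h, l)" "h \<in> halves G" using nth_label[OF b] by metis
  have "rep (quo f) \<in> carrier PA \<and> quo (rep (quo f)) = quo f"
    unfolding rep_def by (rule someI[of _ f]) (use f in simp)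
  then have r: "(\<lambda>p. rep (quo f) p + (- 1) * f p) \<in> rel_ideal" using quo_eq f by blast
  have "label_coord (h, l) (rep (quo f)) + (- 1) * label_coord (h, l) f = 0"
    using label_coord_rel[OF l(2) r, of l] unfolding label_coord_add label_coord_scale .
  then show ?thesis using b l by (simp add: coord_def)
qed

definition eps :: "nat \<Rightarrow> ('h path \<Rightarrow> 'k::field) set"
  where "eps i = quo (path_elem (nth_edge i, []))"

definition base_elem :: "nat \<Rightarrow> nat \<Rightarrow> nat \<Rightarrow> ('h path \<Rightarrow> 'k::field) set"
  where "base_elem i j b = quo (path_elem (label_path (nth_label i j b)))"

text \<open>The k-th power of the arrow ideal; its image in the quotient plays the role of the k-th
  power of the radical.\<close>

definition order_fun :: "nat \<Rightarrow> ('h path \<Rightarrow> 'k::field) set"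
  where "order_fun k = {f \<in> carrier PA. \<forall>e hs. length hs < k \<longrightarrow> f (e, hs) = 0}"

definition rad_pow :: "nat \<Rightarrow> ('h path \<Rightarrow> 'k::field) set set"
  where "rad_pow k = quo ` order_fun k"

lemma triv_closed: "e \<in> edges G \<Longrightarrow> path_elem (e, []) \<in> carrier PA"
  by (rule path_elem_closed) simp

lemma label_path_closed:
  assumes "b < c" shows "path_elem (label_path (nth_label i j b)) \<in> carrier PA"
proof -
  obtain h l where h: "nth_label i j b = (h, l)" "h \<in> halves G" using nth_label[OF assms] by metis
  have "is_walk G (edge_of G h) (chain h l)" for l by (rule is_walk_chain[OF h(2)])
  then show ?thesis using path_elem_closed edge_in_edges[OF h(2)] by (auto simp: h label_path_def loop_path_def)
qed

text \<open>Replace a representative of \<open>x = \<epsilon>\<^sub>i x \<epsilon>\<^sub>j\<close> by its part on the paths from edge \<open>i\<close> to edge \<open>j\<close>.\<close>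

lemma corner_rep:
  assumes x: "x \<in> carrier BA" "eps i \<otimes>\<^bsub>BA\<^esub> x = x" "x \<otimes>\<^bsub>BA\<^esub> eps j = x"
  obtains f where "f \<in> carrier PA" "x = quo f" "\<And>e hs. \<not> (e = nth_edge i \<and> walk_end G e hs = nth_edge j) \<Longrightarrow> f (e, hs) = 0"
proof -
  obtain g where g: "g \<in> carrier PA" "x = quo g" using BA_cases[OF x(1)] .
  let ?i = "path_elem (nth_edge i, [])" and ?j = "path_elem (nth_edge j, [])"
  note ic = triv_closed[OF nth_edge_closed]
  define f where "f = ?i \<otimes>\<^bsub>PA\<^esub> g \<otimes>\<^bsub>PA\<^esub> ?j"
  have fc: "f \<in> carrier PA" unfolding f_def by (intro PA_mult_closed ic g)
  have "quo f = eps i \<otimes>\<^bsub>BA\<^esub> x \<otimes>\<^bsub>BA\<^esub> eps j"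
    unfolding f_def eps_def g(2) using quo_mult[OF PA_mult_closed[OF ic g(1)] ic] quo_mult[OF ic g(1)] by simp
  also have "\<dots> = x" using x by simp
  finally have "x = quo f" by simp
  moreover have "f (e, hs) = 0" if "\<not> (e = nth_edge i \<and> walk_end G e hs = nth_edge j)" for e hs
    using that by (auto simp: f_def mult_end start_mult)
  ultimately show ?thesis using that fc by blast
qed

lemma base_absorb:
  assumes b: "b < c"
  shows "eps i \<otimes>\<^bsub>BA\<^esub> base_elem i j b = (base_elem i j b :: ('h path \<Rightarrow> 'k::field) set)"
    and "base_elem i j b \<otimes>\<^bsub>BA\<^esub> eps j = (base_elem i j b :: ('h path \<Rightarrow> 'k::field) set)"
proof -
  obtain h l where l: "nth_label i j b = (h, l)" "h \<in> halves G" "edge_of G h = nth_edge i" "l \<le> full h"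
    "edge_of G ((nxt G ^^ l) h) = nth_edge j" using nth_label[OF b] by metis
  note e = label_path_ends[OF l(2,4)]
  note ic = triv_closed[OF nth_edge_closed]
  let ?p = "path_elem (label_path (h, l)) :: 'h path \<Rightarrow> 'k"
  have pc: "?p \<in> carrier PA" using label_path_closed[OF b, of i j] l(1) by simp
  have "path_elem (nth_edge i, []) \<otimes>\<^bsub>PA\<^esub> ?p = ?p"
  proof
    fix q :: "'h path" obtain e' hs where q: "q = (e', hs)" by (cases q)
    show "(path_elem (nth_edge i, []) \<otimes>\<^bsub>PA\<^esub> ?p) q = ?p q"
    proof (cases "(e', hs) = label_path (h, l)")
      case True
      have "e' = nth_edge i" using arg_cong[OF True, of fst] e(1) l(3) by simp
      then show ?thesis unfolding q start_mult by simp
    next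
      case False
      then have "?p (e', hs) = 0" by (simp add: path_elem_def)
      then show ?thesis unfolding q start_mult by (metis (full_types))
    qed
  qed
  then show "eps i \<otimes>\<^bsub>BA\<^esub> base_elem i j b = (base_elem i j b :: ('h path \<Rightarrow> 'k) set)"
    unfolding eps_def base_elem_def l(1) quo_mult[OF ic pc] by (rule arg_cong[of _ _ quo])
  have "?p \<otimes>\<^bsub>PA\<^esub> path_elem (nth_edge j, []) = ?p"
  proof
    fix q :: "'h path" obtain e' hs where q: "q = (e', hs)" by (cases q)
    show "(?p \<otimes>\<^bsub>PA\<^esub> path_elem (nth_edge j, [])) q = ?p q"
    proof (cases "(e', hs) = label_path (h, l)")
      case True
      have "walk_end G e' hs = nth_edge j" using arg_cong[OF True, of "\<lambda>p. walk_end G (fst p) (snd p)"] e(2) l(5) by simp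
      then show ?thesis unfolding q mult_end by simp
    next
      case False
      then have "?p (e', hs) = 0" by (simp add: path_elem_def)
      then show ?thesis unfolding q mult_end by (metis (full_types))
    qed
  qed
  then show "base_elem i j b \<otimes>\<^bsub>BA\<^esub> eps j = (base_elem i j b :: ('h path \<Rightarrow> 'k) set)"
    unfolding eps_def base_elem_def l(1) quo_mult[OF pc ic] by (rule arg_cong[of _ _ quo])
qed

text \<open>The partial sums are computed on representatives; as the enumeration is injective below
  the number of edges, their values stay 0 and 1.\<close>

lemma eps_sum_aux:
  "m \<le> card (edges G) \<Longrightarrow> finsum BA eps {..<m} =
    (quo (\<lambda>(e, hs). if hs = [] \<and> e \<in> nth_edge ` {..<m} then 1 else 0) :: ('h path \<Rightarrow> 'k::field) set)"
proof (induction m)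
  interpret B: ring "BA :: ('h path \<Rightarrow> 'k) set ring" by (rule ring_BA)
  let ?f = "\<lambda>m (e, hs). if hs = [] \<and> e \<in> nth_edge ` {..<m} then 1 else (0 :: 'k)"
  case 0
  show ?case by (simp add: case_prod_unfold quo_zero)
next
  interpret B: ring "BA :: ('h path \<Rightarrow> 'k) set ring" by (rule ring_BA)
  let ?f = "\<lambda>m (e, hs). if hs = [] \<and> e \<in> nth_edge ` {..<m} then 1 else (0 :: 'k)"
  case (Suc m)
  have ec: "eps i \<in> carrier (BA :: ('h path \<Rightarrow> 'k) set ring)" for i
    unfolding eps_def by (rule quo_closed[OF triv_closed[OF nth_edge_closed]])
  have fc: "?f m \<in> carrier PA"
  proof -
    have "{p. ?f m p \<noteq> 0} \<subseteq> (\<lambda>e. (e, [])) ` edges G" using nth_edge_closed by (auto split: if_splits)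
    moreover have "(\<lambda>e. (e, [])) ` edges G \<subseteq> paths G" by (auto simp: paths_def)
    ultimately show ?thesis unfolding PA_carrier using finite_subset[OF _ finite_imageI[OF finite_edges]] by blast
  qed
  have "finsum BA eps {..<Suc m} = eps m \<oplus>\<^bsub>BA\<^esub> finsum BA (eps :: nat \<Rightarrow> ('h path \<Rightarrow> 'k) set) {..<m}"
    unfolding lessThan_Suc by (rule B.finsum_insert) (use ec in auto)
  also have "\<dots> = quo (\<lambda>p. path_elem (nth_edge m, []) p + ?f m p)"
  proof -
    have "finsum BA eps {..<m} = quo (?f m)" using Suc by simp
    then show ?thesis unfolding eps_def[of m] using quo_add[OF triv_closed[OF nth_edge_closed[of m]] fc] by (simp only:)
  qed
  also have "(\<lambda>p. path_elem (nth_edge m, []) p + ?f m p) = ?f (Suc m)"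
  proof
    fix p :: "'h path" obtain e hs where p: "p = (e, hs)" by (cases p)
    have "nth_edge m \<notin> nth_edge ` {..<m}"
    proof
      assume "nth_edge m \<in> nth_edge ` {..<m}"
      then obtain l where "l < m" "nth_edge m = nth_edge l" by auto
      then show False using nth_edge_eq[of m l] Suc.prems by simp
    qed
    then show "path_elem (nth_edge m, []) p + ?f m p = ?f (Suc m) p"
      by (auto simp: p path_elem_def lessThan_Suc)
  qed
  finally show ?case .
qed

text \<open>The exponent in the last argument exceeds the length of every full cycle, so a function
  supported on paths of at least this length lies in the ideal.\<close>

theorem cartan_alg_BA:
  "cartan_alg (BA :: ('h path \<Rightarrow> 'k::field) set ring) (\<lambda>t. quo (scal t)) (card (edges G)) c eps base_elem coord rad_pow
    (Suc (\<Sum>h\<in>halves G. full h))"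
proof -
  interpret B: ring "BA :: ('h path \<Rightarrow> 'k) set ring" by (rule ring_BA)
  let ?n = "card (edges G)" and ?N = "Suc (\<Sum>h\<in>halves G. full h)"
  note tc = triv_closed[OF nth_edge_closed]
  have ec: "eps i \<in> carrier (BA :: ('h path \<Rightarrow> 'k) set ring)" for i
    unfolding eps_def by (rule quo_closed[OF tc])
  have triv: "path_elem (e, []) \<otimes>\<^bsub>PA\<^esub> path_elem (e, []) = (path_elem (e, []) :: 'h path \<Rightarrow> 'k)" for e
  proof
    fix p :: "'h path" obtain e0 hs where p: "p = (e0, hs)" by (cases p)
    show "(path_elem (e, []) \<otimes>\<^bsub>PA\<^esub> path_elem (e, [])) p = (path_elem (e, []) :: 'h path \<Rightarrow> 'k) p"
      unfolding p start_mult by (auto simp: path_elem_def)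
  qed
  have oc: "f \<in> carrier PA" if "f \<in> order_fun k" for f :: "'h path \<Rightarrow> 'k" and k using that by (simp add: order_fun_def)
  show ?thesis
  proof (intro_locales)
    show "cartan_alg_axioms (BA :: ('h path \<Rightarrow> 'k) set ring) (\<lambda>t. quo (scal t)) ?n c eps base_elem coord rad_pow ?N"
    proof
      show "quo (scal t) \<in> carrier (BA :: ('h path \<Rightarrow> 'k) set ring)" for t by (rule quo_closed[OF scal_closed])
      show "quo (scal (s + t)) = quo (scal s) \<oplus>\<^bsub>BA\<^esub> quo (scal t :: 'h path \<Rightarrow> 'k)" for s t
        unfolding quo_add[OF scal_closed scal_closed] by (rule arg_cong[of _ _ quo]) (auto simp: scal_def)
      show "quo (scal (s * t)) = quo (scal s) \<otimes>\<^bsub>BA\<^esub> quo (scal t :: 'h path \<Rightarrow> 'k)" for s t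
        unfolding quo_mult[OF scal_closed scal_closed] scal_mult[OF scal_closed]
        by (rule arg_cong[of _ _ quo]) (auto simp: scal_def)
      show "quo (scal 1) = \<one>\<^bsub>BA\<^esub>" by (rule quo_one)
      show "quo (scal t) \<otimes>\<^bsub>BA\<^esub> a = a \<otimes>\<^bsub>BA\<^esub> quo (scal t :: 'h path \<Rightarrow> 'k)" if a: "a \<in> carrier BA" for a t
      proof -
        obtain f where f: "f \<in> carrier PA" "a = quo f" using BA_cases[OF a] .
        show ?thesis unfolding f(2) quo_mult[OF scal_closed f(1)] quo_mult[OF f(1) scal_closed]
          scal_mult[OF f(1)] mult_scal[OF f(1)] ..
      qed
      show "2 \<le> ?n" by (rule edges_ge_2)
      show "0 < c" by (rule c_pos)
      show "eps i \<in> carrier (BA :: ('h path \<Rightarrow> 'k) set ring)" for i by (rule ec)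
      show "eps (i mod ?n) = (eps i :: ('h path \<Rightarrow> 'k) set)" for i by (simp add: eps_def nth_edge_mod)
      show "eps i \<otimes>\<^bsub>BA\<^esub> eps i = (eps i :: ('h path \<Rightarrow> 'k) set)" for i
        unfolding eps_def quo_mult[OF tc tc] triv by simp
      show "(\<Oplus>\<^bsub>BA\<^esub>i\<in>{..<?n}. eps i) = \<one>\<^bsub>(BA :: ('h path \<Rightarrow> 'k) set ring)\<^esub>"
      proof -
        have "nth_edge ` {..<?n} = edges G" using nth_edge_bij by (simp add: bij_betw_def)
        then have "(\<lambda>(e, hs). if hs = [] \<and> e \<in> nth_edge ` {..<?n} then 1 else 0 :: 'k) = scal 1"
          by (auto simp: scal_def)
        then show ?thesis using eps_sum_aux[of ?n, where ?'k = 'k] quo_one by simp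
      qed
      show "base_elem i j b \<in> carrier (BA :: ('h path \<Rightarrow> 'k) set ring)" if "b < c" for i j b
        unfolding base_elem_def by (rule quo_closed[OF label_path_closed[OF that]])
      show "eps i \<otimes>\<^bsub>BA\<^esub> base_elem i j b = (base_elem i j b :: ('h path \<Rightarrow> 'k) set)" if "b < c" for i j b
        by (rule base_absorb(1)[OF that])
      show "base_elem i j b \<otimes>\<^bsub>BA\<^esub> eps j = (base_elem i j b :: ('h path \<Rightarrow> 'k) set)" if "b < c" for i j b
        by (rule base_absorb(2)[OF that])
      show "coord i j b (x \<oplus>\<^bsub>BA\<^esub> y) = coord i j b x + (coord i j b y :: 'k)" if x: "x \<in> carrier BA" and y: "y \<in> carrier BA" for x y i j b
      proof (cases "b < c")
        case True
        obtain f where f: "f \<in> carrier PA" "x = quo f" using BA_cases[OF x] .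
        obtain g where g: "g \<in> carrier PA" "y = quo g" using BA_cases[OF y] .
        have "(\<lambda>p. f p + g p) \<in> carrier PA" using ring.ring_simprules(1)[OF ring_PA f(1) g(1)] by simp
        then show ?thesis unfolding f(2) g(2) quo_add[OF f(1) g(1)] using True
          by (simp add: coord_quo f(1) g(1) label_coord_add)
      qed (simp add: coord_def)
      show "coord i j b (quo (scal t) \<otimes>\<^bsub>BA\<^esub> x) = t * coord i j b x" if x: "x \<in> carrier BA" for x i j b and t :: 'k
      proof (cases "b < c")
        case True
        obtain f where f: "f \<in> carrier PA" "x = quo f" using BA_cases[OF x] .
        show ?thesis unfolding f(2) quo_mult[OF scal_closed f(1)] scal_mult[OF f(1)] using True
          by (simp add: coord_quo f(1) smult_closed label_coord_scale)
      qed (simp add: coord_def)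
      show "coord i j b (base_elem i j b') = (if b = b' then 1 else 0 :: 'k)" if b: "b < c" and b': "b' < c" for i j b b'
      proof -
        obtain h l where l: "nth_label i j b = (h, l)" "h \<in> halves G" "1 \<le> l" "l \<le> full h" using nth_label[OF b] by metis
        obtain h' l' where l': "nth_label i j b' = (h', l')" "h' \<in> halves G" "1 \<le> l'" "l' \<le> full h'" using nth_label[OF b'] by metis
        have "h = h' \<and> l = l' \<longleftrightarrow> b = b'" using nth_label_inj[OF b b', of i j] l(1) l'(1) by auto
        moreover have "coord i j b (base_elem i j b' :: ('h path \<Rightarrow> 'k) set) =
          label_coord (nth_label i j b) (path_elem (label_path (nth_label i j b')))"
          unfolding base_elem_def by (rule coord_quo[OF label_path_closed[OF b'] b])
        ultimately show ?thesis unfolding l(1) l'(1) label_coord_path[OF l(2-4) l'(2-4)] by simp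
      qed
      show "a = \<zero>\<^bsub>BA\<^esub>" if a: "a \<in> carrier BA" "eps i \<otimes>\<^bsub>BA\<^esub> a = a" "a \<otimes>\<^bsub>BA\<^esub> eps j = a"
        and z: "\<And>b. b < c \<Longrightarrow> coord i j b a = (0 :: 'k)" for a i j
      proof -
        obtain f where f: "f \<in> carrier PA" "a = quo f"
          and off: "\<And>e hs. \<not> (e = nth_edge i \<and> walk_end G e hs = nth_edge j) \<Longrightarrow> f (e, hs) = 0"
          using corner_rep[OF a] by metis
        \<comment> \<open>A representative supported on paths between the two edges has zero
          coordinates at the labels of all other pairs of edges, and at the labels of this pair by
          assumption.\<close>
        have "f \<in> rel_ideal"
        proof (rule rel_ideal_label_coord[OF f(1)])
          fix h l assume h: "h \<in> halves G" "1 \<le> l" "l \<le> full h"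
          show "label_coord (h, l) f = 0"
          proof (cases "edge_of G h = nth_edge i \<and> edge_of G ((nxt G ^^ l) h) = nth_edge j")
            case True
            then obtain b where b: "b < c" "nth_label i j b = (h, l)" using nth_label_surj[of h i l j] h by metis
            then show ?thesis using z[OF b(1)] coord_quo[OF f(1) b(1), of i j] f(2) by simp
          next
            case False
            have we: "walk_end G (edge_of G h) (chain h l) = edge_of G ((nxt G ^^ l) h)" by (rule walk_end_chain)
            \<comment> \<open>A label of full length may read the two cycles of the edge or its
              trivial path; all of these start and end at the edge of h.\<close>
            have o: "f (loop_path h) = 0" "f (loop_path (opp G h)) = 0" "f (edge_of G h, []) = 0" if "l = full h"
            proof -
              have n: "(nxt G ^^ l) h = h" using npow_full[OF h(1)] that by simp
              have ne: "\<not> (edge_of G h = nth_edge i \<and> edge_of G h = nth_edge j)" using False n by simp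
              show "f (loop_path h) = 0" unfolding loop_path_def
                by (rule off) (use ne npow_full[OF h(1)] in \<open>simp add: walk_end_chain\<close>)
              show "f (loop_path (opp G h)) = 0" unfolding loop_path_def
                by (rule off) (use ne npow_full[OF opp_closed[OF h(1)]] edge_of_opp[OF h(1)]
                  walk_end_chain[of "opp G h" "full (opp G h)"] in simp)
              show "f (edge_of G h, []) = 0" by (rule off) (use ne in simp)
            qed
            have "f (edge_of G h, chain h l) = 0" by (rule off) (use False we in simp)
            then show ?thesis using o h(3) by (auto simp: label_coord_def)
          qed
        qed
        then show ?thesis using quo_eq_zero[OF f(1)] f(2) by simp
      qed
      show "rad_pow 0 = carrier (BA :: ('h path \<Rightarrow> 'k) set ring)"
      proof
        show "rad_pow 0 \<subseteq> carrier (BA :: ('h path \<Rightarrow> 'k) set ring)" using quo_closed by (auto simp: rad_pow_def order_fun_def)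
        show "carrier (BA :: ('h path \<Rightarrow> 'k) set ring) \<subseteq> rad_pow 0"
        proof
          fix x :: "('h path \<Rightarrow> 'k) set" assume "x \<in> carrier BA"
          then obtain f where "f \<in> carrier PA" "x = quo f" by (rule BA_cases)
          then show "x \<in> rad_pow 0" by (auto simp: rad_pow_def order_fun_def)
        qed
      qed
      show "rad_pow k \<subseteq> carrier (BA :: ('h path \<Rightarrow> 'k) set ring)" for k using quo_closed by (auto simp: rad_pow_def order_fun_def)
      show "x \<oplus>\<^bsub>BA\<^esub> y \<in> rad_pow k" if xy: "x \<in> rad_pow k" "y \<in> rad_pow k" for x y :: "('h path \<Rightarrow> 'k) set" and k
      proof -
        obtain f g where fg: "f \<in> order_fun k" "x = quo f" "g \<in> order_fun k" "y = quo g" using xy by (auto simp: rad_pow_def)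
        have "(\<lambda>p. f p + g p) \<in> carrier PA" using ring.ring_simprules(1)[OF ring_PA oc[OF fg(1)] oc[OF fg(3)]] by simp
        then have "(\<lambda>p. f p + g p) \<in> order_fun k" using fg by (simp add: order_fun_def)
        then show ?thesis unfolding fg(2,4) quo_add[OF oc[OF fg(1)] oc[OF fg(3)]] by (simp add: rad_pow_def)
      qed
      show "\<zero>\<^bsub>BA\<^esub> \<in> (rad_pow k :: ('h path \<Rightarrow> 'k) set set)" for k
      proof -
        have "(\<lambda>p. 0 :: 'k) \<in> order_fun k" using zero_closed_PA by (simp add: order_fun_def)
        then show ?thesis unfolding rad_pow_def quo_zero[symmetric] by (rule imageI)
      qed
      show "quo (scal t) \<otimes>\<^bsub>BA\<^esub> x \<in> rad_pow k" if x: "x \<in> rad_pow k" for x k and t :: 'k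
      proof -
        obtain f where f: "f \<in> order_fun k" "x = quo f" using x by (auto simp: rad_pow_def)
        have "(\<lambda>p. t * f p) \<in> order_fun k" using f(1) smult_closed[of f t] by (simp add: order_fun_def)
        then show ?thesis unfolding f(2) quo_mult[OF scal_closed oc[OF f(1)]] scal_mult[OF oc[OF f(1)]] by (simp add: rad_pow_def)
      qed
      show "x \<otimes>\<^bsub>BA\<^esub> y \<in> rad_pow (Suc k)" if xy: "x \<in> rad_pow 1" "y \<in> rad_pow k" for x y :: "('h path \<Rightarrow> 'k) set" and k
      proof -
        obtain f g where fg: "f \<in> order_fun 1" "x = quo f" "g \<in> order_fun k" "y = quo g" using xy by (auto simp: rad_pow_def)
        \<comment> \<open>A cut before the first arrow is killed by the first factor, and any other
          cut leaves fewer than k arrows to the second.\<close>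
        have "(f \<otimes>\<^bsub>PA\<^esub> g) (e, hs) = 0" if "length hs < Suc k" for e hs
          unfolding PA_mult
        proof (rule sum.neutral, rule ballI)
          fix i assume i: "i \<in> {..length hs}"
          show "f (e, take i hs) * g (walk_end G e (take i hs), drop i hs) = 0"
          proof (cases "i = 0")
            case True
            then have "f (e, take i hs) = 0" using fg(1) by (simp add: order_fun_def)
            then show ?thesis by simp
          next
            case False
            then have "length (drop i hs) < k" using that i by auto
            then have "g (walk_end G e (take i hs), drop i hs) = 0" using fg(3) by (simp add: order_fun_def)
            then show ?thesis by simp
          qed
        qed
        then have "f \<otimes>\<^bsub>PA\<^esub> g \<in> order_fun (Suc k)" using PA_mult_closed[OF oc[OF fg(1)] oc[OF fg(3)]] by (simp add: order_fun_def)
        then show ?thesis unfolding fg(2,4) quo_mult[OF oc[OF fg(1)] oc[OF fg(3)]] by (simp add: rad_pow_def)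
      qed
      show "rad_pow ?N = {\<zero>\<^bsub>(BA :: ('h path \<Rightarrow> 'k) set ring)\<^esub>}"
      proof -
        have "f \<in> rel_ideal" if f: "f \<in> order_fun ?N" for f :: "'h path \<Rightarrow> 'k"
        proof -
          have le: "full h < ?N" if "h \<in> halves G" for h
            using member_le_sum[of h "halves G" full] that finite_halves by simp
          have z: "f (e, chain h j) = 0" if "h \<in> halves G" "j \<le> full h" for e h j
            using f le[OF that(1)] that(2) by (simp add: order_fun_def)
          have "f (loop_path h) = 0" if "h \<in> halves G" for h unfolding loop_path_def by (rule z[OF that]) simp
          then show ?thesis using oc[OF f] z opp_closed by (simp add: rel_ideal_def)
        qed
        then have "quo f = \<zero>\<^bsub>BA\<^esub>" if "f \<in> order_fun ?N" for f :: "'h path \<Rightarrow> 'k"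
          using that quo_eq_zero[OF oc[OF that]] by simp
        moreover have "(\<lambda>p. 0 :: 'k) \<in> order_fun ?N" using zero_closed_PA by (simp add: order_fun_def)
        ultimately show ?thesis unfolding rad_pow_def by blast
      qed
      show "a \<in> rad_pow 1 \<or> (i mod ?n = j mod ?n \<and> (\<exists>t b. t \<noteq> 0 \<and> b \<in> rad_pow 1 \<and> a = quo (scal t) \<otimes>\<^bsub>BA\<^esub> eps i \<oplus>\<^bsub>BA\<^esub> b))"
        if a: "a \<in> carrier BA" "eps i \<otimes>\<^bsub>BA\<^esub> a = a" "a \<otimes>\<^bsub>BA\<^esub> eps j = a" for a :: "('h path \<Rightarrow> 'k) set" and i j
      proof -
        obtain f where f: "f \<in> carrier PA" "a = quo f"
          and off: "\<And>e hs. \<not> (e = nth_edge i \<and> walk_end G e hs = nth_edge j) \<Longrightarrow> f (e, hs) = 0"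
          using corner_rep[OF a] by metis
        show ?thesis
        proof (cases "\<forall>e. f (e, []) = 0")
          case True
          then have "f \<in> order_fun 1" using f(1) by (simp add: order_fun_def)
          then show ?thesis using f(2) by (simp add: rad_pow_def)
        next
          case False
          then obtain e where e: "f (e, []) \<noteq> 0" by blast
          then have eij: "e = nth_edge i" "e = nth_edge j" using off[of e "[]"] by auto
          then have ij: "i mod ?n = j mod ?n" using nth_edge_eq by metis
          \<comment> \<open>Only the trivial path at e can occur in the support; its coefficient is
            the residue of \<open>a\<close> modulo the radical.\<close>
          define t where "t = f (e, [])"
          let ?p = "path_elem (e, []) :: 'h path \<Rightarrow> 'k"
          have pc: "?p \<in> carrier PA" using tc[of i] eij by simp
          define g where "g = (\<lambda>p. f p + (- t) * ?p p)"
          have gc: "g \<in> carrier PA" using ring.ring_simprules(1)[OF ring_PA f(1) smult_closed[OF pc, of "- t"]] by (simp add: g_def)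
          have "g (e', []) = 0" for e'
            using off[of e' "[]"] eij by (cases "e' = e") (auto simp: g_def t_def path_elem_def)
          then have gJ: "g \<in> order_fun 1" using gc by (simp add: order_fun_def)
          have "quo (scal t) \<otimes>\<^bsub>BA\<^esub> eps i \<oplus>\<^bsub>BA\<^esub> quo g = quo (\<lambda>p. t * ?p p + g p)"
            unfolding eps_def eij(1)[symmetric] quo_mult[OF scal_closed pc] scal_mult[OF pc] by (rule quo_add[OF smult_closed[OF pc] gc])
          also have "(\<lambda>p. t * ?p p + g p) = f" by (simp add: g_def fun_eq_iff)
          finally have "a = quo (scal t) \<otimes>\<^bsub>BA\<^esub> eps i \<oplus>\<^bsub>BA\<^esub> quo g" using f(2) by simp
          moreover have "t \<noteq> 0" using e by (simp add: t_def)
          moreover have "quo g \<in> rad_pow 1" using gJ by (simp add: rad_pow_def)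
          ultimately show ?thesis using ij by blast
        qed
      qed
    qed
  qed
qed

end

section \<open>Graphs with one vertex, and bipartite graphs with two vertices\<close>

context brauer_graph
begin

text \<open>One turn around the vertex meets each half-edge exactly once, and m turns meet it m
  times; the induction removes the first turn.\<close>

lemma card_orbit_visits:
  assumes h: "h \<in> halves G" and K: "K \<subseteq> {k \<in> halves G. vert G k = vert G h}"
  shows "card {j. j < m * val G (vert G h) \<and> (nxt G ^^ j) h \<in> K} = m * card K"
proof (induction m)
  case (Suc m)
  let ?v = "val G (vert G h)" and ?p = "\<lambda>j. (nxt G ^^ j) h"
  let ?A = "{j. j < ?v \<and> ?p j \<in> K}" and ?B = "{j. j < m * ?v \<and> ?p j \<in> K}"
  have per: "?p (j + ?v) = ?p j" for j unfolding npow_add nxt_orbit(1)[OF h] ..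
  have bij: "bij_betw ?p {..<?v} {k \<in> halves G. vert G k = vert G h}" by (rule nxt_orbit(2)[OF h])
  have "?p ` {..<?v} = {k \<in> halves G. vert G k = vert G h}" using bij by (simp add: bij_betw_def)
  then have "K \<subseteq> ?p ` {..<?v}" using K by (simp only:)
  then have img: "?p ` ?A = K" by auto
  have "inj_on ?p ?A" by (rule inj_on_subset[OF bij_betw_imp_inj_on[OF bij]]) auto
  from card_image[OF this] have A: "card ?A = card K" unfolding img by (rule sym)
  have "{j. j < Suc m * ?v \<and> ?p j \<in> K} = ?A \<union> (\<lambda>j. j + ?v) ` ?B"
  proof (intro equalityI subsetI)
    fix j assume j: "j \<in> {j. j < Suc m * ?v \<and> ?p j \<in> K}"
    show "j \<in> ?A \<union> (\<lambda>j. j + ?v) ` ?B"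
    proof (cases "j < ?v")
      case False
      then have "j - ?v \<in> ?B" using j per[of "j - ?v"] by auto
      then show ?thesis using False by (intro UnI2 image_eqI[of _ _ "j - ?v"]) auto
    qed (use j in auto)
  qed (auto simp: per)
  then have "card {j. j < Suc m * ?v \<and> ?p j \<in> K} = card ?A + card ((\<lambda>j. j + ?v) ` ?B)"
    by (simp only:) (rule card_Un_disjoint, auto)
  also have "card ((\<lambda>j. j + ?v) ` ?B) = card ?B" by (rule card_image) simp
  finally show ?case using A Suc.IH by simp
qed simp

text \<open>The lengths from 1 to \<open>full h\<close> are m(v) complete turns, counted from the
  successor of h. For this count to be uniform, labels start with length 1 and the trivial path is
  traded for a label of full length.\<close>

lemma card_arrow_labels:
  assumes h: "h \<in> halves G" and e: "e \<in> edges G"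
  shows "card {j. 1 \<le> j \<and> j \<le> full h \<and> edge_of G ((nxt G ^^ j) h) = e} = mlt G (vert G h) * card {k \<in> e. vert G k = vert G h}"
proof -
  let ?K = "{k \<in> e. vert G k = vert G h}" and ?n = "nxt G h"
  have n: "?n \<in> halves G" "vert G ?n = vert G h" using npow_closed[OF h, of 1] nxt_vert[OF h] by auto
  have iff: "edge_of G ((nxt G ^^ Suc j) h) = e \<longleftrightarrow> (nxt G ^^ j) ?n \<in> ?K" for j
  proof -
    have "(nxt G ^^ Suc j) h = (nxt G ^^ j) ?n" by (simp add: funpow_swap1)
    moreover have "edge_of G k = e \<longleftrightarrow> k \<in> e" if "k \<in> halves G" for k
      using edge_member[OF e] by (auto simp: edge_of_def)
    ultimately show ?thesis using npow_closed[OF n(1), of j] npow_vert[OF n(1), of j] n(2) by auto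
  qed
  have "{j. 1 \<le> j \<and> j \<le> full h \<and> edge_of G ((nxt G ^^ j) h) = e} = Suc ` {j. j < mlt G (vert G h) * val G (vert G ?n) \<and> (nxt G ^^ j) ?n \<in> ?K}"
  proof (intro equalityI subsetI)
    fix j assume j: "j \<in> {j. 1 \<le> j \<and> j \<le> full h \<and> edge_of G ((nxt G ^^ j) h) = e}"
    then obtain i where "j = Suc i" by (cases j) auto
    then show "j \<in> Suc ` {j. j < mlt G (vert G h) * val G (vert G ?n) \<and> (nxt G ^^ j) ?n \<in> ?K}"
      using j iff[of i] n(2) by (auto simp: full_def)
  next
    fix j assume "j \<in> Suc ` {j. j < mlt G (vert G h) * val G (vert G ?n) \<and> (nxt G ^^ j) ?n \<in> ?K}"
    then obtain i where "j = Suc i" "i < mlt G (vert G h) * val G (vert G ?n)" "(nxt G ^^ i) ?n \<in> ?K" by blast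
    then show "j \<in> {j. 1 \<le> j \<and> j \<le> full h \<and> edge_of G ((nxt G ^^ j) h) = e}"
      using iff[of i] n(2) by (auto simp: full_def simp del: funpow.simps)
  qed
  moreover have "card {j. j < mlt G (vert G h) * val G (vert G ?n) \<and> (nxt G ^^ j) ?n \<in> ?K} = mlt G (vert G h) * card ?K"
    by (rule card_orbit_visits[OF n(1)]) (use edge_member[OF e] n(2) in auto)
  ultimately show ?thesis by (simp add: card_image)
qed

text \<open>The two halves of the starting edge contribute disjoint sets of labels, also if they lie
  at the same vertex.\<close>

lemma card_labels:
  assumes h: "h \<in> halves G" and e: "e \<in> edges G"
  shows "card (labels (edge_of G h) e) = mlt G (vert G h) * card {k \<in> e. vert G k = vert G h}
    + mlt G (vert G (opp G h)) * card {k \<in> e. vert G k = vert G (opp G h)}"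
proof -
  let ?L = "\<lambda>h. {j. 1 \<le> j \<and> j \<le> full h \<and> edge_of G ((nxt G ^^ j) h) = e}"
  have fin: "finite (?L k)" for k by (rule finite_subset[of _ "{..full k}"]) auto
  have "labels (edge_of G h) e = Pair h ` ?L h \<union> Pair (opp G h) ` ?L (opp G h)"
    unfolding labels_def edge_of_def[of G h] by blast
  moreover have "Pair h ` ?L h \<inter> Pair (opp G h) ` ?L (opp G h) = {}" using opp_neq[OF h] by auto
  ultimately have "card (labels (edge_of G h) e) = card (Pair h ` ?L h) + card (Pair (opp G h) ` ?L (opp G h))"
    using card_Un_disjoint[OF finite_imageI[OF fin] finite_imageI[OF fin]] by (simp only:)
  also have "\<dots> = card (?L h) + card (?L (opp G h))" by (simp add: card_image inj_on_def)
  finally show ?thesis using card_arrow_labels[OF h e] card_arrow_labels[OF opp_closed[OF h] e] by simp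
qed

lemma arrows_all_if_val_ge_2:
  assumes "\<And>h. h \<in> halves G \<Longrightarrow> 2 \<le> val G (vert G h)"
  shows "arrows G = halves G"
proof -
  have "1 < mlt G (vert G h) * val G (vert G h)" if h: "h \<in> halves G" for h
    using mult_le_mono[OF mlt_pos[OF vert_closed[OF h]] assms[OF h]] by simp
  then show ?thesis by (auto simp: arrows_def)
qed

lemma val_ge_2:
  assumes "h \<in> halves G" "k \<in> halves G" "vert G k = vert G h" "k \<noteq> h"
  shows "2 \<le> val G (vert G h)"
proof -
  have "card {h, k} \<le> val G (vert G h)" unfolding val_def by (rule card_mono) (use finite_halves assms in auto)
  then show ?thesis using assms(4) by simp
qed

text \<open>Every edge is a loop: two halves to start from, and each turn meets both halves of the
  target edge, which gives 2 * 2 * m(v). The two halves of a loop also make the valency at least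
  2.\<close>

lemma one_vertex_uniform:
  assumes V: "verts G = {v}" and E: "2 \<le> card (edges G)"
  shows "brauer_uniform G (4 * mlt G v)"
proof -
  have vert: "vert G h = v" if "h \<in> halves G" for h using vert_closed[OF that] V by simp
  have "2 \<le> val G (vert G h)" if h: "h \<in> halves G" for h
    by (rule val_ge_2[OF h opp_closed[OF h]]) (use h opp_closed[OF h] opp_neq[OF h] vert in auto)
  then have all: "arrows G = halves G" by (rule arrows_all_if_val_ge_2)
  have "card (labels e e') = 4 * mlt G v" if ee': "e \<in> edges G" "e' \<in> edges G" for e e'
  proof -
    obtain h h' where h: "h \<in> halves G" "e = edge_of G h" and h': "h' \<in> halves G" "e' = edge_of G h'"
      using ee' by (auto simp: edges_def)
    have "{k \<in> e'. vert G k = v} = {h', opp G h'}" using h' vert opp_closed by (auto simp: edge_of_def)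
    then have "card {k \<in> e'. vert G k = v} = 2" using opp_neq[OF h'(1)] by auto
    then show ?thesis using card_labels[OF h(1) ee'(2)] h vert opp_closed by simp
  qed
  moreover have "0 < 4 * mlt G v" using mlt_pos[of v] V by simp
  ultimately show ?thesis using all E by unfold_locales
qed

text \<open>Every edge has exactly one half at each vertex, so each vertex contributes one start and
  one visit per turn. The half of a second edge makes each valency at least 2.\<close>

lemma two_vertices_uniform:
  assumes V: "card (verts G) = 2" and E: "2 \<le> card (edges G)" and b: "bipartite G"
  shows "\<exists>c. brauer_uniform G c"
proof -
  obtain A B where AB: "A \<union> B = verts G" "A \<inter> B = {}"
    and ends: "\<And>h. h \<in> halves G \<Longrightarrow> vert G h \<in> A \<longleftrightarrow> vert G (opp G h) \<in> B"
    using b by (auto simp: bipartite_def)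
  have fin: "finite A" "finite B" using finite_verts AB(1) finite_Un by metis+
  obtain h0 where h0: "h0 \<in> halves G" using halves_nonempty by blast
  \<comment> \<open>Both classes are nonempty because an edge joins them; with two vertices in total
    each class is a single vertex.\<close>
  have "vert G h0 \<in> A \<union> B" "vert G (opp G h0) \<in> A \<union> B" using vert_closed h0 opp_closed AB(1) by auto
  then have "A \<noteq> {}" "B \<noteq> {}" using ends[OF h0] AB(2) by auto
  then have "0 < card A" "0 < card B" using fin by (auto simp: card_gt_0_iff)
  moreover have "card A + card B = 2" using card_Un_disjoint[OF fin AB(2)] AB(1) V by simp
  ultimately have "card A = 1" "card B = 1" by auto
  then obtain u w where uw: "A = {u}" "B = {w}" by (meson card_1_singletonE)
  then have "u \<noteq> w" using AB(2) by auto
  have ends': "(vert G h = u \<and> vert G (opp G h) = w) \<or> (vert G h = w \<and> vert G (opp G h) = u)" if h: "h \<in> halves G" for h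
    using ends[OF h] vert_closed[OF h] vert_closed[OF opp_closed[OF h]] AB uw by auto
  have one: "card {k \<in> e. vert G k = x} = 1" if e: "e \<in> edges G" and x: "x = u \<or> x = w" for e x
  proof -
    obtain h where h: "h \<in> halves G" "e = edge_of G h" using e by (auto simp: edges_def)
    have "{k \<in> e. vert G k = x} = (if vert G h = x then {h} else {opp G h})"
      using ends'[OF h(1)] x \<open>u \<noteq> w\<close> by (auto simp: h(2) edge_of_def)
    then show ?thesis by simp
  qed
  have "2 \<le> val G (vert G h)" if h: "h \<in> halves G" for h
  proof -
    have "\<not> edges G \<subseteq> {edge_of G h}" using E card_mono[of "{edge_of G h}" "edges G"] by auto
    then obtain e where e: "e \<in> edges G" "e \<noteq> edge_of G h" by blast
    have "card {k \<in> e. vert G k = vert G h} = 1" using one[OF e(1)] ends'[OF h] by auto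
    then obtain k where k: "k \<in> e" "vert G k = vert G h" by (auto simp: card_1_singleton_iff)
    then show ?thesis using val_ge_2[OF h, of k] edge_member[OF e(1) k(1)] e(2) by auto
  qed
  then have all: "arrows G = halves G" by (rule arrows_all_if_val_ge_2)
  have "card (labels e e') = mlt G u + mlt G w" if ee': "e \<in> edges G" "e' \<in> edges G" for e e'
  proof -
    obtain h where h: "h \<in> halves G" "e = edge_of G h" using ee'(1) by (auto simp: edges_def)
    then show ?thesis using card_labels[OF h(1) ee'(2)] ends'[OF h(1)] one[OF ee'(2)] by auto
  qed
  moreover have "0 < mlt G u + mlt G w" using mlt_pos[of u] uw AB(1) by fastforce
  ultimately have "brauer_uniform G (mlt G u + mlt G w)" using all E by unfold_locales
  then show ?thesis ..
qed

end

theorem theorem6: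
  fixes G :: "('v, 'h) bgraph"
  assumes "brauer_graph G"
    and "(card (verts G) = 1 \<and> 2 \<le> card (edges G))
      \<or> (card (verts G) = 2 \<and> 2 \<le> card (edges G) \<and> bipartite G)"
  shows "\<not> tilting_connected
    (brauer_graph_algebra G :: ('h path \<Rightarrow> 'k::alg_closed_field) set ring)"
proof -
  interpret brauer_graph G by (rule assms(1))
  have "\<exists>c. brauer_uniform G c"
    using assms(2) one_vertex_uniform two_vertices_uniform by (auto simp: card_1_singleton_iff)
  then obtain c where "brauer_uniform G c" ..
  then interpret brauer_uniform G c .
  show ?thesis by (rule cartan_alg.not_tilting_connected[OF cartan_alg_BA])
qed

end
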